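(* Let $G$ be a simple Lie group whose complexified Lie algebra is $\mathfrak g_{\mathbb C}=\mathfrak{sl}(2,\mathbb C)$. Let $\xi',\xi''\in\mathbb C\setminus\{0\}$, and let $\{\Pi'_{\lambda'}:\lambda'\in\Lambda(\xi')\}$ and $\{\Pi''_{\lambda''}:\lambda''\in\Lambda(\xi'')\}$ in $\mathcal M(G)$ be reduced coherent families of representations passing through $\Pi'=\Pi'_{\xi'}$ and $\Pi''=\Pi''_{\xi''}$, respectively, where $\xi'$ and $\xi''$ are nonsingular infinitesimal characters. Let $\Pi_{\lambda'''}\in\mathcal M(G)$ be a representation with infinitesimal character $\lambda'''$. Then the multiplicity $$[\Pi'_{\lambda'}\boxtimes\Pi''_{\lambda''}:\Pi_{\lambda'''}]$$ is constant for all parameters $(\lambda',\lambda'')\in\mathcal D(\xi',\xi'';\lambda''')$. In particular, the multiplicity is locally constant within the region $\mathcal D(\xi',\xi'';\lambda''')$ of the parameter space, and may change only when crossing its boundary.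
   Context: As in the definition of reduced coherent families below, $G$ is taken to be a real form of $SL(2,\mathbb C)$, so that the natural representation $\mathbb C^2$ is a $G$-module. $\mathbb N_+=\{1,2,\dots\}$, $\mathbb N_-=\{-1,-2,\dots\}$. $\mathcal M(G)$ is the category of admissible smooth Fréchet representations of $G$ of finite length and moderate growth. The multiplicity $[\Pi'\boxtimes\Pi'':\Pi''']$ is the dimension of the space of continuous homomorphisms $\Pi'\boxtimes\Pi''\to\Pi'''$ for the diagonal subgroup $G\subset G\times G$. Infinitesimal character $\lambda\in\mathbb C/\{\pm1\}$ means that the Casimir element $\Omega=H^2+2(XY+YX)$ acts by $\lambda^2-1$; $P_\tau(V)$ is the $\tau$-primary component (generalized eigenspace of $\mathfrak Z(\mathfrak g_{\mathbb C})=\mathbb C[\Omega]$ for infinitesimal character $\tau$). For $\xi\ne0$: $\Lambda(\xi)=\mathbb Z+\xi$ if $\xi\notin\mathbb Z$, $\Lambda(\xi)=\mathbb N_+$ if $\xi\in\mathbb N_+$, $\Lambda(\xi)=\mathbb N_-$ if $\xi\in\mathbb N_-$. A family $\{\Pi_\lambda\in\mathcal M(G):\lambda\in\Lambda(\xi)\}$ is a reduced coherent family through $\Pi$ (of infinitesimal character $\xi$) if $\Pi_\xi=\Pi$; $\Pi_\lambda$ has infinitesimal character $\lambda$; and for $\delta\in\{1,-1\}$, whenever $\lambda,\lambda+\delta\in\Lambda(\xi)$, $P_{\lambda+\delta}(\Pi_\lambda\otimes\mathbb C^2)\simeq\Pi_{\lambda+\delta}$ and $P_\lambda(\Pi_{\lambda+\delta}\otimes\mathbb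 C^2)\simeq\Pi_\lambda$. Set $(\mathbb Z^2)_{\rm even}=\{(k_1,k_2)\in\mathbb Z^2:k_1\equiv k_2\bmod2\}$ and $\Xi=\Xi(\xi',\xi'')=(\Lambda(\xi')\times\Lambda(\xi''))\cap((\xi',\xi'')+(\mathbb Z^2)_{\rm even})$. For $\mu\in\mathbb C$ and $\alpha,\beta\in\{+,-\}$ (identified with $\{1,-1\}$) define $\mathcal D_{\alpha\beta}\subset\Xi$ by: $\mathcal D_{\alpha\beta}=\Xi$ if $\alpha\xi'+\beta\xi''+\mu\notin2\mathbb Z+1$; and $\mathcal D_{\alpha\beta}=\{(\lambda',\lambda'')\in\Xi:\operatorname{sgn}(\alpha\lambda'+\beta\lambda''+\mu)=\operatorname{sgn}(\alpha\xi'+\beta\xi''+\mu)\}$ if $\alpha\xi'+\beta\xi''+\mu\in2\mathbb Z+1$. Set $\mathcal D(\xi',\xi'';\mu)=\bigcap_{\alpha,\beta\in\{+,-\}}\mathcal D_{\alpha\beta}$. *)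

theory Defs
  imports
    "HOL-Analysis.Analysis"
    "HOL-Library.Poly_Mapping"
    "HOL-Algebra.Module"
begin

section \<open>Topological vector spaces on explicit carriers\<close>

text \<open>
  Representations occur in families whose members live on different spaces, and outer tensor
  products are quotients, so complex vector spaces are modules (with an explicit carrier) over
  the ring of complex numbers.  The fields \<open>mult\<close> and \<open>one\<close> that the library's module record
  inherits from rings play no role.
\<close>

definition complex_ring :: "complex ring" where
  "complex_ring = \<lparr>carrier = UNIV, mult = (*), one = 1, zero = 0, add = (+)\<rparr>"

record 'v tvs = "(complex, 'v) module" +
  tvs_topology :: "'v topology"

definition seminorm_on :: "(complex, 'v, 'm) module_scheme \<Rightarrow> ('v \<Rightarrow> real) \<Rightarrow> bool" where
  "seminorm_on V p \<longleftrightarrow>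
     (\<forall>x\<in>carrier V. 0 \<le> p x) \<and>
     (\<forall>x\<in>carrier V. \<forall>y\<in>carrier V. p (x \<oplus>\<^bsub>V\<^esub> y) \<le> p x + p y) \<and>
     (\<forall>c. \<forall>x\<in>carrier V. p (c \<odot>\<^bsub>V\<^esub> x) = cmod c * p x)"

definition seminorm_open :: "(complex, 'v, 'm) module_scheme \<Rightarrow> ('v \<Rightarrow> real) set \<Rightarrow> 'v set \<Rightarrow> bool" where
  "seminorm_open V P U \<longleftrightarrow>
     U \<subseteq> carrier V \<and>
     (\<forall>x\<in>U. \<exists>F \<epsilon>. finite F \<and> F \<subseteq> P \<and> \<epsilon> > 0 \<and>
        (\<forall>y\<in>carrier V. (\<forall>p\<in>F. p (y \<ominus>\<^bsub>V\<^esub> x) < \<epsilon>) \<longrightarrow> y \<in> U))"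

definition seminorm_topology :: "(complex, 'v, 'm) module_scheme \<Rightarrow> ('v \<Rightarrow> real) set \<Rightarrow> 'v topology" where
  "seminorm_topology V P = topology (seminorm_open V P)"

lemma openin_seminorm_topology: "openin (seminorm_topology V P) U \<longleftrightarrow> seminorm_open V P U"
proof -
  have "istopology (seminorm_open V P)"
    unfolding istopology_def
  proof (intro conjI allI impI)
    fix S T assume S: "seminorm_open V P S" and T: "seminorm_open V P T"
    show "seminorm_open V P (S \<inter> T)"
    unfolding seminorm_open_def
    proof (intro conjI ballI)
      have "S \<subseteq> carrier V"
        using S by (simp add: seminorm_open_def)
      then show "S \<inter> T \<subseteq> carrier V"
        by (rule le_infI1)
    next
      fix x assume "x \<in> S \<inter> T"
      then have x: "x \<in> S" "x \<in> T" by simp_all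
      obtain F e where F: "finite F" "F \<subseteq> P" "e > 0"
          "\<forall>y\<in>carrier V. (\<forall>p\<in>F. p (y \<ominus>\<^bsub>V\<^esub> x) < e) \<longrightarrow> y \<in> S"
        using bspec[OF conjunct2[OF S[unfolded seminorm_open_def]] x(1)] by (elim exE conjE)
      obtain F' e' where F': "finite F'" "F' \<subseteq> P" "e' > 0"
          "\<forall>y\<in>carrier V. (\<forall>p\<in>F'. p (y \<ominus>\<^bsub>V\<^esub> x) < e') \<longrightarrow> y \<in> T"
        using bspec[OF conjunct2[OF T[unfolded seminorm_open_def]] x(2)] by (elim exE conjE)
      show "\<exists>F \<epsilon>. finite F \<and> F \<subseteq> P \<and> \<epsilon> > 0 \<and>
          (\<forall>y\<in>carrier V. (\<forall>p\<in>F. p (y \<ominus>\<^bsub>V\<^esub> x) < \<epsilon>) \<longrightarrow> y \<in> S \<inter> T)"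
      proof (intro exI conjI ballI impI)
        show "finite (F \<union> F')" "F \<union> F' \<subseteq> P" "min e e' > 0"
          using F F' by simp_all
        fix y assume y: "y \<in> carrier V" "\<forall>p\<in>F \<union> F'. p (y \<ominus>\<^bsub>V\<^esub> x) < min e e'"
        have "y \<in> S" by (rule F(4)[rule_format]) (use y in simp_all)
        moreover have "y \<in> T" by (rule F'(4)[rule_format]) (use y in simp_all)
        ultimately show "y \<in> S \<inter> T" by simp
      qed
    qed
  next
    fix K assume K: "\<forall>S\<in>K. seminorm_open V P S"
    show "seminorm_open V P (\<Union>K)"
    unfolding seminorm_open_def
    proof (intro conjI ballI)
      show "\<Union>K \<subseteq> carrier V"
        using K by (intro Union_least) (simp add: seminorm_open_def)
    next
      fix x assume "x \<in> \<Union>K"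
      then obtain S where S: "S \<in> K" "x \<in> S" by (rule UnionE)
      obtain F e where F: "finite F" "F \<subseteq> P" "e > 0"
          "\<forall>y\<in>carrier V. (\<forall>p\<in>F. p (y \<ominus>\<^bsub>V\<^esub> x) < e) \<longrightarrow> y \<in> S"
        using bspec[OF conjunct2[OF bspec[OF K S(1), unfolded seminorm_open_def]] S(2)] by (elim exE conjE)
      show "\<exists>F \<epsilon>. finite F \<and> F \<subseteq> P \<and> \<epsilon> > 0 \<and>
          (\<forall>y\<in>carrier V. (\<forall>p\<in>F. p (y \<ominus>\<^bsub>V\<^esub> x) < \<epsilon>) \<longrightarrow> y \<in> \<Union>K)"
      proof (intro exI conjI ballI impI)
        fix y assume "y \<in> carrier V" "\<forall>p\<in>F. p (y \<ominus>\<^bsub>V\<^esub> x) < e"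
        then have "y \<in> S" by (intro F(4)[rule_format]) simp_all
        with S(1) show "y \<in> \<Union>K" by (rule UnionI)
      qed (fact F)+
    qed
  qed
  then show ?thesis
    by (simp add: seminorm_topology_def)
qed

definition continuous_seminorm :: "('v, 'm) tvs_scheme \<Rightarrow> ('v \<Rightarrow> real) \<Rightarrow> bool" where
  "continuous_seminorm V p \<longleftrightarrow>
     seminorm_on V p \<and> continuous_map (tvs_topology V) euclideanreal p"

definition cauchy_seqs :: "(complex, 'v, 'm) module_scheme \<Rightarrow> ('v \<Rightarrow> real) set \<Rightarrow> (nat \<Rightarrow> 'v) set" where
  "cauchy_seqs V P = {s. range s \<subseteq> carrier V \<and>
     (\<forall>p\<in>P. \<forall>\<epsilon>>0. \<exists>N. \<forall>m\<ge>N. \<forall>n\<ge>N. p (s m \<ominus>\<^bsub>V\<^esub> s n) < \<epsilon>)}"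

definition frechet_space :: "('v, 'm) tvs_scheme \<Rightarrow> bool" where
  "frechet_space V \<longleftrightarrow> module complex_ring V \<and>
     (\<exists>p :: nat \<Rightarrow> 'v \<Rightarrow> real.
        (\<forall>n. seminorm_on V (p n)) \<and>
        tvs_topology V = seminorm_topology V (range p) \<and>
        (\<forall>x\<in>carrier V. (\<forall>n. p n x = 0) \<longrightarrow> x = \<zero>\<^bsub>V\<^esub>) \<and>
        (\<forall>s\<in>cauchy_seqs V (range p). \<exists>x\<in>carrier V. limitin (tvs_topology V) s x sequentially))"

definition linear_map ::
    "(complex, 'v, 'm) module_scheme \<Rightarrow> (complex, 'w, 'n) module_scheme \<Rightarrow> ('v \<Rightarrow> 'w) \<Rightarrow> bool" where
  "linear_map V W T \<longleftrightarrow>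
     T \<in> carrier V \<rightarrow> carrier W \<and>
     (\<forall>x\<in>carrier V. \<forall>y\<in>carrier V. T (x \<oplus>\<^bsub>V\<^esub> y) = T x \<oplus>\<^bsub>W\<^esub> T y) \<and>
     (\<forall>c. \<forall>x\<in>carrier V. T (c \<odot>\<^bsub>V\<^esub> x) = c \<odot>\<^bsub>W\<^esub> T x)"

definition lin_indep :: "(complex, 'v, 'm) module_scheme \<Rightarrow> 'v set \<Rightarrow> bool" where
  "lin_indep V B \<longleftrightarrow> finite B \<and> B \<subseteq> carrier V \<and>
     (\<forall>a. (\<Oplus>\<^bsub>V\<^esub>b\<in>B. a b \<odot>\<^bsub>V\<^esub> b) = \<zero>\<^bsub>V\<^esub> \<longrightarrow> (\<forall>b\<in>B. a b = 0))"

text \<open>The dimension, with value \<open>\<infinity>\<close> for every infinite-dimensional space.\<close>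

definition vdim :: "(complex, 'v, 'm) module_scheme \<Rightarrow> enat" where
  "vdim V = (SUP B \<in> Collect (lin_indep V). enat (card B))"


section \<open>Real forms of SL(2,C)\<close>

type_synonym mat2 = "complex^2^2"

definition SL2C :: "mat2 monoid" where
  "SL2C = \<lparr>carrier = {g. det g = 1}, mult = (**), one = mat 1\<rparr>"

definition cscale :: "complex \<Rightarrow> mat2 \<Rightarrow> mat2" where
  "cscale c X = (\<chi> i j. c * X $ i $ j)"

definition mexp :: "mat2 \<Rightarrow> mat2" where
  "mexp X = suminf (\<lambda>n. (((**) X) ^^ n) (mat 1) /\<^sub>R fact n)"

definition lie_alg :: "mat2 set \<Rightarrow> mat2 set" where
  "lie_alg G = {X. \<forall>t::real. mexp (t *\<^sub>R X) \<in> G}"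

text \<open>
  The last clause says that \<open>lie_alg G\<close> is a real form of \<open>sl(2,C)\<close>.  Up to conjugation the only
  instances are \<open>SU(2)\<close> and \<open>SL(2,R)\<close>.
\<close>

definition real_form_SL2C :: "mat2 set \<Rightarrow> bool" where
  "real_form_SL2C G \<longleftrightarrow> subgroup G SL2C \<and> closed G \<and> connected G \<and>
     (\<forall>Z. trace Z = 0 \<longrightarrow>
        (\<exists>!(A, B). A \<in> lie_alg G \<and> B \<in> lie_alg G \<and> Z = A + cscale \<i> B))"

definition maximal_compact :: "mat2 set \<Rightarrow> mat2 set \<Rightarrow> bool" where
  "maximal_compact K G \<longleftrightarrow> subgroup K SL2C \<and> K \<subseteq> G \<and> compact K \<and>
     (\<forall>K'. subgroup K' SL2C \<and> K' \<subseteq> G \<and> compact K' \<and> K \<subseteq> K' \<longrightarrow> K' = K)"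


section \<open>Representations\<close>

record ('g, 'v) rep = "'v tvs" +
  action :: "'g \<Rightarrow> 'v \<Rightarrow> 'v"

definition with_action :: "'v tvs \<Rightarrow> ('g \<Rightarrow> 'v \<Rightarrow> 'v) \<Rightarrow> ('g, 'v) rep" where
  "with_action V a = tvs.extend V (rep.fields a)"

definition frechet_rep :: "mat2 set \<Rightarrow> (mat2, 'v) rep \<Rightarrow> bool" where
  "frechet_rep G V \<longleftrightarrow> frechet_space V \<and>
     (\<forall>g\<in>G. linear_map V V (action V g)) \<and>
     (\<forall>v\<in>carrier V. action V (mat 1) v = v) \<and>
     (\<forall>g\<in>G. \<forall>h\<in>G. \<forall>v\<in>carrier V. action V (g ** h) v = action V g (action V h v)) \<and>
     continuous_map (prod_topology (top_of_set G) (tvs_topology V)) (tvs_topology V)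
       (\<lambda>(g, v). action V g v)"

text \<open>
  Differentiability classes of vector-valued functions on the Lie group \<open>G\<close>, taken with respect
  to the global frame of left-invariant vector fields \<open>(X f)(g) = d/dt f (g exp (tX))\<close> at \<open>t = 0\<close>.
\<close>

fun Ck_map :: "mat2 set \<Rightarrow> ('v, 'm) tvs_scheme \<Rightarrow> nat \<Rightarrow> (mat2 \<Rightarrow> 'v) \<Rightarrow> bool" where
  "Ck_map G V 0 f = continuous_map (top_of_set G) (tvs_topology V) f"
| "Ck_map G V (Suc k) f =
     (continuous_map (top_of_set G) (tvs_topology V) f \<and>
      (\<forall>X\<in>lie_alg G. \<exists>f'. Ck_map G V k f' \<and>
         (\<forall>g\<in>G. limitin (tvs_topology V)
            (\<lambda>t. complex_of_real (1 / t) \<odot>\<^bsub>V\<^esub> (f (g ** mexp (t *\<^sub>R X)) \<ominus>\<^bsub>V\<^esub> f g))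
            (f' g) (at (0::real)))))"

definition smooth_rep :: "mat2 set \<Rightarrow> (mat2, 'v) rep \<Rightarrow> bool" where
  "smooth_rep G V \<longleftrightarrow> (\<forall>v\<in>carrier V. \<forall>k. Ck_map G V k (\<lambda>g. action V g v))"

text \<open>On \<open>SL(2,C)\<close> the matrices \<open>g\<close> and its inverse have the same Hilbert-Schmidt norm.\<close>

definition moderate_growth :: "mat2 set \<Rightarrow> (mat2, 'v) rep \<Rightarrow> bool" where
  "moderate_growth G V \<longleftrightarrow>
     (\<forall>p. continuous_seminorm V p \<longrightarrow>
        (\<exists>q N. continuous_seminorm V q \<and>
           (\<forall>g\<in>G. \<forall>v\<in>carrier V. p (action V g v) \<le> norm g ^ N * q v)))"

definition closed_invariant :: "mat2 set \<Rightarrow> (mat2, 'v) rep \<Rightarrow> 'v set \<Rightarrow> bool" where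
  "closed_invariant G V W \<longleftrightarrow> submodule W complex_ring V \<and> closedin (tvs_topology V) W \<and>
     (\<forall>g\<in>G. \<forall>w\<in>W. action V g w \<in> W)"

definition irreducible_rep :: "mat2 set \<Rightarrow> (mat2, 'v) rep \<Rightarrow> bool" where
  "irreducible_rep G V \<longleftrightarrow> carrier V \<noteq> {\<zero>\<^bsub>V\<^esub>} \<and>
     (\<forall>W. closed_invariant G V W \<longrightarrow> W = {\<zero>\<^bsub>V\<^esub>} \<or> W = carrier V)"

text \<open>
  A composition series; the successive quotients are irreducible iff no closed invariant
  subspace lies strictly between two consecutive terms.
\<close>

definition finite_length :: "mat2 set \<Rightarrow> (mat2, 'v) rep \<Rightarrow> bool" where
  "finite_length G V \<longleftrightarrow>
     (\<exists>n F. F 0 = {\<zero>\<^bsub>V\<^esub>} \<and> F n = carrier V \<and> (\<forall>i\<le>n. closed_invariant G V (F i)) \<and>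
        (\<forall>i<n. F i \<subset> F (Suc i) \<and>
           \<not> (\<exists>W. closed_invariant G V W \<and> F i \<subset> W \<and> W \<subset> F (Suc i))))"

definition intertwiner :: "mat2 set \<Rightarrow> (mat2, 'v) rep \<Rightarrow> (mat2, 'w) rep \<Rightarrow> ('v \<Rightarrow> 'w) \<Rightarrow> bool" where
  "intertwiner G V W T \<longleftrightarrow> linear_map V W T \<and>
     continuous_map (tvs_topology V) (tvs_topology W) T \<and>
     (\<forall>g\<in>G. \<forall>v\<in>carrier V. T (action V g v) = action W g (T v))"

definition rep_iso :: "mat2 set \<Rightarrow> (mat2, 'v) rep \<Rightarrow> (mat2, 'w) rep \<Rightarrow> bool" where
  "rep_iso G V W \<longleftrightarrow>
     (\<exists>T. intertwiner G V W T \<and> homeomorphic_map (tvs_topology V) (tvs_topology W) T)"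

text \<open>
  Intertwiners are taken extensional on the carrier, so that distinct HOL functions in the space
  are distinct operators.
\<close>

definition hom_space ::
    "mat2 set \<Rightarrow> (mat2, 'v) rep \<Rightarrow> (mat2, 'w) rep \<Rightarrow> (complex, 'v \<Rightarrow> 'w) module" where
  "hom_space G V W =
     \<lparr>carrier = {T \<in> extensional (carrier V). intertwiner G V W T},
      mult = undefined, one = undefined,
      zero = (\<lambda>v\<in>carrier V. \<zero>\<^bsub>W\<^esub>),
      add = (\<lambda>S T. \<lambda>v\<in>carrier V. S v \<oplus>\<^bsub>W\<^esub> T v),
      smult = (\<lambda>c T. \<lambda>v\<in>carrier V. c \<odot>\<^bsub>W\<^esub> T v)\<rparr>"

text \<open>
  Every finite-dimensional complex vector space has an isomorphic copy inside the type
  \<open>nat \<Rightarrow> complex\<close>, and its Frechet topology is unique, so \<open>\<tau>\<close> runs through all irreducible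
  finite-dimensional continuous representations of \<open>K\<close>.
\<close>

definition admissible_rep :: "mat2 set \<Rightarrow> (mat2, 'v) rep \<Rightarrow> bool" where
  "admissible_rep G V \<longleftrightarrow>
     (\<forall>K (\<tau> :: (mat2, nat \<Rightarrow> complex) rep).
        maximal_compact K G \<and> frechet_rep K \<tau> \<and> vdim \<tau> < \<infinity> \<and> irreducible_rep K \<tau> \<longrightarrow>
        vdim (hom_space K \<tau> V) < \<infinity>)"

definition cat_M :: "mat2 set \<Rightarrow> (mat2, 'v) rep set" where
  "cat_M G = {V. frechet_rep G V \<and> smooth_rep G V \<and> moderate_growth G V \<and>
     admissible_rep G V \<and> finite_length G V}"


section \<open>Infinitesimal characters\<close>

definition lie_act :: "(mat2, 'v) rep \<Rightarrow> mat2 \<Rightarrow> 'v \<Rightarrow> 'v" where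
  "lie_act V X v = (THE w. limitin (tvs_topology V)
     (\<lambda>t. complex_of_real (1 / t) \<odot>\<^bsub>V\<^esub> (action V (mexp (t *\<^sub>R X)) v \<ominus>\<^bsub>V\<^esub> v)) w (at (0::real)))"

text \<open>The complex-linear extension of the differentiated action to \<open>sl(2,C)\<close>.\<close>

definition lie_act_C :: "mat2 set \<Rightarrow> (mat2, 'v) rep \<Rightarrow> mat2 \<Rightarrow> 'v \<Rightarrow> 'v" where
  "lie_act_C G V Z v =
     (let (A, B) = (THE (A, B). A \<in> lie_alg G \<and> B \<in> lie_alg G \<and> Z = A + cscale \<i> B)
      in lie_act V A v \<oplus>\<^bsub>V\<^esub> \<i> \<odot>\<^bsub>V\<^esub> lie_act V B v)"

definition sl2_H :: mat2 where "sl2_H = vector [vector [1, 0], vector [0, -1]]"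
definition sl2_X :: mat2 where "sl2_X = vector [vector [0, 1], vector [0, 0]]"
definition sl2_Y :: mat2 where "sl2_Y = vector [vector [0, 0], vector [1, 0]]"

definition casimir :: "mat2 set \<Rightarrow> (mat2, 'v) rep \<Rightarrow> 'v \<Rightarrow> 'v" where
  "casimir G V v =
     (let H = lie_act_C G V sl2_H; X = lie_act_C G V sl2_X; Y = lie_act_C G V sl2_Y
      in H (H v) \<oplus>\<^bsub>V\<^esub> 2 \<odot>\<^bsub>V\<^esub> (X (Y v) \<oplus>\<^bsub>V\<^esub> Y (X v)))"

definition has_inf_char :: "mat2 set \<Rightarrow> (mat2, 'v) rep \<Rightarrow> complex \<Rightarrow> bool" where
  "has_inf_char G V \<nu> \<longleftrightarrow> (\<forall>v\<in>carrier V. casimir G V v = (\<nu>\<^sup>2 - 1) \<odot>\<^bsub>V\<^esub> v)"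

definition primary_component :: "mat2 set \<Rightarrow> complex \<Rightarrow> (mat2, 'v) rep \<Rightarrow> (mat2, 'v) rep" where
  "primary_component G \<tau> V =
     (let W = {v \<in> carrier V.
                \<exists>n. ((\<lambda>u. casimir G V u \<ominus>\<^bsub>V\<^esub> (\<tau>\<^sup>2 - 1) \<odot>\<^bsub>V\<^esub> u) ^^ n) v = \<zero>\<^bsub>V\<^esub>}
      in V\<lparr>carrier := W, tvs_topology := subtopology (tvs_topology V) W\<rparr>)"


section \<open>Reduced coherent families\<close>

text \<open>The tensor product with the natural representation; \<open>(v, w)\<close> stands for
  \<open>v \<otimes> e\<^sub>1 + w \<otimes> e\<^sub>2\<close>, with \<open>e\<^sub>1, e\<^sub>2\<close> the standard basis.\<close>

definition tensor_C2 :: "(mat2, 'v) rep \<Rightarrow> (mat2, 'v \<times> 'v) rep" where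
  "tensor_C2 V =
     \<lparr>carrier = carrier V \<times> carrier V,
      mult = undefined, one = undefined,
      zero = (\<zero>\<^bsub>V\<^esub>, \<zero>\<^bsub>V\<^esub>),
      add = (\<lambda>(v, w) (v', w'). (v \<oplus>\<^bsub>V\<^esub> v', w \<oplus>\<^bsub>V\<^esub> w')),
      smult = (\<lambda>c (v, w). (c \<odot>\<^bsub>V\<^esub> v, c \<odot>\<^bsub>V\<^esub> w)),
      tvs_topology = prod_topology (tvs_topology V) (tvs_topology V),
      action = (\<lambda>g (v, w).
        (g $ 1 $ 1 \<odot>\<^bsub>V\<^esub> action V g v \<oplus>\<^bsub>V\<^esub> g $ 1 $ 2 \<odot>\<^bsub>V\<^esub> action V g w,
         g $ 2 $ 1 \<odot>\<^bsub>V\<^esub> action V g v \<oplus>\<^bsub>V\<^esub> g $ 2 $ 2 \<odot>\<^bsub>V\<^esub> action V g w))\<rparr>"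

definition Lambda :: "complex \<Rightarrow> complex set" where
  "Lambda \<xi> =
     (if \<xi> \<notin> \<int> then {of_int k + \<xi> | k. True}
      else if \<exists>n>0. \<xi> = of_int n then {of_int k | k. k > 0}
      else {of_int k | k. k < 0})"

definition reduced_coherent_family ::
    "mat2 set \<Rightarrow> complex \<Rightarrow> (mat2, 'v) rep \<Rightarrow> (complex \<Rightarrow> (mat2, 'v) rep) \<Rightarrow> bool" where
  "reduced_coherent_family G \<xi> \<pi> F \<longleftrightarrow>
     F \<xi> = \<pi> \<and>
     (\<forall>\<nu>\<in>Lambda \<xi>. F \<nu> \<in> cat_M G \<and> has_inf_char G (F \<nu>) \<nu>) \<and>
     (\<forall>\<delta>\<in>{1, -1}. \<forall>\<nu>. \<nu> \<in> Lambda \<xi> \<and> \<nu> + \<delta> \<in> Lambda \<xi> \<longrightarrow>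
        rep_iso G (primary_component G (\<nu> + \<delta>) (tensor_C2 (F \<nu>))) (F (\<nu> + \<delta>)) \<and>
        rep_iso G (primary_component G \<nu> (tensor_C2 (F (\<nu> + \<delta>)))) (F \<nu>))"


section \<open>Outer tensor products and multiplicities\<close>

text \<open>
  The outer tensor product is the completed projective tensor product: the Hausdorff completion
  of the algebraic tensor product, which is the free vector space on \<open>V \<times> W\<close> modulo the
  bilinearity relations, for the seminorms
  \<open>p \<otimes> q (x) = inf (\<Sum>i. p (v\<^sub>i) q (w\<^sub>i))\<close> over all representations \<open>x = (\<Sum>i. v\<^sub>i \<otimes> w\<^sub>i)\<close>.
  These seminorms vanish on the relations, so the free vector space can be completed directly.
\<close>

definition free_space ::
    "(complex, 'v, 'm) module_scheme \<Rightarrow> (complex, 'w, 'n) module_scheme \<Rightarrow>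
     (complex, ('v \<times> 'w) \<Rightarrow>\<^sub>0 complex) module" where
  "free_space V W =
     \<lparr>carrier = {x. Poly_Mapping.keys x \<subseteq> carrier V \<times> carrier W},
      mult = undefined, one = undefined,
      zero = 0, add = (+), smult = (\<lambda>c. Poly_Mapping.map ((*) c))\<rparr>"

inductive_set bilinear_relations ::
    "(complex, 'v, 'm) module_scheme \<Rightarrow> (complex, 'w, 'n) module_scheme \<Rightarrow>
     (('v \<times> 'w) \<Rightarrow>\<^sub>0 complex) set"
  for V :: "(complex, 'v, 'm) module_scheme" and W :: "(complex, 'w, 'n) module_scheme" where
  add_left: "\<lbrakk>v \<in> carrier V; v' \<in> carrier V; w \<in> carrier W\<rbrakk> \<Longrightarrow>
    Poly_Mapping.single (v \<oplus>\<^bsub>V\<^esub> v', w) c - Poly_Mapping.single (v, w) c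
      - Poly_Mapping.single (v', w) c \<in> bilinear_relations V W"
| add_right: "\<lbrakk>v \<in> carrier V; w \<in> carrier W; w' \<in> carrier W\<rbrakk> \<Longrightarrow>
    Poly_Mapping.single (v, w \<oplus>\<^bsub>W\<^esub> w') c - Poly_Mapping.single (v, w) c
      - Poly_Mapping.single (v, w') c \<in> bilinear_relations V W"
| smult_left: "\<lbrakk>v \<in> carrier V; w \<in> carrier W\<rbrakk> \<Longrightarrow>
    Poly_Mapping.single (a \<odot>\<^bsub>V\<^esub> v, w) c - Poly_Mapping.single (v, w) (a * c)
      \<in> bilinear_relations V W"
| smult_right: "\<lbrakk>v \<in> carrier V; w \<in> carrier W\<rbrakk> \<Longrightarrow>
    Poly_Mapping.single (v, a \<odot>\<^bsub>W\<^esub> w) c - Poly_Mapping.single (v, w) (a * c)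
      \<in> bilinear_relations V W"
| diff: "\<lbrakk>x \<in> bilinear_relations V W; y \<in> bilinear_relations V W\<rbrakk> \<Longrightarrow>
    x - y \<in> bilinear_relations V W"

definition projective_seminorm ::
    "(complex, 'v, 'm) module_scheme \<Rightarrow> (complex, 'w, 'n) module_scheme \<Rightarrow>
     ('v \<Rightarrow> real) \<Rightarrow> ('w \<Rightarrow> real) \<Rightarrow> (('v \<times> 'w) \<Rightarrow>\<^sub>0 complex) \<Rightarrow> real" where
  "projective_seminorm V W p q x =
     (INF y \<in> {y \<in> carrier (free_space V W). x - y \<in> bilinear_relations V W}.
        \<Sum>(v, w)\<in>Poly_Mapping.keys y. cmod (Poly_Mapping.lookup y (v, w)) * p v * q w)"

definition projective_seminorms ::
    "('v, 'm) tvs_scheme \<Rightarrow> ('w, 'n) tvs_scheme \<Rightarrow> ((('v \<times> 'w) \<Rightarrow>\<^sub>0 complex) \<Rightarrow> real) set" where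
  "projective_seminorms V W =
     {projective_seminorm V W p q | p q. continuous_seminorm V p \<and> continuous_seminorm W q}"

text \<open>
  The Hausdorff completion of a vector space with respect to a family of seminorms whose topology
  is pseudometrizable: Cauchy sequences modulo sequences converging to zero.
\<close>

definition cauchy_class ::
    "(complex, 'v, 'm) module_scheme \<Rightarrow> ('v \<Rightarrow> real) set \<Rightarrow> (nat \<Rightarrow> 'v) \<Rightarrow> (nat \<Rightarrow> 'v) set" where
  "cauchy_class V P s =
     {t \<in> cauchy_seqs V P. \<forall>p\<in>P. (\<lambda>n. p (s n \<ominus>\<^bsub>V\<^esub> t n)) \<longlonglongrightarrow> 0}"

definition completion_module ::
    "(complex, 'v, 'm) module_scheme \<Rightarrow> ('v \<Rightarrow> real) set \<Rightarrow> (complex, (nat \<Rightarrow> 'v) set) module" where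
  "completion_module V P =
     \<lparr>carrier = cauchy_class V P ` cauchy_seqs V P,
      mult = undefined, one = undefined,
      zero = cauchy_class V P (\<lambda>_. \<zero>\<^bsub>V\<^esub>),
      add = (\<lambda>A B. \<Union>s\<in>A. \<Union>t\<in>B. cauchy_class V P (\<lambda>n. s n \<oplus>\<^bsub>V\<^esub> t n)),
      smult = (\<lambda>c A. \<Union>s\<in>A. cauchy_class V P (\<lambda>n. c \<odot>\<^bsub>V\<^esub> s n))\<rparr>"

definition completion_seminorm :: "('v \<Rightarrow> real) \<Rightarrow> (nat \<Rightarrow> 'v) set \<Rightarrow> real" where
  "completion_seminorm p A = (THE l. \<forall>s\<in>A. (\<lambda>n. p (s n)) \<longlonglongrightarrow> l)"

definition completion ::
    "(complex, 'v, 'm) module_scheme \<Rightarrow> ('v \<Rightarrow> real) set \<Rightarrow> (nat \<Rightarrow> 'v) set tvs" where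
  "completion V P =
     module.extend (completion_module V P)
       (tvs.fields (seminorm_topology (completion_module V P) (completion_seminorm ` P)))"

definition free_map :: "('a \<Rightarrow> 'b) \<Rightarrow> ('a \<Rightarrow>\<^sub>0 complex) \<Rightarrow> ('b \<Rightarrow>\<^sub>0 complex)" where
  "free_map f x = (\<Sum>k\<in>Poly_Mapping.keys x. Poly_Mapping.single (f k) (Poly_Mapping.lookup x k))"

definition outer_tensor ::
    "('g, 'v) rep \<Rightarrow> ('h, 'w) rep \<Rightarrow> ('g \<times> 'h, (nat \<Rightarrow> ('v \<times> 'w) \<Rightarrow>\<^sub>0 complex) set) rep"
    (infixl \<open>\<boxtimes>\<close> 70) where
  "V \<boxtimes> W =
     with_action (completion (free_space V W) (projective_seminorms V W))
       (\<lambda>(g, h) A. \<Union>s\<in>A. cauchy_class (free_space V W) (projective_seminorms V W)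
          (\<lambda>n. free_map (\<lambda>(v, w). (action V g v, action W h w)) (s n)))"

definition diagonal_restriction :: "('g \<times> 'g, 'v) rep \<Rightarrow> ('g, 'v) rep" where
  "diagonal_restriction V = with_action (tvs.truncate V) (\<lambda>g. action V (g, g))"

definition mult_dim :: "mat2 set \<Rightarrow> (mat2 \<times> mat2, 'v) rep \<Rightarrow> (mat2, 'w) rep \<Rightarrow> enat" where
  "mult_dim G V W = vdim (hom_space G (diagonal_restriction V) W)"


section \<open>The parameter region\<close>

definition Xi :: "complex \<Rightarrow> complex \<Rightarrow> (complex \<times> complex) set" where
  "Xi \<xi>' \<xi>'' = (Lambda \<xi>' \<times> Lambda \<xi>'') \<inter>
     {(\<xi>' + of_int k1, \<xi>'' + of_int k2) | k1 k2. even (k1 - k2)}"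

text \<open>In the second case \<open>\<alpha> \<nu>' + \<beta> \<nu>'' + \<mu>\<close> is an odd integer for all \<open>(\<nu>', \<nu>'') \<in> Xi \<xi>' \<xi>''\<close>,
  so passing to the real part loses nothing.\<close>

definition D_sign ::
    "complex \<Rightarrow> complex \<Rightarrow> complex \<Rightarrow> complex \<Rightarrow> complex \<Rightarrow> (complex \<times> complex) set" where
  "D_sign \<alpha> \<beta> \<xi>' \<xi>'' \<mu> =
     (if \<exists>k::int. \<alpha> * \<xi>' + \<beta> * \<xi>'' + \<mu> = of_int (2 * k + 1)
      then {(\<nu>', \<nu>'') \<in> Xi \<xi>' \<xi>''.
              sgn (Re (\<alpha> * \<nu>' + \<beta> * \<nu>'' + \<mu>)) = sgn (Re (\<alpha> * \<xi>' + \<beta> * \<xi>'' + \<mu>))}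
      else Xi \<xi>' \<xi>'')"

definition D_region :: "complex \<Rightarrow> complex \<Rightarrow> complex \<Rightarrow> (complex \<times> complex) set" where
  "D_region \<xi>' \<xi>'' \<mu> = (\<Inter>\<alpha>\<in>{1, -1}. \<Inter>\<beta>\<in>{1, -1}. D_sign \<alpha> \<beta> \<xi>' \<xi>'' \<mu>)"

end

theory Submission
  imports Defs
begin

text \<open>
  The multiplicity is the dimension of the space of continuous \<open>G\<close>-equivariant bilinear maps
  \<open>b : V \<times> W \<rightarrow> U\<close>, by the universal property of the completed projective tensor product
  (\<open>vdim_hom_space_tensor\<close>).  It therefore suffices to compare these spaces for neighbouring
  members of the two coherent families and to join any two points of the region by admissible
  steps.

  Let \<open>V\<close>, \<open>W\<close>, \<open>U\<close> have infinitesimal characters \<open>\<nu>'\<close>, \<open>\<nu>''\<close>, \<open>\<mu>\<close> and let \<open>\<delta>'\<close>, \<open>\<delta>''\<close> be signs.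
  The next members of the families are isomorphic to the primary components of
  \<open>V \<otimes> C\<^sup>2\<close> and \<open>W \<otimes> C\<^sup>2\<close> for \<open>\<nu>' + \<delta>'\<close> and \<open>\<nu>'' + \<delta>''\<close>.  Contracting the two factors \<open>C\<^sup>2\<close> with the
  symplectic form turns \<open>b\<close> into an equivariant bilinear map on the tensor products, which is then
  restricted to the primary components.  This is a linear map between the spaces of bilinear maps,
  and it is injective unless \<open>(\<delta>' \<nu>' + \<delta>'' \<nu>'' + 1)\<^sup>2 = \<mu>\<^sup>2\<close>.  Indeed the mixed part
  \<open>m = H \<otimes> H + 2 X \<otimes> Y + 2 Y \<otimes> X\<close> of the Casimir operator of \<open>V \<otimes> C\<^sup>2\<close> satisfies
  \<open>(m + 1)\<^sup>2 = \<nu>'\<^sup>2\<close>, hence \<open>\<delta>' \<nu>' + 1 + m\<close> maps into the primary component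
  (\<open>projection_primary\<close>), and contracting the images of \<open>v \<otimes> e\<close> and \<open>w \<otimes> f\<close> over dual bases
  of \<open>C\<^sup>2\<close> gives \<open>b (v, w)\<close> times \<open>(\<delta>' \<nu>' + \<delta>'' \<nu>'' + 1)\<^sup>2 - \<mu>\<^sup>2\<close>, because the Casimir operators of
  \<open>V\<close>, \<open>W\<close> and \<open>U\<close> determine the mixed term of \<open>b\<close> (\<open>contracted_projections\<close>).  The condition is
  symmetric under reversing the step, so both inequalities of dimensions follow
  (\<open>mult_dim_translation\<close>).

  In the coordinates \<open>(m, n)\<close> with \<open>(\<nu>', \<nu>'') = (\<xi>' + m + n, \<xi>'' + m - n)\<close> the sign conditions
  of the region bound \<open>m\<close> and \<open>n\<close> separately, and unit steps in \<open>m\<close> or \<open>n\<close> inside the region never meet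
  the exceptional values: crossing one would change a sign.  Two points of the region are joined
  by a path that turns once, since the parameters of a family run through a coset or a half-line
  of the integers (\<open>constant_on_lattice_region\<close>).

  The computations in the Lie algebra need that the derivative of a smooth representation is
  linear in the Lie algebra element and compatible with brackets.  Both are obtained from a
  product formula for curves through the identity (\<open>curve_powers\<close>, \<open>curve_derivative\<close>).
\<close>

section \<open>Complex vector spaces on carriers\<close>

lemma cring_complex_ring: "cring complex_ring"
  by (unfold_locales)
     (auto simp: complex_ring_def Units_def algebra_simps intro: exI[of _ "- _"]
        intro!: exI[where x="- _"] add.left_inverse)

lemma complex_ring_simps [simp]:
  "carrier complex_ring = UNIV" "a \<otimes>\<^bsub>complex_ring\<^esub> b = a * b" "\<one>\<^bsub>complex_ring\<^esub> = 1"
  "\<zero>\<^bsub>complex_ring\<^esub> = 0" "a \<oplus>\<^bsub>complex_ring\<^esub> b = a + b"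
  by (simp_all add: complex_ring_def)

lemma uminus_complex_ring [simp]: "\<ominus>\<^bsub>complex_ring\<^esub> a = - a"
proof -
  interpret cring complex_ring by (rule cring_complex_ring)
  show ?thesis by (rule minus_equality) simp_all
qed

locale complex_space =
  fixes V :: "(complex, 'v, 'm) module_scheme" (structure)
  assumes is_module: "module complex_ring V"
begin

sublocale M: module complex_ring V by (rule is_module)

lemma closed [simp, intro]:
  "\<zero> \<in> carrier V"
  "\<lbrakk>x \<in> carrier V; y \<in> carrier V\<rbrakk> \<Longrightarrow> x \<oplus> y \<in> carrier V"
  "\<lbrakk>x \<in> carrier V; y \<in> carrier V\<rbrakk> \<Longrightarrow> x \<ominus> y \<in> carrier V"
  "x \<in> carrier V \<Longrightarrow> c \<odot> x \<in> carrier V"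
  by auto

lemma smult_add_left: "x \<in> carrier V \<Longrightarrow> a \<odot> x \<oplus> b \<odot> x = (a + b) \<odot> x"
  using M.smult_l_distr[of a b x] by simp

lemma smult_add_right:
  "\<lbrakk>x \<in> carrier V; y \<in> carrier V\<rbrakk> \<Longrightarrow> a \<odot> (x \<oplus> y) = a \<odot> x \<oplus> a \<odot> y"
  using M.smult_r_distr[of a x y] by simp

lemma smult_smult [simp]: "x \<in> carrier V \<Longrightarrow> a \<odot> (b \<odot> x) = (a * b) \<odot> x"
  using M.smult_assoc1[of a b x] by simp

lemma smult_1 [simp]: "x \<in> carrier V \<Longrightarrow> 1 \<odot> x = x"
  using M.smult_one[of x] by simp

lemma smult_0 [simp]: "x \<in> carrier V \<Longrightarrow> 0 \<odot> x = \<zero>" "c \<odot> \<zero> = \<zero>"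
  using M.smult_l_null[of x] M.smult_r_null[of c] by simp_all

lemma minus_eq: "\<lbrakk>x \<in> carrier V; y \<in> carrier V\<rbrakk> \<Longrightarrow> x \<ominus> y = x \<oplus> (- 1) \<odot> y"
  using M.smult_l_minus[of 1 y] by (simp add: a_minus_def)

lemma minus_self [simp]: "x \<in> carrier V \<Longrightarrow> x \<ominus> x = \<zero>"
  by (simp add: M.r_neg a_minus_def)

text \<open>
  A linear identity between given vectors holds as soon as the coefficients agree: rewriting
  each vector as the image of a coordinate vector reduces it to an identity of numbers.
\<close>

lemma coordinates:
  assumes "set xs \<subseteq> carrier V"
  obtains L :: "complex list \<Rightarrow> 'v" where
    "\<And>cs ds. \<lbrakk>length cs = length xs; length ds = length xs\<rbrakk> \<Longrightarrow> L cs \<oplus> L ds = L (map2 (+) cs ds)"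
    "\<And>cs ds. \<lbrakk>length cs = length xs; length ds = length xs\<rbrakk> \<Longrightarrow> L cs \<ominus> L ds = L (map2 (-) cs ds)"
    "\<And>c cs. length cs = length xs \<Longrightarrow> c \<odot> L cs = L (map ((*) c) cs)"
    "\<zero> = L (replicate (length xs) 0)"
    "\<And>i. i < length xs \<Longrightarrow> xs ! i = L ((replicate (length xs) 0)[i := 1])"
proof -
  define L where "L xs cs = foldr (\<lambda>(c, x) y. c \<odot> x \<oplus> y) (zip cs xs) \<zero>" for xs and cs :: "complex list"
  have cl: "L xs cs \<in> carrier V" if "set xs \<subseteq> carrier V" for xs cs
    using that
  proof (induction xs arbitrary: cs)
    case (Cons x xs) then show ?case by (cases cs) (auto simp: L_def)
  qed (simp add: L_def)
  have Lc: "L (x # xs) (c # cs) = c \<odot> x \<oplus> L xs cs" for x xs c cs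
    by (simp add: L_def)
  have smult: "c \<odot> L xs cs = L xs (map ((*) c) cs)"
    if "set xs \<subseteq> carrier V" "length cs = length xs" for xs c cs
    using that(2,1)
    by (induction rule: list_induct2) (auto simp: Lc smult_add_right cl, simp add: L_def)
  have add: "L xs cs \<oplus> L xs ds = L xs (map2 (+) cs ds)"
    if "set xs \<subseteq> carrier V" "length cs = length xs" "length ds = length xs" for xs cs ds
    using that
  proof (induction xs arbitrary: cs ds)
    case Nil then show ?case by (simp add: L_def)
  next
    case (Cons x xs)
    obtain c cs' d ds' where [simp]: "cs = c # cs'" "ds = d # ds'"
      using Cons.prems by (cases cs; cases ds) auto
    have "L xs cs' \<oplus> L xs ds' = L xs (map2 (+) cs' ds')"
      by (rule Cons.IH) (use Cons.prems in auto)
    moreover have "c \<odot> x \<oplus> L xs cs' \<oplus> (d \<odot> x \<oplus> L xs ds') =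
        (c \<odot> x \<oplus> d \<odot> x) \<oplus> (L xs cs' \<oplus> L xs ds')"
      using Cons.prems by (simp add: cl M.a_ac)
    ultimately show ?case
      using Cons.prems by (simp add: Lc smult_add_left)
  qed
  have zero: "\<zero> = L xs (replicate (length xs) 0)" if "set xs \<subseteq> carrier V" for xs
    using that
  proof (induction xs)
    case (Cons x xs)
    then have "\<zero> = L xs (replicate (length xs) 0)" by simp
    then show ?case using Cons.prems by (simp add: Lc flip: \<open>\<zero> = _\<close>)
  qed (simp add: L_def)
  have unit: "xs ! i = L xs ((replicate (length xs) 0)[i := 1])"
    if "set xs \<subseteq> carrier V" "i < length xs" for xs i
    using that
  proof (induction xs arbitrary: i)
    case (Cons x xs)
    show ?case
    proof (cases i)
      case 0
      then show ?thesis
        using Cons.prems by (simp add: Lc flip: zero)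
    next
      case (Suc j)
      have "xs ! j = L xs ((replicate (length xs) 0)[j := 1])"
        by (rule Cons.IH) (use Cons.prems Suc in auto)
      then show ?thesis using Cons.prems Suc cl[of xs] by (auto simp: Lc)
    qed
  qed simp
  show thesis
  proof (rule that[of "L xs"])
    fix cs ds :: "complex list" assume l: "length cs = length xs" "length ds = length xs"
    show "L xs cs \<oplus> L xs ds = L xs (map2 (+) cs ds)" by (rule add[OF assms l])
    have "L xs cs \<ominus> L xs ds = L xs cs \<oplus> L xs (map ((*) (- 1)) ds)"
      by (simp only: minus_eq[OF cl[OF assms] cl[OF assms]] smult[OF assms l(2)])
    also have "\<dots> = L xs (map2 (-) cs ds)"
      by (subst add) (use l assms in \<open>auto simp: zip_map2 intro!: arg_cong[where f = "L xs"]\<close>)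
    finally show "L xs cs \<ominus> L xs ds = L xs (map2 (-) cs ds)" .
  qed (use assms smult zero unit in auto)
qed

lemma coordinates1:
  assumes "x \<in> carrier V"
  obtains L :: "complex list \<Rightarrow> 'v" where
    "\<And>a a'. L [a] \<oplus> L [a'] = L [a + a']" "\<And>a a'. L [a] \<ominus> L [a'] = L [a - a']"
    "\<And>c a. c \<odot> L [a] = L [c * a]" "\<zero> = L [0]" "x = L [1]"
  apply (rule coordinates[of "[x]"])
  using assms apply simp
  subgoal premises prems for L
    apply (rule that[of L])
    using prems(2-5) prems(6)[of 0] by simp_all
  done

lemma coordinates2:
  assumes "x \<in> carrier V" "y \<in> carrier V"
  obtains L :: "complex list \<Rightarrow> 'v" where
    "\<And>a b a' b'. L [a, b] \<oplus> L [a', b'] = L [a + a', b + b']"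
    "\<And>a b a' b'. L [a, b] \<ominus> L [a', b'] = L [a - a', b - b']"
    "\<And>c a b. c \<odot> L [a, b] = L [c * a, c * b]" "\<zero> = L [0, 0]" "x = L [1, 0]" "y = L [0, 1]"
  apply (rule coordinates[of "[x, y]"])
  using assms apply simp
  subgoal premises prems for L
    apply (rule that[of L])
    using prems(2-5) prems(6)[of 0] prems(6)[of 1] by simp_all
  done

lemma coordinates3:
  assumes "x \<in> carrier V" "y \<in> carrier V" "z \<in> carrier V"
  obtains L :: "complex list \<Rightarrow> 'v" where
    "\<And>a b c a' b' c'. L [a, b, c] \<oplus> L [a', b', c'] = L [a + a', b + b', c + c']"
    "\<And>a b c a' b' c'. L [a, b, c] \<ominus> L [a', b', c'] = L [a - a', b - b', c - c']"
    "\<And>k a b c. k \<odot> L [a, b, c] = L [k * a, k * b, k * c]" "\<zero> = L [0, 0, 0]"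
    "x = L [1, 0, 0]" "y = L [0, 1, 0]" "z = L [0, 0, 1]"
  apply (rule coordinates[of "[x, y, z]"])
  using assms apply simp
  subgoal premises prems for L
    apply (rule that[of L])
    using prems(2-5) prems(6)[of 0] prems(6)[of 1] prems(6)[of 2] by simp_all
  done

lemma coordinates4:
  assumes "x \<in> carrier V" "y \<in> carrier V" "z \<in> carrier V" "w \<in> carrier V"
  obtains L :: "complex list \<Rightarrow> 'v" where
    "\<And>a b c d a' b' c' d'. L [a, b, c, d] \<oplus> L [a', b', c', d'] = L [a + a', b + b', c + c', d + d']"
    "\<And>a b c d a' b' c' d'. L [a, b, c, d] \<ominus> L [a', b', c', d'] = L [a - a', b - b', c - c', d - d']"
    "\<And>k a b c d. k \<odot> L [a, b, c, d] = L [k * a, k * b, k * c, k * d]" "\<zero> = L [0, 0, 0, 0]"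
    "x = L [1, 0, 0, 0]" "y = L [0, 1, 0, 0]" "z = L [0, 0, 1, 0]" "w = L [0, 0, 0, 1]"
  apply (rule coordinates[of "[x, y, z, w]"])
  using assms apply simp
  subgoal premises prems for L
    apply (rule that[of L])
    using prems(2-5) prems(6)[of 0] prems(6)[of 1] prems(6)[of 2] prems(6)[of 3] by simp_all
  done

lemma coordinates6:
  assumes "x1 \<in> carrier V" "x2 \<in> carrier V" "x3 \<in> carrier V" "x4 \<in> carrier V" "x5 \<in> carrier V" "x6 \<in> carrier V"
  obtains L :: "complex list \<Rightarrow> 'v" where
    "\<And>a b c d e f a' b' c' d' e' f'. L [a, b, c, d, e, f] \<oplus> L [a', b', c', d', e', f'] =
       L [a + a', b + b', c + c', d + d', e + e', f + f']"
    "\<And>a b c d e f a' b' c' d' e' f'. L [a, b, c, d, e, f] \<ominus> L [a', b', c', d', e', f'] =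
       L [a - a', b - b', c - c', d - d', e - e', f - f']"
    "\<And>k a b c d e f. k \<odot> L [a, b, c, d, e, f] = L [k * a, k * b, k * c, k * d, k * e, k * f]"
    "x1 = L [1, 0, 0, 0, 0, 0]" "x2 = L [0, 1, 0, 0, 0, 0]" "x3 = L [0, 0, 1, 0, 0, 0]"
    "x4 = L [0, 0, 0, 1, 0, 0]" "x5 = L [0, 0, 0, 0, 1, 0]" "x6 = L [0, 0, 0, 0, 0, 1]"
  apply (rule coordinates[of "[x1, x2, x3, x4, x5, x6]"])
  using assms apply simp
  subgoal premises prems for L
    apply (rule that[of L])
    using prems(2-4) prems(6)[of 0] prems(6)[of 1] prems(6)[of 2] prems(6)[of 3] prems(6)[of 4] prems(6)[of 5]
    by simp_all
  done

lemma coordinates9: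
  assumes "x1 \<in> carrier V" "x2 \<in> carrier V" "x3 \<in> carrier V" "x4 \<in> carrier V" "x5 \<in> carrier V"
    "x6 \<in> carrier V" "x7 \<in> carrier V" "x8 \<in> carrier V" "x9 \<in> carrier V"
  obtains L :: "complex list \<Rightarrow> 'v" where
    "\<And>a b c d e f g h i a' b' c' d' e' f' g' h' i'.
       L [a, b, c, d, e, f, g, h, i] \<oplus> L [a', b', c', d', e', f', g', h', i'] =
       L [a + a', b + b', c + c', d + d', e + e', f + f', g + g', h + h', i + i']"
    "\<And>k a b c d e f g h i. k \<odot> L [a, b, c, d, e, f, g, h, i] =
       L [k * a, k * b, k * c, k * d, k * e, k * f, k * g, k * h, k * i]"
    "x1 = L [1, 0, 0, 0, 0, 0, 0, 0, 0]" "x2 = L [0, 1, 0, 0, 0, 0, 0, 0, 0]" "x3 = L [0, 0, 1, 0, 0, 0, 0, 0, 0]"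
    "x4 = L [0, 0, 0, 1, 0, 0, 0, 0, 0]" "x5 = L [0, 0, 0, 0, 1, 0, 0, 0, 0]" "x6 = L [0, 0, 0, 0, 0, 1, 0, 0, 0]"
    "x7 = L [0, 0, 0, 0, 0, 0, 1, 0, 0]" "x8 = L [0, 0, 0, 0, 0, 0, 0, 1, 0]" "x9 = L [0, 0, 0, 0, 0, 0, 0, 0, 1]"
  apply (rule coordinates[of "[x1, x2, x3, x4, x5, x6, x7, x8, x9]"])
  using assms apply simp
  subgoal premises prems for L
    apply (rule that[of L])
    using prems(2-4) prems(6)[of 0] prems(6)[of 1] prems(6)[of 2] prems(6)[of 3] prems(6)[of 4] prems(6)[of 5]
      prems(6)[of 6] prems(6)[of 7] prems(6)[of 8]
    by simp_all
  done

lemma minus_0_iff: "\<lbrakk>x \<in> carrier V; y \<in> carrier V\<rbrakk> \<Longrightarrow> x \<ominus> y = \<zero> \<longleftrightarrow> x = y"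
  by (metis M.minus_eq M.minus_minus M.minus_equality M.a_inv_closed M.r_neg M.minus_unique)

lemma smult_minus: "\<lbrakk>x \<in> carrier V; y \<in> carrier V\<rbrakk> \<Longrightarrow> a \<odot> (x \<ominus> y) = a \<odot> x \<ominus> a \<odot> y"
  by (rule coordinates2[of x y]; simp)

end

section \<open>Seminorms and the topologies they define\<close>

locale seminormed_space = complex_space V for V :: "(complex, 'v, 'm) module_scheme" (structure) +
  fixes P :: "('v \<Rightarrow> real) set"
  assumes seminorms: "p \<in> P \<Longrightarrow> seminorm_on V p"

context complex_space
begin

lemma seminorm_onD:
  assumes "seminorm_on V p"
  shows "x \<in> carrier V \<Longrightarrow> 0 \<le> p x"
    "\<lbrakk>x \<in> carrier V; y \<in> carrier V\<rbrakk> \<Longrightarrow> p (x \<oplus> y) \<le> p x + p y"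
    "x \<in> carrier V \<Longrightarrow> p (c \<odot> x) = cmod c * p x"
    "p \<zero> = 0"
    "\<lbrakk>x \<in> carrier V; y \<in> carrier V\<rbrakk> \<Longrightarrow> p (x \<ominus> y) = p (y \<ominus> x)"
    "\<lbrakk>x \<in> carrier V; y \<in> carrier V; z \<in> carrier V\<rbrakk> \<Longrightarrow> p (x \<ominus> z) \<le> p (x \<ominus> y) + p (y \<ominus> z)"
    "\<lbrakk>x \<in> carrier V; y \<in> carrier V\<rbrakk> \<Longrightarrow> p x \<le> p y + p (x \<ominus> y)"
    "\<lbrakk>x \<in> carrier V; y \<in> carrier V\<rbrakk> \<Longrightarrow> \<bar>p x - p y\<bar> \<le> p (x \<ominus> y)"
    "\<lbrakk>x \<in> carrier V; y \<in> carrier V\<rbrakk> \<Longrightarrow> p (x \<ominus> y) \<le> p x + p y"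
proof -
  note D = assms[unfolded seminorm_on_def]
  show nn: "0 \<le> p x" if "x \<in> carrier V" for x using D that by blast
  show tri: "p (x \<oplus> y) \<le> p x + p y" if "x \<in> carrier V" "y \<in> carrier V" for x y using D that by blast
  show sm: "p (c \<odot> x) = cmod c * p x" if "x \<in> carrier V" for x c using D that by blast
  show "p \<zero> = 0" using sm[of \<zero> 0] by simp
  show comm: "p (x \<ominus> y) = p (y \<ominus> x)" if xy: "x \<in> carrier V" "y \<in> carrier V" for x y
  proof -
    have "y \<ominus> x = (- 1) \<odot> (x \<ominus> y)" by (rule coordinates2[OF xy]) simp
    then show ?thesis using sm[of "x \<ominus> y" "- 1"] xy by simp
  qed
  show "p (x \<ominus> z) \<le> p (x \<ominus> y) + p (y \<ominus> z)"
    if xyz: "x \<in> carrier V" "y \<in> carrier V" "z \<in> carrier V" for x y z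
  proof -
    have "x \<ominus> z = (x \<ominus> y) \<oplus> (y \<ominus> z)" by (rule coordinates3[OF xyz]) simp
    then show ?thesis using tri[of "x \<ominus> y" "y \<ominus> z"] xyz by simp
  qed
  show le: "p x \<le> p y + p (x \<ominus> y)" if xy: "x \<in> carrier V" "y \<in> carrier V" for x y
  proof -
    have "x = y \<oplus> (x \<ominus> y)" by (rule coordinates2[OF xy]) simp
    then show ?thesis using tri[of y "x \<ominus> y"] xy by simp
  qed
  show "\<bar>p x - p y\<bar> \<le> p (x \<ominus> y)" if xy: "x \<in> carrier V" "y \<in> carrier V" for x y
    using le[OF xy] le[OF xy(2,1)] comm[OF xy] by linarith
  show "p (x \<ominus> y) \<le> p x + p y" if xy: "x \<in> carrier V" "y \<in> carrier V" for x y
    using tri[of x "(- 1) \<odot> y"] sm[of y "- 1"] xy by (simp add: minus_eq)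
qed

text \<open>
  The vectors on which finitely many seminorms are below \<open>e\<close> are mapped into the unit ball of
  \<open>q\<close>; scaling turns this into a bound.
\<close>

lemma seminorm_bound:
  assumes "finite F" "\<And>p. p \<in> F \<Longrightarrow> seminorm_on V p" "e > 0"
    and q: "\<And>x c. x \<in> carrier V \<Longrightarrow> q (c \<odot> x) = cmod c * q x"
    and bd: "\<And>x. \<lbrakk>x \<in> carrier V; \<And>p. p \<in> F \<Longrightarrow> p x < e\<rbrakk> \<Longrightarrow> q x < 1"
    and x: "x \<in> carrier V"
  shows "q x \<le> (1 / e) * (\<Sum>p\<in>F. p x)"
proof (rule field_le_epsilon)
  fix d :: real assume d: "d > 0"
  define s where "s = (\<Sum>p\<in>F. p x) + e * d"
  have nn: "0 \<le> (\<Sum>p\<in>F. p x)" using assms(2) seminorm_onD(1) x by (intro sum_nonneg) auto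
  then have s: "s > 0" using d \<open>e > 0\<close> by (simp add: s_def add_nonneg_pos)
  define c where "c = complex_of_real (e / s)"
  have c: "cmod c = e / s" using s \<open>e > 0\<close> by (simp add: c_def norm_divide)
  have "q (c \<odot> x) < 1"
  proof (rule bd)
    fix p assume p: "p \<in> F"
    have "p x \<le> (\<Sum>p\<in>F. p x)"
      by (rule member_le_sum) (use p assms(1,2) x seminorm_onD(1) in auto)
    also have "\<dots> < s" using d \<open>e > 0\<close> by (simp add: s_def)
    finally have "e * p x < e * s" using \<open>e > 0\<close> by simp
    then show "p (c \<odot> x) < e"
      using seminorm_onD(3)[OF assms(2)[OF p] x, of c] s by (simp add: c divide_less_eq mult.commute)
  qed (use x in simp)
  then have "q x < s / e" using q[OF x] s \<open>e > 0\<close> by (simp add: c field_simps)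
  also have "s / e = (1 / e) * (\<Sum>p\<in>F. p x) + d" using \<open>e > 0\<close> by (simp add: s_def field_simps)
  finally show "q x \<le> (1 / e) * (\<Sum>p\<in>F. p x) + d" by simp
qed

lemma seminorm_on_sum:
  assumes "finite F" "\<And>p. p \<in> F \<Longrightarrow> seminorm_on V p" "c \<ge> 0"
  shows "seminorm_on V (\<lambda>x. c * (\<Sum>p\<in>F. p x))"
  unfolding seminorm_on_def
proof (intro conjI ballI allI)
  fix x y assume xy: "x \<in> carrier V" "y \<in> carrier V"
  show "0 \<le> c * (\<Sum>p\<in>F. p x)" using assms(2,3) seminorm_onD(1) xy by (intro mult_nonneg_nonneg sum_nonneg) auto
  have "(\<Sum>p\<in>F. p (x \<oplus> y)) \<le> (\<Sum>p\<in>F. p x + p y)"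
    using assms(2) seminorm_onD(2) xy by (intro sum_mono) auto
  then show "c * (\<Sum>p\<in>F. p (x \<oplus> y)) \<le> c * (\<Sum>p\<in>F. p x) + c * (\<Sum>p\<in>F. p y)"
    using assms(3) by (simp add: sum.distrib mult_left_mono flip: distrib_left)
next
  fix k x assume x: "x \<in> carrier V"
  have "(\<Sum>p\<in>F. p (k \<odot> x)) = cmod k * (\<Sum>p\<in>F. p x)"
    using assms(2) seminorm_onD(3) x by (simp add: sum_distrib_left)
  then show "c * (\<Sum>p\<in>F. p (k \<odot> x)) = cmod k * (c * (\<Sum>p\<in>F. p x))" by simp
qed

end

context seminormed_space
begin

lemmas sn = seminorm_onD[OF seminorms]

lemma ball_open:
  assumes "p \<in> P" "x \<in> carrier V"
  shows "openin (seminorm_topology V P) {y \<in> carrier V. p (y \<ominus> x) < e}"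
  unfolding openin_seminorm_topology seminorm_open_def
proof (intro conjI ballI)
  fix y assume "y \<in> {y \<in> carrier V. p (y \<ominus> x) < e}"
  then have y: "y \<in> carrier V" "p (y \<ominus> x) < e" by auto
  show "\<exists>F \<epsilon>. finite F \<and> F \<subseteq> P \<and> 0 < \<epsilon> \<and>
      (\<forall>z\<in>carrier V. (\<forall>p\<in>F. p (z \<ominus> y) < \<epsilon>) \<longrightarrow> z \<in> {y \<in> carrier V. p (y \<ominus> x) < e})"
    by (rule exI[of _ "{p}"], rule exI[of _ "e - p (y \<ominus> x)"])
       (use assms y sn(6)[OF assms(1) _ y(1) assms(2)] in \<open>force\<close>)
qed auto

lemma topspace_seminorm [simp]: "topspace (seminorm_topology V P) = carrier V"
proof
  show "topspace (seminorm_topology V P) \<subseteq> carrier V"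
    using openin_topspace[of "seminorm_topology V P"]
    unfolding openin_seminorm_topology seminorm_open_def by blast
  have "openin (seminorm_topology V P) (carrier V)"
    unfolding openin_seminorm_topology seminorm_open_def
    by (auto intro!: exI[of _ "{}"] exI[of _ "1::real"])
  then show "carrier V \<subseteq> topspace (seminorm_topology V P)" by (rule openin_subset)
qed

lemma limitin_iff:
  "limitin (seminorm_topology V P) f l F \<longleftrightarrow>
     l \<in> carrier V \<and> (\<forall>\<^sub>F t in F. f t \<in> carrier V) \<and> (\<forall>p\<in>P. ((\<lambda>t. p (f t \<ominus> l)) \<longlongrightarrow> 0) F)"
proof
  assume L: "limitin (seminorm_topology V P) f l F"
  then have l: "l \<in> carrier V" using limitin_topspace by fastforce
  have ev: "\<forall>\<^sub>F t in F. f t \<in> carrier V"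
    using limitinD[OF L, of "carrier V"] l openin_topspace[of "seminorm_topology V P"] by simp
  have "((\<lambda>t. p (f t \<ominus> l)) \<longlongrightarrow> 0) F" if p: "p \<in> P" for p
  proof (rule tendstoI)
    fix e :: real assume e: "e > 0"
    have "\<forall>\<^sub>F t in F. f t \<in> {y \<in> carrier V. p (y \<ominus> l) < e}"
      by (rule limitinD[OF L ball_open[OF p l]]) (use e l sn(4)[OF p] in simp)
    then show "\<forall>\<^sub>F t in F. dist (p (f t \<ominus> l)) 0 < e"
      by eventually_elim (use sn(1)[OF p] l in auto)
  qed
  with l ev show "l \<in> carrier V \<and> (\<forall>\<^sub>F t in F. f t \<in> carrier V) \<and> (\<forall>p\<in>P. ((\<lambda>t. p (f t \<ominus> l)) \<longlongrightarrow> 0) F)"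
    by blast
next
  assume R: "l \<in> carrier V \<and> (\<forall>\<^sub>F t in F. f t \<in> carrier V) \<and> (\<forall>p\<in>P. ((\<lambda>t. p (f t \<ominus> l)) \<longlongrightarrow> 0) F)"
  show "limitin (seminorm_topology V P) f l F"
    unfolding limitin_def
  proof (intro conjI allI impI)
    show "l \<in> topspace (seminorm_topology V P)" using R by simp
    fix U assume U: "openin (seminorm_topology V P) U \<and> l \<in> U"
    then obtain E e where E: "finite E" "E \<subseteq> P" "e > 0"
      "\<And>y. \<lbrakk>y \<in> carrier V; \<forall>p\<in>E. p (y \<ominus> l) < e\<rbrakk> \<Longrightarrow> y \<in> U"
      unfolding openin_seminorm_topology seminorm_open_def by meson
    have "\<forall>\<^sub>F t in F. \<forall>p\<in>E. p (f t \<ominus> l) < e"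
      using E R by (intro eventually_ball_finite) (auto intro: order_tendstoD)
    moreover have "\<forall>\<^sub>F t in F. f t \<in> carrier V" using R by blast
    ultimately show "\<forall>\<^sub>F t in F. f t \<in> U"
      by eventually_elim (use E(4) in auto)
  qed
qed

lemma seminorm_continuous: "p \<in> P \<Longrightarrow> continuous_map (seminorm_topology V P) euclideanreal p"
  unfolding continuous_map_atin
proof
  fix x assume p: "p \<in> P" and x: "x \<in> topspace (seminorm_topology V P)"
  have "limitin (seminorm_topology V P) id x (atin (seminorm_topology V P) x)"
    by (rule limitin_continuous_map) (use x in auto)
  then have ev: "\<forall>\<^sub>F y in atin (seminorm_topology V P) x. y \<in> carrier V"
    and lim: "((\<lambda>y. p (y \<ominus> x)) \<longlongrightarrow> 0) (atin (seminorm_topology V P) x)"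
    using p by (simp_all add: limitin_iff)
  have "((\<lambda>y. p y - p x) \<longlongrightarrow> 0) (atin (seminorm_topology V P) x)"
    by (rule Lim_null_comparison[OF _ lim]) (use ev x sn(8)[OF p] in \<open>auto elim!: eventually_mono\<close>)
  then show "limitin euclideanreal p (p x) (atin (seminorm_topology V P) x)"
    by (simp add: LIM_zero_iff)
qed

end

section \<open>Locally convex spaces\<close>

text \<open>
  The topology is described by all its continuous seminorms rather than by a chosen countable
  family, because sums and pullbacks of continuous seminorms are again continuous seminorms.
\<close>

locale lcs = complex_space V for V :: "('v, 'm) tvs_scheme" (structure) +
  assumes topology_eq: "tvs_topology V = seminorm_topology V {p. continuous_seminorm V p}"
    and separated: "\<lbrakk>x \<in> carrier V; \<And>p. continuous_seminorm V p \<Longrightarrow> p x = 0\<rbrakk> \<Longrightarrow> x = \<zero>"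

locale complete_lcs = lcs +
  assumes complete: "s \<in> cauchy_seqs V {p. continuous_seminorm V p} \<Longrightarrow>
    \<exists>x\<in>carrier V. limitin (tvs_topology V) s x sequentially"

text \<open>
  The countable family and the family of all continuous seminorms define the same topology: the
  former is contained in the latter, and conversely a neighbourhood cut out by finitely many
  continuous seminorms is open.
\<close>

lemma frechet_space_lcs:
  fixes V :: "('v, 'm) tvs_scheme"
  assumes "frechet_space V"
  shows "complete_lcs V"
proof -
  let ?CS = "{p. continuous_seminorm V p}"
  obtain p :: "nat \<Rightarrow> 'v \<Rightarrow> real" where p: "\<forall>n. seminorm_on V (p n)"
    and top: "tvs_topology V = seminorm_topology V (range p)"
    and sep0: "\<forall>x\<in>carrier V. (\<forall>n. p n x = 0) \<longrightarrow> x = \<zero>\<^bsub>V\<^esub>"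
    and compl0: "\<forall>s\<in>cauchy_seqs V (range p). \<exists>x\<in>carrier V. limitin (tvs_topology V) s x sequentially"
    using assms unfolding frechet_space_def by blast
  note sep = sep0[rule_format] and compl = bspec[OF compl0]
  interpret complex_space V
    using assms by (intro complex_space.intro) (simp add: frechet_space_def)
  interpret seminormed_space V "range p"
    by unfold_locales (use p in auto)
  interpret C: seminormed_space V ?CS
    by unfold_locales (simp add: continuous_seminorm_def)
  have cs: "continuous_seminorm V (p n)" for n
    using p seminorm_continuous[of "p n"] top by (simp add: continuous_seminorm_def)
  have "openin (seminorm_topology V (range p)) U \<longleftrightarrow> openin (seminorm_topology V ?CS) U" for U
  proof
    assume "openin (seminorm_topology V (range p)) U"
    moreover have "range p \<subseteq> ?CS" using cs by auto
    ultimately show "openin (seminorm_topology V ?CS) U"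
      unfolding openin_seminorm_topology seminorm_open_def by (meson subset_trans)
  next
    assume U: "openin (seminorm_topology V ?CS) U"
    show "openin (seminorm_topology V (range p)) U"
      unfolding openin_subopen[of _ U]
    proof
      fix x assume x: "x \<in> U"
      then obtain F e where F: "finite F" "F \<subseteq> ?CS" "e > 0"
        "\<forall>y\<in>carrier V. (\<forall>p\<in>F. p (y \<ominus>\<^bsub>V\<^esub> x) < e) \<longrightarrow> y \<in> U"
        using U unfolding openin_seminorm_topology seminorm_open_def by meson
      have xV: "x \<in> carrier V" using x U C.topspace_seminorm openin_subset by blast
      define N where "N = {y \<in> topspace (seminorm_topology V (range p)). \<forall>q\<in>F. q (y \<ominus>\<^bsub>V\<^esub> x) < e}"
      have cont: "continuous_map (seminorm_topology V (range p)) euclideanreal (\<lambda>y. q (y \<ominus>\<^bsub>V\<^esub> x))"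
        if "q \<in> F" for q
      proof -
        have "continuous_map (seminorm_topology V (range p)) (seminorm_topology V (range p)) (\<lambda>y. y \<ominus>\<^bsub>V\<^esub> x)"
          unfolding continuous_map_atin
        proof
          fix z assume z: "z \<in> topspace (seminorm_topology V (range p))"
          have "limitin (seminorm_topology V (range p)) id z (atin (seminorm_topology V (range p)) z)"
            by (rule limitin_continuous_map) (use z in auto)
          moreover have "(y \<ominus>\<^bsub>V\<^esub> x) \<ominus>\<^bsub>V\<^esub> (z \<ominus>\<^bsub>V\<^esub> x) = y \<ominus>\<^bsub>V\<^esub> z" if "y \<in> carrier V" for y
            using that z xV by (rule_tac coordinates3[of x y z]) auto
          ultimately show "limitin (seminorm_topology V (range p)) (\<lambda>y. y \<ominus>\<^bsub>V\<^esub> x) (z \<ominus>\<^bsub>V\<^esub> x)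
              (atin (seminorm_topology V (range p)) z)"
            using xV z unfolding limitin_iff
            by (auto elim: eventually_mono intro: Lim_transform_eventually)
               (smt (verit, best) Lim_transform_eventually eventually_mono)
        qed
        moreover have "continuous_map (seminorm_topology V (range p)) euclideanreal q"
          using that F(2) top by (auto simp: continuous_seminorm_def)
        ultimately show ?thesis using continuous_map_compose[unfolded o_def] by blast
      qed
      have op: "openin (seminorm_topology V (range p)) {y \<in> topspace (seminorm_topology V (range p)). q (y \<ominus>\<^bsub>V\<^esub> x) \<in> {..<e}}"
        if "q \<in> F" for q
        by (rule openin_continuous_map_preimage[OF cont[OF that]]) simp
      have "openin (seminorm_topology V (range p)) (topspace (seminorm_topology V (range p)) \<inter>
          (\<Inter>q\<in>F. {y \<in> topspace (seminorm_topology V (range p)). q (y \<ominus>\<^bsub>V\<^esub> x) \<in> {..<e}}))"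
        by (rule openin_Int_Inter) (use op F(1) in blast)+
      also have "\<dots> = N" by (auto simp: N_def)
      finally have "openin (seminorm_topology V (range p)) N" .
      moreover have "q (x \<ominus>\<^bsub>V\<^esub> x) < e" if "q \<in> F" for q
        using C.sn(4)[of q] xV F(2,3) that by auto
      then have "x \<in> N" using xV by (simp add: N_def)
      moreover have "N \<subseteq> U" using F(4) by (auto simp: N_def)
      ultimately show "\<exists>T. openin (seminorm_topology V (range p)) T \<and> x \<in> T \<and> T \<subseteq> U" by blast
    qed
  qed
  then have eq: "seminorm_topology V (range p) = seminorm_topology V ?CS"
    by (simp add: topology_eq)
  show ?thesis
  proof unfold_locales
    show "tvs_topology V = seminorm_topology V ?CS" using top eq by simp
    show "x = \<zero>\<^bsub>V\<^esub>" if "x \<in> carrier V" "\<And>p. continuous_seminorm V p \<Longrightarrow> p x = 0" for x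
      using sep[of x] that cs by blast
    show "\<exists>x\<in>carrier V. limitin (tvs_topology V) s x sequentially" if "s \<in> cauchy_seqs V ?CS" for s
      by (rule compl) (use that cs in \<open>auto simp: cauchy_seqs_def\<close>)
  qed
qed

context lcs
begin

sublocale seminormed_space V "{p. continuous_seminorm V p}"
  by unfold_locales (simp add: continuous_seminorm_def)

lemmas csn = sn[OF CollectI]

lemma topspace_tvs [simp]: "topspace (tvs_topology V) = carrier V"
  using topspace_seminorm topology_eq by simp

lemma limitin_tvs:
  "limitin (tvs_topology V) f l F \<longleftrightarrow>
     l \<in> carrier V \<and> (\<forall>\<^sub>F t in F. f t \<in> carrier V) \<and>
     (\<forall>p. continuous_seminorm V p \<longrightarrow> ((\<lambda>t. p (f t \<ominus> l)) \<longlongrightarrow> 0) F)"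
  using limitin_iff[of f l F] topology_eq by simp

lemma limitin_tvsI:
  assumes "l \<in> carrier V" "\<forall>\<^sub>F t in F. f t \<in> carrier V"
    "\<And>p. continuous_seminorm V p \<Longrightarrow> ((\<lambda>t. p (f t \<ominus> l)) \<longlongrightarrow> 0) F"
  shows "limitin (tvs_topology V) f l F"
  using assms limitin_tvs by blast

lemma limitin_tvsD:
  assumes "limitin (tvs_topology V) f l F"
  shows "l \<in> carrier V" "\<forall>\<^sub>F t in F. f t \<in> carrier V"
    "continuous_seminorm V p \<Longrightarrow> ((\<lambda>t. p (f t \<ominus> l)) \<longlongrightarrow> 0) F"
    "\<lbrakk>continuous_seminorm V p; e > 0\<rbrakk> \<Longrightarrow> \<forall>\<^sub>F t in F. f t \<in> carrier V \<and> p (f t \<ominus> l) < e"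
proof -
  show *: "l \<in> carrier V" "\<forall>\<^sub>F t in F. f t \<in> carrier V"
    "continuous_seminorm V p \<Longrightarrow> ((\<lambda>t. p (f t \<ominus> l)) \<longlongrightarrow> 0) F" for p
    using assms limitin_tvs by blast+
  show "\<lbrakk>continuous_seminorm V p; e > 0\<rbrakk> \<Longrightarrow> \<forall>\<^sub>F t in F. f t \<in> carrier V \<and> p (f t \<ominus> l) < e"
    using *(2) order_tendstoD(2)[OF *(3)] by (auto simp: eventually_conj_iff)
qed

lemma limit_add:
  assumes f: "limitin (tvs_topology V) f l F" and g: "limitin (tvs_topology V) g m F"
  shows "limitin (tvs_topology V) (\<lambda>t. f t \<oplus> g t) (l \<oplus> m) F"
proof (rule limitin_tvsI)
  note lm = limitin_tvsD(1)[OF f] limitin_tvsD(1)[OF g]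
  note ev = eventually_conj[OF limitin_tvsD(2)[OF f] limitin_tvsD(2)[OF g]]
  show "l \<oplus> m \<in> carrier V" using lm by simp
  show "\<forall>\<^sub>F t in F. f t \<oplus> g t \<in> carrier V" using ev by eventually_elim simp
  fix p assume p: "continuous_seminorm V p"
  have lim: "((\<lambda>t. p (f t \<ominus> l) + p (g t \<ominus> m)) \<longlongrightarrow> 0) F"
    using tendsto_add[OF limitin_tvsD(3)[OF f p] limitin_tvsD(3)[OF g p]] by simp
  show "((\<lambda>t. p (f t \<oplus> g t \<ominus> (l \<oplus> m))) \<longlongrightarrow> 0) F"
  proof (rule Lim_null_comparison[OF _ lim])
    show "\<forall>\<^sub>F t in F. norm (p (f t \<oplus> g t \<ominus> (l \<oplus> m))) \<le> p (f t \<ominus> l) + p (g t \<ominus> m)"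
      using ev
    proof eventually_elim
      case (elim t)
      have "f t \<oplus> g t \<ominus> (l \<oplus> m) = (f t \<ominus> l) \<oplus> (g t \<ominus> m)"
        by (rule coordinates4[of "f t" "g t" l m]) (use elim lm in auto)
      then show ?case
        using csn(1,2)[OF p] elim lm by simp
    qed
  qed
qed

lemma limit_smult:
  assumes f: "limitin (tvs_topology V) f l F" and c: "(c \<longlongrightarrow> k) F"
  shows "limitin (tvs_topology V) (\<lambda>t. c t \<odot> f t) (k \<odot> l) F"
proof (rule limitin_tvsI)
  note l = limitin_tvsD(1)[OF f]
  note ev = limitin_tvsD(2)[OF f]
  show "k \<odot> l \<in> carrier V" using l by simp
  show "\<forall>\<^sub>F t in F. c t \<odot> f t \<in> carrier V" using ev by eventually_elim simp
  fix p assume p: "continuous_seminorm V p"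
  have "((\<lambda>t. cmod (c t) * p (f t \<ominus> l) + cmod (c t - k) * p l) \<longlongrightarrow> cmod k * 0 + 0 * p l) F"
    by (intro tendsto_intros c limitin_tvsD(3)[OF f p] tendsto_norm_zero) (use c in \<open>simp add: LIM_zero_iff\<close>)
  then have lim: "((\<lambda>t. cmod (c t) * p (f t \<ominus> l) + cmod (c t - k) * p l) \<longlongrightarrow> 0) F" by simp
  show "((\<lambda>t. p (c t \<odot> f t \<ominus> k \<odot> l)) \<longlongrightarrow> 0) F"
  proof (rule Lim_null_comparison[OF _ lim])
    show "\<forall>\<^sub>F t in F. norm (p (c t \<odot> f t \<ominus> k \<odot> l)) \<le> cmod (c t) * p (f t \<ominus> l) + cmod (c t - k) * p l"
      using ev
    proof eventually_elim
      case (elim t)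
      have "c t \<odot> f t \<ominus> k \<odot> l = c t \<odot> (f t \<ominus> l) \<oplus> (c t - k) \<odot> l"
        by (rule coordinates2[of "f t" l]) (use elim l in \<open>auto simp: algebra_simps\<close>)
      then show ?case
        using csn(1)[OF p, of "c t \<odot> f t \<ominus> k \<odot> l"] csn(2)[OF p, of "c t \<odot> (f t \<ominus> l)" "(c t - k) \<odot> l"]
          csn(3)[OF p] elim l by simp
    qed
  qed
qed

lemma limit_const [simp]: "limitin (tvs_topology V) (\<lambda>t. l) l F \<longleftrightarrow> l \<in> carrier V"
  by (simp add: Abstract_Limits.limitin_const_iff)

lemma limit_minus:
  assumes f: "limitin (tvs_topology V) f l F" and g: "limitin (tvs_topology V) g m F"
  shows "limitin (tvs_topology V) (\<lambda>t. f t \<ominus> g t) (l \<ominus> m) F"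
proof -
  have "limitin (tvs_topology V) (\<lambda>t. f t \<oplus> (- 1) \<odot> g t) (l \<oplus> (- 1) \<odot> m) F"
    by (intro limit_add limit_smult f g tendsto_const)
  moreover have "\<forall>\<^sub>F t in F. f t \<oplus> (- 1) \<odot> g t = f t \<ominus> g t"
    using limitin_tvsD(2)[OF f] limitin_tvsD(2)[OF g] by eventually_elim (simp add: minus_eq)
  ultimately show ?thesis
    using limitin_tvsD(1)[OF f] limitin_tvsD(1)[OF g]
    by (simp add: minus_eq limitin_transform_eventually)
qed

lemma limit_seminorm:
  assumes f: "limitin (tvs_topology V) f l F" and p: "continuous_seminorm V p"
  shows "((\<lambda>t. p (f t)) \<longlongrightarrow> p l) F"
  using continuous_map_limit[OF _ f, of euclideanreal p] p by (simp add: continuous_seminorm_def o_def)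

lemma limit_unique:
  assumes f: "limitin (tvs_topology V) f l F" and g: "limitin (tvs_topology V) f m F" and "F \<noteq> bot"
  shows "l = m"
proof -
  note lm = limitin_tvsD(1)[OF f] limitin_tvsD(1)[OF g]
  have "limitin (tvs_topology V) (\<lambda>t. f t \<ominus> f t) (l \<ominus> m) F" by (rule limit_minus[OF f g])
  moreover have "\<forall>\<^sub>F t in F. f t \<ominus> f t = \<zero>" using limitin_tvsD(2)[OF f] by eventually_elim simp
  ultimately have L: "limitin (tvs_topology V) (\<lambda>t. \<zero>) (l \<ominus> m) F"
    by (rule limitin_transform_eventually[rotated])
  have "p (l \<ominus> m) = 0" if p: "continuous_seminorm V p" for p
    using tendsto_unique[OF \<open>F \<noteq> bot\<close> limit_seminorm[OF L p] tendsto_const] csn(4)[OF p] by simp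
  then have "l \<ominus> m = \<zero>" using separated lm by simp
  then show ?thesis using lm minus_0_iff by simp
qed

lemma continuous_seminorm_sum:
  assumes F: "finite F" "\<And>p. p \<in> F \<Longrightarrow> continuous_seminorm V p" and "c \<ge> 0"
  shows "continuous_seminorm V (\<lambda>x. c * (\<Sum>p\<in>F. p x))"
  unfolding continuous_seminorm_def
proof
  show "seminorm_on V (\<lambda>x. c * (\<Sum>p\<in>F. p x))"
    by (rule seminorm_on_sum) (use assms in \<open>auto simp: continuous_seminorm_def\<close>)
  show "continuous_map (tvs_topology V) euclideanreal (\<lambda>x. c * (\<Sum>p\<in>F. p x))"
    using assms by (intro continuous_map_real_mult_left continuous_map_sum) (auto simp: continuous_seminorm_def)
qed

lemma open_seminorm_nbhd:
  assumes "openin (tvs_topology V) U" "x \<in> U"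
  obtains F e where "finite F" "\<forall>p\<in>F. continuous_seminorm V p" "e > 0"
    "\<forall>y\<in>carrier V. (\<forall>p\<in>F. p (y \<ominus> x) < e) \<longrightarrow> y \<in> U"
proof -
  obtain F e where F: "finite F" "F \<subseteq> {p. continuous_seminorm V p}" "e > 0"
    "\<forall>y\<in>carrier V. (\<forall>p\<in>F. p (y \<ominus> x) < e) \<longrightarrow> y \<in> U"
    using assms unfolding topology_eq openin_seminorm_topology seminorm_open_def by meson
  show thesis by (rule that[of F e]) (use F in auto)
qed

lemma minus_zero [simp]: "y \<in> carrier V \<Longrightarrow> y \<ominus> \<zero> = y"
  by (simp add: minus_eq)

lemma pullback_seminorm:
  assumes "linear_map V W T" "continuous_map (tvs_topology V) (tvs_topology W) T" "continuous_seminorm W q"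
  shows "continuous_seminorm V (\<lambda>x. q (T x))"
  unfolding continuous_seminorm_def
proof
  show "continuous_map (tvs_topology V) euclideanreal (\<lambda>x. q (T x))"
    using continuous_map_compose[OF assms(2), of euclideanreal q] assms(3)
    by (simp add: continuous_seminorm_def o_def)
  show "seminorm_on V (\<lambda>x. q (T x))"
    using assms(1,3) unfolding seminorm_on_def continuous_seminorm_def linear_map_def
    by (auto simp: Pi_iff)
qed

end

section \<open>Bilinear maps\<close>

definition bilinear_map where
  "bilinear_map V W U b \<longleftrightarrow>
     (\<forall>w\<in>carrier W. linear_map V U (\<lambda>v. b (v, w))) \<and> (\<forall>v\<in>carrier V. linear_map W U (\<lambda>w. b (v, w)))"

lemma bilinear_mapD:
  assumes "bilinear_map V W U b"
  shows "\<lbrakk>v \<in> carrier V; w \<in> carrier W\<rbrakk> \<Longrightarrow> b (v, w) \<in> carrier U"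
    "\<lbrakk>v \<in> carrier V; v' \<in> carrier V; w \<in> carrier W\<rbrakk> \<Longrightarrow> b (v \<oplus>\<^bsub>V\<^esub> v', w) = b (v, w) \<oplus>\<^bsub>U\<^esub> b (v', w)"
    "\<lbrakk>v \<in> carrier V; w \<in> carrier W; w' \<in> carrier W\<rbrakk> \<Longrightarrow> b (v, w \<oplus>\<^bsub>W\<^esub> w') = b (v, w) \<oplus>\<^bsub>U\<^esub> b (v, w')"
    "\<lbrakk>v \<in> carrier V; w \<in> carrier W\<rbrakk> \<Longrightarrow> b (c \<odot>\<^bsub>V\<^esub> v, w) = c \<odot>\<^bsub>U\<^esub> b (v, w)"
    "\<lbrakk>v \<in> carrier V; w \<in> carrier W\<rbrakk> \<Longrightarrow> b (v, c \<odot>\<^bsub>W\<^esub> w) = c \<odot>\<^bsub>U\<^esub> b (v, w)"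
  using assms unfolding bilinear_map_def linear_map_def Pi_iff by blast+

lemma bilinear_mapI:
  assumes "\<And>v w. \<lbrakk>v \<in> carrier V; w \<in> carrier W\<rbrakk> \<Longrightarrow> b (v, w) \<in> carrier U"
    "\<And>v v' w. \<lbrakk>v \<in> carrier V; v' \<in> carrier V; w \<in> carrier W\<rbrakk> \<Longrightarrow> b (v \<oplus>\<^bsub>V\<^esub> v', w) = b (v, w) \<oplus>\<^bsub>U\<^esub> b (v', w)"
    "\<And>v w w'. \<lbrakk>v \<in> carrier V; w \<in> carrier W; w' \<in> carrier W\<rbrakk> \<Longrightarrow> b (v, w \<oplus>\<^bsub>W\<^esub> w') = b (v, w) \<oplus>\<^bsub>U\<^esub> b (v, w')"
    "\<And>v w c. \<lbrakk>v \<in> carrier V; w \<in> carrier W\<rbrakk> \<Longrightarrow> b (c \<odot>\<^bsub>V\<^esub> v, w) = c \<odot>\<^bsub>U\<^esub> b (v, w)"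
    "\<And>v w c. \<lbrakk>v \<in> carrier V; w \<in> carrier W\<rbrakk> \<Longrightarrow> b (v, c \<odot>\<^bsub>W\<^esub> w) = c \<odot>\<^bsub>U\<^esub> b (v, w)"
  shows "bilinear_map V W U b"
  using assms unfolding bilinear_map_def linear_map_def Pi_iff by blast

locale bilinear_pairing = V: complex_space V + W: complex_space W + U: complex_space U
  for V (structure) and W (structure) and U (structure) + fixes b
  assumes bilinear: "bilinear_map V W U b"
begin

lemmas bilin [simp] = bilinear_mapD[OF bilinear]

lemma bilin_minus [simp]:
  "\<lbrakk>v \<in> carrier V; v' \<in> carrier V; w \<in> carrier W\<rbrakk> \<Longrightarrow> b (v \<ominus>\<^bsub>V\<^esub> v', w) = b (v, w) \<ominus>\<^bsub>U\<^esub> b (v', w)"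
  "\<lbrakk>v \<in> carrier V; w \<in> carrier W; w' \<in> carrier W\<rbrakk> \<Longrightarrow> b (v, w \<ominus>\<^bsub>W\<^esub> w') = b (v, w) \<ominus>\<^bsub>U\<^esub> b (v, w')"
  by (simp_all add: V.minus_eq W.minus_eq U.minus_eq)

lemma bilin_zero [simp]:
  "w \<in> carrier W \<Longrightarrow> b (\<zero>\<^bsub>V\<^esub>, w) = \<zero>\<^bsub>U\<^esub>" "v \<in> carrier V \<Longrightarrow> b (v, \<zero>\<^bsub>W\<^esub>) = \<zero>\<^bsub>U\<^esub>"
  using bilin(4)[of "\<zero>\<^bsub>V\<^esub>" w 0] bilin(5)[of v "\<zero>\<^bsub>W\<^esub>" 0] by simp_all

end

locale continuous_bilinear = bilinear_pairing V W U b + V: lcs V + W: lcs W + U: lcs U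
  for V :: "('v, 'a) tvs_scheme" and W :: "('w, 'b) tvs_scheme" and U :: "('u, 'c) tvs_scheme" and b +
  assumes continuous: "continuous_map (prod_topology (tvs_topology V) (tvs_topology W)) (tvs_topology U) b"
begin

text \<open>
  A product of two balls lies in the preimage of the unit ball of \<open>r\<close>; scaling the first and then
  the second argument turns this into a bound.
\<close>

lemma bilinear_bound:
  assumes r: "continuous_seminorm U r"
  obtains p q where "continuous_seminorm V p" "continuous_seminorm W q"
    "\<And>v w. \<lbrakk>v \<in> carrier V; w \<in> carrier W\<rbrakk> \<Longrightarrow> r (b (v, w)) \<le> p v * q w"
proof -
  let ?T = "prod_topology (tvs_topology V) (tvs_topology W)"
  have "continuous_map ?T euclideanreal (\<lambda>x. r (b x))"
    using continuous_map_compose[OF continuous, of euclideanreal r] r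
    by (simp add: continuous_seminorm_def o_def)
  then have op: "openin ?T {x \<in> topspace ?T. r (b x) \<in> {..<1}}"
    by (rule openin_continuous_map_preimage) simp
  have mem: "(\<zero>\<^bsub>V\<^esub>, \<zero>\<^bsub>W\<^esub>) \<in> {x \<in> topspace ?T. r (b x) \<in> {..<1}}"
    using U.csn(4)[OF r] by simp
  obtain A B where AB: "openin (tvs_topology V) A" "openin (tvs_topology W) B"
    "\<zero>\<^bsub>V\<^esub> \<in> A" "\<zero>\<^bsub>W\<^esub> \<in> B" "A \<times> B \<subseteq> {x \<in> topspace ?T. r (b x) \<in> {..<1}}"
    using op[unfolded openin_prod_topology_alt, rule_format, OF mem] by (elim exE conjE) (rule that)
  obtain F e where F: "finite F" "\<forall>p\<in>F. continuous_seminorm V p" "e > 0"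
    "\<forall>y\<in>carrier V. (\<forall>p\<in>F. p (y \<ominus>\<^bsub>V\<^esub> \<zero>\<^bsub>V\<^esub>) < e) \<longrightarrow> y \<in> A"
    by (rule V.open_seminorm_nbhd[OF AB(1,3)])
  obtain F' e' where F': "finite F'" "\<forall>p\<in>F'. continuous_seminorm W p" "e' > 0"
    "\<forall>y\<in>carrier W. (\<forall>p\<in>F'. p (y \<ominus>\<^bsub>W\<^esub> \<zero>\<^bsub>W\<^esub>) < e') \<longrightarrow> y \<in> B"
    by (rule W.open_seminorm_nbhd[OF AB(2,4)])
  define p where "p v = 1 / e * (\<Sum>p\<in>F. p v)" for v
  define q where "q w = 1 / e' * (\<Sum>p\<in>F'. p w)" for w
  have p: "continuous_seminorm V p" unfolding p_def
    by (rule V.continuous_seminorm_sum) (use F in auto)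
  have q: "continuous_seminorm W q" unfolding q_def
    by (rule W.continuous_seminorm_sum) (use F' in auto)
  have 1: "r (b (v, w)) \<le> p v"
    if v: "v \<in> carrier V" and w: "w \<in> carrier W" "\<And>p. p \<in> F' \<Longrightarrow> p w < e'" for v w
    unfolding p_def
  proof (rule V.seminorm_bound[OF F(1) _ F(3) _ _ v])
    show "seminorm_on V p" if "p \<in> F" for p using F(2) that by (simp add: continuous_seminorm_def)
    show "r (b (c \<odot>\<^bsub>V\<^esub> x, w)) = cmod c * r (b (x, w))" if "x \<in> carrier V" for x c
      using U.csn(3)[OF r] that w by simp
    show "r (b (x, w)) < 1" if x: "x \<in> carrier V" "\<And>p. p \<in> F \<Longrightarrow> p x < e" for x
    proof -
      have "x \<in> A" using F(4) x by simp
      moreover have "w \<in> B" using F'(4) w by simp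
      ultimately show ?thesis using AB(5) by blast
    qed
  qed
  show thesis
  proof (rule that[OF p q])
    fix v w assume v: "v \<in> carrier V" and w: "w \<in> carrier W"
    have pv: "p v \<ge> 0" using V.csn(1)[OF p v] .
    have qw: "q w \<ge> 0" using W.csn(1)[OF q w] .
    show "r (b (v, w)) \<le> p v * q w"
    proof (rule field_le_epsilon)
      fix d :: real assume d: "d > 0"
      \<comment> \<open>The second summand makes \<open>k\<close> positive and costs at most \<open>d\<close> after multiplication by \<open>q w\<close>.\<close>
      define k where "k = p v + d / (q w + 1)"
      have k: "k > p v" "k > 0" using d qw pv by (simp_all add: k_def add_nonneg_pos)
      have "r (b (v, w)) / k \<le> 1 / e' * (\<Sum>p\<in>F'. p w)"
      proof (rule W.seminorm_bound[OF F'(1) _ F'(3) _ _ w])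
        show "seminorm_on W p" if "p \<in> F'" for p using F'(2) that by (simp add: continuous_seminorm_def)
        show "r (b (v, c \<odot>\<^bsub>W\<^esub> x)) / k = cmod c * (r (b (v, x)) / k)" if "x \<in> carrier W" for x c
          using U.csn(3)[OF r] that v by simp
        show "r (b (v, x)) / k < 1" if x: "x \<in> carrier W" "\<And>p. p \<in> F' \<Longrightarrow> p x < e'" for x
        proof -
          have "r (b (v, x)) \<le> p v" by (rule 1) (use v x in auto)
          then show ?thesis using k by simp
        qed
      qed
      then have "r (b (v, w)) \<le> k * q w" using k by (simp add: q_def field_simps)
      also have "\<dots> = p v * q w + d * (q w / (q w + 1))" by (simp add: k_def algebra_simps)
      also have "\<dots> \<le> p v * q w + d"
        using d qw by (simp add: mult_left_le divide_le_eq)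
      finally show "r (b (v, w)) \<le> p v * q w + d" .
    qed
  qed
qed

lemma limit_bilinear:
  assumes "limitin (tvs_topology V) f v F" "limitin (tvs_topology W) g w F"
  shows "limitin (tvs_topology U) (\<lambda>t. b (f t, g t)) (b (v, w)) F"
  using continuous_map_limit[OF continuous, of "\<lambda>t. (f t, g t)" "(v, w)" F] assms
  by (simp add: limitin_pairwise o_def)

end

section \<open>The exponential of two-by-two matrices\<close>

lemmas mat2_simps = vec_eq_iff forall_2 matrix_matrix_mult_def sum_2 mat_def cscale_def

definition mpow :: "mat2 \<Rightarrow> nat \<Rightarrow> mat2" where
  "mpow a n = ((**) a ^^ n) (mat 1)"

lemma mpow_simps [simp]: "mpow a 0 = mat 1" "mpow a (Suc n) = a ** mpow a n"
  by (simp_all add: mpow_def)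

lemma mat_mult_distrib:
  fixes A B C :: mat2
  shows "A ** (B + C) = A ** B + A ** C" "(A + B) ** C = A ** C + B ** C"
    "A ** (B - C) = A ** B - A ** C" "(A - B) ** C = A ** C - B ** C"
    "(r *\<^sub>R A) ** B = r *\<^sub>R (A ** B)" "A ** (r *\<^sub>R B) = r *\<^sub>R (A ** B)"
    "cscale c A ** B = cscale c (A ** B)" "A ** cscale c B = cscale c (A ** B)"
  by (simp_all add: mat2_simps algebra_simps)

lemma bounded_bilinear_mat_mult: "bounded_bilinear ((**) :: mat2 \<Rightarrow> mat2 \<Rightarrow> mat2)"
proof -
  have "bilinear ((**) :: mat2 \<Rightarrow> mat2 \<Rightarrow> mat2)"
    unfolding bilinear_def by (auto intro!: linearI simp: mat_mult_distrib)
  then show ?thesis by (simp add: bilinear_conv_bounded_bilinear)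
qed

lemma bounded_linear_cscale: "bounded_linear (\<lambda>c. cscale c X)"
proof -
  have "linear (\<lambda>c. cscale c X)"
    by (rule linearI) (simp_all add: mat2_simps algebra_simps)
  then show ?thesis by (simp add: linear_conv_bounded_linear)
qed

lemma mpow_scaleR: "mpow (t *\<^sub>R X) n = t ^ n *\<^sub>R mpow X n"
  by (induction n) (simp_all add: mat_mult_distrib)

text \<open>
  By the Cayley-Hamilton theorem the powers of \<open>X\<close> are combinations of \<open>1\<close> and \<open>X\<close>, whose
  coefficients are determined by the eigenvalues \<open>r\<close> and \<open>s\<close>.
\<close>

lemma mexp_formula:
  fixes X :: mat2
  obtains p q r s where
    "r + s = trace X" "r * s = det X"
    "\<And>t. (\<lambda>n. mpow (t *\<^sub>R X) n /\<^sub>R fact n) sums (cscale (p (of_real t)) (mat 1) + cscale (q (of_real t)) X)"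
    "\<And>t. p t + q t * r = exp (t * r)" "\<And>t. p t + q t * s = exp (t * s)"
    "\<And>t u. p (t + u) = p t * p u - r * s * q t * q u"
    "\<And>t u. q (t + u) = p t * q u + q t * p u + (r + s) * q t * q u"
    "(p has_field_derivative 0) (at 0)" "(q has_field_derivative 1) (at 0)"
    "continuous_on UNIV p" "continuous_on UNIV q" "p 0 = 1" "q 0 = 0"
proof -
  define w where "w = csqrt ((trace X)\<^sup>2 - 4 * det X)"
  define r where "r = (trace X + w) / 2"
  define s where "s = (trace X - w) / 2"
  have rs: "r + s = trace X" by (simp add: r_def s_def field_simps)
  have "w\<^sup>2 = (trace X)\<^sup>2 - 4 * det X" by (simp add: w_def)
  then have rs': "r * s = det X" by (simp add: r_def s_def field_simps power2_eq_square)
  have CH: "X ** X = cscale (r + s) X - cscale (r * s) (mat 1)"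
    unfolding rs rs' by (simp add: mat2_simps trace_def det_2 algebra_simps)
  have powers: "mpow X n = cscale (a n) (mat 1) + cscale (b n) X"
    if "a 0 = 1" "b 0 = 0" "\<And>n. a (Suc n) = - (r * s) * b n" "\<And>n. b (Suc n) = a n + (r + s) * b n"
    for a b :: "nat \<Rightarrow> complex" and n
  proof (induction n)
    case 0 then show ?case using that by (simp add: mat2_simps)
  next
    case (Suc n)
    have "mpow X (Suc n) = cscale (a n) X + cscale (b n) (X ** X)"
      by (simp add: Suc mat_mult_distrib)
    also have "\<dots> = cscale (a (Suc n)) (mat 1) + cscale (b (Suc n)) X"
      unfolding CH that by (simp add: mat2_simps algebra_simps)
    finally show ?case .
  qed
  have sums: "(\<lambda>n. mpow (t *\<^sub>R X) n /\<^sub>R fact n) sums (cscale x (mat 1) + cscale y X)"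
    if "\<And>n. mpow X n = cscale (a n) (mat 1) + cscale (b n) X"
      "(\<lambda>n. of_real t ^ n * a n /\<^sub>R fact n) sums x" "(\<lambda>n. of_real t ^ n * b n /\<^sub>R fact n) sums y"
    for a b t x y
  proof -
    have "(\<lambda>n. cscale (of_real t ^ n * a n /\<^sub>R fact n) (mat 1) + cscale (of_real t ^ n * b n /\<^sub>R fact n) X)
        sums (cscale x (mat 1) + cscale y X)"
      by (intro sums_add bounded_linear.sums[OF bounded_linear_cscale] that)
    moreover have "mpow (t *\<^sub>R X) n /\<^sub>R fact n =
        cscale (of_real t ^ n * a n /\<^sub>R fact n) (mat 1) + cscale (of_real t ^ n * b n /\<^sub>R fact n) X" for n
      unfolding mpow_scaleR that(1)
      by (simp add: mat2_simps) (simp add: scaleR_conv_of_real algebra_simps)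
    ultimately show ?thesis by simp
  qed
  have exps: "(\<lambda>n. of_real t ^ n * z ^ n /\<^sub>R fact n) sums exp (of_real t * z)" for t :: real and z :: complex
    using exp_converges[of "of_real t * z"] by (simp add: power_mult_distrib)
  show thesis
  proof (cases "r = s")
    case False
    define p where "p t = (r * exp (t * s) - s * exp (t * r)) / (r - s)" for t
    define q where "q t = (exp (t * r) - exp (t * s)) / (r - s)" for t
    have d: "r - s \<noteq> 0" using False by simp
    show thesis
    proof (rule that[of r s p q, OF rs rs'])
      fix t :: real
      show "(\<lambda>n. mpow (t *\<^sub>R X) n /\<^sub>R fact n) sums (cscale (p (of_real t)) (mat 1) + cscale (q (of_real t)) X)"
      proof (rule sums[where a = "\<lambda>n. (r * s ^ n - s * r ^ n) / (r - s)" and b = "\<lambda>n. (r ^ n - s ^ n) / (r - s)"])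
        show "mpow X n = cscale ((r * s ^ n - s * r ^ n) / (r - s)) (mat 1) + cscale ((r ^ n - s ^ n) / (r - s)) X" for n
        proof (rule powers)
          show "(r * s ^ Suc n - s * r ^ Suc n) / (r - s) = - (r * s) * ((r ^ n - s ^ n) / (r - s))" for n
            unfolding times_divide_eq_right by (simp add: algebra_simps)
          show "(r ^ Suc n - s ^ Suc n) / (r - s) =
              (r * s ^ n - s * r ^ n) / (r - s) + (r + s) * ((r ^ n - s ^ n) / (r - s))" for n
            unfolding times_divide_eq_right add_divide_distrib[symmetric] by (simp add: algebra_simps)
        qed (use d in simp_all)
        have "(\<lambda>n. (r * (of_real t ^ n * s ^ n /\<^sub>R fact n) - s * (of_real t ^ n * r ^ n /\<^sub>R fact n)) / (r - s)) sums p (of_real t)"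
          unfolding p_def by (intro sums_divide sums_diff sums_mult exps)
        then show "(\<lambda>n. of_real t ^ n * ((r * s ^ n - s * r ^ n) / (r - s)) /\<^sub>R fact n) sums p (of_real t)"
          by (rule back_subst[where P = "\<lambda>f. f sums _"]) (simp add: fun_eq_iff scaleR_conv_of_real field_simps)
        have "(\<lambda>n. (of_real t ^ n * r ^ n /\<^sub>R fact n - of_real t ^ n * s ^ n /\<^sub>R fact n) / (r - s)) sums q (of_real t)"
          unfolding q_def by (intro sums_divide sums_diff sums_mult exps)
        then show "(\<lambda>n. of_real t ^ n * ((r ^ n - s ^ n) / (r - s)) /\<^sub>R fact n) sums q (of_real t)"
          by (rule back_subst[where P = "\<lambda>f. f sums _"]) (simp add: fun_eq_iff scaleR_conv_of_real field_simps)
      qed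
    next
      fix t
      show "p t + q t * r = exp (t * r)" "p t + q t * s = exp (t * s)"
        using d by (simp_all add: p_def q_def divide_simps) (simp_all add: algebra_simps)
    next
      fix t u
      show "p (t + u) = p t * p u - r * s * q t * q u"
        "q (t + u) = p t * q u + q t * p u + (r + s) * q t * q u"
        using d by (simp_all add: p_def q_def distrib_right exp_add divide_simps) (simp_all add: algebra_simps)
    next
      show "(p has_field_derivative 0) (at 0)" "(q has_field_derivative 1) (at 0)"
        unfolding p_def q_def using d by (auto intro!: derivative_eq_intros)
      show "continuous_on UNIV p" "continuous_on UNIV q"
        unfolding p_def q_def by (intro continuous_intros; use d in simp)+
      show "p 0 = 1" "q 0 = 0" using d by (simp_all add: p_def q_def)
    qed
  next
    case True
    \<comment> \<open>These are the limits of the coefficients above as the eigenvalues merge.\<close>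
    define p where "p t = exp (t * r) * (1 - t * r)" for t
    define q where "q t = exp (t * r) * t" for t
    have qs: "(\<lambda>n. of_real t ^ n * (of_nat n * r ^ (n - 1)) /\<^sub>R fact n) sums q (of_real t)" for t
    proof -
      have "(\<lambda>n. of_real t ^ Suc n * (of_nat (Suc n) * r ^ n) /\<^sub>R fact (Suc n)) =
          (\<lambda>n. (of_real t ^ n * r ^ n /\<^sub>R fact n) * of_real t)"
      proof
        fix n
        have "complex_of_real (fact (Suc n)) = of_nat (Suc n) * of_real (fact n)" by simp
        then show "of_real t ^ Suc n * (of_nat (Suc n) * r ^ n) /\<^sub>R fact (Suc n) =
            (of_real t ^ n * r ^ n /\<^sub>R fact n) * of_real t"
          unfolding scaleR_conv_of_real of_real_inverse by (simp del: of_nat_Suc fact_Suc add: field_simps)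
      qed
      moreover have "(\<lambda>n. (of_real t ^ n * r ^ n /\<^sub>R fact n) * of_real t) sums q (of_real t)"
        unfolding q_def by (intro sums_mult2 exps)
      ultimately have "(\<lambda>n. of_real t ^ Suc n * (of_nat (Suc n) * r ^ (Suc n - 1)) /\<^sub>R fact (Suc n)) sums q (of_real t)"
        by simp
      then show ?thesis by (subst (asm) sums_Suc_iff) simp
    qed
    show thesis
    proof (rule that[of r s p q, OF rs rs'])
      fix t :: real
      show "(\<lambda>n. mpow (t *\<^sub>R X) n /\<^sub>R fact n) sums (cscale (p (of_real t)) (mat 1) + cscale (q (of_real t)) X)"
      proof (rule sums[where a = "\<lambda>n. (1 - of_nat n) * r ^ n" and b = "\<lambda>n. of_nat n * r ^ (n - 1)"])
        show "mpow X n = cscale ((1 - of_nat n) * r ^ n) (mat 1) + cscale (of_nat n * r ^ (n - 1)) X" for n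
        proof (rule powers)
          show "(1 - of_nat (Suc n)) * r ^ Suc n = - (r * s) * (of_nat n * r ^ (n - 1))" for n
            using True by (cases n) (simp_all add: algebra_simps)
          show "of_nat (Suc n) * r ^ (Suc n - 1) = (1 - of_nat n) * r ^ n + (r + s) * (of_nat n * r ^ (n - 1))" for n
            using True by (cases n) (simp_all add: algebra_simps)
        qed simp_all
        show "(\<lambda>n. of_real t ^ n * (of_nat n * r ^ (n - 1)) /\<^sub>R fact n) sums q (of_real t)" by (rule qs)
        have "(\<lambda>n. of_real t ^ n * r ^ n /\<^sub>R fact n - r * (of_real t ^ n * (of_nat n * r ^ (n - 1)) /\<^sub>R fact n))
            sums (exp (of_real t * r) - r * q (of_real t))"
          by (intro sums_diff sums_mult exps qs)
        moreover have "exp (of_real t * r) - r * q (of_real t) = p (of_real t)"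
          by (simp add: p_def q_def algebra_simps)
        moreover have "of_real t ^ n * r ^ n /\<^sub>R fact n - r * (of_real t ^ n * (of_nat n * r ^ (n - 1)) /\<^sub>R fact n) =
            of_real t ^ n * ((1 - of_nat n) * r ^ n) /\<^sub>R fact n" for n
          by (cases n) (simp_all add: scaleR_conv_of_real algebra_simps)
        ultimately show "(\<lambda>n. of_real t ^ n * ((1 - of_nat n) * r ^ n) /\<^sub>R fact n) sums p (of_real t)" by simp
      qed
    next
      fix t
      show "p t + q t * r = exp (t * r)" "p t + q t * s = exp (t * s)"
        using True by (simp_all add: p_def q_def algebra_simps)
    next
      fix t u
      show "p (t + u) = p t * p u - r * s * q t * q u"
        "q (t + u) = p t * q u + q t * p u + (r + s) * q t * q u"
        using True by (simp_all add: p_def q_def distrib_right exp_add algebra_simps)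
    next
      show "(p has_field_derivative 0) (at 0)" "(q has_field_derivative 1) (at 0)"
        unfolding p_def q_def by (auto intro!: derivative_eq_intros)
      show "continuous_on UNIV p" "continuous_on UNIV q"
        unfolding p_def q_def by (intro continuous_intros)+
      show "p 0 = 1" "q 0 = 0" by (simp_all add: p_def q_def)
    qed
  qed
qed

lemma mexp_sums: "(\<lambda>n. mpow X n /\<^sub>R fact n) sums mexp X"
proof (rule mexp_formula[of X])
  fix p q :: "complex \<Rightarrow> complex"
  assume "\<And>t. (\<lambda>n. mpow (t *\<^sub>R X) n /\<^sub>R fact n) sums (cscale (p (of_real t)) (mat 1) + cscale (q (of_real t)) X)"
  from this[of 1] show ?thesis
    unfolding mexp_def mpow_def[symmetric] by (simp add: sums_iff)
qed

lemma mexp_eq: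
  fixes X :: mat2
  obtains p q r s where
    "r + s = trace X" "r * s = det X"
    "\<And>t. mexp (t *\<^sub>R X) = cscale (p (of_real t)) (mat 1) + cscale (q (of_real t)) X"
    "\<And>t. p t + q t * r = exp (t * r)" "\<And>t. p t + q t * s = exp (t * s)"
    "\<And>t u. p (t + u) = p t * p u - r * s * q t * q u"
    "\<And>t u. q (t + u) = p t * q u + q t * p u + (r + s) * q t * q u"
    "(p has_field_derivative 0) (at 0)" "(q has_field_derivative 1) (at 0)"
    "continuous_on UNIV p" "continuous_on UNIV q" "p 0 = 1" "q 0 = 0"
proof (rule mexp_formula[of X])
  fix p q :: "complex \<Rightarrow> complex" and r s
  assume e: "\<And>t. (\<lambda>n. mpow (t *\<^sub>R X) n /\<^sub>R fact n) sums (cscale (p (of_real t)) (mat 1) + cscale (q (of_real t)) X)"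
    and *: "r + s = trace X" "r * s = det X"
    "\<And>t. p t + q t * r = exp (t * r)" "\<And>t. p t + q t * s = exp (t * s)"
    "\<And>t u. p (t + u) = p t * p u - r * s * q t * q u"
    "\<And>t u. q (t + u) = p t * q u + q t * p u + (r + s) * q t * q u"
    "(p has_field_derivative 0) (at 0)" "(q has_field_derivative 1) (at 0)"
    "continuous_on UNIV p" "continuous_on UNIV q" "p 0 = 1" "q 0 = 0"
  have m: "mexp (t *\<^sub>R X) = cscale (p (of_real t)) (mat 1) + cscale (q (of_real t)) X" for t
    by (rule sums_unique2[OF mexp_sums e])
  show thesis by (rule that[of r s p q, OF *(1,2) m *(3-)])
qed

lemma mexp_zero [simp]: "mexp 0 = mat 1"
proof (rule mexp_eq[of 0])
  fix p q :: "complex \<Rightarrow> complex"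
  assume "\<And>t. mexp (t *\<^sub>R 0) = cscale (p (of_real t)) (mat 1) + cscale (q (of_real t)) 0" "p 0 = 1"
  from this(1)[of 0] this(2) show ?thesis by (simp add: mat2_simps)
qed

lemma mexp_add: "mexp ((t + u) *\<^sub>R X) = mexp (t *\<^sub>R X) ** mexp (u *\<^sub>R X)"
proof (rule mexp_eq[of X])
  fix p q :: "complex \<Rightarrow> complex" and r s
  assume rs: "r + s = trace X" "r * s = det X"
    and e: "\<And>t. mexp (t *\<^sub>R X) = cscale (p (of_real t)) (mat 1) + cscale (q (of_real t)) X"
    and p: "\<And>t u. p (t + u) = p t * p u - r * s * q t * q u"
    and q: "\<And>t u. q (t + u) = p t * q u + q t * p u + (r + s) * q t * q u"
  have CH: "X ** X = cscale (r + s) X - cscale (r * s) (mat 1)"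
    unfolding rs by (simp add: mat2_simps trace_def det_2 algebra_simps)
  have "mexp (t *\<^sub>R X) ** mexp (u *\<^sub>R X) =
      cscale (p t * p u) (mat 1) + cscale (p t * q u + q t * p u) X + cscale (q t * q u) (X ** X)"
    unfolding e by (simp add: mat2_simps algebra_simps)
  also have "\<dots> = mexp ((t + u) *\<^sub>R X)"
    unfolding CH e of_real_add p q by (simp add: mat2_simps algebra_simps)
  finally show ?thesis by simp
qed

text \<open>
  The eigenvalues of \<open>mexp X\<close> are \<open>p + q r = exp r\<close> and \<open>p + q s = exp s\<close>.
\<close>

lemma det_mexp: "det (mexp X) = exp (trace X)"
proof (rule mexp_eq[of X])
  fix p q :: "complex \<Rightarrow> complex" and r s
  assume rs: "r + s = trace X" "r * s = det X"
    and e: "\<And>t. mexp (t *\<^sub>R X) = cscale (p (of_real t)) (mat 1) + cscale (q (of_real t)) X"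
    and pq: "\<And>t. p t + q t * r = exp (t * r)" "\<And>t. p t + q t * s = exp (t * s)"
  have "det (mexp (1 *\<^sub>R X)) = p 1 * p 1 + p 1 * q 1 * trace X + q 1 * q 1 * det X"
    unfolding e by (simp add: det_2 trace_def mat2_simps algebra_simps)
  also have "\<dots> = (p 1 + q 1 * r) * (p 1 + q 1 * s)"
    unfolding rs[symmetric] by (simp add: algebra_simps)
  also have "\<dots> = exp (trace X)" unfolding pq rs[symmetric] by (simp add: exp_add)
  finally show ?thesis by simp
qed

lemma mexp_conj:
  assumes "g' ** g = mat 1" "g ** g' = mat 1"
  shows "mexp (g ** X ** g') = g ** mexp X ** g'"
proof -
  have "mpow (g ** X ** g') n = g ** mpow X n ** g'" for n
  proof (induction n)
    case (Suc n)
    have "g ** X ** g' ** (g ** mpow X n ** g') = g ** X ** (g' ** g) ** mpow X n ** g'"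
      by (simp only: matrix_mul_assoc)
    then show ?case by (simp add: Suc assms matrix_mul_assoc)
  qed (simp add: assms)
  moreover have "(\<lambda>n. (g ** (mpow X n /\<^sub>R fact n)) ** g') sums ((g ** mexp X) ** g')"
    by (intro bounded_linear.sums[OF bounded_bilinear.bounded_linear_left[OF bounded_bilinear_mat_mult]]
        bounded_linear.sums[OF bounded_bilinear.bounded_linear_right[OF bounded_bilinear_mat_mult]] mexp_sums)
  ultimately have "(\<lambda>n. mpow (g ** X ** g') n /\<^sub>R fact n) sums (g ** mexp X ** g')"
    by (simp add: mat_mult_distrib)
  then show ?thesis using mexp_sums sums_unique2 by blast
qed

lemma continuous_on_mexp: "continuous_on UNIV (\<lambda>t. mexp (t *\<^sub>R X))"
proof (rule mexp_eq[of X])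
  fix p q :: "complex \<Rightarrow> complex"
  assume e: "\<And>t. mexp (t *\<^sub>R X) = cscale (p (of_real t)) (mat 1) + cscale (q (of_real t)) X"
    and c: "continuous_on UNIV p" "continuous_on UNIV q"
  show ?thesis unfolding e
    by (intro continuous_intros bounded_linear.continuous_on[OF bounded_linear_cscale]
        continuous_on_compose2[OF c(1)] continuous_on_compose2[OF c(2)]) auto
qed

lemma mexp_derivative: "((\<lambda>t. (1 / t) *\<^sub>R (mexp (t *\<^sub>R X) - mat 1)) \<longlongrightarrow> X) (at 0)"
proof (rule mexp_eq[of X])
  fix p q :: "complex \<Rightarrow> complex"
  assume e: "\<And>t. mexp (t *\<^sub>R X) = cscale (p (of_real t)) (mat 1) + cscale (q (of_real t)) X"
    and d: "(p has_field_derivative 0) (at 0)" "(q has_field_derivative 1) (at 0)"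
    and z: "p 0 = 1" "q 0 = 0"
  have r: "filterlim complex_of_real (at 0) (at 0)"
    by (rule filterlim_atI) (auto intro!: tendsto_eq_intros simp: eventually_at_filter)
  have p: "((\<lambda>t. (p (of_real t) - 1) / of_real t) \<longlongrightarrow> 0) (at 0)"
    using filterlim_compose[OF d(1)[unfolded has_field_derivative_iff] r] z by simp
  have q: "((\<lambda>t. q (of_real t) / of_real t) \<longlongrightarrow> 1) (at 0)"
    using filterlim_compose[OF d(2)[unfolded has_field_derivative_iff] r] z by simp
  have "((\<lambda>t. cscale ((p (of_real t) - 1) / of_real t) (mat 1) + cscale (q (of_real t) / of_real t) X)
      \<longlongrightarrow> cscale 0 (mat 1) + cscale 1 X) (at 0)"
    by (intro tendsto_add bounded_linear.tendsto[OF bounded_linear_cscale] p q)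
  moreover have "cscale 0 (mat 1) + cscale 1 X = X" by (simp add: mat2_simps)
  moreover have "cscale ((p (of_real t) - 1) / of_real t) (mat 1) + cscale (q (of_real t) / of_real t) X =
      (1 / t) *\<^sub>R (mexp (t *\<^sub>R X) - mat 1)" for t
    unfolding e by (simp add: mat2_simps) (simp add: scaleR_conv_of_real divide_inverse algebra_simps)
  ultimately show ?thesis by simp
qed

text \<open>
  If a curve \<open>a\<close> starts at \<open>1\<close> with velocity \<open>X\<close>, then \<open>(a (t / n))^n\<close> tends to \<open>exp (t X)\<close>, and
  for small \<open>t\<close> the intermediate powers stay close to \<open>1\<close>.  The second part makes averages along
  these powers converge.
\<close>

lemma curve_powers:
  fixes a :: "real \<Rightarrow> mat2"
  assumes a: "((\<lambda>s. (1 / s) *\<^sub>R (a s - mat 1)) \<longlongrightarrow> X) (at 0)"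
  shows "t \<noteq> 0 \<Longrightarrow> (\<lambda>n. mpow (a (t / real n)) n) \<longlonglongrightarrow> mexp (t *\<^sub>R X)"
    and "d > 0 \<Longrightarrow> \<exists>\<eta>>0. \<forall>t. t \<noteq> 0 \<and> \<bar>t\<bar> < \<eta> \<longrightarrow>
           (\<forall>\<^sub>F n in sequentially. \<forall>k\<le>n. norm (mpow (a (t / real n)) k - mat 1) < d)"
proof -
  obtain K where K0: "K > 0" "\<forall>(A :: mat2) (B :: mat2). norm (A ** B) \<le> norm A * norm B * K"
    using bounded_bilinear.pos_bounded[OF bounded_bilinear_mat_mult] by (elim exE conjE) (rule that)
  note K = K0(1) K0(2)[rule_format]
  \<comment> \<open>The factor makes the norm submultiplicative.\<close>
  define N where "N A = K * norm A" for A :: mat2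
  have N_mult: "N (A ** B) \<le> N A * N B" for A B
    using mult_left_mono[OF K(2)[of A B], of K] K(1) by (simp add: N_def algebra_simps)
  have N_add: "N (A + B) \<le> N A + N B" for A B
    using mult_left_mono[OF norm_triangle_ineq[of A B], of K] K(1) by (simp add: N_def algebra_simps)
  have N_nn: "N A \<ge> 0" for A using K(1) by (simp add: N_def)
  have pow1: "1 + N (mpow A k - mat 1) \<le> exp (real k * \<delta>)" if "N (A - mat 1) \<le> \<delta>" for A \<delta> k
  proof (induction k)
    case 0 then show ?case by (simp add: N_def)
  next
    case (Suc k)
    have eq: "mpow A (Suc k) - mat 1 = (A - mat 1) ** (mpow A k - mat 1) + (A - mat 1) + (mpow A k - mat 1)"
      by (simp add: mat_mult_distrib)
    have "N (mpow A (Suc k) - mat 1) \<le>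
        N (A - mat 1) * N (mpow A k - mat 1) + N (A - mat 1) + N (mpow A k - mat 1)"
      unfolding eq
      using N_add[of "(A - mat 1) ** (mpow A k - mat 1) + (A - mat 1)" "mpow A k - mat 1"]
        N_add[of "(A - mat 1) ** (mpow A k - mat 1)" "A - mat 1"] N_mult[of "A - mat 1" "mpow A k - mat 1"]
      by linarith
    then have "1 + N (mpow A (Suc k) - mat 1) \<le> (1 + N (A - mat 1)) * (1 + N (mpow A k - mat 1))"
      by (simp add: algebra_simps)
    also have "\<dots> \<le> exp \<delta> * exp (real k * \<delta>)"
    proof (rule mult_mono)
      show "1 + N (A - mat 1) \<le> exp \<delta>" using that exp_ge_add_one_self[of \<delta>] by linarith
      show "0 \<le> 1 + N (mpow A k - mat 1)" using N_nn[of "mpow A k - mat 1"] by linarith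
    qed (use Suc in simp_all)
    finally show ?case by (simp add: exp_add[symmetric] algebra_simps)
  qed
  have pow2: "N (mpow A k - mpow B k) \<le> real k * N (A - B) * exp (real k * \<delta>)"
    if A: "N (A - mat 1) \<le> \<delta>" and B: "N (B - mat 1) \<le> \<delta>" for A B \<delta> k
  proof (induction k)
    case 0 then show ?case by (simp add: N_def)
  next
    case (Suc k)
    have d0: "\<delta> \<ge> 0" using N_nn A order_trans by blast
    have eq: "mpow A (Suc k) - mpow B (Suc k) =
        ((A - B) ** (mpow A k - mat 1) + (A - B)) + ((B - mat 1) ** (mpow A k - mpow B k) + (mpow A k - mpow B k))"
      by (simp add: mat_mult_distrib)
    have "N (mpow A (Suc k) - mpow B (Suc k)) \<le> (N (A - B) * N (mpow A k - mat 1) + N (A - B)) +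
       (N (B - mat 1) * N (mpow A k - mpow B k) + N (mpow A k - mpow B k))"
      unfolding eq
      using N_add[of "(A - B) ** (mpow A k - mat 1) + (A - B)" "(B - mat 1) ** (mpow A k - mpow B k) + (mpow A k - mpow B k)"]
        N_add[of "(A - B) ** (mpow A k - mat 1)" "A - B"] N_mult[of "A - B" "mpow A k - mat 1"]
        N_add[of "(B - mat 1) ** (mpow A k - mpow B k)" "mpow A k - mpow B k"] N_mult[of "B - mat 1" "mpow A k - mpow B k"]
      by linarith
    also have "\<dots> = N (A - B) * (1 + N (mpow A k - mat 1)) + (1 + N (B - mat 1)) * N (mpow A k - mpow B k)"
      by (simp add: algebra_simps)
    also have "\<dots> \<le> N (A - B) * exp (real (Suc k) * \<delta>) + exp \<delta> * (real k * N (A - B) * exp (real k * \<delta>))"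
    proof (intro add_mono mult_left_mono mult_mono)
      show "1 + N (mpow A k - mat 1) \<le> exp (real (Suc k) * \<delta>)"
      proof -
        have "exp (real k * \<delta>) \<le> exp (real (Suc k) * \<delta>)" using d0 by (simp add: algebra_simps)
        then show ?thesis using pow1[OF A, of k] by linarith
      qed
      show "1 + N (B - mat 1) \<le> exp \<delta>" using B exp_ge_add_one_self[of \<delta>] by linarith
    qed (use N_nn Suc in auto)
    also have "\<dots> = real (Suc k) * N (A - B) * exp (real (Suc k) * \<delta>)"
      by (simp add: algebra_simps exp_add)
    finally show ?case .
  qed
  have small: "\<exists>s0>0. \<forall>s. s \<noteq> 0 \<and> \<bar>s\<bar> < s0 \<longrightarrow> N (b s - mat 1) \<le> \<bar>s\<bar> * (K * (norm X + 1))"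
    if b: "((\<lambda>s. (1 / s) *\<^sub>R (b s - mat 1)) \<longlongrightarrow> X) (at 0)" for b :: "real \<Rightarrow> mat2"
  proof -
    have "\<forall>\<^sub>F s in at 0. norm ((1 / s) *\<^sub>R (b s - mat 1)) < norm X + 1"
      using order_tendstoD(2)[OF tendsto_norm[OF b]] by simp
    then obtain s0 where s0: "s0 > 0" "\<And>s. \<lbrakk>s \<noteq> 0; \<bar>s\<bar> < s0\<rbrakk> \<Longrightarrow> norm ((1 / s) *\<^sub>R (b s - mat 1)) < norm X + 1"
      unfolding eventually_at by (auto simp: dist_real_def)
    have "N (b s - mat 1) \<le> \<bar>s\<bar> * (K * (norm X + 1))" if "s \<noteq> 0" "\<bar>s\<bar> < s0" for s
    proof -
      have "norm (b s - mat 1) = \<bar>s\<bar> * norm ((1 / s) *\<^sub>R (b s - mat 1))"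
        unfolding norm_scaleR using that(1) by simp
      also have "\<dots> \<le> \<bar>s\<bar> * (norm X + 1)"
        using s0(2)[OF that] by (intro mult_left_mono) simp_all
      finally have "norm (b s - mat 1) \<le> \<bar>s\<bar> * (norm X + 1)" .
      then show ?thesis using K(1) by (simp add: N_def mult.left_commute)
    qed
    with s0(1) show ?thesis by blast
  qed
  have seq: "filterlim (\<lambda>n. t / real n) (at 0) sequentially" if "t \<noteq> 0" for t
  proof (rule filterlim_atI)
    show "(\<lambda>n. t / real n) \<longlonglongrightarrow> 0" by (rule lim_const_over_n)
    show "\<forall>\<^sub>F n in sequentially. t / real n \<noteq> 0"
      using eventually_gt_at_top[of 0] by eventually_elim (use that in auto)
  qed
  obtain s1 where s1: "s1 > 0" "\<And>s. \<lbrakk>s \<noteq> 0; \<bar>s\<bar> < s1\<rbrakk> \<Longrightarrow> N (a s - mat 1) \<le> \<bar>s\<bar> * (K * (norm X + 1))"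
    using small[OF a] by blast
  obtain s2 where s2: "s2 > 0" "\<And>s. \<lbrakk>s \<noteq> 0; \<bar>s\<bar> < s2\<rbrakk> \<Longrightarrow> N (mexp (s *\<^sub>R X) - mat 1) \<le> \<bar>s\<bar> * (K * (norm X + 1))"
    using small[OF mexp_derivative] by blast
  define C where "C = K * (norm X + 1)"
  have ev: "\<forall>\<^sub>F n in sequentially. n > 0 \<and> N (a (t / n) - mat 1) \<le> \<bar>t\<bar> * C / real n \<and>
      N (mexp ((t / n) *\<^sub>R X) - mat 1) \<le> \<bar>t\<bar> * C / real n" if t: "t \<noteq> 0" for t
  proof -
    have "\<forall>\<^sub>F s in at 0. s \<noteq> 0 \<and> \<bar>s\<bar> < min s1 s2"
      using s1(1) s2(1) unfolding eventually_at by (auto simp: dist_real_def intro!: exI[of _ "min s1 s2"])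
    then have "\<forall>\<^sub>F n in sequentially. t / real n \<noteq> 0 \<and> \<bar>t / real n\<bar> < min s1 s2"
      using seq[OF t] by (rule eventually_compose_filterlim)
    then show ?thesis
      using eventually_gt_at_top[of 0]
    proof eventually_elim
      case (elim n)
      have "N (a (t / n) - mat 1) \<le> \<bar>t / n\<bar> * C" "N (mexp ((t / n) *\<^sub>R X) - mat 1) \<le> \<bar>t / n\<bar> * C"
        unfolding C_def by (rule s1(2) s2(2); use elim in simp)+
      then show ?case using elim by simp
    qed
  qed
  {
    assume t: "t \<noteq> 0"
    define e where "e n = real n * N (a (t / real n) - mexp ((t / real n) *\<^sub>R X)) * exp (\<bar>t\<bar> * C)" for n
    have "((\<lambda>s. (1 / s) *\<^sub>R (a s - mat 1) - (1 / s) *\<^sub>R (mexp (s *\<^sub>R X) - mat 1)) \<longlongrightarrow> X - X) (at 0)"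
      by (intro tendsto_diff a mexp_derivative)
    then have "((\<lambda>s. (1 / s) *\<^sub>R (a s - mexp (s *\<^sub>R X))) \<longlongrightarrow> 0) (at 0)"
      by (simp flip: scaleR_diff_right)
    then have "(\<lambda>n. norm ((1 / (t / real n)) *\<^sub>R (a (t / real n) - mexp ((t / real n) *\<^sub>R X)))) \<longlonglongrightarrow> 0"
      by (rule tendsto_norm_zero[OF filterlim_compose[OF _ seq[OF t]]])
    then have "(\<lambda>n. \<bar>t\<bar> * K * exp (\<bar>t\<bar> * C) * norm ((1 / (t / real n)) *\<^sub>R (a (t / real n) - mexp ((t / real n) *\<^sub>R X)))) \<longlonglongrightarrow> 0"
      by (rule tendsto_mult_right_zero)
    then have e0: "e \<longlonglongrightarrow> 0"
      by (rule back_subst[where P = "\<lambda>f. f \<longlonglongrightarrow> 0"]) (use t in \<open>auto simp: e_def N_def fun_eq_iff\<close>)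
    have pw: "mpow (mexp ((t / real n) *\<^sub>R X)) k = mexp ((real k * t / real n) *\<^sub>R X)" for n k
      by (induction k) (simp_all add: algebra_simps add_divide_distrib flip: mexp_add)
    have "\<forall>\<^sub>F n in sequentially. norm (mpow (a (t / real n)) n - mexp (t *\<^sub>R X)) \<le> e n / K"
      using ev[OF t]
    proof eventually_elim
      case (elim n)
      have "N (mpow (a (t / real n)) n - mpow (mexp ((t / real n) *\<^sub>R X)) n) \<le> e n"
        using pow2[of "a (t / real n)" "\<bar>t\<bar> * C / real n" "mexp ((t / real n) *\<^sub>R X)" n] elim
        by (simp add: e_def)
      then show ?case using K(1) elim by (simp add: pw N_def field_simps)
    qed
    moreover have "(\<lambda>n. e n / K) \<longlonglongrightarrow> 0" using tendsto_divide_zero[OF e0] .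
    ultimately have "(\<lambda>n. mpow (a (t / real n)) n - mexp (t *\<^sub>R X)) \<longlonglongrightarrow> 0"
      by (rule Lim_null_comparison)
    then show "(\<lambda>n. mpow (a (t / real n)) n) \<longlonglongrightarrow> mexp (t *\<^sub>R X)" by (simp add: LIM_zero_iff)
  }
  {
    assume d: "d > 0"
    have "((\<lambda>t. exp (\<bar>t\<bar> * C)) \<longlongrightarrow> exp (\<bar>0\<bar> * C)) (at 0)" by (intro tendsto_intros)
    then have "\<forall>\<^sub>F t in at 0. exp (\<bar>t\<bar> * C) < 1 + K * d"
      by (rule order_tendstoD(2)) (use K(1) d in simp)
    then obtain \<eta> where \<eta>: "\<eta> > 0" "\<And>t. \<lbrakk>t \<noteq> 0; \<bar>t\<bar> < \<eta>\<rbrakk> \<Longrightarrow> exp (\<bar>t\<bar> * C) < 1 + K * d"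
      unfolding eventually_at by (auto simp: dist_real_def)
    have "\<forall>\<^sub>F n in sequentially. \<forall>k\<le>n. norm (mpow (a (t / real n)) k - mat 1) < d"
      if t: "t \<noteq> 0" "\<bar>t\<bar> < \<eta>" for t
      using ev[OF t(1)]
    proof eventually_elim
      case (elim n)
      show ?case
      proof (intro allI impI)
        fix k assume k: "k \<le> n"
        have C0: "C \<ge> 0" using K(1) by (simp add: C_def)
        have "1 + N (mpow (a (t / real n)) k - mat 1) \<le> exp (real k * (\<bar>t\<bar> * C / real n))"
          by (rule pow1) (use elim in simp)
        also have "\<dots> \<le> exp (\<bar>t\<bar> * C)"
        proof -
          have "real k * (\<bar>t\<bar> * C) \<le> real n * (\<bar>t\<bar> * C)"
            using k C0 by (intro mult_right_mono) simp_all
          then show ?thesis using elim by (simp add: divide_le_eq mult.commute)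
        qed
        also have "\<dots> < 1 + K * d" by (rule \<eta>(2)[OF t])
        finally show "norm (mpow (a (t / real n)) k - mat 1) < d" using K(1) by (simp add: N_def)
      qed
    qed
    with \<eta>(1) show "\<exists>\<eta>>0. \<forall>t. t \<noteq> 0 \<and> \<bar>t\<bar> < \<eta> \<longrightarrow>
        (\<forall>\<^sub>F n in sequentially. \<forall>k\<le>n. norm (mpow (a (t / real n)) k - mat 1) < d)" by blast
  }
qed

section \<open>The Lie algebra of a real form\<close>

definition adjugate :: "mat2 \<Rightarrow> mat2" where
  "adjugate g = vector [vector [g $ 2 $ 2, - g $ 1 $ 2], vector [- g $ 2 $ 1, g $ 1 $ 1]]"

lemma adjugate:
  assumes "det g = 1"
  shows "g ** adjugate g = mat 1" "adjugate g ** g = mat 1" "det (adjugate g) = 1"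
proof -
  have "g $ 1 $ 1 * g $ 2 $ 2 - g $ 1 $ 2 * g $ 2 $ 1 = 1" using assms by (simp add: det_2)
  then show "g ** adjugate g = mat 1" "adjugate g ** g = mat 1" "det (adjugate g) = 1"
    by (simp_all add: adjugate_def mat2_simps det_2 mult.commute)
qed

lemma group_SL2C: "group SL2C"
proof (rule groupI)
  show "\<exists>y\<in>carrier SL2C. y \<otimes>\<^bsub>SL2C\<^esub> x = \<one>\<^bsub>SL2C\<^esub>" if "x \<in> carrier SL2C" for x
    by (rule bexI[of _ "adjugate x"]) (use that adjugate[of x] in \<open>simp_all add: SL2C_def\<close>)
qed (simp_all add: SL2C_def det_mul matrix_mul_assoc)

lemma inv_SL2C: "det g = 1 \<Longrightarrow> inv\<^bsub>SL2C\<^esub> g = adjugate g"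
  using group.inv_equality[OF group_SL2C, of "adjugate g" g] adjugate[of g] by (simp add: SL2C_def)

lemma trace_conj:
  fixes X :: mat2
  assumes "g' ** g = mat 1"
  shows "trace (g ** X ** g') = trace X"
proof -
  have "trace (g ** X ** g') = trace (g' ** (g ** X))" by (rule trace_mul_sym)
  then show ?thesis by (simp add: matrix_mul_assoc assms)
qed

lemma trace_commutator: "trace (A ** B - B ** A) = 0" for A B :: mat2
  using trace_mul_sym[of A B] by (simp add: trace_sub)

locale real_form =
  fixes G :: "mat2 set"
  assumes real_form: "real_form_SL2C G"
begin

lemma subgroup_G: "subgroup G SL2C" and closed_G: "closed G"
  using real_form by (simp_all add: real_form_SL2C_def)

lemma G_det [simp]: "g \<in> G \<Longrightarrow> det g = 1"
  using subgroup.mem_carrier[OF subgroup_G] by (simp add: SL2C_def)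

lemma G_one [simp, intro]: "mat 1 \<in> G"
  using subgroup.one_closed[OF subgroup_G] by (simp add: SL2C_def)

lemma G_mult [simp, intro]: "\<lbrakk>g \<in> G; h \<in> G\<rbrakk> \<Longrightarrow> g ** h \<in> G"
  using subgroup.m_closed[OF subgroup_G, of g h] by (simp add: SL2C_def)

lemma G_inv [simp, intro]: "g \<in> G \<Longrightarrow> adjugate g \<in> G"
  using subgroup.m_inv_closed[OF subgroup_G, of g] inv_SL2C[of g] by simp

lemma G_mpow [simp, intro]: "g \<in> G \<Longrightarrow> mpow g n \<in> G"
  by (induction n) auto

lemma mexp_in_G [simp, intro]: "X \<in> lie_alg G \<Longrightarrow> mexp (t *\<^sub>R X) \<in> G"
  by (simp add: lie_alg_def)

text \<open>
  Since \<open>exp (t trace X) = det (mexp (t X)) = 1\<close> for all real \<open>t\<close>, the trace vanishes.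
\<close>

lemma trace_lie_alg [simp]:
  assumes "X \<in> lie_alg G"
  shows "trace X = 0"
proof -
  have tr: "trace (t *\<^sub>R X) = of_real t * trace X" for t
    by (simp add: trace_def sum_2 algebra_simps) (simp add: scaleR_conv_of_real)
  have e: "exp (of_real t * trace X) = 1" for t
    using det_mexp[of "t *\<^sub>R X"] G_det[OF mexp_in_G[OF assms]] tr by simp
  have Re: "Re (trace X) = 0" using e[of 1] by (simp add: exp_eq_1)
  have "Im (trace X) = 0"
  proof (rule ccontr)
    assume nz: "Im (trace X) \<noteq> 0"
    \<comment> \<open>This makes \<open>t Im (trace X)\<close> equal to \<open>1\<close> or \<open>- 1\<close>, which is not a multiple of \<open>2 \<pi>\<close>.\<close>
    define t where "t = 1 / \<bar>Im (trace X)\<bar>"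
    obtain n :: int where n: "t * Im (trace X) = of_int (2 * n) * pi"
      using e[of t] by (auto simp: exp_eq_1)
    have "\<bar>of_int (2 * n) * pi\<bar> = 1" using nz unfolding n[symmetric] by (simp add: t_def abs_mult)
    then have "2 * real_of_int \<bar>n\<bar> * pi = 1" by (simp add: abs_mult)
    moreover have "2 * real_of_int \<bar>n\<bar> * pi = 0 \<or> 2 * real_of_int \<bar>n\<bar> * pi > 1"
    proof (cases "n = 0")
      case False
      then have "real_of_int \<bar>n\<bar> * pi \<ge> 1 * pi" by (intro mult_right_mono) auto
      then show ?thesis using pi_gt3 by linarith
    qed simp
    ultimately show False by linarith
  qed
  with Re show ?thesis by (simp add: complex_eq_iff)
qed

lemma lie_alg_zero [simp, intro]: "0 \<in> lie_alg G"
  by (simp add: lie_alg_def del: mexp_in_G)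

lemma lie_alg_scale [simp, intro]: "X \<in> lie_alg G \<Longrightarrow> r *\<^sub>R X \<in> lie_alg G"
  by (simp add: lie_alg_def del: mexp_in_G)

lemma mexp_scaled_conj:
  assumes "g \<in> G"
  shows "mexp (t *\<^sub>R (g ** X ** adjugate g)) = g ** mexp (t *\<^sub>R X) ** adjugate g"
proof -
  have "t *\<^sub>R (g ** X ** adjugate g) = g ** (t *\<^sub>R X) ** adjugate g"
    by (simp only: mat_mult_distrib(5,6))
  then show ?thesis
    by (simp only: mexp_conj[OF adjugate(2,1)[OF G_det[OF assms]]])
qed

lemma lie_alg_conj:
  assumes "X \<in> lie_alg G" "g \<in> G"
  shows "g ** X ** adjugate g \<in> lie_alg G"
  unfolding lie_alg_def
proof safe
  fix t :: real
  show "mexp (t *\<^sub>R (g ** X ** adjugate g)) \<in> G"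
    unfolding mexp_scaled_conj[OF assms(2)] using assms by simp
qed

lemma product_velocity:
  "((\<lambda>s. (1 / s) *\<^sub>R (mexp (s *\<^sub>R X) ** mexp (s *\<^sub>R Y) - mat 1)) \<longlongrightarrow> X + Y) (at 0)"
proof -
  have c: "((\<lambda>s. mexp (s *\<^sub>R Y)) \<longlongrightarrow> mexp (0 *\<^sub>R Y)) (at 0)"
    using continuous_on_mexp[of Y] unfolding continuous_on_def by blast
  have "((\<lambda>s. ((1 / s) *\<^sub>R (mexp (s *\<^sub>R X) - mat 1)) ** mexp (s *\<^sub>R Y) + (1 / s) *\<^sub>R (mexp (s *\<^sub>R Y) - mat 1))
      \<longlongrightarrow> X ** mexp (0 *\<^sub>R Y) + Y) (at 0)"
    by (intro tendsto_add bounded_bilinear.tendsto[OF bounded_bilinear_mat_mult] mexp_derivative c)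
  moreover have "((1 / s) *\<^sub>R (mexp (s *\<^sub>R X) - mat 1)) ** mexp (s *\<^sub>R Y) + (1 / s) *\<^sub>R (mexp (s *\<^sub>R Y) - mat 1) =
      (1 / s) *\<^sub>R (mexp (s *\<^sub>R X) ** mexp (s *\<^sub>R Y) - mat 1)" for s
    by (simp add: mat_mult_distrib flip: scaleR_add_right)
  ultimately show ?thesis by simp
qed

text \<open>
  Lie's product formula: \<open>exp (t (X + Y))\<close> is the limit of the \<open>n\<close>-th powers of
  \<open>exp (t X / n) exp (t Y / n)\<close>, and \<open>G\<close> is closed.
\<close>

lemma lie_alg_add [simp, intro]:
  assumes X: "X \<in> lie_alg G" and Y: "Y \<in> lie_alg G"
  shows "X + Y \<in> lie_alg G"
  unfolding lie_alg_def
proof safe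
  fix t :: real
  show "mexp (t *\<^sub>R (X + Y)) \<in> G"
  proof (cases "t = 0")
    case False
    show ?thesis
      by (rule closed_sequentially[OF closed_G _ curve_powers(1)[OF product_velocity False]])
         (use X Y in auto)
  qed simp
qed

lemma complexified:
  assumes "trace Z = 0"
  shows "\<exists>!(A, B). A \<in> lie_alg G \<and> B \<in> lie_alg G \<and> Z = A + cscale \<i> B"
proof -
  have "\<forall>Z. trace Z = 0 \<longrightarrow> (\<exists>!(A, B). A \<in> lie_alg G \<and> B \<in> lie_alg G \<and> Z = A + cscale \<i> B)"
    using real_form unfolding real_form_SL2C_def by (elim conjE)
  from this[rule_format, OF assms] show ?thesis .
qed

lemma complexified_unique:
  assumes "A \<in> lie_alg G" "B \<in> lie_alg G" "A' \<in> lie_alg G" "B' \<in> lie_alg G"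
    "A + cscale \<i> B = A' + cscale \<i> B'"
  shows "A = A' \<and> B = B'"
proof -
  have "trace (A + cscale \<i> B) = trace A + \<i> * trace B"
    by (simp add: trace_def sum_2 cscale_def algebra_simps)
  then have "trace (A + cscale \<i> B) = 0" using assms by simp
  from complexified[OF this] have "(A, B) = (A', B')"
    by (elim ex1E) (use assms in \<open>auto dest: spec[of _ "(A, B)"] spec[of _ "(A', B')"]\<close>)
  then show ?thesis by simp
qed

lemma complexified_exists:
  assumes "trace Z = 0"
  obtains A B where "A \<in> lie_alg G" "B \<in> lie_alg G" "Z = A + cscale \<i> B"
  using complexified[OF assms] that by (auto elim!: ex1E)

end

section \<open>Differentiating a representation\<close>

lemma (in real_form) lie_act_C_eq:
  assumes "A \<in> lie_alg G" "B \<in> lie_alg G"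
  shows "lie_act_C G V (A + cscale \<i> B) v = lie_act V A v \<oplus>\<^bsub>V\<^esub> \<i> \<odot>\<^bsub>V\<^esub> lie_act V B v"
proof -
  have "(THE (C, D). C \<in> lie_alg G \<and> D \<in> lie_alg G \<and> A + cscale \<i> B = C + cscale \<i> D) = (A, B)"
    by (rule the_equality) (use assms complexified_unique in \<open>auto\<close>)
  then show ?thesis by (simp add: lie_act_C_def)
qed

lemma limitin_filterlim: "\<lbrakk>limitin T f l F; filterlim g F H\<rbrakk> \<Longrightarrow> limitin T (\<lambda>x. f (g x)) l H"
  unfolding limitin_def by (auto intro: eventually_compose_filterlim[where f = g and P = "\<lambda>x. f x \<in> _"])

locale smooth_representation = real_form G + lcs V
  for G and V :: "(mat2, 'v) rep" (structure) +
  assumes frechet: "frechet_rep G V" and smooth: "smooth_rep G V"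
begin

abbreviation act where "act \<equiv> action V"

definition derivative :: "mat2 \<Rightarrow> 'v \<Rightarrow> 'v \<Rightarrow> bool" where
  "derivative X v w \<longleftrightarrow> limitin (tvs_topology V)
     (\<lambda>t. complex_of_real (1 / t) \<odot> (act (mexp (t *\<^sub>R X)) v \<ominus> v)) w (at (0::real))"

lemma act_closed [simp, intro]: "\<lbrakk>g \<in> G; v \<in> carrier V\<rbrakk> \<Longrightarrow> act g v \<in> carrier V"
  and act_add: "\<lbrakk>g \<in> G; v \<in> carrier V; w \<in> carrier V\<rbrakk> \<Longrightarrow> act g (v \<oplus> w) = act g v \<oplus> act g w"
  and act_smult: "\<lbrakk>g \<in> G; v \<in> carrier V\<rbrakk> \<Longrightarrow> act g (c \<odot> v) = c \<odot> act g v"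
  using frechet unfolding frechet_rep_def linear_map_def Pi_iff by blast+

lemma act_one [simp]: "v \<in> carrier V \<Longrightarrow> act (mat 1) v = v"
  and act_mult: "\<lbrakk>g \<in> G; h \<in> G; v \<in> carrier V\<rbrakk> \<Longrightarrow> act (g ** h) v = act g (act h v)"
  and act_continuous: "continuous_map (prod_topology (top_of_set G) (tvs_topology V)) (tvs_topology V)
       (\<lambda>(g, v). act g v)"
  using frechet unfolding frechet_rep_def by blast+

lemma act_minus: "\<lbrakk>g \<in> G; v \<in> carrier V; w \<in> carrier V\<rbrakk> \<Longrightarrow> act g (v \<ominus> w) = act g v \<ominus> act g w"
  by (simp add: minus_eq act_add act_smult)

lemma act_zero [simp]: "g \<in> G \<Longrightarrow> act g \<zero> = \<zero>"
  using act_smult[of g \<zero> 0] by simp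

lemma act_inv [simp]:
  "\<lbrakk>g \<in> G; v \<in> carrier V\<rbrakk> \<Longrightarrow> act (adjugate g) (act g v) = v"
  "\<lbrakk>g \<in> G; v \<in> carrier V\<rbrakk> \<Longrightarrow> act g (act (adjugate g) v) = v"
  using act_mult[of g "adjugate g" v] act_mult[of "adjugate g" g v] adjugate[of g] by simp_all

lemma limit_act:
  assumes "(g \<longlongrightarrow> g0) F" "\<forall>\<^sub>F t in F. g t \<in> G" "g0 \<in> G" "limitin (tvs_topology V) f v F"
  shows "limitin (tvs_topology V) (\<lambda>t. act (g t) (f t)) (act g0 v) F"
  using continuous_map_limit[OF act_continuous, of "\<lambda>t. (g t, f t)" "(g0, v)" F] assms
  by (simp add: limitin_pairwise o_def limitin_subtopology)

lemma act_linear_continuous: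
  assumes "g \<in> G"
  shows "linear_map V V (act g)" "continuous_map (tvs_topology V) (tvs_topology V) (act g)"
proof -
  show "linear_map V V (act g)" using frechet assms by (simp add: frechet_rep_def)
  have "continuous_map (tvs_topology V) (prod_topology (top_of_set G) (tvs_topology V)) (\<lambda>v. (g, v))"
    using assms by (intro continuous_map_pairedI) auto
  from continuous_map_compose[OF this act_continuous]
  show "continuous_map (tvs_topology V) (tvs_topology V) (act g)" by (simp add: o_def)
qed

lemma mexp_tendsto: "((\<lambda>t. mexp (t *\<^sub>R X)) \<longlongrightarrow> mat 1) (at 0)"
proof -
  have "((\<lambda>t. mexp (t *\<^sub>R X)) \<longlongrightarrow> mexp (0 *\<^sub>R X)) (at 0)"
    using continuous_on_mexp[of X] unfolding continuous_on_def by blast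
  then show ?thesis by simp
qed

lemma derivative_unique: "\<lbrakk>derivative X v w; derivative X v w'\<rbrakk> \<Longrightarrow> w = w'"
  unfolding derivative_def by (erule (1) limit_unique) (rule trivial_limit_at)

lemma lie_act_eq: "derivative X v w \<Longrightarrow> lie_act V X v = w"
  unfolding lie_act_def using derivative_unique unfolding derivative_def by (intro the_equality) blast+

lemma derivative_lie_act:
  assumes "X \<in> lie_alg G" "v \<in> carrier V"
  shows "derivative X v (lie_act V X v)"
proof -
  have "Ck_map G V (Suc 0) (\<lambda>g. act g v)"
    using smooth assms(2) unfolding smooth_rep_def by blast
  then have "\<forall>X\<in>lie_alg G. \<exists>f'. Ck_map G V 0 f' \<and> (\<forall>g\<in>G. limitin (tvs_topology V)
            (\<lambda>t. complex_of_real (1 / t) \<odot> (act (g ** mexp (t *\<^sub>R X)) v \<ominus> act g v)) (f' g) (at (0::real)))"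
    unfolding Ck_map.simps by (elim conjE)
  then obtain f' where "\<And>g. g \<in> G \<Longrightarrow> limitin (tvs_topology V)
            (\<lambda>t. complex_of_real (1 / t) \<odot> (act (g ** mexp (t *\<^sub>R X)) v \<ominus> act g v)) (f' g) (at (0::real))"
    using assms(1) by blast
  from this[of "mat 1"] have "derivative X v (f' (mat 1))"
    using assms(2) by (simp add: derivative_def)
  then show ?thesis using lie_act_eq by simp
qed

lemma lie_act_closed [simp, intro]:
  "\<lbrakk>X \<in> lie_alg G; v \<in> carrier V\<rbrakk> \<Longrightarrow> lie_act V X v \<in> carrier V"
  using derivative_lie_act[of X v] limitin_tvsD(1) by (auto simp: derivative_def)

text \<open>
  A telescoping sum along the powers of \<open>a (t / n)\<close> writes the difference quotient of the
  one-parameter group as an average of translates of difference quotients of \<open>a\<close>.  A constant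
  vector \<open>x\<close> and a product of one-parameter groups give additivity in the Lie algebra; a varying
  vector and a single one-parameter group show that the operators of the Lie algebra are closed.
\<close>

lemma curve_derivative:
  assumes X: "X \<in> lie_alg G" and aG: "\<And>s. a s \<in> G"
    and a: "((\<lambda>s. (1 / s) *\<^sub>R (a s - mat 1)) \<longlongrightarrow> X) (at 0)"
    and F: "F \<noteq> bot"
    and x: "limitin (tvs_topology V) x x0 F" and z: "limitin (tvs_topology V) z y F"
    and d: "\<forall>\<^sub>F i in F. limitin (tvs_topology V) (\<lambda>s. complex_of_real (1 / s) \<odot> (act (a s) (x i) \<ominus> x i)) (z i) (at 0)"
  shows "derivative X x0 y"
  unfolding derivative_def
proof (rule limitin_tvsI)
  note x0 [simp] = limitin_tvsD(1)[OF x]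
  note y [simp] = limitin_tvsD(1)[OF z]
  show "y \<in> carrier V" by simp
  show "\<forall>\<^sub>F t in at 0. complex_of_real (1 / t) \<odot> (act (mexp (t *\<^sub>R X)) x0 \<ominus> x0) \<in> carrier V"
    using X by simp
  fix p assume p: "continuous_seminorm V p"
  have "\<exists>\<eta>>0. \<forall>t. t \<noteq> 0 \<and> \<bar>t\<bar> < \<eta> \<longrightarrow>
      p (complex_of_real (1 / t) \<odot> (act (mexp (t *\<^sub>R X)) x0 \<ominus> x0) \<ominus> y) \<le> e" if e: "e > 0" for e
  proof -
    let ?T = "prod_topology (top_of_set G) (tvs_topology V)"
    have op: "openin ?T {u \<in> topspace ?T. (\<lambda>(g, v). act g v) u \<in> {v \<in> carrier V. p (v \<ominus> y) < e}}"
      using ball_open[of p y e] p by (intro openin_continuous_map_preimage[OF act_continuous]) (simp add: topology_eq)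
    have mem: "(mat 1, y) \<in> {u \<in> topspace ?T. (\<lambda>(g, v). act g v) u \<in> {v \<in> carrier V. p (v \<ominus> y) < e}}"
      using e csn(4)[OF p] by simp
    obtain A B where AB: "openin (top_of_set G) A" "openin (tvs_topology V) B" "mat 1 \<in> A" "y \<in> B"
      "A \<times> B \<subseteq> {u \<in> topspace ?T. (\<lambda>(g, v). act g v) u \<in> {v \<in> carrier V. p (v \<ominus> y) < e}}"
      using op[unfolded openin_prod_topology_alt, rule_format, OF mem] by (elim exE conjE) (rule that)
    obtain \<delta> where \<delta>: "\<delta> > 0" "\<And>g. \<lbrakk>g \<in> G; norm (g - mat 1) < \<delta>\<rbrakk> \<Longrightarrow> g \<in> A"
      using AB(1,3) unfolding openin_euclidean_subtopology_iff dist_norm by metis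
    have near: "p (act g u \<ominus> y) < e" if "g \<in> G" "norm (g - mat 1) < \<delta>" "u \<in> B" for g u
      using AB(5) \<delta>(2)[OF that(1,2)] that(3) by auto
    obtain \<eta> where \<eta>: "\<eta> > 0" "\<And>t. \<lbrakk>t \<noteq> 0; \<bar>t\<bar> < \<eta>\<rbrakk> \<Longrightarrow>
        \<forall>\<^sub>F n in sequentially. \<forall>k\<le>n. norm (mpow (a (t / real n)) k - mat 1) < \<delta>"
      using curve_powers(2)[OF a \<delta>(1)] by blast
    have "p (complex_of_real (1 / t) \<odot> (act (mexp (t *\<^sub>R X)) x0 \<ominus> x0) \<ominus> y) \<le> e"
      if t: "t \<noteq> 0" "\<bar>t\<bar> < \<eta>" for t
    proof -
      have main: "p (complex_of_real (1 / t) \<odot> (act (mexp (t *\<^sub>R X)) v \<ominus> v) \<ominus> y) \<le> e"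
        if v [simp]: "v \<in> carrier V" and w: "w \<in> B"
          and lim: "limitin (tvs_topology V) (\<lambda>s. complex_of_real (1 / s) \<odot> (act (a s) v \<ominus> v)) w (at 0)" for v w
      proof -
        define u where "u n = complex_of_real (1 / (t / real n)) \<odot> (act (a (t / real n)) v \<ominus> v)" for n
        have u [simp]: "u n \<in> carrier V" for n using aG by (simp add: u_def)
        have "filterlim (\<lambda>n. t / real n) (at 0) sequentially"
        proof (rule filterlim_atI)
          show "(\<lambda>n. t / real n) \<longlonglongrightarrow> 0" by (rule lim_const_over_n)
          show "\<forall>\<^sub>F n in sequentially. t / real n \<noteq> 0"
            using eventually_gt_at_top[of 0] by eventually_elim (use t in auto)
        qed
        moreover have "\<forall>\<^sub>F s in at 0. complex_of_real (1 / s) \<odot> (act (a s) v \<ominus> v) \<in> B"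
          by (rule limitinD[OF lim AB(2) w])
        ultimately have "\<forall>\<^sub>F n in sequentially. u n \<in> B"
          unfolding u_def by (rule eventually_compose_filterlim[rotated])
        then have ev: "\<forall>\<^sub>F n in sequentially. n > 0 \<and> u n \<in> B \<and> (\<forall>k\<le>n. norm (mpow (a (t / real n)) k - mat 1) < \<delta>)"
          using \<eta>(2)[OF t] eventually_gt_at_top[of 0] by eventually_elim auto
        have "\<forall>\<^sub>F n in sequentially. p (complex_of_real (1 / t) \<odot> (act (mpow (a (t / real n)) n) v \<ominus> v) \<ominus> y) \<le> e"
          using ev
        proof eventually_elim
          case (elim n)
          define h where "h = a (t / real n)"
          have h [simp]: "h \<in> G" by (simp add: h_def aG)
          define D where "D k = complex_of_real (real n / t) \<odot> (act (mpow h k) v \<ominus> v) \<ominus> complex_of_real (real k) \<odot> y" for k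
          have step: "D (Suc k) = D k \<oplus> (act (mpow h k) (u n) \<ominus> y)" for k
          proof -
            have "h ** mpow h k = mpow h k ** h" by (induction k) (simp_all add: matrix_mul_assoc)
            then have 1: "act (mpow h (Suc k)) v = act (mpow h k) (act h v)" by (simp add: act_mult)
            have 2: "act (mpow h k) (u n) = complex_of_real (real n / t) \<odot> (act (mpow h k) (act h v) \<ominus> act (mpow h k) v)"
              by (simp add: u_def act_smult act_minus flip: h_def)
            show ?thesis
              unfolding D_def 1 2
              by (rule coordinates4[of v y "act (mpow h k) v" "act (mpow h k) (act h v)"]) (simp_all add: algebra_simps)
          qed
          have Dc [simp]: "D k \<in> carrier V" for k by (simp add: D_def)
          have "k \<le> n \<longrightarrow> p (D k) \<le> real k * e" for k
          proof (induction k)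
            case 0 then show ?case using csn(4)[OF p] by (simp add: D_def)
          next
            case (Suc k)
            show ?case
            proof
              assume k: "Suc k \<le> n"
              have "p (act (mpow h k) (u n) \<ominus> y) < e"
                by (rule near) (use elim k in \<open>auto simp: h_def aG\<close>)
              moreover have "p (D (Suc k)) \<le> p (D k) + p (act (mpow h k) (u n) \<ominus> y)"
                unfolding step by (rule csn(2)[OF p]) auto
              ultimately show "p (D (Suc k)) \<le> real (Suc k) * e"
                using Suc k by (simp add: algebra_simps)
            qed
          qed
          then have "p (D n) \<le> real n * e" by simp
          moreover have "D n = of_real (real n) \<odot> (complex_of_real (1 / t) \<odot> (act (mpow h n) v \<ominus> v) \<ominus> y)"
            unfolding D_def by (rule coordinates3[of v y "act (mpow h n) v"]) (simp_all add: algebra_simps)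
          ultimately have "real n * p (complex_of_real (1 / t) \<odot> (act (mpow h n) v \<ominus> v) \<ominus> y) \<le> real n * e"
            using csn(3)[OF p] by simp
          then show ?case using elim by (simp add: h_def)
        qed
        moreover have "(\<lambda>n. p (complex_of_real (1 / t) \<odot> (act (mpow (a (t / real n)) n) v \<ominus> v) \<ominus> y))
            \<longlonglongrightarrow> p (complex_of_real (1 / t) \<odot> (act (mexp (t *\<^sub>R X)) v \<ominus> v) \<ominus> y)"
          by (intro limit_seminorm[OF _ p] limit_minus limit_smult limit_act tendsto_const curve_powers(1)[OF a t(1)])
             (use aG X in auto)
        ultimately show ?thesis
          by (intro tendsto_upperbound[where F = sequentially]) auto
      qed
      have "\<forall>\<^sub>F i in F. p (complex_of_real (1 / t) \<odot> (act (mexp (t *\<^sub>R X)) (x i) \<ominus> x i) \<ominus> y) \<le> e"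
        using d limitin_tvsD(2)[OF x] limitinD[OF z AB(2,4)]
        by eventually_elim (rule main)
      moreover have "((\<lambda>i. p (complex_of_real (1 / t) \<odot> (act (mexp (t *\<^sub>R X)) (x i) \<ominus> x i) \<ominus> y))
          \<longlongrightarrow> p (complex_of_real (1 / t) \<odot> (act (mexp (t *\<^sub>R X)) x0 \<ominus> x0) \<ominus> y)) F"
        by (intro limit_seminorm[OF _ p] limit_minus limit_smult limit_act tendsto_const x) (use X in auto)
      ultimately show ?thesis
        using F by (intro tendsto_upperbound) auto
    qed
    with \<eta>(1) show ?thesis by blast
  qed
  note * = this
  show "((\<lambda>t. p (complex_of_real (1 / t) \<odot> (act (mexp (t *\<^sub>R X)) x0 \<ominus> x0) \<ominus> y)) \<longlongrightarrow> 0) (at 0)"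
  proof (rule tendstoI)
    fix e :: real assume "e > 0"
    then obtain \<eta> where \<eta>: "\<eta> > 0" "\<And>t. \<lbrakk>t \<noteq> 0; \<bar>t\<bar> < \<eta>\<rbrakk> \<Longrightarrow>
      p (complex_of_real (1 / t) \<odot> (act (mexp (t *\<^sub>R X)) x0 \<ominus> x0) \<ominus> y) \<le> e / 2"
      using *[of "e / 2"] by auto
    have "dist (p (complex_of_real (1 / t) \<odot> (act (mexp (t *\<^sub>R X)) x0 \<ominus> x0) \<ominus> y)) 0 < e"
      if "t \<noteq> 0" "\<bar>t\<bar> < \<eta>" for t
    proof -
      have "p (complex_of_real (1 / t) \<odot> (act (mexp (t *\<^sub>R X)) x0 \<ominus> x0) \<ominus> y) \<ge> 0"
        by (rule csn(1)[OF p]) (use X in auto)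
      then show ?thesis using \<eta>(2)[OF that] \<open>e > 0\<close> by simp
    qed
    then show "\<forall>\<^sub>F t in at 0. dist (p (complex_of_real (1 / t) \<odot> (act (mexp (t *\<^sub>R X)) x0 \<ominus> x0) \<ominus> y)) 0 < e"
      using \<eta>(1) unfolding eventually_at by (auto simp: dist_real_def)
  qed
qed

lemma lie_act_add_vector:
  assumes "X \<in> lie_alg G" "v \<in> carrier V" "w \<in> carrier V"
  shows "lie_act V X (v \<oplus> w) = lie_act V X v \<oplus> lie_act V X w"
proof (rule lie_act_eq)
  have "complex_of_real (1 / t) \<odot> (act (mexp (t *\<^sub>R X)) v \<ominus> v) \<oplus> complex_of_real (1 / t) \<odot> (act (mexp (t *\<^sub>R X)) w \<ominus> w)
      = complex_of_real (1 / t) \<odot> (act (mexp (t *\<^sub>R X)) (v \<oplus> w) \<ominus> (v \<oplus> w))" for t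
    unfolding act_add[OF mexp_in_G[OF assms(1)] assms(2,3)]
    using assms
    by (rule_tac coordinates4[of v w "act (mexp (t *\<^sub>R X)) v" "act (mexp (t *\<^sub>R X)) w"]) (auto simp: algebra_simps)
  then show "derivative X (v \<oplus> w) (lie_act V X v \<oplus> lie_act V X w)"
    using limit_add[OF derivative_lie_act[unfolded derivative_def, OF assms(1,2)] derivative_lie_act[unfolded derivative_def, OF assms(1,3)]]
    by (simp add: derivative_def)
qed

lemma lie_act_smult_vector:
  assumes "X \<in> lie_alg G" "v \<in> carrier V"
  shows "lie_act V X (c \<odot> v) = c \<odot> lie_act V X v"
proof (rule lie_act_eq)
  have "c \<odot> (complex_of_real (1 / t) \<odot> (act (mexp (t *\<^sub>R X)) v \<ominus> v))
      = complex_of_real (1 / t) \<odot> (act (mexp (t *\<^sub>R X)) (c \<odot> v) \<ominus> (c \<odot> v))" for t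
    using assms by (simp add: act_smult smult_minus mult.commute)
  then show "derivative X (c \<odot> v) (c \<odot> lie_act V X v)"
    using limit_smult[OF derivative_lie_act[unfolded derivative_def, OF assms] tendsto_const[of c]]
    by (simp add: derivative_def)
qed

lemma lie_act_minus_vector:
  "\<lbrakk>X \<in> lie_alg G; v \<in> carrier V; w \<in> carrier V\<rbrakk> \<Longrightarrow> lie_act V X (v \<ominus> w) = lie_act V X v \<ominus> lie_act V X w"
  by (simp add: minus_eq lie_act_add_vector lie_act_smult_vector)

lemma lie_act_add:
  assumes "X \<in> lie_alg G" "Y \<in> lie_alg G" "v \<in> carrier V"
  shows "lie_act V (X + Y) v = lie_act V X v \<oplus> lie_act V Y v"
proof (rule lie_act_eq)
  let ?a = "\<lambda>s. mexp (s *\<^sub>R X) ** mexp (s *\<^sub>R Y)"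
  have "limitin (tvs_topology V) (\<lambda>s. complex_of_real (1 / s) \<odot> (act (mexp (s *\<^sub>R X)) v \<ominus> v) \<oplus>
      act (mexp (s *\<^sub>R X)) (complex_of_real (1 / s) \<odot> (act (mexp (s *\<^sub>R Y)) v \<ominus> v)))
      (lie_act V X v \<oplus> act (mat 1) (lie_act V Y v)) (at 0)"
    using derivative_lie_act assms unfolding derivative_def
    by (intro limit_add limit_act mexp_tendsto) auto
  moreover have "complex_of_real (1 / s) \<odot> (act (mexp (s *\<^sub>R X)) v \<ominus> v) \<oplus>
      act (mexp (s *\<^sub>R X)) (complex_of_real (1 / s) \<odot> (act (mexp (s *\<^sub>R Y)) v \<ominus> v)) =
      complex_of_real (1 / s) \<odot> (act (?a s) v \<ominus> v)" for s
    using assms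
    by (rule_tac coordinates3[of v "act (mexp (s *\<^sub>R X)) v" "act (mexp (s *\<^sub>R X)) (act (mexp (s *\<^sub>R Y)) v)"])
       (auto simp: act_smult act_minus act_mult algebra_simps)
  ultimately have "limitin (tvs_topology V) (\<lambda>s. complex_of_real (1 / s) \<odot> (act (?a s) v \<ominus> v))
      (lie_act V X v \<oplus> lie_act V Y v) (at 0)"
    using assms by simp
  then show "derivative (X + Y) v (lie_act V X v \<oplus> lie_act V Y v)"
    using assms
    by (intro curve_derivative[OF _ _ product_velocity sequentially_bot, where x = "\<lambda>_. v" and z = "\<lambda>_. lie_act V X v \<oplus> lie_act V Y v"]) auto
qed

lemma lie_act_closed_operator:
  assumes X: "X \<in> lie_alg G" and F: "F \<noteq> bot"
    and x: "limitin (tvs_topology V) x x0 F"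
    and z: "limitin (tvs_topology V) (\<lambda>i. lie_act V X (x i)) y F"
  shows "lie_act V X x0 = y"
proof (rule lie_act_eq, rule curve_derivative[OF X _ mexp_derivative F x z])
  show "\<forall>\<^sub>F i in F. limitin (tvs_topology V)
      (\<lambda>s. complex_of_real (1 / s) \<odot> (act (mexp (s *\<^sub>R X)) (x i) \<ominus> x i)) (lie_act V X (x i)) (at 0)"
    using limitin_tvsD(2)[OF x]
    by eventually_elim (use derivative_lie_act[OF X] in \<open>simp add: derivative_def\<close>)
qed (use X in auto)

lemma lie_act_scale:
  assumes "X \<in> lie_alg G" "v \<in> carrier V"
  shows "lie_act V (r *\<^sub>R X) v = of_real r \<odot> lie_act V X v"
proof (rule lie_act_eq)
  show "derivative (r *\<^sub>R X) v (of_real r \<odot> lie_act V X v)"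
  proof (cases "r = 0")
    case True
    then show ?thesis using assms by (simp add: derivative_def)
  next
    case False
    have "filterlim (\<lambda>t. t * r) (at 0) (at (0::real))"
      by (rule filterlim_atI) (use False in \<open>auto intro!: tendsto_eq_intros simp: eventually_at_filter\<close>)
    then have "limitin (tvs_topology V) (\<lambda>t. complex_of_real (1 / (t * r)) \<odot> (act (mexp ((t * r) *\<^sub>R X)) v \<ominus> v)) (lie_act V X v) (at 0)"
      by (rule limitin_filterlim[OF derivative_lie_act[OF assms, unfolded derivative_def]])
    from limit_smult[OF this tendsto_const[of "complex_of_real r"]]
    show ?thesis
      using assms False by (simp add: derivative_def)
  qed
qed

lemma lie_act_conj:
  assumes "X \<in> lie_alg G" "g \<in> G" "v \<in> carrier V"
  shows "lie_act V (g ** X ** adjugate g) (act g v) = act g (lie_act V X v)"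
proof (rule lie_act_eq)
  have "act (mexp (t *\<^sub>R (g ** X ** adjugate g))) (act g v) = act g (act (mexp (t *\<^sub>R X)) v)" for t
    unfolding mexp_scaled_conj[OF assms(2)] using assms by (simp add: act_mult)
  moreover have "limitin (tvs_topology V) (\<lambda>t. act g (complex_of_real (1 / t) \<odot> (act (mexp (t *\<^sub>R X)) v \<ominus> v)))
      (act g (lie_act V X v)) (at 0)"
    by (rule limit_act[OF tendsto_const]) (use derivative_lie_act assms in \<open>auto simp: derivative_def\<close>)
  ultimately show "derivative (g ** X ** adjugate g) (act g v) (act g (lie_act V X v))"
    using assms by (simp add: derivative_def act_smult act_minus)
qed

section \<open>The complexified Lie algebra action\<close>

abbreviation lieC where "lieC \<equiv> lie_act_C G V"

lemmas lieC_eq = lie_act_C_eq[where V = V]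

lemma lieC_real: "\<lbrakk>A \<in> lie_alg G; v \<in> carrier V\<rbrakk> \<Longrightarrow> lieC A v = lie_act V A v"
  using lieC_eq[of A 0 v] lie_act_scale[of A v 0] lie_act_scale[of 0 v 0]
  by (simp add: cscale_def zero_vec_def[symmetric] vec_lambda_eta)

lemma lieC_closed [simp, intro]: "\<lbrakk>trace Z = 0; v \<in> carrier V\<rbrakk> \<Longrightarrow> lieC Z v \<in> carrier V"
  by (erule complexified_exists) (simp add: lieC_eq)

lemma lieC_add_vector:
  assumes "trace Z = 0" "v \<in> carrier V" "w \<in> carrier V"
  shows "lieC Z (v \<oplus> w) = lieC Z v \<oplus> lieC Z w"
proof -
  obtain A B where [simp]: "A \<in> lie_alg G" "B \<in> lie_alg G" "Z = A + cscale \<i> B"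
    using complexified_exists[OF assms(1)] .
  show ?thesis
    using assms(2,3)
    by (rule_tac coordinates4[of "lie_act V A v" "lie_act V B v" "lie_act V A w" "lie_act V B w"])
       (auto simp: lieC_eq lie_act_add_vector)
qed

lemma lieC_smult_vector:
  assumes "trace Z = 0" "v \<in> carrier V"
  shows "lieC Z (c \<odot> v) = c \<odot> lieC Z v"
proof -
  obtain A B where [simp]: "A \<in> lie_alg G" "B \<in> lie_alg G" "Z = A + cscale \<i> B"
    using complexified_exists[OF assms(1)] .
  show ?thesis
    using assms(2) by (simp add: lieC_eq lie_act_smult_vector smult_add_right mult.commute)
qed

lemma lieC_add:
  assumes "trace Z = 0" "trace W = 0" "v \<in> carrier V"
  shows "lieC (Z + W) v = lieC Z v \<oplus> lieC W v"
proof -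
  obtain A B where AB [simp]: "A \<in> lie_alg G" "B \<in> lie_alg G" and Z: "Z = A + cscale \<i> B"
    using complexified_exists[OF assms(1)] .
  obtain C D where CD [simp]: "C \<in> lie_alg G" "D \<in> lie_alg G" and W: "W = C + cscale \<i> D"
    using complexified_exists[OF assms(2)] .
  have *: "Z + W = (A + C) + cscale \<i> (B + D)" by (simp add: Z W mat2_simps algebra_simps)
  have "lieC (Z + W) v = (lie_act V A v \<oplus> lie_act V C v) \<oplus> \<i> \<odot> (lie_act V B v \<oplus> lie_act V D v)"
    unfolding * using assms(3) by (simp add: lieC_eq lie_act_add)
  also have "\<dots> = lieC Z v \<oplus> lieC W v"
    using assms(3)
    by (rule_tac coordinates4[of "lie_act V A v" "lie_act V B v" "lie_act V C v" "lie_act V D v"])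
       (auto simp: lieC_eq Z W)
  finally show ?thesis .
qed

lemma lieC_cscale:
  assumes "trace Z = 0" "v \<in> carrier V"
  shows "lieC (cscale c Z) v = c \<odot> lieC Z v"
proof -
  obtain A B where AB [simp]: "A \<in> lie_alg G" "B \<in> lie_alg G" and Z: "Z = A + cscale \<i> B"
    using complexified_exists[OF assms(1)] .
  have *: "cscale c Z = (Re c *\<^sub>R A - Im c *\<^sub>R B) + cscale \<i> (Re c *\<^sub>R B + Im c *\<^sub>R A)"
    by (simp add: Z mat2_simps complex_eq_iff algebra_simps)
  have m: "Re c *\<^sub>R A - Im c *\<^sub>R B = Re c *\<^sub>R A + (- Im c) *\<^sub>R B" by simp
  have "lieC (cscale c Z) v = (of_real (Re c) \<odot> lie_act V A v \<oplus> of_real (- Im c) \<odot> lie_act V B v) \<oplus>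
      \<i> \<odot> (of_real (Re c) \<odot> lie_act V B v \<oplus> of_real (Im c) \<odot> lie_act V A v)"
    unfolding * m using assms(2) AB by (simp only: lieC_eq lie_act_add lie_act_scale lie_alg_add lie_alg_scale)
  also have "\<dots> = c \<odot> lieC Z v"
    using assms(2)
    by (rule_tac coordinates2[of "lie_act V A v" "lie_act V B v"])
       (auto simp: lieC_eq Z complex_eq_iff intro!: arg_cong2[where f = "\<lambda>a b. _ [a, b]"])
  finally show ?thesis .
qed

lemma trace_basis [simp]: "trace sl2_H = 0" "trace sl2_X = 0" "trace sl2_Y = 0"
  by (simp_all add: trace_def sum_2 sl2_H_def sl2_X_def sl2_Y_def)

lemma trace_cscale [simp]: "trace (cscale c Z) = c * trace Z"
  by (simp add: trace_def sum_2 cscale_def algebra_simps)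

lemma lieC_basis:
  assumes "trace Z = 0" "v \<in> carrier V"
  shows "lieC Z v = Z $ 1 $ 1 \<odot> lieC sl2_H v \<oplus> Z $ 1 $ 2 \<odot> lieC sl2_X v \<oplus> Z $ 2 $ 1 \<odot> lieC sl2_Y v"
proof -
  have "Z = cscale (Z $ 1 $ 1) sl2_H + cscale (Z $ 1 $ 2) sl2_X + cscale (Z $ 2 $ 1) sl2_Y"
    using assms(1) by (simp add: mat2_simps sl2_H_def sl2_X_def sl2_Y_def trace_def add_eq_0_iff)
  then have "lieC Z v = lieC (cscale (Z $ 1 $ 1) sl2_H + cscale (Z $ 1 $ 2) sl2_X + cscale (Z $ 2 $ 1) sl2_Y) v"
    by simp
  also have "\<dots> = Z $ 1 $ 1 \<odot> lieC sl2_H v \<oplus> Z $ 1 $ 2 \<odot> lieC sl2_X v \<oplus> Z $ 2 $ 1 \<odot> lieC sl2_Y v"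
    using assms(2) by (simp add: lieC_add lieC_cscale trace_add)
  finally show ?thesis .
qed

lemma lieC_conj:
  assumes "trace Z = 0" "g \<in> G" "v \<in> carrier V"
  shows "act g (lieC Z v) = lieC (g ** Z ** adjugate g) (act g v)"
proof -
  obtain A B where AB [simp]: "A \<in> lie_alg G" "B \<in> lie_alg G" and Z: "Z = A + cscale \<i> B"
    using complexified_exists[OF assms(1)] .
  have "g ** Z ** adjugate g = g ** A ** adjugate g + cscale \<i> (g ** B ** adjugate g)"
    by (simp add: Z mat_mult_distrib)
  then show ?thesis
    using assms by (simp add: Z lieC_eq lie_alg_conj lie_act_conj act_add act_smult)
qed

lemma limit_lieC:
  assumes "(Z \<longlongrightarrow> Z0) F" "\<And>t. trace (Z t) = 0" "trace Z0 = 0" "v \<in> carrier V"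
  shows "limitin (tvs_topology V) (\<lambda>t. lieC (Z t) v) (lieC Z0 v) F"
  unfolding lieC_basis[OF assms(2,4)] lieC_basis[OF assms(3,4)]
  by (intro limit_add limit_smult tendsto_vec_nth assms) (use assms(4) in auto)

text \<open>
  Differentiate \<open>B (exp (tA) v) = exp (tA) (Ad (exp (-tA)) B) v\<close> at \<open>t = 0\<close>; the operator \<open>B\<close> may be
  interchanged with the limit because it is closed.
\<close>

lemma lie_act_commutator:
  assumes A: "A \<in> lie_alg G" and B: "B \<in> lie_alg G" and v: "v \<in> carrier V"
  shows "lie_act V A (lie_act V B v) = lie_act V B (lie_act V A v) \<oplus> lieC (A ** B - B ** A) v"
proof -
  define E where "E t = mexp (t *\<^sub>R A)" for t
  define m where "m t = E (- t) ** B ** E t" for t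
  have E: "E t \<in> G" "E (- t) ** E t = mat 1" "E t ** E (- t) = mat 1" for t
    using A mexp_add[of t "- t" A] mexp_add[of "- t" t A] by (simp_all add: E_def)
  have adj: "adjugate (E (- t)) = E t" for t
    using E adjugate[of "E (- t)"] by (metis G_det matrix_mul_assoc matrix_mul_lid matrix_mul_rid)
  have mL: "m t \<in> lie_alg G" for t
    using lie_alg_conj[OF B E(1), of "- t"] adj by (simp add: m_def)
  have trm: "trace (m t - B) = 0" for t using mL B by (simp add: trace_sub)
  let ?q = "\<lambda>t. complex_of_real (1 / t) \<odot> (act (E t) v \<ominus> v)"
  have key: "lie_act V B (?q t) = act (E t) (lieC ((1 / t) *\<^sub>R (m t - B)) v) \<oplus>
      complex_of_real (1 / t) \<odot> (act (E t) (lie_act V B v) \<ominus> lie_act V B v)" for t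
  proof -
    have "act (E (- t)) (lie_act V B (act (E t) v)) = lie_act V (m t) v"
      using lie_act_conj[OF B E(1)[of "- t"], of "act (E t) v"] adj E v
      by (simp add: m_def flip: act_mult)
    then have "lie_act V B (act (E t) v) = act (E t) (lie_act V (m t) v)"
      using E v B by (metis act_closed act_mult act_one lie_act_closed)
    then have 1: "lie_act V B (?q t) = complex_of_real (1 / t) \<odot> (act (E t) (lie_act V (m t) v) \<ominus> lie_act V B v)"
      using v E B
      by (simp add: lie_act_smult_vector lie_act_minus_vector)
    have "(1 / t) *\<^sub>R (m t - B) = cscale (of_real (1 / t)) (m t - B)"
      by (simp add: mat2_simps) (simp add: scaleR_conv_of_real)
    moreover have "lieC (m t) v = lieC (m t - B) v \<oplus> lieC B v"
      using lieC_add[OF trm, of B v t] B v by simp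
    ultimately have 2: "act (E t) (lieC ((1 / t) *\<^sub>R (m t - B)) v) =
        complex_of_real (1 / t) \<odot> act (E t) (lieC (m t - B) v)"
      "act (E t) (lie_act V (m t) v) = act (E t) (lieC (m t - B) v) \<oplus> act (E t) (lie_act V B v)"
      using trm v E B mL by (simp_all add: lieC_cscale act_smult act_add flip: lieC_real)
    show ?thesis
      unfolding 1 2
      by (rule coordinates3[of "act (E t) (lieC (m t - B) v)" "act (E t) (lie_act V B v)" "lie_act V B v"])
         (use trm v E B in \<open>auto simp: algebra_simps\<close>)
  qed
  have E0: "(E \<longlongrightarrow> mat 1) (at 0)" using mexp_tendsto by (simp add: E_def[abs_def])
  have neg: "filterlim (\<lambda>t::real. - t) (at 0) (at 0)"
    by (rule filterlim_atI) (auto intro!: tendsto_eq_intros simp: eventually_at_filter)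
  have d1: "((\<lambda>t. (1 / t) *\<^sub>R (E t - mat 1)) \<longlongrightarrow> A) (at 0)"
    using mexp_derivative by (simp add: E_def)
  have "((\<lambda>t. - ((1 / - t) *\<^sub>R (E (- t) - mat 1))) \<longlongrightarrow> - A) (at 0)"
    by (rule tendsto_minus[OF filterlim_compose[OF d1 neg]])
  then have d2: "((\<lambda>t. (1 / t) *\<^sub>R (E (- t) - mat 1)) \<longlongrightarrow> - A) (at 0)"
    by simp
  have "((\<lambda>t. ((1 / t) *\<^sub>R (E (- t) - mat 1)) ** B ** E t + B ** ((1 / t) *\<^sub>R (E t - mat 1)))
      \<longlongrightarrow> (- A) ** B ** mat 1 + B ** A) (at 0)"
    by (intro tendsto_add bounded_bilinear.tendsto[OF bounded_bilinear_mat_mult] d1 d2 E0 tendsto_const)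
  moreover have "((1 / t) *\<^sub>R (E (- t) - mat 1)) ** B ** E t + B ** ((1 / t) *\<^sub>R (E t - mat 1)) =
      (1 / t) *\<^sub>R (m t - B)" for t
    by (simp add: mat_mult_distrib m_def flip: scaleR_add_right)
  moreover have "(- A) ** B ** mat 1 + B ** A = B ** A - A ** B"
    by (simp add: mat2_simps)
  ultimately have md: "((\<lambda>t. (1 / t) *\<^sub>R (m t - B)) \<longlongrightarrow> B ** A - A ** B) (at 0)" by simp
  have tr': "trace ((1 / t) *\<^sub>R (m t - B)) = 0" for t
    using trm[of t] by (simp add: trace_def sum_2 flip: scaleR_add_right)
  have lim: "limitin (tvs_topology V) (\<lambda>t. lie_act V B (?q t))
      (act (mat 1) (lieC (B ** A - A ** B) v) \<oplus> lie_act V A (lie_act V B v)) (at 0)"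
    unfolding key
    by (intro limit_add limit_act[OF E0] limit_lieC md tr' v trace_commutator)
       (use E v A B derivative_lie_act[OF A, of "lie_act V B v"] in \<open>auto simp: derivative_def E_def\<close>)
  have lim': "limitin (tvs_topology V) (\<lambda>t. lie_act V B (?q t))
      (lieC (B ** A - A ** B) v \<oplus> lie_act V A (lie_act V B v)) (at 0)"
    using lim act_one[OF lieC_closed[OF trace_commutator v]] by (simp only:)
  have "lie_act V B (lie_act V A v) = lieC (B ** A - A ** B) v \<oplus> lie_act V A (lie_act V B v)"
    by (rule lie_act_closed_operator[OF B _ _ lim'])
       (use derivative_lie_act[OF A v] in \<open>auto simp: derivative_def E_def\<close>)
  moreover have "lieC (A ** B - B ** A) v = (- 1) \<odot> lieC (B ** A - A ** B) v"
  proof -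
    have "A ** B - B ** A = cscale (- 1) (B ** A - A ** B)" by (simp add: mat2_simps)
    then show ?thesis by (simp only: lieC_cscale[OF trace_commutator v])
  qed
  ultimately show ?thesis
    using v A B trace_commutator[of B A]
    by (rule_tac coordinates2[of "lieC (B ** A - A ** B) v" "lie_act V A (lie_act V B v)"]) auto
qed

text \<open>
  Both sides are complex linear in \<open>Z\<close> and in \<open>W\<close>.
\<close>

lemma lieC_commutator:
  assumes "trace Z = 0" "trace W = 0" and v: "v \<in> carrier V"
  shows "lieC Z (lieC W v) = lieC W (lieC Z v) \<oplus> lieC (Z ** W - W ** Z) v"
proof -
  have half: "lie_act V A (lieC W v) = lieC W (lie_act V A v) \<oplus> lieC (A ** W - W ** A) v"
    if A: "A \<in> lie_alg G" for A
  proof -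
    obtain C D where CD [simp]: "C \<in> lie_alg G" "D \<in> lie_alg G" and W: "W = C + cscale \<i> D"
      using complexified_exists[OF assms(2)] .
    have "A ** W - W ** A = (A ** C - C ** A) + cscale \<i> (A ** D - D ** A)"
      by (simp add: W mat2_simps algebra_simps)
    then have "lieC (A ** W - W ** A) v = lieC (A ** C - C ** A) v \<oplus> \<i> \<odot> lieC (A ** D - D ** A) v"
      using v by (simp add: lieC_add lieC_cscale trace_commutator)
    then show ?thesis
      unfolding W using v A
      by (rule_tac coordinates4[of "lie_act V C (lie_act V A v)" "lie_act V D (lie_act V A v)"
            "lieC (A ** C - C ** A) v" "lieC (A ** D - D ** A) v"])
         (auto simp: lieC_eq lie_act_add_vector lie_act_smult_vector lie_act_commutator[OF A CD(1) v]
            lie_act_commutator[OF A CD(2) v] trace_commutator)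
  qed
  obtain A B where AB [simp]: "A \<in> lie_alg G" "B \<in> lie_alg G" and Z: "Z = A + cscale \<i> B"
    using complexified_exists[OF assms(1)] .
  have "Z ** W - W ** Z = (A ** W - W ** A) + cscale \<i> (B ** W - W ** B)"
    by (simp add: Z mat2_simps algebra_simps)
  then have "lieC (Z ** W - W ** Z) v = lieC (A ** W - W ** A) v \<oplus> \<i> \<odot> lieC (B ** W - W ** B) v"
    using v by (simp add: lieC_add lieC_cscale trace_commutator)
  then show ?thesis
    unfolding Z using v assms(2)
    by (rule_tac coordinates4[of "lieC W (lie_act V A v)" "lieC W (lie_act V B v)"
          "lieC (A ** W - W ** A) v" "lieC (B ** W - W ** B) v"])
       (auto simp: lieC_eq lieC_add_vector lieC_smult_vector half trace_commutator)
qed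

end

section \<open>The Casimir operator on the tensor product with the natural representation\<close>

lemma tensor_C2_simps [simp]:
  "carrier (tensor_C2 V) = carrier V \<times> carrier V"
  "\<zero>\<^bsub>tensor_C2 V\<^esub> = (\<zero>\<^bsub>V\<^esub>, \<zero>\<^bsub>V\<^esub>)"
  "(v, w) \<oplus>\<^bsub>tensor_C2 V\<^esub> (v', w') = (v \<oplus>\<^bsub>V\<^esub> v', w \<oplus>\<^bsub>V\<^esub> w')"
  "c \<odot>\<^bsub>tensor_C2 V\<^esub> (v, w) = (c \<odot>\<^bsub>V\<^esub> v, c \<odot>\<^bsub>V\<^esub> w)"
  "tvs_topology (tensor_C2 V) = prod_topology (tvs_topology V) (tvs_topology V)"
  "action (tensor_C2 V) g (v, w) =
     (g $ 1 $ 1 \<odot>\<^bsub>V\<^esub> action V g v \<oplus>\<^bsub>V\<^esub> g $ 1 $ 2 \<odot>\<^bsub>V\<^esub> action V g w,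
      g $ 2 $ 1 \<odot>\<^bsub>V\<^esub> action V g v \<oplus>\<^bsub>V\<^esub> g $ 2 $ 2 \<odot>\<^bsub>V\<^esub> action V g w)"
  by (simp_all add: tensor_C2_def)

context smooth_representation
begin

abbreviation E where "E \<equiv> tensor_C2 V"

lemma complex_space_tensor: "complex_space E"
proof (rule complex_space.intro)
  show "module complex_ring E"
  proof (rule moduleI[OF cring_complex_ring])
    show "abelian_group E"
    proof (rule abelian_groupI)
      show "\<exists>y\<in>carrier E. y \<oplus>\<^bsub>E\<^esub> x = \<zero>\<^bsub>E\<^esub>" if x: "x \<in> carrier E" for x
      proof -
        obtain v w where vw: "x = (v, w)" "v \<in> carrier V" "w \<in> carrier V" using x by auto
        have "(- 1) \<odot> u \<oplus> u = \<zero>" if "u \<in> carrier V" for u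
          by (rule coordinates1[OF that]) simp
        then show ?thesis using vw by (intro bexI[of _ "((- 1) \<odot> v, (- 1) \<odot> w)"]) auto
      qed
    qed (auto simp: M.a_ac)
  qed (auto simp: smult_add_right smult_add_left[symmetric])
qed

sublocale T: complex_space E by (rule complex_space_tensor)

lemma tensor_minus [simp]:
  assumes "v \<in> carrier V" "w \<in> carrier V" "v' \<in> carrier V" "w' \<in> carrier V"
  shows "(v, w) \<ominus>\<^bsub>E\<^esub> (v', w') = (v \<ominus> v', w \<ominus> w')"
  using T.minus_eq[of "(v, w)" "(v', w')"] assms by (simp add: minus_eq)

lemma lie_act_tensor:
  assumes X: "X \<in> lie_alg G" and v: "v \<in> carrier V" and w: "w \<in> carrier V"
  shows "lie_act E X (v, w) =
    (lie_act V X v \<oplus> (X $ 1 $ 1 \<odot> v \<oplus> X $ 1 $ 2 \<odot> w), lie_act V X w \<oplus> (X $ 2 $ 1 \<odot> v \<oplus> X $ 2 $ 2 \<odot> w))"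
    (is "_ = (?l1, ?l2)")
proof -
  define g where "g t = mexp (t *\<^sub>R X)" for t
  have g [simp]: "g t \<in> G" for t using X by (simp add: g_def)
  have entry: "((\<lambda>t. (g t $ i $ j - (mat 1 :: mat2) $ i $ j) / of_real t) \<longlongrightarrow> X $ i $ j) (at 0)" for i j
  proof -
    have "((\<lambda>t. ((1 / t) *\<^sub>R (g t - mat 1)) $ i $ j) \<longlongrightarrow> X $ i $ j) (at 0)"
      unfolding g_def by (intro tendsto_vec_nth mexp_derivative)
    moreover have "((1 / t) *\<^sub>R (g t - mat 1)) $ i $ j = (g t $ i $ j - (mat 1 :: mat2) $ i $ j) / of_real t" for t
      by (simp only: vector_scaleR_component vector_minus_component) (simp add: scaleR_conv_of_real divide_inverse mult.commute)
    ultimately show ?thesis by simp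
  qed
  have g0: "(g \<longlongrightarrow> mat 1) (at 0)" unfolding g_def[abs_def] by (rule mexp_tendsto)
  have entry0: "((\<lambda>t. g t $ i $ j) \<longlongrightarrow> (mat 1 :: mat2) $ i $ j) (at 0)" for i j by (intro tendsto_vec_nth g0)
  have cont: "limitin (tvs_topology V) (\<lambda>t. act (g t) u) u (at 0)" if "u \<in> carrier V" for u
    using limit_act[OF g0, of "\<lambda>_. u" u] that by simp
  have d: "limitin (tvs_topology V) (\<lambda>t. complex_of_real (1 / t) \<odot> (act (g t) u \<ominus> u)) (lie_act V X u) (at 0)"
    if "u \<in> carrier V" for u
    using derivative_lie_act[OF X that] by (simp only: derivative_def g_def)
  have "limitin (tvs_topology V) (\<lambda>t. g t $ 1 $ 1 \<odot> (complex_of_real (1 / t) \<odot> (act (g t) v \<ominus> v)) \<oplus>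
      (((g t $ 1 $ 1 - (mat 1 :: mat2) $ 1 $ 1) / of_real t) \<odot> v \<oplus> ((g t $ 1 $ 2 - (mat 1 :: mat2) $ 1 $ 2) / of_real t) \<odot> act (g t) w))
      ((mat 1 :: mat2) $ 1 $ 1 \<odot> lie_act V X v \<oplus> (X $ 1 $ 1 \<odot> v \<oplus> X $ 1 $ 2 \<odot> w)) (at 0)"
    by (intro limit_add limit_smult d entry entry0 cont v w) (use v in simp)
  moreover have "g t $ 1 $ 1 \<odot> (complex_of_real (1 / t) \<odot> (act (g t) v \<ominus> v)) \<oplus>
      (((g t $ 1 $ 1 - (mat 1 :: mat2) $ 1 $ 1) / of_real t) \<odot> v \<oplus> ((g t $ 1 $ 2 - (mat 1 :: mat2) $ 1 $ 2) / of_real t) \<odot> act (g t) w) =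
      complex_of_real (1 / t) \<odot> (g t $ 1 $ 1 \<odot> act (g t) v \<oplus> g t $ 1 $ 2 \<odot> act (g t) w \<ominus> v)" for t
    using v w
    by (rule_tac coordinates3[of v "act (g t) v" "act (g t) w"])
       (simp_all add: mat_def divide_inverse algebra_simps)
  ultimately have lim1: "limitin (tvs_topology V)
      (\<lambda>t. complex_of_real (1 / t) \<odot> (g t $ 1 $ 1 \<odot> act (g t) v \<oplus> g t $ 1 $ 2 \<odot> act (g t) w \<ominus> v)) ?l1 (at 0)"
    using v w X by (simp add: mat_def)
  have "limitin (tvs_topology V) (\<lambda>t. g t $ 2 $ 2 \<odot> (complex_of_real (1 / t) \<odot> (act (g t) w \<ominus> w)) \<oplus>
      (((g t $ 2 $ 1 - (mat 1 :: mat2) $ 2 $ 1) / of_real t) \<odot> act (g t) v \<oplus> ((g t $ 2 $ 2 - (mat 1 :: mat2) $ 2 $ 2) / of_real t) \<odot> w))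
      ((mat 1 :: mat2) $ 2 $ 2 \<odot> lie_act V X w \<oplus> (X $ 2 $ 1 \<odot> v \<oplus> X $ 2 $ 2 \<odot> w)) (at 0)"
    by (intro limit_add limit_smult d entry entry0 cont v w) (use w in simp)
  moreover have "g t $ 2 $ 2 \<odot> (complex_of_real (1 / t) \<odot> (act (g t) w \<ominus> w)) \<oplus>
      (((g t $ 2 $ 1 - (mat 1 :: mat2) $ 2 $ 1) / of_real t) \<odot> act (g t) v \<oplus> ((g t $ 2 $ 2 - (mat 1 :: mat2) $ 2 $ 2) / of_real t) \<odot> w) =
      complex_of_real (1 / t) \<odot> (g t $ 2 $ 1 \<odot> act (g t) v \<oplus> g t $ 2 $ 2 \<odot> act (g t) w \<ominus> w)" for t
    using v w
    by (rule_tac coordinates3[of w "act (g t) v" "act (g t) w"])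
       (simp_all add: mat_def divide_inverse algebra_simps)
  ultimately have lim2: "limitin (tvs_topology V)
      (\<lambda>t. complex_of_real (1 / t) \<odot> (g t $ 2 $ 1 \<odot> act (g t) v \<oplus> g t $ 2 $ 2 \<odot> act (g t) w \<ominus> w)) ?l2 (at 0)"
    using v w X by (simp add: mat_def)
  have q: "complex_of_real (1 / t) \<odot>\<^bsub>E\<^esub> (action E (g t) (v, w) \<ominus>\<^bsub>E\<^esub> (v, w)) =
      (complex_of_real (1 / t) \<odot> (g t $ 1 $ 1 \<odot> act (g t) v \<oplus> g t $ 1 $ 2 \<odot> act (g t) w \<ominus> v),
       complex_of_real (1 / t) \<odot> (g t $ 2 $ 1 \<odot> act (g t) v \<oplus> g t $ 2 $ 2 \<odot> act (g t) w \<ominus> w))" for t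
    using v w by simp
  have "limitin (tvs_topology E) (\<lambda>t. complex_of_real (1 / t) \<odot>\<^bsub>E\<^esub> (action E (mexp (t *\<^sub>R X)) (v, w) \<ominus>\<^bsub>E\<^esub> (v, w))) l (at 0)
      \<longleftrightarrow> l = (?l1, ?l2)" for l
    unfolding g_def[symmetric] q unfolding tensor_C2_simps limitin_pairwise o_def fst_conv snd_conv
    apply (rule iffI)
     apply (elim conjE)
     apply (drule limit_unique[OF _ lim1 at_neq_bot])
     apply (drule limit_unique[OF _ lim2 at_neq_bot])
     apply (simp add: prod_eq_iff)
    apply (simp only: fst_conv snd_conv lim1 lim2 simp_thms)
    done
  then show ?thesis unfolding lie_act_def by simp
qed

lemma lieC_tensor:
  assumes "trace Z = 0" and v: "v \<in> carrier V" and w: "w \<in> carrier V"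
  shows "lie_act_C G E Z (v, w) =
    (lieC Z v \<oplus> (Z $ 1 $ 1 \<odot> v \<oplus> Z $ 1 $ 2 \<odot> w), lieC Z w \<oplus> (Z $ 2 $ 1 \<odot> v \<oplus> Z $ 2 $ 2 \<odot> w))"
proof -
  obtain A B where AB [simp]: "A \<in> lie_alg G" "B \<in> lie_alg G" and Z: "Z = A + cscale \<i> B"
    using complexified_exists[OF assms(1)] .
  have e: "Z $ i $ j = A $ i $ j + \<i> * B $ i $ j" for i j by (simp add: Z cscale_def)
  have "lie_act V A v \<oplus> (A $ 1 $ 1 \<odot> v \<oplus> A $ 1 $ 2 \<odot> w) \<oplus> \<i> \<odot> (lie_act V B v \<oplus> (B $ 1 $ 1 \<odot> v \<oplus> B $ 1 $ 2 \<odot> w)) =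
      lieC Z v \<oplus> (Z $ 1 $ 1 \<odot> v \<oplus> Z $ 1 $ 2 \<odot> w)"
    unfolding e unfolding Z
    by (rule coordinates4[of v w "lie_act V A v" "lie_act V B v"]) (use v w in \<open>simp_all add: lieC_eq algebra_simps\<close>)
  moreover have "lie_act V A w \<oplus> (A $ 2 $ 1 \<odot> v \<oplus> A $ 2 $ 2 \<odot> w) \<oplus> \<i> \<odot> (lie_act V B w \<oplus> (B $ 2 $ 1 \<odot> v \<oplus> B $ 2 $ 2 \<odot> w)) =
      lieC Z w \<oplus> (Z $ 2 $ 1 \<odot> v \<oplus> Z $ 2 $ 2 \<odot> w)"
    unfolding e unfolding Z
    by (rule coordinates4[of v w "lie_act V A w" "lie_act V B w"]) (use v w in \<open>simp_all add: lieC_eq algebra_simps\<close>)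
  ultimately show ?thesis
    unfolding Z lie_act_C_eq[OF AB] lie_act_tensor[OF AB(1) v w] lie_act_tensor[OF AB(2) v w] by simp
qed

abbreviation H where "H \<equiv> lieC sl2_H"
abbreviation X where "X \<equiv> lieC sl2_X"
abbreviation Y where "Y \<equiv> lieC sl2_Y"

lemma sl2_entries [simp]:
  "sl2_H $ 1 $ 1 = 1" "sl2_H $ 1 $ 2 = 0" "sl2_H $ 2 $ 1 = 0" "sl2_H $ 2 $ 2 = - 1"
  "sl2_X $ 1 $ 1 = 0" "sl2_X $ 1 $ 2 = 1" "sl2_X $ 2 $ 1 = 0" "sl2_X $ 2 $ 2 = 0"
  "sl2_Y $ 1 $ 1 = 0" "sl2_Y $ 1 $ 2 = 0" "sl2_Y $ 2 $ 1 = 1" "sl2_Y $ 2 $ 2 = 0"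
  by (simp_all add: sl2_H_def sl2_X_def sl2_Y_def)

lemma sl2_tensor:
  assumes "v \<in> carrier V" "w \<in> carrier V"
  shows "lie_act_C G E sl2_H (v, w) = (H v \<oplus> v, H w \<ominus> w)"
    "lie_act_C G E sl2_X (v, w) = (X v \<oplus> w, X w)"
    "lie_act_C G E sl2_Y (v, w) = (Y v, Y w \<oplus> v)"
  using assms
  by (simp_all add: lieC_tensor minus_eq)

lemma sl2_linear:
  assumes "v \<in> carrier V"
  shows "H v \<in> carrier V" "X v \<in> carrier V" "Y v \<in> carrier V"
    "H (c \<odot> v) = c \<odot> H v" "X (c \<odot> v) = c \<odot> X v" "Y (c \<odot> v) = c \<odot> Y v"
    "w \<in> carrier V \<Longrightarrow> H (v \<oplus> w) = H v \<oplus> H w" "w \<in> carrier V \<Longrightarrow> X (v \<oplus> w) = X v \<oplus> X w"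
    "w \<in> carrier V \<Longrightarrow> Y (v \<oplus> w) = Y v \<oplus> Y w"
    "w \<in> carrier V \<Longrightarrow> H (v \<ominus> w) = H v \<ominus> H w" "w \<in> carrier V \<Longrightarrow> X (v \<ominus> w) = X v \<ominus> X w"
    "w \<in> carrier V \<Longrightarrow> Y (v \<ominus> w) = Y v \<ominus> Y w"
  using assms by (simp_all add: lieC_add_vector lieC_smult_vector minus_eq)

lemma sl2_brackets:
  assumes "v \<in> carrier V"
  shows "H (X v) = X (H v) \<oplus> 2 \<odot> X v" "H (Y v) = Y (H v) \<oplus> (- 2) \<odot> Y v" "X (Y v) = Y (X v) \<oplus> H v"
proof -
  have "sl2_H ** sl2_X - sl2_X ** sl2_H = cscale 2 sl2_X" "sl2_H ** sl2_Y - sl2_Y ** sl2_H = cscale (- 2) sl2_Y"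
    "sl2_X ** sl2_Y - sl2_Y ** sl2_X = sl2_H"
    by (simp_all add: mat2_simps sl2_H_def sl2_X_def sl2_Y_def)
  then show "H (X v) = X (H v) \<oplus> 2 \<odot> X v" "H (Y v) = Y (H v) \<oplus> (- 2) \<odot> Y v" "X (Y v) = Y (X v) \<oplus> H v"
    using lieC_commutator[of sl2_H sl2_X v] lieC_commutator[of sl2_H sl2_Y v] lieC_commutator[of sl2_X sl2_Y v] assms
    by (simp_all add: lieC_cscale)
qed

lemma casimir_eq: "casimir G V v = H (H v) \<oplus> 2 \<odot> (X (Y v) \<oplus> Y (X v))"
  by (simp add: casimir_def Let_def)

text \<open>
  The Casimir operator acts on \<open>C\<^sup>2\<close> by \<open>2\<^sup>2 - 1 = 3\<close>; the remaining summand is twice the mixed term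
  \<open>H \<otimes> H + 2 X \<otimes> Y + 2 Y \<otimes> X\<close>.
\<close>

lemma casimir_tensor:
  assumes v: "v \<in> carrier V" and w: "w \<in> carrier V"
  shows "casimir G E (v, w) =
    (casimir G V v \<oplus> (3 \<odot> v \<oplus> 2 \<odot> (H v \<oplus> 2 \<odot> Y w)), casimir G V w \<oplus> (3 \<odot> w \<oplus> 2 \<odot> (2 \<odot> X v \<ominus> H w)))"
proof -
  note [simp] = sl2_linear
  have "casimir G E (v, w) =
    ((H (H v) \<oplus> H v \<oplus> (H v \<oplus> v)) \<oplus> 2 \<odot> ((X (Y v) \<oplus> (Y w \<oplus> v)) \<oplus> (Y (X v) \<oplus> Y w)),
     (H (H w) \<ominus> H w \<ominus> (H w \<ominus> w)) \<oplus> 2 \<odot> ((X (Y w) \<oplus> X v) \<oplus> (Y (X w) \<oplus> (X v \<oplus> w))))"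
    using v w by (simp add: casimir_def Let_def sl2_tensor M.a_assoc)
  moreover have "(H (H v) \<oplus> H v \<oplus> (H v \<oplus> v)) \<oplus> 2 \<odot> ((X (Y v) \<oplus> (Y w \<oplus> v)) \<oplus> (Y (X v) \<oplus> Y w)) =
      casimir G V v \<oplus> (3 \<odot> v \<oplus> 2 \<odot> (H v \<oplus> 2 \<odot> Y w))"
    unfolding casimir_eq
    by (rule coordinates6[of "H (H v)" "X (Y v)" "Y (X v)" "H v" "Y w" v]) (use v w in \<open>simp_all only: mult_1 mult_zero_right add_0 sl2_linear, simp_all\<close>)
  moreover have "(H (H w) \<ominus> H w \<ominus> (H w \<ominus> w)) \<oplus> 2 \<odot> ((X (Y w) \<oplus> X v) \<oplus> (Y (X w) \<oplus> (X v \<oplus> w))) =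
      casimir G V w \<oplus> (3 \<odot> w \<oplus> 2 \<odot> (2 \<odot> X v \<ominus> H w))"
    unfolding casimir_eq
    by (rule coordinates6[of "H (H w)" "X (Y w)" "Y (X w)" "H w" "X v" w]) (use v w in \<open>simp_all only: mult_1 mult_zero_right add_0 sl2_linear, simp_all\<close>)
  ultimately show ?thesis by simp
qed

text \<open>
  The mixed part \<open>H \<otimes> H + 2 X \<otimes> Y + 2 Y \<otimes> X\<close> of the Casimir operator of \<open>V \<otimes> C\<^sup>2\<close>.
\<close>

definition mixed :: "'v \<times> 'v \<Rightarrow> 'v \<times> 'v" where
  "mixed = (\<lambda>(v, w). (H v \<oplus> 2 \<odot> Y w, 2 \<odot> X v \<ominus> H w))"

lemma mixed_closed [simp]: "u \<in> carrier E \<Longrightarrow> mixed u \<in> carrier E"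
  by (auto simp: mixed_def sl2_linear)

lemma mixed_add: "\<lbrakk>u \<in> carrier E; u' \<in> carrier E\<rbrakk> \<Longrightarrow> mixed (u \<oplus>\<^bsub>E\<^esub> u') = mixed u \<oplus>\<^bsub>E\<^esub> mixed u'"
  by (auto simp: mixed_def sl2_linear smult_add_right minus_eq M.a_ac)

lemma mixed_smult: "u \<in> carrier E \<Longrightarrow> mixed (c \<odot>\<^bsub>E\<^esub> u) = c \<odot>\<^bsub>E\<^esub> mixed u"
  by (auto simp: mixed_def sl2_linear smult_add_right minus_eq mult.commute)

lemma act_tensor_closed [simp]: "\<lbrakk>g \<in> G; u \<in> carrier E\<rbrakk> \<Longrightarrow> action E g u \<in> carrier E"
  by auto

lemma act_tensor_add:
  "\<lbrakk>g \<in> G; u \<in> carrier E; u' \<in> carrier E\<rbrakk> \<Longrightarrow> action E g (u \<oplus>\<^bsub>E\<^esub> u') = action E g u \<oplus>\<^bsub>E\<^esub> action E g u'"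
  by (auto simp: act_add smult_add_right M.a_ac)

lemma act_tensor_smult:
  "\<lbrakk>g \<in> G; u \<in> carrier E\<rbrakk> \<Longrightarrow> action E g (c \<odot>\<^bsub>E\<^esub> u) = c \<odot>\<^bsub>E\<^esub> action E g u"
  by (auto simp: act_smult smult_add_right mult.commute)

text \<open>
  The coefficients are the entries of the conjugates of \<open>H\<close>, \<open>X\<close> and \<open>Y\<close> by \<open>g\<close>.
\<close>

lemma act_sl2:
  assumes g: "g \<in> G" and v: "v \<in> carrier V"
  defines "a \<equiv> g $ 1 $ 1" and "b \<equiv> g $ 1 $ 2" and "c \<equiv> g $ 2 $ 1" and "d \<equiv> g $ 2 $ 2"
  shows "act g (H v) = (a * d + b * c) \<odot> H (act g v) \<oplus> (- 2 * a * b) \<odot> X (act g v) \<oplus> (2 * c * d) \<odot> Y (act g v)"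
    "act g (X v) = (- a * c) \<odot> H (act g v) \<oplus> (a * a) \<odot> X (act g v) \<oplus> (- c * c) \<odot> Y (act g v)"
    "act g (Y v) = (b * d) \<odot> H (act g v) \<oplus> (- b * b) \<odot> X (act g v) \<oplus> (d * d) \<odot> Y (act g v)"
proof -
  have tr: "trace (g ** Z ** adjugate g) = 0" if "trace Z = 0" for Z
    using trace_conj[OF adjugate(2)[OF G_det[OF g]], of Z] that by simp
  have e: "(g ** Z ** adjugate g) $ 1 $ 1 = (a * Z $ 1 $ 1 + b * Z $ 2 $ 1) * d - (a * Z $ 1 $ 2 + b * Z $ 2 $ 2) * c"
    "(g ** Z ** adjugate g) $ 1 $ 2 = - (a * Z $ 1 $ 1 + b * Z $ 2 $ 1) * b + (a * Z $ 1 $ 2 + b * Z $ 2 $ 2) * a"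
    "(g ** Z ** adjugate g) $ 2 $ 1 = (c * Z $ 1 $ 1 + d * Z $ 2 $ 1) * d - (c * Z $ 1 $ 2 + d * Z $ 2 $ 2) * c" for Z
    by (simp_all add: adjugate_def matrix_matrix_mult_def sum_2 a_def b_def c_def d_def algebra_simps)
  show "act g (H v) = (a * d + b * c) \<odot> H (act g v) \<oplus> (- 2 * a * b) \<odot> X (act g v) \<oplus> (2 * c * d) \<odot> Y (act g v)"
    "act g (X v) = (- a * c) \<odot> H (act g v) \<oplus> (a * a) \<odot> X (act g v) \<oplus> (- c * c) \<odot> Y (act g v)"
    "act g (Y v) = (b * d) \<odot> H (act g v) \<oplus> (- b * b) \<odot> X (act g v) \<oplus> (d * d) \<odot> Y (act g v)"
    using g v by (simp_all add: lieC_conj lieC_basis[OF tr] e) (simp_all add: algebra_simps)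
qed

text \<open>
  The tensor \<open>H \<otimes> H + 2 X \<otimes> Y + 2 Y \<otimes> X\<close> is invariant under conjugation; comparing coefficients
  of \<open>H\<close>, \<open>X\<close>, \<open>Y\<close> this amounts to eight identities that hold because \<open>det g = 1\<close>.
\<close>

lemma mixed_act:
  assumes g: "g \<in> G" and u: "u \<in> carrier E"
  shows "action E g (mixed u) = mixed (action E g u)"
proof -
  obtain v w where vw: "u = (v, w)" "v \<in> carrier V" "w \<in> carrier V" using u by auto
  define a b c d where "a = g $ 1 $ 1" and "b = g $ 1 $ 2" and "c = g $ 2 $ 1" and "d = g $ 2 $ 2"
  have det: "a * d - b * c = 1" using G_det[OF g] by (simp add: det_2 a_def b_def c_def d_def)
  have coef: "a * (a * d + b * c) - b * (2 * (a * c)) = a" "a * (2 * c * d) - b * (2 * (c * c)) = 2 * c"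
    "a * (2 * (b * d)) + b * (- (a * d) - b * c) = b" "a * (2 * (d * d)) - b * (2 * c * d) = 2 * d"
    "c * (a * d + b * c) - d * (2 * (a * c)) = - c" "d * (2 * (a * a)) - c * (2 * a * b) = 2 * a"
    "c * (2 * (b * d)) + d * (- (a * d) - b * c) = - d" "d * (2 * a * b) - c * (2 * (b * b)) = 2 * b"
  proof -
    have "a * (a * d + b * c) - b * (2 * (a * c)) = a * (a * d - b * c)"
      "a * (2 * c * d) - b * (2 * (c * c)) = 2 * c * (a * d - b * c)"
      "a * (2 * (b * d)) + b * (- (a * d) - b * c) = b * (a * d - b * c)"
      "a * (2 * (d * d)) - b * (2 * c * d) = 2 * d * (a * d - b * c)"
      "c * (a * d + b * c) - d * (2 * (a * c)) = - c * (a * d - b * c)"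
      "d * (2 * (a * a)) - c * (2 * a * b) = 2 * a * (a * d - b * c)"
      "c * (2 * (b * d)) + d * (- (a * d) - b * c) = - d * (a * d - b * c)"
      "d * (2 * a * b) - c * (2 * (b * b)) = 2 * b * (a * d - b * c)"
      by (simp_all add: algebra_simps)
    then show "a * (a * d + b * c) - b * (2 * (a * c)) = a" "a * (2 * c * d) - b * (2 * (c * c)) = 2 * c"
      "a * (2 * (b * d)) + b * (- (a * d) - b * c) = b" "a * (2 * (d * d)) - b * (2 * c * d) = 2 * d"
      "c * (a * d + b * c) - d * (2 * (a * c)) = - c" "d * (2 * (a * a)) - c * (2 * a * b) = 2 * a"
      "c * (2 * (b * d)) + d * (- (a * d) - b * c) = - d" "d * (2 * a * b) - c * (2 * (b * b)) = 2 * b"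
      unfolding det by simp_all
  qed
  define x y where "x = act g v" and "y = act g w"
  have xy: "x \<in> carrier V" "y \<in> carrier V" using vw g by (simp_all add: x_def y_def)
  have "action E g (mixed u) =
    (a \<odot> (act g (H v) \<oplus> 2 \<odot> act g (Y w)) \<oplus> b \<odot> (2 \<odot> act g (X v) \<ominus> act g (H w)),
     c \<odot> (act g (H v) \<oplus> 2 \<odot> act g (Y w)) \<oplus> d \<odot> (2 \<odot> act g (X v) \<ominus> act g (H w)))"
    using vw g by (simp add: mixed_def act_add act_smult act_minus sl2_linear a_def b_def c_def d_def)
  moreover have "mixed (action E g u) =
    (H (a \<odot> x \<oplus> b \<odot> y) \<oplus> 2 \<odot> Y (c \<odot> x \<oplus> d \<odot> y), 2 \<odot> X (a \<odot> x \<oplus> b \<odot> y) \<ominus> H (c \<odot> x \<oplus> d \<odot> y))"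
    by (simp add: mixed_def vw x_def y_def a_def b_def c_def d_def)
  moreover have "a \<odot> (act g (H v) \<oplus> 2 \<odot> act g (Y w)) \<oplus> b \<odot> (2 \<odot> act g (X v) \<ominus> act g (H w)) =
      H (a \<odot> x \<oplus> b \<odot> y) \<oplus> 2 \<odot> Y (c \<odot> x \<oplus> d \<odot> y)"
    unfolding act_sl2[OF g vw(2)] act_sl2[OF g vw(3)] a_def[symmetric] b_def[symmetric] c_def[symmetric] d_def[symmetric]
      x_def[symmetric] y_def[symmetric]
    using xy
    apply (simp only: sl2_linear closed)
    apply (rule coordinates6[of "H x" "X x" "Y x" "H y" "X y" "Y y"])
    apply (simp_all only: sl2_linear)
    apply simp
    apply (rule arg_cong[where f = "_ :: complex list \<Rightarrow> 'v"])
    using coef by simp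
  moreover have "c \<odot> (act g (H v) \<oplus> 2 \<odot> act g (Y w)) \<oplus> d \<odot> (2 \<odot> act g (X v) \<ominus> act g (H w)) =
      2 \<odot> X (a \<odot> x \<oplus> b \<odot> y) \<ominus> H (c \<odot> x \<oplus> d \<odot> y)"
    unfolding act_sl2[OF g vw(2)] act_sl2[OF g vw(3)] a_def[symmetric] b_def[symmetric] c_def[symmetric] d_def[symmetric]
      x_def[symmetric] y_def[symmetric]
    using xy
    apply (simp only: sl2_linear closed)
    apply (rule coordinates6[of "H x" "X x" "Y x" "H y" "X y" "Y y"])
    apply (simp_all only: sl2_linear)
    apply simp
    apply (rule arg_cong[where f = "_ :: complex list \<Rightarrow> 'v"])
    using coef by simp
  ultimately show ?thesis by simp
qed

text \<open>
  In other words \<open>(mixed + 1)\<^sup>2 = \<nu>\<^sup>2\<close>.  The eigenvalues \<open>- 1 + \<nu>\<close> and \<open>- 1 - \<nu>\<close> belong to the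
  infinitesimal characters \<open>\<nu> + 1\<close> and \<open>\<nu> - 1\<close> of the tensor product.
\<close>

lemma mixed_mixed:
  assumes "u \<in> carrier E" and inf: "has_inf_char G V \<nu>"
  shows "mixed (mixed u) = (\<nu>\<^sup>2 - 1) \<odot>\<^bsub>E\<^esub> u \<oplus>\<^bsub>E\<^esub> (- 2) \<odot>\<^bsub>E\<^esub> mixed u"
proof -
  obtain v w where vw: "u = (v, w)" "v \<in> carrier V" "w \<in> carrier V" using assms by auto
  have cas: "(\<nu>\<^sup>2 - 1) \<odot> x = H (H x) \<oplus> 2 \<odot> (X (Y x) \<oplus> Y (X x))" if "x \<in> carrier V" for x
    using inf that by (simp add: has_inf_char_def casimir_eq)
  have "H (H v \<oplus> 2 \<odot> Y w) \<oplus> 2 \<odot> Y (2 \<odot> X v \<ominus> H w) =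
      (H (H v) \<oplus> 2 \<odot> (X (Y v) \<oplus> Y (X v))) \<oplus> (- 2) \<odot> (H v \<oplus> 2 \<odot> Y w)"
    using vw(2,3)
    apply (simp only: sl2_linear sl2_brackets closed)
    apply (rule coordinates6[of "H (H v)" "Y (X v)" "H v" "Y w" "Y (H w)" "X (X v)"])
    by (simp_all only: sl2_linear) simp
  moreover have "2 \<odot> X (H v \<oplus> 2 \<odot> Y w) \<ominus> H (2 \<odot> X v \<ominus> H w) =
      (H (H w) \<oplus> 2 \<odot> (X (Y w) \<oplus> Y (X w))) \<oplus> (- 2) \<odot> (2 \<odot> X v \<ominus> H w)"
    using vw(2,3)
    apply (simp only: sl2_linear sl2_brackets closed)
    apply (rule coordinates6[of "H (H w)" "Y (X w)" "H w" "X v" "X (H v)" "X (X v)"])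
    by (simp_all only: sl2_linear) simp
  ultimately show ?thesis using vw by (simp add: mixed_def cas)
qed

section \<open>Primary components of the tensor product\<close>

abbreviation shifted where "shifted \<tau> \<equiv> (\<lambda>u. casimir G E u \<ominus>\<^bsub>E\<^esub> (\<tau>\<^sup>2 - 1) \<odot>\<^bsub>E\<^esub> u)"

lemma shifted_eq:
  assumes "u \<in> carrier E" and inf: "has_inf_char G V \<nu>"
  shows "shifted \<tau> u = (\<nu>\<^sup>2 - \<tau>\<^sup>2 + 3) \<odot>\<^bsub>E\<^esub> u \<oplus>\<^bsub>E\<^esub> 2 \<odot>\<^bsub>E\<^esub> mixed u"
proof -
  obtain v w where vw: "u = (v, w)" "v \<in> carrier V" "w \<in> carrier V" using assms by auto
  have cas: "casimir G V x = (\<nu>\<^sup>2 - 1) \<odot> x" if "x \<in> carrier V" for x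
    using inf that by (simp add: has_inf_char_def)
  have m: "H v \<oplus> 2 \<odot> Y w \<in> carrier V" "2 \<odot> X v \<ominus> H w \<in> carrier V"
    using vw by (simp_all add: sl2_linear)
  have *: "(\<nu>\<^sup>2 - 1) \<odot> x \<oplus> (3 \<odot> x \<oplus> 2 \<odot> y) \<ominus> (\<tau>\<^sup>2 - 1) \<odot> x = (\<nu>\<^sup>2 - \<tau>\<^sup>2 + 3) \<odot> x \<oplus> 2 \<odot> y"
    if "x \<in> carrier V" "y \<in> carrier V" for x y
    by (rule coordinates2[OF that]) (simp add: algebra_simps)
  show ?thesis
    using vw m by (simp add: casimir_tensor cas mixed_def *)
qed

definition primary :: "complex \<Rightarrow> ('v \<times> 'v) set" where
  "primary \<tau> = {u \<in> carrier E. \<exists>n. (shifted \<tau> ^^ n) u = \<zero>\<^bsub>E\<^esub>}"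

lemma primary_component_simps [simp]:
  "carrier (primary_component G \<tau> E) = primary \<tau>"
  "u \<oplus>\<^bsub>primary_component G \<tau> E\<^esub> u' = u \<oplus>\<^bsub>E\<^esub> u'"
  "c \<odot>\<^bsub>primary_component G \<tau> E\<^esub> u = c \<odot>\<^bsub>E\<^esub> u"
  "action (primary_component G \<tau> E) = action E"
  "tvs_topology (primary_component G \<tau> E) = subtopology (tvs_topology E) (primary \<tau>)"
  by (simp_all add: primary_component_def primary_def Let_def)

text \<open>
  The shifted Casimir operator is linear and commutes with \<open>G\<close>, since the mixed part does.
\<close>

lemma primary_closed:
  assumes inf: "has_inf_char G V \<nu>"
  shows "primary \<tau> \<subseteq> carrier E"
    and "\<lbrakk>u \<in> primary \<tau>; u' \<in> primary \<tau>\<rbrakk> \<Longrightarrow> u \<oplus>\<^bsub>E\<^esub> u' \<in> primary \<tau>"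
    and "u \<in> primary \<tau> \<Longrightarrow> c \<odot>\<^bsub>E\<^esub> u \<in> primary \<tau>"
    and "\<lbrakk>g \<in> G; u \<in> primary \<tau>\<rbrakk> \<Longrightarrow> action E g u \<in> primary \<tau>"
proof -
  let ?N = "shifted \<tau>"
  note N = shifted_eq[OF _ inf]
  have cl: "?N u \<in> carrier E" if "u \<in> carrier E" for u
    unfolding N[OF that] using that by (intro T.closed mixed_closed)
  have add: "?N (u \<oplus>\<^bsub>E\<^esub> u') = ?N u \<oplus>\<^bsub>E\<^esub> ?N u'" if "u \<in> carrier E" "u' \<in> carrier E" for u u'
    unfolding N[OF that(1)] N[OF that(2)] N[OF T.closed(2)[OF that]] mixed_add[OF that]
    by (rule T.coordinates4[OF that mixed_closed[OF that(1)] mixed_closed[OF that(2)]])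
       (simp only: mult_1_right mult_zero_right add_0_left add_0_right distrib_left)
  have smult: "?N (c \<odot>\<^bsub>E\<^esub> u) = c \<odot>\<^bsub>E\<^esub> ?N u" if "u \<in> carrier E" for u c
    unfolding N[OF that] N[OF T.closed(4)[OF that]] mixed_smult[OF that]
    by (rule T.coordinates2[OF that mixed_closed[OF that]]) (simp only: mult_ac distrib_left)
  have act: "?N (action E g u) = action E g (?N u)" if "g \<in> G" "u \<in> carrier E" for g u
    unfolding N[OF that(2)] N[OF act_tensor_closed[OF that]] mixed_act[OF that, symmetric]
    using that by (simp only: act_tensor_add act_tensor_smult mixed_closed T.closed)
  have cln: "(?N ^^ n) u \<in> carrier E" if "u \<in> carrier E" for u n
    by (induction n) (use that cl in auto)
  have addn: "(?N ^^ n) (u \<oplus>\<^bsub>E\<^esub> u') = (?N ^^ n) u \<oplus>\<^bsub>E\<^esub> (?N ^^ n) u'" if "u \<in> carrier E" "u' \<in> carrier E" for u u' n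
  proof (induction n)
    case (Suc n) then show ?case using add[OF cln[OF that(1)] cln[OF that(2)]] by (simp only: funpow.simps o_apply)
  qed simp
  have smultn: "(?N ^^ n) (c \<odot>\<^bsub>E\<^esub> u) = c \<odot>\<^bsub>E\<^esub> (?N ^^ n) u" if "u \<in> carrier E" for u c n
  proof (induction n)
    case (Suc n) then show ?case using smult[OF cln[OF that]] by (simp only: funpow.simps o_apply)
  qed simp
  have actn: "(?N ^^ n) (action E g u) = action E g ((?N ^^ n) u)" if "g \<in> G" "u \<in> carrier E" for g u n
  proof (induction n)
    case (Suc n) then show ?case using act[OF that(1) cln[OF that(2)]] by (simp only: funpow.simps o_apply)
  qed simp
  have zero: "(?N ^^ n) \<zero>\<^bsub>E\<^esub> = \<zero>\<^bsub>E\<^esub>" for n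
    using smultn[of "\<zero>\<^bsub>E\<^esub>" n 0] T.smult_0(1)[OF cln[OF T.closed(1)]] T.smult_0(2) T.closed(1) by metis
  show sub: "primary \<tau> \<subseteq> carrier E" unfolding primary_def by blast
  show "u \<oplus>\<^bsub>E\<^esub> u' \<in> primary \<tau>" if u: "u \<in> primary \<tau>" and u': "u' \<in> primary \<tau>"
  proof -
    note c = subsetD[OF sub u] subsetD[OF sub u']
    obtain n m where n: "(?N ^^ n) u = \<zero>\<^bsub>E\<^esub>" and m: "(?N ^^ m) u' = \<zero>\<^bsub>E\<^esub>"
      using u u' unfolding primary_def by blast
    have "(?N ^^ (m + n)) u = \<zero>\<^bsub>E\<^esub>" unfolding funpow_add o_apply n by (rule zero)
    moreover have "(?N ^^ (m + n)) u' = \<zero>\<^bsub>E\<^esub>" unfolding add.commute[of m n] unfolding funpow_add o_apply m by (rule zero)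
    ultimately have "(?N ^^ (m + n)) (u \<oplus>\<^bsub>E\<^esub> u') = \<zero>\<^bsub>E\<^esub>"
      unfolding addn[OF c] using T.M.l_zero[OF T.closed(1)] by (simp only:)
    then show ?thesis unfolding primary_def using T.closed(2)[OF c] by blast
  qed
  show "c \<odot>\<^bsub>E\<^esub> u \<in> primary \<tau>" if u: "u \<in> primary \<tau>" for c
  proof -
    note c = subsetD[OF sub u]
    obtain n where n: "(?N ^^ n) u = \<zero>\<^bsub>E\<^esub>" using u unfolding primary_def by blast
    have "(?N ^^ n) (c \<odot>\<^bsub>E\<^esub> u) = \<zero>\<^bsub>E\<^esub>" unfolding smultn[OF c] n by (rule T.smult_0(2))
    then show ?thesis unfolding primary_def using T.closed(4)[OF c] by blast
  qed
  show "action E g u \<in> primary \<tau>" if g: "g \<in> G" and u: "u \<in> primary \<tau>"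
  proof -
    note c = subsetD[OF sub u]
    obtain n where n: "(?N ^^ n) u = \<zero>\<^bsub>E\<^esub>" using u unfolding primary_def by blast
    have "action E g \<zero>\<^bsub>E\<^esub> = \<zero>\<^bsub>E\<^esub>" using g by simp
    then have "(?N ^^ n) (action E g u) = \<zero>\<^bsub>E\<^esub>" unfolding actn[OF g c] n .
    then show ?thesis unfolding primary_def using act_tensor_closed[OF g c] by blast
  qed
qed

text \<open>
  The operator \<open>mixed - (\<delta> \<nu> - 1)\<close>, which is half the shifted Casimir operator for \<open>\<nu> + \<delta>\<close>, is
  zero on the image of \<open>\<delta> \<nu> + 1 + mixed\<close>, because \<open>(mixed + 1)\<^sup>2 = \<nu>\<^sup>2\<close>.
\<close>

lemma projection_primary:
  assumes inf: "has_inf_char G V \<nu>" and \<delta>: "\<delta> * \<delta> = 1" and u: "u \<in> carrier E"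
  shows "(\<delta> * \<nu> + 1) \<odot>\<^bsub>E\<^esub> u \<oplus>\<^bsub>E\<^esub> mixed u \<in> primary (\<nu> + \<delta>)" (is "?p \<in> _")
proof -
  have p: "?p \<in> carrier E" using u by (intro T.closed mixed_closed)
  have k: "\<nu>\<^sup>2 - (\<nu> + \<delta>)\<^sup>2 + 3 = 2 - 2 * (\<delta> * \<nu>)"
    using \<delta> by (simp add: power2_eq_square algebra_simps)
  have l: "\<nu>\<^sup>2 - 1 = (\<delta> * \<nu>) * (\<delta> * \<nu>) - 1"
    using \<delta> by (simp add: power2_eq_square algebra_simps)
  have "shifted (\<nu> + \<delta>) ?p = (2 - 2 * (\<delta> * \<nu>)) \<odot>\<^bsub>E\<^esub> ?p \<oplus>\<^bsub>E\<^esub>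
      2 \<odot>\<^bsub>E\<^esub> ((\<delta> * \<nu> + 1) \<odot>\<^bsub>E\<^esub> mixed u \<oplus>\<^bsub>E\<^esub> (((\<delta> * \<nu>) * (\<delta> * \<nu>) - 1) \<odot>\<^bsub>E\<^esub> u \<oplus>\<^bsub>E\<^esub> (- 2) \<odot>\<^bsub>E\<^esub> mixed u))"
    unfolding shifted_eq[OF p inf] k l[symmetric]
    using u by (simp only: mixed_add mixed_smult mixed_mixed[OF _ inf] mixed_closed T.closed)
  also have "\<dots> = \<zero>\<^bsub>E\<^esub>"
  proof (rule T.coordinates2[OF u mixed_closed[OF u]])
    fix L :: "complex list \<Rightarrow> 'v \<times> 'v"
    assume *: "\<And>a b a' b'. L [a, b] \<oplus>\<^bsub>E\<^esub> L [a', b'] = L [a + a', b + b']"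
      "\<And>c a b. c \<odot>\<^bsub>E\<^esub> L [a, b] = L [c * a, c * b]" "\<zero>\<^bsub>E\<^esub> = L [0, 0]" "u = L [1, 0]" "mixed u = L [0, 1]"
    show "(2 - 2 * (\<delta> * \<nu>)) \<odot>\<^bsub>E\<^esub> ?p \<oplus>\<^bsub>E\<^esub>
      2 \<odot>\<^bsub>E\<^esub> ((\<delta> * \<nu> + 1) \<odot>\<^bsub>E\<^esub> mixed u \<oplus>\<^bsub>E\<^esub> (((\<delta> * \<nu>) * (\<delta> * \<nu>) - 1) \<odot>\<^bsub>E\<^esub> u \<oplus>\<^bsub>E\<^esub> (- 2) \<odot>\<^bsub>E\<^esub> mixed u)) = \<zero>\<^bsub>E\<^esub>"
      unfolding *(5) unfolding *(4) unfolding *(3) *(1,2)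
      by (rule arg_cong[where f = L]) (simp add: algebra_simps)
  qed
  finally have "(shifted (\<nu> + \<delta>) ^^ 1) ?p = \<zero>\<^bsub>E\<^esub>" by (simp only: funpow.simps One_nat_def o_apply id_apply)
  then show ?thesis unfolding primary_def using p by blast
qed

end

section \<open>Comparing dimensions\<close>

lemma linear_mapD:
  assumes "linear_map V W T"
  shows "x \<in> carrier V \<Longrightarrow> T x \<in> carrier W"
    "\<lbrakk>x \<in> carrier V; y \<in> carrier V\<rbrakk> \<Longrightarrow> T (x \<oplus>\<^bsub>V\<^esub> y) = T x \<oplus>\<^bsub>W\<^esub> T y"
    "x \<in> carrier V \<Longrightarrow> T (c \<odot>\<^bsub>V\<^esub> x) = c \<odot>\<^bsub>W\<^esub> T x"
  using assms unfolding linear_map_def by blast+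

lemma linear_mapI:
  assumes "\<And>x. x \<in> carrier V \<Longrightarrow> T x \<in> carrier W"
    "\<And>x y. \<lbrakk>x \<in> carrier V; y \<in> carrier V\<rbrakk> \<Longrightarrow> T (x \<oplus>\<^bsub>V\<^esub> y) = T x \<oplus>\<^bsub>W\<^esub> T y"
    "\<And>x c. x \<in> carrier V \<Longrightarrow> T (c \<odot>\<^bsub>V\<^esub> x) = c \<odot>\<^bsub>W\<^esub> T x"
  shows "linear_map V W T"
  using assms unfolding linear_map_def by blast

lemma vdim_le_injective:
  fixes V :: "(complex, 'v, 'm) module_scheme" and W :: "(complex, 'w, 'n) module_scheme"
  assumes "complex_space V" "complex_space W" and T: "linear_map V W T" and inj: "inj_on T (carrier V)"
  shows "vdim V \<le> vdim W"
  unfolding vdim_def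
proof (rule SUP_mono)
  interpret V: complex_space V by fact
  interpret W: complex_space W by fact
  note T' = linear_mapD[OF T]
  have T0: "T \<zero>\<^bsub>V\<^esub> = \<zero>\<^bsub>W\<^esub>" using T'(3)[of "\<zero>\<^bsub>V\<^esub>" 0] T'(1) by simp
  fix B assume "B \<in> Collect (lin_indep V)"
  then have B: "finite B" "B \<subseteq> carrier V"
    and ind: "\<And>a. (\<Oplus>\<^bsub>V\<^esub>b\<in>B. a b \<odot>\<^bsub>V\<^esub> b) = \<zero>\<^bsub>V\<^esub> \<Longrightarrow> \<forall>b\<in>B. a b = 0"
    unfolding lin_indep_def by simp_all
  have injB: "inj_on T B" using inj B(2) by (rule inj_on_subset)
  have sum: "T (\<Oplus>\<^bsub>V\<^esub>b\<in>C. a b \<odot>\<^bsub>V\<^esub> b) = (\<Oplus>\<^bsub>W\<^esub>b\<in>C. a b \<odot>\<^bsub>W\<^esub> T b)" if "C \<subseteq> carrier V" "finite C" for a C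
    using that(2,1)
  proof (induction rule: finite_induct)
    case empty then show ?case using T0 by simp
  next
    case (insert x F)
    then have m: "(\<lambda>b. a b \<odot>\<^bsub>V\<^esub> b) \<in> F \<rightarrow> carrier V" "(\<lambda>b. a b \<odot>\<^bsub>W\<^esub> T b) \<in> F \<rightarrow> carrier W"
      using T'(1) by auto
    have "x \<in> carrier V" using insert.prems by simp
    then show ?case
      using insert m T' by (simp add: V.M.finsum_insert W.M.finsum_insert V.M.finsum_closed)
  qed
  have "lin_indep W (T ` B)"
    unfolding lin_indep_def
  proof (intro conjI allI impI)
    show "finite (T ` B)" "T ` B \<subseteq> carrier W" using B T'(1) by auto
    fix a assume z: "(\<Oplus>\<^bsub>W\<^esub>b\<in>T ` B. a b \<odot>\<^bsub>W\<^esub> b) = \<zero>\<^bsub>W\<^esub>"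
    have "(\<Oplus>\<^bsub>W\<^esub>b\<in>T ` B. a b \<odot>\<^bsub>W\<^esub> b) = (\<Oplus>\<^bsub>W\<^esub>b\<in>B. a (T b) \<odot>\<^bsub>W\<^esub> T b)"
      by (rule W.M.add.finprod_reindex[OF _ injB]) (use B T'(1) in auto)
    also have "\<dots> = T (\<Oplus>\<^bsub>V\<^esub>b\<in>B. a (T b) \<odot>\<^bsub>V\<^esub> b)"
      using sum[OF B(2,1), of "\<lambda>b. a (T b)"] by simp
    finally have "T (\<Oplus>\<^bsub>V\<^esub>b\<in>B. a (T b) \<odot>\<^bsub>V\<^esub> b) = T \<zero>\<^bsub>V\<^esub>" using z T0 by simp
    moreover have "(\<Oplus>\<^bsub>V\<^esub>b\<in>B. a (T b) \<odot>\<^bsub>V\<^esub> b) \<in> carrier V"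
      using B by (intro V.M.finsum_closed) auto
    ultimately have "(\<Oplus>\<^bsub>V\<^esub>b\<in>B. a (T b) \<odot>\<^bsub>V\<^esub> b) = \<zero>\<^bsub>V\<^esub>"
      using inj by (auto dest: inj_onD)
    from ind[OF this] show "\<forall>b\<in>T ` B. a b = 0" by simp
  qed
  then show "\<exists>C\<in>Collect (lin_indep W). enat (card B) \<le> enat (card C)"
    using card_image[OF injB] by (intro bexI[of _ "T ` B"]) simp_all
qed

text \<open>
  The common shape of the spaces of intertwiners and of equivariant bilinear maps: functions on a
  carrier \<open>D\<close> with pointwise operations, undefined outside \<open>D\<close>.
\<close>

definition function_space ::
    "'d set \<Rightarrow> (complex, 'u, 'm) module_scheme \<Rightarrow> ('d \<Rightarrow> 'u) set \<Rightarrow> (complex, 'd \<Rightarrow> 'u) module" where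
  "function_space D U S =
     \<lparr>carrier = S, mult = undefined, one = undefined, zero = (\<lambda>v\<in>D. \<zero>\<^bsub>U\<^esub>),
      add = (\<lambda>S T. \<lambda>v\<in>D. S v \<oplus>\<^bsub>U\<^esub> T v), smult = (\<lambda>c T. \<lambda>v\<in>D. c \<odot>\<^bsub>U\<^esub> T v)\<rparr>"

lemma function_space_simps [simp]:
  "carrier (function_space D U S) = S"
  "f \<oplus>\<^bsub>function_space D U S\<^esub> g = (\<lambda>v\<in>D. f v \<oplus>\<^bsub>U\<^esub> g v)"
  "c \<odot>\<^bsub>function_space D U S\<^esub> f = (\<lambda>v\<in>D. c \<odot>\<^bsub>U\<^esub> f v)"
  "\<zero>\<^bsub>function_space D U S\<^esub> = (\<lambda>v\<in>D. \<zero>\<^bsub>U\<^esub>)"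
  by (simp_all add: function_space_def)

lemma complex_space_function_space:
  assumes "complex_space U"
    and S: "\<And>f. f \<in> S \<Longrightarrow> f \<in> extensional D" "\<And>f v. \<lbrakk>f \<in> S; v \<in> D\<rbrakk> \<Longrightarrow> f v \<in> carrier U"
    and zero: "(\<lambda>v\<in>D. \<zero>\<^bsub>U\<^esub>) \<in> S"
    and add: "\<And>f g. \<lbrakk>f \<in> S; g \<in> S\<rbrakk> \<Longrightarrow> (\<lambda>v\<in>D. f v \<oplus>\<^bsub>U\<^esub> g v) \<in> S"
    and smult: "\<And>f c. f \<in> S \<Longrightarrow> (\<lambda>v\<in>D. c \<odot>\<^bsub>U\<^esub> f v) \<in> S"
  shows "complex_space (function_space D U S)"
proof -
  interpret U: complex_space U by fact
  let ?F = "function_space D U S"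
  note ext = extensionalityI[where A = D, OF restrict_extensional restrict_extensional]
    extensionalityI[where A = D, OF restrict_extensional S(1)]
  have "abelian_group ?F"
  proof (rule abelian_groupI)
    show "\<exists>g\<in>carrier ?F. g \<oplus>\<^bsub>?F\<^esub> f = \<zero>\<^bsub>?F\<^esub>" if "f \<in> carrier ?F" for f
    proof (rule bexI)
      show "(\<lambda>v\<in>D. (- 1) \<odot>\<^bsub>U\<^esub> f v) \<oplus>\<^bsub>?F\<^esub> f = \<zero>\<^bsub>?F\<^esub>"
        unfolding function_space_simps
      proof (rule ext(1))
        fix v assume v: "v \<in> D"
        then have "f v \<in> carrier U" using S(2) that by simp
        then have "(- 1) \<odot>\<^bsub>U\<^esub> f v \<oplus>\<^bsub>U\<^esub> f v = \<zero>\<^bsub>U\<^esub>"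
          by (rule U.coordinates1) simp
        then show "(\<lambda>v\<in>D. (\<lambda>v\<in>D. (- 1) \<odot>\<^bsub>U\<^esub> f v) v \<oplus>\<^bsub>U\<^esub> f v) v = (\<lambda>v\<in>D. \<zero>\<^bsub>U\<^esub>) v"
          using v by simp
      qed
    qed (use smult that in simp)
  qed (use zero add S in \<open>auto intro!: ext simp: U.M.a_ac\<close>)
  then have "module complex_ring ?F"
    by (rule moduleI[OF cring_complex_ring])
       (use zero add smult S in \<open>auto intro!: ext simp: U.smult_add_left[symmetric] U.smult_add_right\<close>)
  then show ?thesis by (rule complex_space.intro)
qed

lemma hom_space_eq:
  "hom_space G V W = function_space (carrier V) W {T \<in> extensional (carrier V). intertwiner G V W T}"
  by (simp add: hom_space_def function_space_def)

section \<open>Equivariant bilinear maps\<close>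

definition equivariant_bilinear_map ::
    "mat2 set \<Rightarrow> (mat2, 'v) rep \<Rightarrow> (mat2, 'w) rep \<Rightarrow> (mat2, 'u) rep \<Rightarrow> ('v \<times> 'w \<Rightarrow> 'u) \<Rightarrow> bool" where
  "equivariant_bilinear_map G V W U b \<longleftrightarrow> bilinear_map V W U b \<and>
     continuous_map (prod_topology (tvs_topology V) (tvs_topology W)) (tvs_topology U) b \<and>
     (\<forall>g\<in>G. \<forall>v\<in>carrier V. \<forall>w\<in>carrier W. b (action V g v, action W g w) = action U g (b (v, w)))"

definition bilinear_space where
  "bilinear_space G V W U = function_space (carrier V \<times> carrier W) U
     {b \<in> extensional (carrier V \<times> carrier W). equivariant_bilinear_map G V W U b}"

text \<open>The contraction with the symplectic form of the natural representation.\<close>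

definition contraction :: "('u, 'm) ring_scheme \<Rightarrow> ('v \<times> 'w \<Rightarrow> 'u) \<Rightarrow> ('v \<times> 'v) \<times> ('w \<times> 'w) \<Rightarrow> 'u" where
  "contraction U b = (\<lambda>((v1, v2), (w1, w2)). b (v1, w2) \<ominus>\<^bsub>U\<^esub> b (v2, w1))"

locale equivariant_bilinear =
  V: smooth_representation G V + W: smooth_representation G W + U: smooth_representation G U +
  continuous_bilinear V W U b
  for G and V :: "(mat2, 'v) rep" and W :: "(mat2, 'w) rep" and U :: "(mat2, 'u) rep" and b +
  assumes equivariant: "\<lbrakk>g \<in> G; v \<in> carrier V; w \<in> carrier W\<rbrakk> \<Longrightarrow>
    b (action V g v, action W g w) = action U g (b (v, w))"
begin

lemma lie_act_bilinear:
  assumes X: "X \<in> lie_alg G" and v: "v \<in> carrier V" and w: "w \<in> carrier W"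
  shows "lie_act U X (b (v, w)) = b (lie_act V X v, w) \<oplus>\<^bsub>U\<^esub> b (v, lie_act W X w)"
proof (rule U.lie_act_eq)
  define g where "g t = mexp (t *\<^sub>R X)" for t
  have g [simp]: "g t \<in> G" for t using X by (simp add: g_def)
  have g0: "(g \<longlongrightarrow> mat 1) (at 0)" unfolding g_def[abs_def] by (rule V.mexp_tendsto)
  have cont: "limitin (tvs_topology W) (\<lambda>t. action W (g t) w) w (at 0)"
    using W.limit_act[OF g0, of "\<lambda>_. w" w] w by simp
  have dV: "limitin (tvs_topology V) (\<lambda>t. complex_of_real (1 / t) \<odot>\<^bsub>V\<^esub> (action V (g t) v \<ominus>\<^bsub>V\<^esub> v)) (lie_act V X v) (at 0)"
    using V.derivative_lie_act[OF X v] by (simp only: V.derivative_def g_def)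
  have dW: "limitin (tvs_topology W) (\<lambda>t. complex_of_real (1 / t) \<odot>\<^bsub>W\<^esub> (action W (g t) w \<ominus>\<^bsub>W\<^esub> w)) (lie_act W X w) (at 0)"
    using W.derivative_lie_act[OF X w] by (simp only: W.derivative_def g_def)
  have "limitin (tvs_topology U)
      (\<lambda>t. b (complex_of_real (1 / t) \<odot>\<^bsub>V\<^esub> (action V (g t) v \<ominus>\<^bsub>V\<^esub> v), action W (g t) w) \<oplus>\<^bsub>U\<^esub>
        b (v, complex_of_real (1 / t) \<odot>\<^bsub>W\<^esub> (action W (g t) w \<ominus>\<^bsub>W\<^esub> w)))
      (b (lie_act V X v, w) \<oplus>\<^bsub>U\<^esub> b (v, lie_act W X w)) (at 0)"
    by (intro U.limit_add limit_bilinear dV dW cont) (use v in simp)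
  moreover have "b (complex_of_real (1 / t) \<odot>\<^bsub>V\<^esub> (action V (g t) v \<ominus>\<^bsub>V\<^esub> v), action W (g t) w) \<oplus>\<^bsub>U\<^esub>
        b (v, complex_of_real (1 / t) \<odot>\<^bsub>W\<^esub> (action W (g t) w \<ominus>\<^bsub>W\<^esub> w)) =
      complex_of_real (1 / t) \<odot>\<^bsub>U\<^esub> (action U (g t) (b (v, w)) \<ominus>\<^bsub>U\<^esub> b (v, w))" for t
    unfolding equivariant[OF g v w, symmetric] using v w
    by (rule_tac U.coordinates3[of "b (action V (g t) v, action W (g t) w)" "b (v, action W (g t) w)" "b (v, w)"]) simp_all
  ultimately show "U.derivative X (b (v, w)) (b (lie_act V X v, w) \<oplus>\<^bsub>U\<^esub> b (v, lie_act W X w))"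
    by (simp only: U.derivative_def g_def)
qed

lemma lieC_bilinear:
  assumes "trace Z = 0" and v: "v \<in> carrier V" and w: "w \<in> carrier W"
  shows "lie_act_C G U Z (b (v, w)) = b (lie_act_C G V Z v, w) \<oplus>\<^bsub>U\<^esub> b (v, lie_act_C G W Z w)"
proof -
  obtain A B where AB [simp]: "A \<in> lie_alg G" "B \<in> lie_alg G" and Z: "Z = A + cscale \<i> B"
    using V.complexified_exists[OF assms(1)] .
  show ?thesis
    unfolding Z V.lie_act_C_eq[OF AB] lie_act_bilinear[OF AB(1) v w] lie_act_bilinear[OF AB(2) v w]
    using v w
    by (rule_tac U.coordinates4[of "b (lie_act V A v, w)" "b (lie_act V B v, w)" "b (v, lie_act W A w)" "b (v, lie_act W B w)"])
       simp_all
qed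

text \<open>
  By the Leibniz rule the Casimir operator of \<open>U\<close> applied to \<open>b (v, w)\<close> consists of the Casimir
  operators of \<open>V\<close> and \<open>W\<close> applied to the arguments and of this mixed term.
\<close>

lemma mixed_casimir:
  assumes V: "has_inf_char G V \<nu>'" and W: "has_inf_char G W \<nu>''" and U: "has_inf_char G U \<mu>"
    and v: "v \<in> carrier V" and w: "w \<in> carrier W"
  shows "2 \<odot>\<^bsub>U\<^esub> (b (V.H v, W.H w) \<oplus>\<^bsub>U\<^esub> 2 \<odot>\<^bsub>U\<^esub> (b (V.X v, W.Y w) \<oplus>\<^bsub>U\<^esub> b (V.Y v, W.X w))) =
    (\<mu>\<^sup>2 - \<nu>'\<^sup>2 - \<nu>''\<^sup>2 + 1) \<odot>\<^bsub>U\<^esub> b (v, w)" (is "?c = _")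
proof -
  note [simp] = V.sl2_linear W.sl2_linear
  have 1: "casimir G U (b (v, w)) =
      b (casimir G V v, w) \<oplus>\<^bsub>U\<^esub> b (v, casimir G W w) \<oplus>\<^bsub>U\<^esub> ?c"
    unfolding U.casimir_eq V.casimir_eq W.casimir_eq
    using v w
    apply (simp only: lieC_bilinear V.trace_basis U.sl2_linear V.sl2_linear W.sl2_linear bilin V.closed W.closed U.closed)
    apply (rule U.coordinates9[of "b (V.H (V.H v), w)" "b (V.X (V.Y v), w)" "b (V.Y (V.X v), w)"
        "b (v, W.H (W.H w))" "b (v, W.X (W.Y w))" "b (v, W.Y (W.X w))"
        "b (V.H v, W.H w)" "b (V.X v, W.Y w)" "b (V.Y v, W.X w)"])
    by (simp_all only: bilin V.sl2_linear W.sl2_linear) simp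
  have "casimir G U (b (v, w)) = (\<mu>\<^sup>2 - 1) \<odot>\<^bsub>U\<^esub> b (v, w)" "casimir G V v = (\<nu>'\<^sup>2 - 1) \<odot>\<^bsub>V\<^esub> v"
    "casimir G W w = (\<nu>''\<^sup>2 - 1) \<odot>\<^bsub>W\<^esub> w"
    using assms by (simp_all add: has_inf_char_def)
  with 1 have 2: "(\<mu>\<^sup>2 - 1) \<odot>\<^bsub>U\<^esub> b (v, w) = (\<nu>'\<^sup>2 - 1) \<odot>\<^bsub>U\<^esub> b (v, w) \<oplus>\<^bsub>U\<^esub> (\<nu>''\<^sup>2 - 1) \<odot>\<^bsub>U\<^esub> b (v, w) \<oplus>\<^bsub>U\<^esub> ?c"
    using v w by simp
  have c: "?c \<in> carrier U" using v w by simp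
  have "?c = (\<mu>\<^sup>2 - 1) \<odot>\<^bsub>U\<^esub> b (v, w) \<ominus>\<^bsub>U\<^esub> ((\<nu>'\<^sup>2 - 1) \<odot>\<^bsub>U\<^esub> b (v, w) \<oplus>\<^bsub>U\<^esub> (\<nu>''\<^sup>2 - 1) \<odot>\<^bsub>U\<^esub> b (v, w))"
    unfolding 2 by (rule U.coordinates2[of ?c "b (v, w)"]) (use c v w in auto)
  also have "\<dots> = (\<mu>\<^sup>2 - \<nu>'\<^sup>2 - \<nu>''\<^sup>2 + 1) \<odot>\<^bsub>U\<^esub> b (v, w)"
    by (rule U.coordinates1[of "b (v, w)"]) (use v w in \<open>auto simp: algebra_simps\<close>)
  finally show ?thesis .
qed

abbreviation contracted where "contracted \<equiv> contraction U b"

text \<open>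
  Contracting the projections of \<open>v \<otimes> e\<close> and \<open>w \<otimes> f\<close> over dual bases \<open>e\<close> and \<open>f\<close> leaves a scalar
  multiple of \<open>b (v, w)\<close>: the terms linear in the Lie algebra have trace zero, and the quadratic
  ones form the mixed term.  Two contractions suffice, one for each of the pairs
  \<open>(e\<^sub>1, e\<^sub>2)\<close> and \<open>(e\<^sub>2, e\<^sub>1)\<close>; both vanish if the contraction is zero on the primary components.
\<close>

lemma contracted_projections:
  assumes V: "has_inf_char G V \<nu>'" and W: "has_inf_char G W \<nu>''" and U: "has_inf_char G U \<mu>"
    and \<delta>: "\<delta>' * \<delta>' = 1" "\<delta>'' * \<delta>'' = 1"
    and v: "v \<in> carrier V" and w: "w \<in> carrier W"
    and zero: "\<And>x y. \<lbrakk>x \<in> V.primary (\<nu>' + \<delta>'); y \<in> W.primary (\<nu>'' + \<delta>'')\<rbrakk> \<Longrightarrow> contracted (x, y) = \<zero>\<^bsub>U\<^esub>"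
  shows "((\<delta>' * \<nu>' + \<delta>'' * \<nu>'' + 1)\<^sup>2 - \<mu>\<^sup>2) \<odot>\<^bsub>U\<^esub> b (v, w) = \<zero>\<^bsub>U\<^esub>"
proof -
  note [simp] = V.sl2_linear W.sl2_linear
  define c where "c = \<delta>' * \<nu>' + 1"
  define d where "d = \<delta>'' * \<nu>'' + 1"
  have H0: "V.H \<zero>\<^bsub>V\<^esub> = \<zero>\<^bsub>V\<^esub>" "V.X \<zero>\<^bsub>V\<^esub> = \<zero>\<^bsub>V\<^esub>" "V.Y \<zero>\<^bsub>V\<^esub> = \<zero>\<^bsub>V\<^esub>"
    using V.sl2_linear(4-6)[of "\<zero>\<^bsub>V\<^esub>" 0] V.sl2_linear(1-3)[of "\<zero>\<^bsub>V\<^esub>"] by simp_all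
  have H0': "W.H \<zero>\<^bsub>W\<^esub> = \<zero>\<^bsub>W\<^esub>" "W.X \<zero>\<^bsub>W\<^esub> = \<zero>\<^bsub>W\<^esub>" "W.Y \<zero>\<^bsub>W\<^esub> = \<zero>\<^bsub>W\<^esub>"
    using W.sl2_linear(4-6)[of "\<zero>\<^bsub>W\<^esub>" 0] W.sl2_linear(1-3)[of "\<zero>\<^bsub>W\<^esub>"] by simp_all
  have "c \<odot>\<^bsub>V.E\<^esub> (v, \<zero>\<^bsub>V\<^esub>) \<oplus>\<^bsub>V.E\<^esub> V.mixed (v, \<zero>\<^bsub>V\<^esub>) \<in> V.primary (\<nu>' + \<delta>')"
    unfolding c_def by (rule V.projection_primary[OF V \<delta>(1)]) (use v in simp)
  then have x1: "(c \<odot>\<^bsub>V\<^esub> v \<oplus>\<^bsub>V\<^esub> V.H v, 2 \<odot>\<^bsub>V\<^esub> V.X v) \<in> V.primary (\<nu>' + \<delta>')"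
    using v by (simp add: V.mixed_def H0)
  have "c \<odot>\<^bsub>V.E\<^esub> (\<zero>\<^bsub>V\<^esub>, v) \<oplus>\<^bsub>V.E\<^esub> V.mixed (\<zero>\<^bsub>V\<^esub>, v) \<in> V.primary (\<nu>' + \<delta>')"
    unfolding c_def by (rule V.projection_primary[OF V \<delta>(1)]) (use v in simp)
  then have x2: "(2 \<odot>\<^bsub>V\<^esub> V.Y v, c \<odot>\<^bsub>V\<^esub> v \<oplus>\<^bsub>V\<^esub> (- 1) \<odot>\<^bsub>V\<^esub> V.H v) \<in> V.primary (\<nu>' + \<delta>')"
    using v by (simp add: V.mixed_def H0 V.minus_eq)
  have "d \<odot>\<^bsub>W.E\<^esub> (w, \<zero>\<^bsub>W\<^esub>) \<oplus>\<^bsub>W.E\<^esub> W.mixed (w, \<zero>\<^bsub>W\<^esub>) \<in> W.primary (\<nu>'' + \<delta>'')"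
    unfolding d_def by (rule W.projection_primary[OF W \<delta>(2)]) (use w in simp)
  then have y1: "(d \<odot>\<^bsub>W\<^esub> w \<oplus>\<^bsub>W\<^esub> W.H w, 2 \<odot>\<^bsub>W\<^esub> W.X w) \<in> W.primary (\<nu>'' + \<delta>'')"
    using w by (simp add: W.mixed_def H0')
  have "d \<odot>\<^bsub>W.E\<^esub> (\<zero>\<^bsub>W\<^esub>, w) \<oplus>\<^bsub>W.E\<^esub> W.mixed (\<zero>\<^bsub>W\<^esub>, w) \<in> W.primary (\<nu>'' + \<delta>'')"
    unfolding d_def by (rule W.projection_primary[OF W \<delta>(2)]) (use w in simp)
  then have y2: "(2 \<odot>\<^bsub>W\<^esub> W.Y w, d \<odot>\<^bsub>W\<^esub> w \<oplus>\<^bsub>W\<^esub> (- 1) \<odot>\<^bsub>W\<^esub> W.H w) \<in> W.primary (\<nu>'' + \<delta>'')"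
    using w by (simp add: W.mixed_def H0' W.minus_eq)
  let ?c = "2 \<odot>\<^bsub>U\<^esub> (b (V.H v, W.H w) \<oplus>\<^bsub>U\<^esub> 2 \<odot>\<^bsub>U\<^esub> (b (V.X v, W.Y w) \<oplus>\<^bsub>U\<^esub> b (V.Y v, W.X w)))"
  have "contracted ((c \<odot>\<^bsub>V\<^esub> v \<oplus>\<^bsub>V\<^esub> V.H v, 2 \<odot>\<^bsub>V\<^esub> V.X v), (2 \<odot>\<^bsub>W\<^esub> W.Y w, d \<odot>\<^bsub>W\<^esub> w \<oplus>\<^bsub>W\<^esub> (- 1) \<odot>\<^bsub>W\<^esub> W.H w)) \<ominus>\<^bsub>U\<^esub>
      contracted ((2 \<odot>\<^bsub>V\<^esub> V.Y v, c \<odot>\<^bsub>V\<^esub> v \<oplus>\<^bsub>V\<^esub> (- 1) \<odot>\<^bsub>V\<^esub> V.H v), (d \<odot>\<^bsub>W\<^esub> w \<oplus>\<^bsub>W\<^esub> W.H w, 2 \<odot>\<^bsub>W\<^esub> W.X w)) =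
      (2 * (c * d)) \<odot>\<^bsub>U\<^esub> b (v, w) \<ominus>\<^bsub>U\<^esub> ?c"
    unfolding contraction_def prod.case
    using v w
    apply (simp only: bilin V.sl2_linear W.sl2_linear V.closed W.closed)
    apply (rule U.coordinates6[of "b (v, w)" "b (V.H v, w)" "b (v, W.H w)" "b (V.H v, W.H w)" "b (V.X v, W.Y w)" "b (V.Y v, W.X w)"])
    by (simp_all only: bilin V.sl2_linear W.sl2_linear) simp
  then have "\<zero>\<^bsub>U\<^esub> = (2 * (c * d)) \<odot>\<^bsub>U\<^esub> b (v, w) \<ominus>\<^bsub>U\<^esub> ?c"
    unfolding zero[OF x1 y2] zero[OF x2 y1] by simp
  also have "\<dots> = (2 * (c * d)) \<odot>\<^bsub>U\<^esub> b (v, w) \<ominus>\<^bsub>U\<^esub> (\<mu>\<^sup>2 - \<nu>'\<^sup>2 - \<nu>''\<^sup>2 + 1) \<odot>\<^bsub>U\<^esub> b (v, w)"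
    unfolding mixed_casimir[OF V W U v w] ..
  also have "\<dots> = (2 * (c * d) - (\<mu>\<^sup>2 - \<nu>'\<^sup>2 - \<nu>''\<^sup>2 + 1)) \<odot>\<^bsub>U\<^esub> b (v, w)"
    by (rule U.coordinates1[of "b (v, w)"]) (use v w in auto)
  also have "2 * (c * d) - (\<mu>\<^sup>2 - \<nu>'\<^sup>2 - \<nu>''\<^sup>2 + 1) = (\<delta>' * \<nu>' + \<delta>'' * \<nu>'' + 1)\<^sup>2 - \<mu>\<^sup>2"
  proof -
    have "\<nu>'\<^sup>2 = (\<delta>' * \<nu>') * (\<delta>' * \<nu>')" "\<nu>''\<^sup>2 = (\<delta>'' * \<nu>'') * (\<delta>'' * \<nu>'')"
      using \<delta> by (simp_all add: power2_eq_square algebra_simps)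
    then show ?thesis
      unfolding c_def d_def by (simp only: power2_eq_square) (simp add: algebra_simps)
  qed
  finally show ?thesis by simp
qed

end

section \<open>Translation of equivariant bilinear maps\<close>

lemma (in real_form) cat_M_representation:
  assumes "V \<in> cat_M G"
  shows "smooth_representation G V" "complete_lcs V"
proof -
  have "frechet_rep G V" "smooth_rep G V" using assms by (simp_all add: cat_M_def)
  then show "complete_lcs V" by (intro frechet_space_lcs) (simp add: frechet_rep_def)
  then have "lcs V" by (rule complete_lcs.axioms)
  then show "smooth_representation G V"
    using \<open>frechet_rep G V\<close> \<open>smooth_rep G V\<close> real_form_axioms
    by (intro smooth_representation.intro smooth_representation_axioms.intro)
qed

context lcs
begin

lemma continuous_map_add:
  "\<lbrakk>continuous_map T (tvs_topology V) f; continuous_map T (tvs_topology V) g\<rbrakk> \<Longrightarrow>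
    continuous_map T (tvs_topology V) (\<lambda>x. f x \<oplus> g x)"
  unfolding continuous_map_atin using limit_add by blast

lemma continuous_map_smult:
  "continuous_map T (tvs_topology V) f \<Longrightarrow> continuous_map T (tvs_topology V) (\<lambda>x. c \<odot> f x)"
  unfolding continuous_map_atin using limit_smult[OF _ tendsto_const] by blast

lemma continuous_map_minus:
  "\<lbrakk>continuous_map T (tvs_topology V) f; continuous_map T (tvs_topology V) g\<rbrakk> \<Longrightarrow>
    continuous_map T (tvs_topology V) (\<lambda>x. f x \<ominus> g x)"
  unfolding continuous_map_atin using limit_minus by blast

end

lemma complex_space_hom_space:
  assumes "complex_space V" "topspace (tvs_topology V) = carrier V"
    and act: "\<And>g v. \<lbrakk>g \<in> G; v \<in> carrier V\<rbrakk> \<Longrightarrow> action V g v \<in> carrier V"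
    and "smooth_representation G W"
  shows "complex_space (hom_space G V W)"
proof -
  interpret V: complex_space V by fact
  interpret W: smooth_representation G W by fact
  note cong = continuous_map_eq[where X = "tvs_topology V" and X' = "tvs_topology W"]
  show ?thesis
    unfolding hom_space_eq
  proof (rule complex_space_function_space)
    show "complex_space W" ..
    show "f v \<in> carrier W" if "f \<in> {T \<in> extensional (carrier V). intertwiner G V W T}" "v \<in> carrier V" for f v
      using that by (auto simp: intertwiner_def linear_map_def)
    have "continuous_map (tvs_topology V) (tvs_topology W) (\<lambda>v\<in>carrier V. \<zero>\<^bsub>W\<^esub>)"
      by (rule cong[of "\<lambda>v. \<zero>\<^bsub>W\<^esub>"]) (use assms(2) in auto)
    then show "(\<lambda>v\<in>carrier V. \<zero>\<^bsub>W\<^esub>) \<in> {T \<in> extensional (carrier V). intertwiner G V W T}"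
      using act by (auto simp: intertwiner_def linear_map_def)
    show "(\<lambda>v\<in>carrier V. f v \<oplus>\<^bsub>W\<^esub> h v) \<in> {T \<in> extensional (carrier V). intertwiner G V W T}"
      if f: "f \<in> {T \<in> extensional (carrier V). intertwiner G V W T}"
        and h: "h \<in> {T \<in> extensional (carrier V). intertwiner G V W T}" for f h
    proof -
      have fh: "linear_map V W f" "linear_map V W h" using f h by (auto simp: intertwiner_def)
      note D = linear_mapD[OF fh(1)] linear_mapD[OF fh(2)]
      have "continuous_map (tvs_topology V) (tvs_topology W) (\<lambda>v\<in>carrier V. f v \<oplus>\<^bsub>W\<^esub> h v)"
        by (rule cong[OF W.continuous_map_add[of _ f h]]) (use f h assms(2) in \<open>auto simp: intertwiner_def\<close>)
      then show ?thesis
        using act f h D by (auto simp: intertwiner_def linear_map_def W.M.a_ac W.smult_add_right W.act_add)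
    qed
    show "(\<lambda>v\<in>carrier V. c \<odot>\<^bsub>W\<^esub> f v) \<in> {T \<in> extensional (carrier V). intertwiner G V W T}"
      if f: "f \<in> {T \<in> extensional (carrier V). intertwiner G V W T}" for f c
    proof -
      have "linear_map V W f" using f by (auto simp: intertwiner_def)
      note D = linear_mapD[OF this]
      have "continuous_map (tvs_topology V) (tvs_topology W) (\<lambda>v\<in>carrier V. c \<odot>\<^bsub>W\<^esub> f v)"
        by (rule cong[OF W.continuous_map_smult[of _ f]]) (use f assms(2) in \<open>auto simp: intertwiner_def\<close>)
      then show ?thesis
        using act f D by (auto simp: intertwiner_def linear_map_def W.smult_add_right W.act_smult mult.commute)
    qed
  qed auto
qed

lemma complex_space_bilinear_space:
  assumes "smooth_representation G V" "smooth_representation G W" "smooth_representation G U"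
  shows "complex_space (bilinear_space G V W U)"
proof -
  interpret V: smooth_representation G V by fact
  interpret W: smooth_representation G W by fact
  interpret U: smooth_representation G U by fact
  let ?D = "carrier V \<times> carrier W"
  let ?S = "{b \<in> extensional ?D. equivariant_bilinear_map G V W U b}"
  let ?T = "prod_topology (tvs_topology V) (tvs_topology W)"
  note cong = continuous_map_eq[where X = ?T and X' = "tvs_topology U"]
  show ?thesis
    unfolding bilinear_space_def
  proof (rule complex_space_function_space)
    show "complex_space U" ..
    show "f v \<in> carrier U" if "f \<in> ?S" "v \<in> ?D" for f v
      using that bilinear_mapD(1)[of V W U f] by (auto simp: equivariant_bilinear_map_def)
    have "continuous_map ?T (tvs_topology U) (\<lambda>v\<in>?D. \<zero>\<^bsub>U\<^esub>)"
      by (rule cong[of "\<lambda>v. \<zero>\<^bsub>U\<^esub>"]) auto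
    then show "(\<lambda>v\<in>?D. \<zero>\<^bsub>U\<^esub>) \<in> ?S"
      by (auto simp: equivariant_bilinear_map_def intro!: bilinear_mapI)
    show "(\<lambda>v\<in>?D. f v \<oplus>\<^bsub>U\<^esub> h v) \<in> ?S" if f: "f \<in> ?S" and h: "h \<in> ?S" for f h
    proof -
      have fh: "bilinear_map V W U f" "bilinear_map V W U h" using f h by (auto simp: equivariant_bilinear_map_def)
      note D = bilinear_mapD[OF fh(1)] bilinear_mapD[OF fh(2)]
      have "continuous_map ?T (tvs_topology U) (\<lambda>v\<in>?D. f v \<oplus>\<^bsub>U\<^esub> h v)"
        by (rule cong[OF U.continuous_map_add[of _ f h]]) (use f h in \<open>auto simp: equivariant_bilinear_map_def\<close>)
      moreover have "bilinear_map V W U (\<lambda>v\<in>?D. f v \<oplus>\<^bsub>U\<^esub> h v)"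
        using D by (auto intro!: bilinear_mapI simp: U.M.a_ac U.smult_add_right)
      ultimately show ?thesis
        using f h D by (auto simp: equivariant_bilinear_map_def U.act_add)
    qed
    show "(\<lambda>v\<in>?D. c \<odot>\<^bsub>U\<^esub> f v) \<in> ?S" if f: "f \<in> ?S" for f c
    proof -
      have "bilinear_map V W U f" using f by (auto simp: equivariant_bilinear_map_def)
      note D = bilinear_mapD[OF this]
      have "continuous_map ?T (tvs_topology U) (\<lambda>v\<in>?D. c \<odot>\<^bsub>U\<^esub> f v)"
        by (rule cong[OF U.continuous_map_smult[of _ f]]) (use f in \<open>auto simp: equivariant_bilinear_map_def\<close>)
      moreover have "bilinear_map V W U (\<lambda>v\<in>?D. c \<odot>\<^bsub>U\<^esub> f v)"
        using D by (auto intro!: bilinear_mapI simp: U.smult_add_right mult.commute)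
      ultimately show ?thesis
        using f D by (auto simp: equivariant_bilinear_map_def U.act_smult)
    qed
  qed auto
qed

lemma equivariant_bilinearI:
  assumes "smooth_representation G V" "smooth_representation G W" "smooth_representation G U"
    and "equivariant_bilinear_map G V W U b"
  shows "equivariant_bilinear G V W U b"
proof -
  interpret V: smooth_representation G V by fact
  interpret W: smooth_representation G W by fact
  interpret U: smooth_representation G U by fact
  show ?thesis
    by unfold_locales (use assms(4) in \<open>auto simp: equivariant_bilinear_map_def\<close>)
qed

text \<open>
  An isomorphism from a primary component is inverted; the inverse is again linear, continuous
  and equivariant because the component is an invariant subspace.
\<close>

lemma (in smooth_representation) primary_inverse:
  assumes inf: "has_inf_char G V \<nu>" and iso: "rep_iso G (primary_component G \<tau> E) W"
    and W: "smooth_representation G W"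
  obtains S where "linear_map W E S" "continuous_map (tvs_topology W) (tvs_topology E) S"
    "S ` carrier W = primary \<tau>"
    "\<And>g w. \<lbrakk>g \<in> G; w \<in> carrier W\<rbrakk> \<Longrightarrow> S (action W g w) = action E g (S w)"
proof -
  interpret W: smooth_representation G W by fact
  let ?P = "primary_component G \<tau> E"
  note cl = primary_closed[OF inf, where \<tau> = \<tau>]
  obtain T where T: "intertwiner G ?P W T" and h: "homeomorphic_map (tvs_topology ?P) (tvs_topology W) T"
    using iso unfolding rep_iso_def by blast
  obtain S where hm: "homeomorphic_maps (tvs_topology ?P) (tvs_topology W) T S"
    using h unfolding homeomorphic_map_maps by blast
  have top: "topspace (tvs_topology ?P) = primary \<tau>" using cl(1) by auto
  have ST: "S (T u) = u" if "u \<in> primary \<tau>" for u using hm that top by (simp add: homeomorphic_maps_def)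
  have TS: "T (S w) = w" if "w \<in> carrier W" for w using hm that by (simp add: homeomorphic_maps_def)
  have Scont: "continuous_map (tvs_topology W) (tvs_topology ?P) S" using hm by (simp add: homeomorphic_maps_def)
  have Sc: "S w \<in> primary \<tau>" if "w \<in> carrier W" for w
    using continuous_map_funspace[OF Scont] that top by auto
  have lin: "linear_map ?P W T" using T by (simp add: intertwiner_def)
  have Tadd: "T (u \<oplus>\<^bsub>E\<^esub> u') = T u \<oplus>\<^bsub>W\<^esub> T u'" if "u \<in> primary \<tau>" "u' \<in> primary \<tau>" for u u'
    using linear_mapD(2)[OF lin] that by simp
  have Tsm: "T (c \<odot>\<^bsub>E\<^esub> u) = c \<odot>\<^bsub>W\<^esub> T u" if "u \<in> primary \<tau>" for u c
    using linear_mapD(3)[OF lin] that by simp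
  have Tact: "T (action E g u) = action W g (T u)" if "g \<in> G" "u \<in> primary \<tau>" for g u
    using T that by (simp add: intertwiner_def)
  have Tc: "T u \<in> carrier W" if "u \<in> primary \<tau>" for u using linear_mapD(1)[OF lin] that by simp
  show thesis
  proof (rule that[of S])
    show "linear_map W E S"
    proof (rule linear_mapI)
      show "S x \<in> carrier E" if "x \<in> carrier W" for x using Sc[OF that] cl(1) by blast
      fix x y assume xy: "x \<in> carrier W" "y \<in> carrier W"
      have "S (x \<oplus>\<^bsub>W\<^esub> y) = S (T (S x \<oplus>\<^bsub>E\<^esub> S y))"
        by (simp only: Tadd[OF Sc[OF xy(1)] Sc[OF xy(2)]] TS[OF xy(1)] TS[OF xy(2)])
      also have "\<dots> = S x \<oplus>\<^bsub>E\<^esub> S y" by (rule ST[OF cl(2)[OF Sc[OF xy(1)] Sc[OF xy(2)]]])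
      finally show "S (x \<oplus>\<^bsub>W\<^esub> y) = S x \<oplus>\<^bsub>E\<^esub> S y" .
    next
      fix x c assume x: "x \<in> carrier W"
      have "S (c \<odot>\<^bsub>W\<^esub> x) = S (T (c \<odot>\<^bsub>E\<^esub> S x))"
        by (simp only: Tsm[OF Sc[OF x]] TS[OF x])
      also have "\<dots> = c \<odot>\<^bsub>E\<^esub> S x" by (rule ST[OF cl(3)[OF Sc[OF x]]])
      finally show "S (c \<odot>\<^bsub>W\<^esub> x) = c \<odot>\<^bsub>E\<^esub> S x" .
    qed
    show "continuous_map (tvs_topology W) (tvs_topology E) S"
      using Scont unfolding primary_component_simps by (simp only: continuous_map_in_subtopology)
    show "S ` carrier W = primary \<tau>"
    proof
      show "S ` carrier W \<subseteq> primary \<tau>" using Sc by blast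
      show "primary \<tau> \<subseteq> S ` carrier W"
      proof
        fix u assume u: "u \<in> primary \<tau>"
        show "u \<in> S ` carrier W" by (rule image_eqI[where x = "T u"]) (simp_all add: ST[OF u] Tc[OF u])
      qed
    qed
    fix g w assume g: "g \<in> G" and w: "w \<in> carrier W"
    have "S (action W g w) = S (T (action E g (S w)))"
      by (simp only: Tact[OF g Sc[OF w]] TS[OF w])
    also have "\<dots> = action E g (S w)" by (rule ST[OF cl(4)[OF g Sc[OF w]]])
    finally show "S (action W g w) = action E g (S w)" .
  qed
qed

context equivariant_bilinear
begin

lemma contracted_bilinear: "bilinear_map V.E W.E U contracted"
proof (rule bilinear_mapI)
  fix x y assume "x \<in> carrier V.E" "y \<in> carrier W.E"
  then show "contracted (x, y) \<in> carrier U" by (auto simp: contraction_def)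
next
  fix x x' y assume "x \<in> carrier V.E" "x' \<in> carrier V.E" "y \<in> carrier W.E"
  then obtain v1 v2 v1' v2' w1 w2 where e: "x = (v1, v2)" "x' = (v1', v2')" "y = (w1, w2)" and
    c: "v1 \<in> carrier V" "v2 \<in> carrier V" "v1' \<in> carrier V" "v2' \<in> carrier V" "w1 \<in> carrier W" "w2 \<in> carrier W"
    by (cases x; cases x'; cases y) auto
  show "contracted (x \<oplus>\<^bsub>V.E\<^esub> x', y) = contracted (x, y) \<oplus>\<^bsub>U\<^esub> contracted (x', y)"
    unfolding e contraction_def using c
    by (rule_tac U.coordinates4[of "b (v1, w2)" "b (v2, w1)" "b (v1', w2)" "b (v2', w1)"]) simp_all
next
  fix x y y' assume "x \<in> carrier V.E" "y \<in> carrier W.E" "y' \<in> carrier W.E"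
  then obtain v1 v2 w1' w2' w1 w2 where e: "x = (v1, v2)" "y = (w1, w2)" "y' = (w1', w2')" and
    c: "v1 \<in> carrier V" "v2 \<in> carrier V" "w1' \<in> carrier W" "w2' \<in> carrier W" "w1 \<in> carrier W" "w2 \<in> carrier W"
    by (cases x; cases y'; cases y) auto
  show "contracted (x, y \<oplus>\<^bsub>W.E\<^esub> y') = contracted (x, y) \<oplus>\<^bsub>U\<^esub> contracted (x, y')"
    unfolding e contraction_def using c
    by (rule_tac U.coordinates4[of "b (v1, w2)" "b (v2, w1)" "b (v1, w2')" "b (v2, w1')"]) simp_all
next
  fix x y c assume "x \<in> carrier V.E" "y \<in> carrier W.E"
  then show "contracted (c \<odot>\<^bsub>V.E\<^esub> x, y) = c \<odot>\<^bsub>U\<^esub> contracted (x, y)"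
    "contracted (x, c \<odot>\<^bsub>W.E\<^esub> y) = c \<odot>\<^bsub>U\<^esub> contracted (x, y)"
    by (auto simp: contraction_def U.smult_minus)
qed

text \<open>
  Matrices of determinant one preserve the symplectic form.
\<close>

lemma contracted_equivariant:
  assumes g: "g \<in> G" and xy: "x \<in> carrier V.E" "y \<in> carrier W.E"
  shows "contracted (action V.E g x, action W.E g y) = action U g (contracted (x, y))"
proof -
  obtain v1 v2 w1 w2 where e: "x = (v1, v2)" "y = (w1, w2)" and
    c: "v1 \<in> carrier V" "v2 \<in> carrier V" "w1 \<in> carrier W" "w2 \<in> carrier W"
    using xy by (cases x; cases y) auto
  define p q r s where "p = g $ 1 $ 1" and "q = g $ 1 $ 2" and "r = g $ 2 $ 1" and "s = g $ 2 $ 2"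
  have det: "p * s - q * r = 1" using V.G_det[OF g] by (simp add: det_2 p_def q_def r_def s_def)
  define v1' v2' w1' w2' where d: "v1' = action V g v1" "v2' = action V g v2" "w1' = action W g w1" "w2' = action W g w2"
  have c': "v1' \<in> carrier V" "v2' \<in> carrier V" "w1' \<in> carrier W" "w2' \<in> carrier W" using c g by (simp_all add: d)
  have "action U g (contracted (x, y)) = b (v1', w2') \<ominus>\<^bsub>U\<^esub> b (v2', w1')"
    unfolding e contraction_def d using c g by (simp add: U.act_minus equivariant)
  also have "\<dots> = (p * s - q * r) \<odot>\<^bsub>U\<^esub> (b (v1', w2') \<ominus>\<^bsub>U\<^esub> b (v2', w1'))"
    unfolding det using c' by simp
  also have "\<dots> = contracted (action V.E g x, action W.E g y)"
    unfolding e contraction_def tensor_C2_simps prod.case p_def[symmetric] q_def[symmetric] r_def[symmetric] s_def[symmetric] d[symmetric]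
    using c'
    by (rule_tac U.coordinates4[of "b (v1', w1')" "b (v1', w2')" "b (v2', w1')" "b (v2', w2')"]) (simp_all add: algebra_simps)
  finally show ?thesis by simp
qed

lemma contracted_continuous:
  "continuous_map (prod_topology (tvs_topology V.E) (tvs_topology W.E)) (tvs_topology U) contracted"
proof -
  let ?T = "prod_topology (tvs_topology V.E) (tvs_topology W.E)"
  have p: "continuous_map ?T (prod_topology (tvs_topology V) (tvs_topology W)) (\<lambda>z. (fst (fst z), snd (snd z)))"
    "continuous_map ?T (prod_topology (tvs_topology V) (tvs_topology W)) (\<lambda>z. (snd (fst z), fst (snd z)))"
    unfolding tensor_C2_simps
    by (intro continuous_map_pairedI continuous_map_fst_of continuous_map_snd_of continuous_map_fst continuous_map_snd
        continuous_map_compose[OF continuous_map_fst continuous_map_fst, unfolded o_def]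
        continuous_map_compose[OF continuous_map_fst continuous_map_snd, unfolded o_def]
        continuous_map_compose[OF continuous_map_snd continuous_map_fst, unfolded o_def]
        continuous_map_compose[OF continuous_map_snd continuous_map_snd, unfolded o_def])+
  have "continuous_map ?T (tvs_topology U) (\<lambda>z. b (fst (fst z), snd (snd z)) \<ominus>\<^bsub>U\<^esub> b (snd (fst z), fst (snd z)))"
    by (intro U.continuous_map_minus continuous_map_compose[OF p(1) continuous, unfolded o_def]
        continuous_map_compose[OF p(2) continuous, unfolded o_def])
  moreover have "contracted = (\<lambda>z. b (fst (fst z), snd (snd z)) \<ominus>\<^bsub>U\<^esub> b (snd (fst z), fst (snd z)))"
    by (auto simp: contraction_def fun_eq_iff)
  ultimately show ?thesis by simp
qed

end

lemma linear_map_injI: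
  assumes "complex_space V" "complex_space W" "linear_map V W T"
    and "\<And>x. \<lbrakk>x \<in> carrier V; T x = \<zero>\<^bsub>W\<^esub>\<rbrakk> \<Longrightarrow> x = \<zero>\<^bsub>V\<^esub>"
  shows "inj_on T (carrier V)"
proof (rule inj_onI)
  interpret V: complex_space V by fact
  interpret W: complex_space W by fact
  fix x y assume xy: "x \<in> carrier V" "y \<in> carrier V" "T x = T y"
  note D = linear_mapD[OF assms(3)]
  have "T (x \<ominus>\<^bsub>V\<^esub> y) = T x \<ominus>\<^bsub>W\<^esub> T y" using xy(1,2) D by (simp add: V.minus_eq W.minus_eq)
  also have "\<dots> = \<zero>\<^bsub>W\<^esub>" using xy D(1) by simp
  finally have "x \<ominus>\<^bsub>V\<^esub> y = \<zero>\<^bsub>V\<^esub>" using xy by (intro assms(4)) simp_all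
  then show "x = y" using xy V.minus_0_iff by simp
qed

text \<open>
  Contraction followed by restriction to the primary components is a linear map between the two
  spaces.  A bilinear map in its kernel is annihilated by the scalar of \<open>contracted_projections\<close>,
  which is nonzero by assumption.
\<close>

lemma (in real_form) vdim_translation:
  fixes V :: "(mat2, 'v) rep" and W :: "(mat2, 'w) rep" and U :: "(mat2, 'u) rep"
  assumes V: "smooth_representation G V" and V1: "smooth_representation G V1"
    and W: "smooth_representation G W" and W1: "smooth_representation G W1"
    and U: "smooth_representation G U"
    and inf: "has_inf_char G V \<nu>'" "has_inf_char G W \<nu>''" "has_inf_char G U \<mu>"
    and iso: "rep_iso G (primary_component G (\<nu>' + \<delta>') (tensor_C2 V)) V1"
      "rep_iso G (primary_component G (\<nu>'' + \<delta>'') (tensor_C2 W)) W1"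
    and \<delta>: "\<delta>' * \<delta>' = 1" "\<delta>'' * \<delta>'' = 1"
    and noncrossing: "(\<delta>' * \<nu>' + \<delta>'' * \<nu>'' + 1)\<^sup>2 \<noteq> \<mu>\<^sup>2"
  shows "vdim (bilinear_space G V W U) \<le> vdim (bilinear_space G V1 W1 U)"
proof -
  interpret V: smooth_representation G V by fact
  interpret W: smooth_representation G W by fact
  interpret V1: smooth_representation G V1 by fact
  interpret W1: smooth_representation G W1 by fact
  interpret U: smooth_representation G U by fact
  obtain S where S: "linear_map V1 V.E S" "continuous_map (tvs_topology V1) (tvs_topology V.E) S"
    "S ` carrier V1 = V.primary (\<nu>' + \<delta>')"
    "\<And>g w. \<lbrakk>g \<in> G; w \<in> carrier V1\<rbrakk> \<Longrightarrow> S (action V1 g w) = action V.E g (S w)"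
    using V.primary_inverse[OF inf(1) iso(1) V1] by blast
  obtain R where R: "linear_map W1 W.E R" "continuous_map (tvs_topology W1) (tvs_topology W.E) R"
    "R ` carrier W1 = W.primary (\<nu>'' + \<delta>'')"
    "\<And>g w. \<lbrakk>g \<in> G; w \<in> carrier W1\<rbrakk> \<Longrightarrow> R (action W1 g w) = action W.E g (R w)"
    using W.primary_inverse[OF inf(2) iso(2) W1] by blast
  note SD = linear_mapD[OF S(1)] and RD = linear_mapD[OF R(1)]
  let ?D = "carrier V \<times> carrier W" and ?D1 = "carrier V1 \<times> carrier W1"
  let ?B = "bilinear_space G V W U" and ?B1 = "bilinear_space G V1 W1 U"
  define \<Phi> where "\<Phi> b = (\<lambda>(x, y)\<in>?D1. contraction U b (S x, R y))" for b
  note spaces = complex_space_bilinear_space[OF V W U] complex_space_bilinear_space[OF V1 W1 U]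
  have eb: "equivariant_bilinear G V W U b" if "b \<in> carrier ?B" for b
    by (rule equivariant_bilinearI[OF V W U]) (use that in \<open>simp add: bilinear_space_def\<close>)
  have lin: "linear_map ?B ?B1 \<Phi>"
  proof (rule linear_mapI)
    fix b assume "b \<in> carrier ?B"
    then interpret equivariant_bilinear G V W U b by (rule eb)
    note cb = bilinear_mapD[OF contracted_bilinear]
    have "bilinear_map V1 W1 U (\<Phi> b)"
      by (rule bilinear_mapI) (simp_all add: \<Phi>_def SD RD cb del: tensor_C2_simps)
    moreover have "continuous_map (prod_topology (tvs_topology V1) (tvs_topology W1)) (tvs_topology U) (\<Phi> b)"
    proof (rule continuous_map_eq)
      have "continuous_map (prod_topology (tvs_topology V1) (tvs_topology W1))
          (prod_topology (tvs_topology V.E) (tvs_topology W.E)) (\<lambda>z. (S (fst z), R (snd z)))"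
        by (intro continuous_map_pairedI continuous_map_compose[OF continuous_map_fst S(2), unfolded o_def]
            continuous_map_compose[OF continuous_map_snd R(2), unfolded o_def])
      from continuous_map_compose[OF this contracted_continuous]
      show "continuous_map (prod_topology (tvs_topology V1) (tvs_topology W1)) (tvs_topology U)
          (\<lambda>z. contracted (S (fst z), R (snd z)))" by (simp add: o_def)
    qed (auto simp: \<Phi>_def)
    moreover have "\<Phi> b (action V1 g v, action W1 g w) = action U g (\<Phi> b (v, w))"
      if "g \<in> G" "v \<in> carrier V1" "w \<in> carrier W1" for g v w
      using that by (simp add: \<Phi>_def S(4) R(4) contracted_equivariant SD RD del: tensor_C2_simps)
    moreover have "\<Phi> b \<in> extensional ?D1" by (simp add: \<Phi>_def)
    ultimately show "\<Phi> b \<in> carrier ?B1"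
      by (simp add: bilinear_space_def equivariant_bilinear_map_def)
  next
    fix b b' assume bb: "b \<in> carrier ?B" "b' \<in> carrier ?B"
    interpret b: equivariant_bilinear G V W U b by (rule eb[OF bb(1)])
    interpret b': equivariant_bilinear G V W U b' by (rule eb[OF bb(2)])
    have *: "contraction U (\<lambda>v\<in>?D. b v \<oplus>\<^bsub>U\<^esub> b' v) (x, y) = contraction U b (x, y) \<oplus>\<^bsub>U\<^esub> contraction U b' (x, y)"
      if "x \<in> carrier V.E" "y \<in> carrier W.E" for x y
    proof -
      obtain v1 v2 w1 w2 where e: "x = (v1, v2)" "y = (w1, w2)" and
        c: "v1 \<in> carrier V" "v2 \<in> carrier V" "w1 \<in> carrier W" "w2 \<in> carrier W"
        using \<open>x \<in> carrier V.E\<close> \<open>y \<in> carrier W.E\<close> by (cases x; cases y) auto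
      show ?thesis
        unfolding e contraction_def using c
        by (rule_tac U.coordinates4[of "b (v1, w2)" "b (v2, w1)" "b' (v1, w2)" "b' (v2, w1)"]) simp_all
    qed
    show "\<Phi> (b \<oplus>\<^bsub>?B\<^esub> b') = \<Phi> b \<oplus>\<^bsub>?B1\<^esub> \<Phi> b'"
      by (auto simp: \<Phi>_def bilinear_space_def fun_eq_iff * SD RD simp del: tensor_C2_simps)
  next
    fix b c assume b: "b \<in> carrier ?B"
    interpret b: equivariant_bilinear G V W U b by (rule eb[OF b])
    have *: "contraction U (\<lambda>v\<in>?D. c \<odot>\<^bsub>U\<^esub> b v) (x, y) = c \<odot>\<^bsub>U\<^esub> contraction U b (x, y)"
      if "x \<in> carrier V.E" "y \<in> carrier W.E" for x y
      using that by (auto simp: contraction_def U.smult_minus)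
    show "\<Phi> (c \<odot>\<^bsub>?B\<^esub> b) = c \<odot>\<^bsub>?B1\<^esub> \<Phi> b"
      by (auto simp: \<Phi>_def bilinear_space_def fun_eq_iff * SD RD simp del: tensor_C2_simps)
  qed
  moreover have "inj_on \<Phi> (carrier ?B)"
  proof (rule linear_map_injI[OF spaces lin])
    fix b assume b: "b \<in> carrier ?B" and z: "\<Phi> b = \<zero>\<^bsub>?B1\<^esub>"
    interpret b: equivariant_bilinear G V W U b by (rule eb[OF b])
    have zero: "contraction U b (x, y) = \<zero>\<^bsub>U\<^esub>"
      if xy: "x \<in> V.primary (\<nu>' + \<delta>')" "y \<in> W.primary (\<nu>'' + \<delta>'')" for x y
    proof -
      obtain s r where sr: "s \<in> carrier V1" "x = S s" "r \<in> carrier W1" "y = R r"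
        using xy unfolding S(3)[symmetric] R(3)[symmetric] by blast
      have "\<Phi> b (s, r) = \<zero>\<^bsub>U\<^esub>" unfolding z using sr by (simp add: bilinear_space_def)
      then show ?thesis using sr by (simp add: \<Phi>_def)
    qed
    have "b (v, w) = \<zero>\<^bsub>U\<^esub>" if vw: "v \<in> carrier V" "w \<in> carrier W" for v w
    proof -
      define \<kappa> where "\<kappa> = (\<delta>' * \<nu>' + \<delta>'' * \<nu>'' + 1)\<^sup>2 - \<mu>\<^sup>2"
      have "\<kappa> \<noteq> 0" using noncrossing by (simp add: \<kappa>_def)
      have "\<kappa> \<odot>\<^bsub>U\<^esub> b (v, w) = \<zero>\<^bsub>U\<^esub>"
        unfolding \<kappa>_def by (rule b.contracted_projections[OF inf \<delta> vw zero])
      then have "(inverse \<kappa>) \<odot>\<^bsub>U\<^esub> (\<kappa> \<odot>\<^bsub>U\<^esub> b (v, w)) = \<zero>\<^bsub>U\<^esub>" by simp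
      then show ?thesis using \<open>\<kappa> \<noteq> 0\<close> vw by simp
    qed
    moreover have "b \<in> extensional ?D" using b by (simp add: bilinear_space_def)
    ultimately show "b = \<zero>\<^bsub>?B\<^esub>"
      by (auto simp: bilinear_space_def fun_eq_iff extensional_def)
  qed
  ultimately show ?thesis by (rule vdim_le_injective[OF spaces])
qed

section \<open>Completions\<close>

context seminormed_space
begin

abbreviation cauchy where "cauchy \<equiv> cauchy_seqs V P"
abbreviation cls where "cls \<equiv> cauchy_class V P"
abbreviation C where "C \<equiv> completion_module V P"

definition equivalent :: "(nat \<Rightarrow> 'v) \<Rightarrow> (nat \<Rightarrow> 'v) \<Rightarrow> bool" where
  "equivalent s t \<longleftrightarrow> (\<forall>p\<in>P. (\<lambda>n. p (s n \<ominus> t n)) \<longlonglongrightarrow> 0)"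

lemma cauchy_carrier [simp]: "s \<in> cauchy \<Longrightarrow> s n \<in> carrier V"
  by (auto simp: cauchy_seqs_def)

lemma cauchyD: "\<lbrakk>s \<in> cauchy; p \<in> P; e > 0\<rbrakk> \<Longrightarrow> \<exists>N. \<forall>m\<ge>N. \<forall>n\<ge>N. p (s m \<ominus> s n) < e"
  unfolding cauchy_seqs_def by blast

lemma cauchyI:
  "\<lbrakk>\<And>n. s n \<in> carrier V; \<And>p e. \<lbrakk>p \<in> P; e > 0\<rbrakk> \<Longrightarrow> \<exists>N. \<forall>m\<ge>N. \<forall>n\<ge>N. p (s m \<ominus> s n) < e\<rbrakk> \<Longrightarrow> s \<in> cauchy"
  unfolding cauchy_seqs_def by blast

lemma cauchy_const [simp]: "x \<in> carrier V \<Longrightarrow> (\<lambda>_. x) \<in> cauchy"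
  by (rule cauchyI) (simp_all add: sn(4))

lemma cauchy_add [simp]:
  assumes s: "s \<in> cauchy" and t: "t \<in> cauchy"
  shows "(\<lambda>n. s n \<oplus> t n) \<in> cauchy"
proof (rule cauchyI)
  fix p and e :: real assume p: "p \<in> P" and e: "e > 0"
  obtain N where N: "\<And>m n. \<lbrakk>m \<ge> N; n \<ge> N\<rbrakk> \<Longrightarrow> p (s m \<ominus> s n) < e / 2"
    using cauchyD[OF s p, of "e / 2"] e by auto
  obtain M where M: "\<And>m n. \<lbrakk>m \<ge> M; n \<ge> M\<rbrakk> \<Longrightarrow> p (t m \<ominus> t n) < e / 2"
    using cauchyD[OF t p, of "e / 2"] e by auto
  have "p (s m \<oplus> t m \<ominus> (s n \<oplus> t n)) < e" if "m \<ge> max N M" "n \<ge> max N M" for m n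
  proof -
    have "s m \<oplus> t m \<ominus> (s n \<oplus> t n) = (s m \<ominus> s n) \<oplus> (t m \<ominus> t n)"
      using s t by (rule_tac coordinates4[of "s m" "s n" "t m" "t n"]) simp_all
    then have "p (s m \<oplus> t m \<ominus> (s n \<oplus> t n)) \<le> p (s m \<ominus> s n) + p (t m \<ominus> t n)"
      using sn(2)[OF p, of "s m \<ominus> s n" "t m \<ominus> t n"] s t by simp
    then show ?thesis using N[of m n] M[of m n] that by simp
  qed
  then show "\<exists>N. \<forall>m\<ge>N. \<forall>n\<ge>N. p (s m \<oplus> t m \<ominus> (s n \<oplus> t n)) < e" by blast
qed (use s t in simp)

lemma cauchy_smult [simp]:
  assumes s: "s \<in> cauchy"
  shows "(\<lambda>n. c \<odot> s n) \<in> cauchy"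
proof (rule cauchyI)
  fix p and e :: real assume p: "p \<in> P" and e: "e > 0"
  have c1: "cmod c + 1 > 0" using norm_ge_zero[of c] by linarith
  obtain N where N: "\<And>m n. \<lbrakk>m \<ge> N; n \<ge> N\<rbrakk> \<Longrightarrow> p (s m \<ominus> s n) < e / (cmod c + 1)"
    using cauchyD[OF s p, of "e / (cmod c + 1)"] e c1 by auto
  have "p (c \<odot> s m \<ominus> c \<odot> s n) < e" if mn: "m \<ge> N" "n \<ge> N" for m n
  proof -
    have nn: "p (s m \<ominus> s n) \<ge> 0" using sn(1)[OF p] s by simp
    have "p (c \<odot> s m \<ominus> c \<odot> s n) = cmod c * p (s m \<ominus> s n)"
      using s sn(3)[OF p, of "s m \<ominus> s n" c] by (simp add: smult_minus)
    also have "\<dots> \<le> (cmod c + 1) * p (s m \<ominus> s n)"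
      using nn by (intro mult_right_mono) auto
    also have "\<dots> < e"
      using N[OF mn] c1 by (simp add: less_divide_eq mult.commute)
    finally show ?thesis .
  qed
  then show "\<exists>N. \<forall>m\<ge>N. \<forall>n\<ge>N. p (c \<odot> s m \<ominus> c \<odot> s n) < e" by blast
qed (use s in simp)

lemma equivalent_refl: "s \<in> cauchy \<Longrightarrow> equivalent s s"
  by (simp add: equivalent_def sn(4))

lemma equivalent_sym: "\<lbrakk>s \<in> cauchy; t \<in> cauchy; equivalent s t\<rbrakk> \<Longrightarrow> equivalent t s"
  using sn(5) by (simp add: equivalent_def)

lemma equivalent_trans:
  assumes "s \<in> cauchy" "t \<in> cauchy" "u \<in> cauchy" "equivalent s t" "equivalent t u"
  shows "equivalent s u"
  unfolding equivalent_def
proof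
  fix p assume p: "p \<in> P"
  have "(\<lambda>n. p (s n \<ominus> t n) + p (t n \<ominus> u n)) \<longlonglongrightarrow> 0 + 0"
    using assms(4,5) p by (intro tendsto_add) (auto simp: equivalent_def)
  then have lim: "(\<lambda>n. p (s n \<ominus> t n) + p (t n \<ominus> u n)) \<longlonglongrightarrow> 0" by simp
  show "(\<lambda>n. p (s n \<ominus> u n)) \<longlonglongrightarrow> 0"
    by (rule Lim_null_comparison[OF _ lim]) (use assms sn(1,6)[OF p] in simp)
qed

lemma mem_cls: "t \<in> cls s \<longleftrightarrow> t \<in> cauchy \<and> equivalent s t"
  by (simp add: cauchy_class_def equivalent_def)

lemma cls_eq: "\<lbrakk>s \<in> cauchy; t \<in> cauchy\<rbrakk> \<Longrightarrow> cls s = cls t \<longleftrightarrow> equivalent s t"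
proof
  assume st: "s \<in> cauchy" "t \<in> cauchy"
  show "equivalent s t" if "cls s = cls t"
  proof -
    have "t \<in> cls t" using st equivalent_refl by (simp add: mem_cls)
    then have "t \<in> cls s" using that by simp
    then show ?thesis by (simp add: mem_cls)
  qed
  show "cls s = cls t" if e: "equivalent s t"
  proof (rule Set.set_eqI)
    fix u show "u \<in> cls s \<longleftrightarrow> u \<in> cls t"
      unfolding mem_cls using st e equivalent_trans[of s t u] equivalent_trans[of t s u] equivalent_sym[of s t] by blast
  qed
qed

lemma cls_self: "s \<in> cauchy \<Longrightarrow> s \<in> cls s"
  by (simp add: mem_cls equivalent_refl)

text \<open>Operations on classes are given by unions over representatives, all of which agree.\<close>

lemma UN_representatives:
  assumes "s \<in> cauchy" and "\<And>t. \<lbrakk>t \<in> cauchy; equivalent s t\<rbrakk> \<Longrightarrow> f t = f s"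
  shows "(\<Union>t\<in>cls s. f t) = f s"
proof -
  have "(\<Union>t\<in>cls s. f t) = (\<Union>t\<in>cls s. f s)"
    by (rule SUP_cong) (use assms(2) mem_cls in auto)
  then show ?thesis using cls_self[OF assms(1)] by auto
qed

lemma completion_simps:
  "carrier C = cls ` cauchy"
  "\<zero>\<^bsub>C\<^esub> = cls (\<lambda>_. \<zero>)"
  by (simp_all add: completion_module_def)

lemma cls_add:
  assumes s: "s \<in> cauchy" and t: "t \<in> cauchy"
  shows "cls s \<oplus>\<^bsub>C\<^esub> cls t = cls (\<lambda>n. s n \<oplus> t n)"
proof -
  have eq: "cls (\<lambda>n. s' n \<oplus> t' n) = cls (\<lambda>n. s n \<oplus> t n)"
    if "s' \<in> cauchy" "equivalent s s'" "t' \<in> cauchy" "equivalent t t'" for s' t'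
  proof (subst cls_eq)
    show "equivalent (\<lambda>n. s' n \<oplus> t' n) (\<lambda>n. s n \<oplus> t n)"
      unfolding equivalent_def
    proof
      fix p assume p: "p \<in> P"
      have "(\<lambda>n. p (s' n \<ominus> s n) + p (t' n \<ominus> t n)) \<longlonglongrightarrow> 0 + 0"
        using equivalent_sym[OF s that(1,2)] equivalent_sym[OF t that(3,4)] p
        by (intro tendsto_add) (auto simp: equivalent_def)
      then have lim: "(\<lambda>n. p (s' n \<ominus> s n) + p (t' n \<ominus> t n)) \<longlonglongrightarrow> 0" by simp
      show "(\<lambda>n. p (s' n \<oplus> t' n \<ominus> (s n \<oplus> t n))) \<longlonglongrightarrow> 0"
      proof (rule Lim_null_comparison[OF always_eventually lim], rule allI)
        fix n
        have "s' n \<oplus> t' n \<ominus> (s n \<oplus> t n) = (s' n \<ominus> s n) \<oplus> (t' n \<ominus> t n)"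
          using s t that by (rule_tac coordinates4[of "s' n" "s n" "t' n" "t n"]) simp_all
        then show "norm (p (s' n \<oplus> t' n \<ominus> (s n \<oplus> t n))) \<le> p (s' n \<ominus> s n) + p (t' n \<ominus> t n)"
          using sn(1)[OF p, of "(s' n \<ominus> s n) \<oplus> (t' n \<ominus> t n)"] sn(2)[OF p, of "s' n \<ominus> s n" "t' n \<ominus> t n"] s t that
          by simp
      qed
    qed
  qed (use s t that in simp_all)
  have "cls s \<oplus>\<^bsub>C\<^esub> cls t = (\<Union>s'\<in>cls s. \<Union>t'\<in>cls t. cls (\<lambda>n. s' n \<oplus> t' n))"
    by (simp add: completion_module_def)
  also have "\<dots> = (\<Union>s'\<in>cls s. cls (\<lambda>n. s' n \<oplus> t n))"
  proof (rule SUP_cong[OF refl])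
    fix s' assume s': "s' \<in> cls s"
    show "(\<Union>t'\<in>cls t. cls (\<lambda>n. s' n \<oplus> t' n)) = cls (\<lambda>n. s' n \<oplus> t n)"
      by (rule UN_representatives[OF t]) (use eq s' t equivalent_refl in \<open>auto simp: mem_cls\<close>)
  qed
  also have "\<dots> = cls (\<lambda>n. s n \<oplus> t n)"
    by (rule UN_representatives[OF s]) (use eq t equivalent_refl in auto)
  finally show ?thesis .
qed

lemma cls_smult:
  assumes s: "s \<in> cauchy"
  shows "c \<odot>\<^bsub>C\<^esub> cls s = cls (\<lambda>n. c \<odot> s n)"
proof -
  have eq: "cls (\<lambda>n. c \<odot> s' n) = cls (\<lambda>n. c \<odot> s n)" if "s' \<in> cauchy" "equivalent s s'" for s'
  proof (subst cls_eq)
    show "equivalent (\<lambda>n. c \<odot> s' n) (\<lambda>n. c \<odot> s n)"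
      unfolding equivalent_def
    proof
      fix p assume p: "p \<in> P"
      have "(\<lambda>n. cmod c * p (s' n \<ominus> s n)) \<longlonglongrightarrow> cmod c * 0"
        using equivalent_sym[OF s that] p by (intro tendsto_mult tendsto_const) (auto simp: equivalent_def)
      moreover have "p (c \<odot> s' n \<ominus> c \<odot> s n) = cmod c * p (s' n \<ominus> s n)" for n
        using s that sn(3)[OF p, of "s' n \<ominus> s n" c] by (simp add: smult_minus)
      ultimately show "(\<lambda>n. p (c \<odot> s' n \<ominus> c \<odot> s n)) \<longlonglongrightarrow> 0" by simp
    qed
  qed (use s that in simp_all)
  have "c \<odot>\<^bsub>C\<^esub> cls s = (\<Union>s'\<in>cls s. cls (\<lambda>n. c \<odot> s' n))"
    by (simp add: completion_module_def)
  also have "\<dots> = cls (\<lambda>n. c \<odot> s n)"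
    by (rule UN_representatives[OF s]) (use eq in auto)
  finally show ?thesis .
qed

lemma completionE:
  assumes "A \<in> carrier C"
  obtains s where "s \<in> cauchy" "A = cls s"
  using assms by (auto simp: completion_simps)

lemma cls_closed [simp]: "s \<in> cauchy \<Longrightarrow> cls s \<in> carrier C"
  by (simp add: completion_simps)

lemma complex_space_completion: "complex_space C"
proof (rule complex_space.intro)
  have "abelian_group C"
  proof (rule abelian_groupI)
    fix A assume "A \<in> carrier C"
    then obtain s where s: "s \<in> cauchy" "A = cls s" by (rule completionE)
    have "(- 1) \<odot> s n \<oplus> s n = \<zero>" for n
      using s by (rule_tac coordinates1[of "s n"]) simp_all
    then show "\<exists>B\<in>carrier C. B \<oplus>\<^bsub>C\<^esub> A = \<zero>\<^bsub>C\<^esub>"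
      using s by (intro bexI[of _ "cls (\<lambda>n. (- 1) \<odot> s n)"]) (simp_all add: cls_add completion_simps(2))
  qed (auto elim!: completionE simp: cls_add completion_simps(2) M.a_ac)
  then show "module complex_ring C"
    by (rule moduleI[OF cring_complex_ring])
       (auto elim!: completionE simp: cls_add cls_smult smult_add_left[symmetric] smult_add_right)
qed

sublocale C: complex_space C by (rule complex_space_completion)

lemma cls_minus:
  assumes "s \<in> cauchy" "t \<in> cauchy"
  shows "cls s \<ominus>\<^bsub>C\<^esub> cls t = cls (\<lambda>n. s n \<ominus> t n)"
proof -
  have "(\<lambda>n. s n \<ominus> t n) = (\<lambda>n. s n \<oplus> (- 1) \<odot> t n)" using assms by (simp add: minus_eq)
  then show ?thesis using assms by (simp add: C.minus_eq cls_smult cls_add)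
qed

lemma cauchy_minus [simp]: "\<lbrakk>s \<in> cauchy; t \<in> cauchy\<rbrakk> \<Longrightarrow> (\<lambda>n. s n \<ominus> t n) \<in> cauchy"
  using cauchy_add[of s "\<lambda>n. (- 1) \<odot> t n"] by (simp add: minus_eq)

lemma completion_seminorm_lim:
  assumes p: "p \<in> P" and s: "s \<in> cauchy"
  shows "(\<lambda>n. p (s n)) \<longlonglongrightarrow> completion_seminorm p (cls s)"
proof -
  have "Cauchy (\<lambda>n. p (s n))"
    unfolding Cauchy_def dist_real_def
  proof (intro allI impI)
    fix e :: real assume "e > 0"
    then obtain N where N: "\<And>m n. \<lbrakk>m \<ge> N; n \<ge> N\<rbrakk> \<Longrightarrow> p (s m \<ominus> s n) < e"
      using cauchyD[OF s p] by blast
    have "\<bar>p (s m) - p (s n)\<bar> < e" if "m \<ge> N" "n \<ge> N" for m n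
      using sn(8)[OF p, of "s m" "s n"] N[OF that] s by simp
    then show "\<exists>M. \<forall>m\<ge>M. \<forall>n\<ge>M. \<bar>p (s m) - p (s n)\<bar> < e" by blast
  qed
  then obtain l where l: "(\<lambda>n. p (s n)) \<longlonglongrightarrow> l"
    using Cauchy_convergent convergent_def by blast
  have all: "(\<lambda>n. p (t n)) \<longlonglongrightarrow> l" if t: "t \<in> cls s" for t
  proof -
    have t': "t \<in> cauchy" "equivalent s t" using t by (simp_all add: mem_cls)
    have lim: "(\<lambda>n. p (s n \<ominus> t n)) \<longlonglongrightarrow> 0" using t'(2) p by (simp add: equivalent_def)
    have "(\<lambda>n. p (t n) - p (s n)) \<longlonglongrightarrow> 0"
      by (rule Lim_null_comparison[OF _ lim]) (use sn(8)[OF p] s t' in \<open>simp add: abs_minus_commute\<close>)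
    from tendsto_add[OF this l] show ?thesis by simp
  qed
  have "completion_seminorm p (cls s) = l"
    unfolding completion_seminorm_def
  proof (rule the_equality)
    show "\<forall>t\<in>cls s. (\<lambda>n. p (t n)) \<longlonglongrightarrow> l" using all by blast
    show "l' = l" if "\<forall>t\<in>cls s. (\<lambda>n. p (t n)) \<longlonglongrightarrow> l'" for l'
      using that cls_self[OF s] l LIMSEQ_unique by blast
  qed
  with l show ?thesis by simp
qed

lemma completion_seminorm_eq: "\<lbrakk>p \<in> P; s \<in> cauchy; (\<lambda>n. p (s n)) \<longlonglongrightarrow> l\<rbrakk> \<Longrightarrow> completion_seminorm p (cls s) = l"
  using completion_seminorm_lim LIMSEQ_unique by blast

lemma seminorm_on_completion:
  assumes p: "p \<in> P"
  shows "seminorm_on C (completion_seminorm p)"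
  unfolding seminorm_on_def
proof (intro conjI ballI allI)
  fix A B assume "A \<in> carrier C" "B \<in> carrier C"
  then obtain s t where s: "s \<in> cauchy" "A = cls s" and t: "t \<in> cauchy" "B = cls t"
    by (auto elim!: completionE)
  note ls = completion_seminorm_lim[OF p s(1)] and lt = completion_seminorm_lim[OF p t(1)]
  show "0 \<le> completion_seminorm p A"
    unfolding s(2) by (rule LIMSEQ_le_const[OF ls]) (use sn(1)[OF p] s in auto)
  show "completion_seminorm p (A \<oplus>\<^bsub>C\<^esub> B) \<le> completion_seminorm p A + completion_seminorm p B"
    unfolding s(2) t(2) cls_add[OF s(1) t(1)]
    by (rule LIMSEQ_le[OF completion_seminorm_lim[OF p cauchy_add[OF s(1) t(1)]] tendsto_add[OF ls lt]])
       (use sn(2)[OF p] s t in auto)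
next
  fix c A assume "A \<in> carrier C"
  then obtain s where s: "s \<in> cauchy" "A = cls s" by (rule completionE)
  show "completion_seminorm p (c \<odot>\<^bsub>C\<^esub> A) = cmod c * completion_seminorm p A"
    unfolding s(2) cls_smult[OF s(1)]
  proof (rule completion_seminorm_eq[OF p])
    have "(\<lambda>n. cmod c * p (s n)) \<longlonglongrightarrow> cmod c * completion_seminorm p (cls s)"
      by (intro tendsto_mult tendsto_const completion_seminorm_lim p s)
    then show "(\<lambda>n. p (c \<odot> s n)) \<longlonglongrightarrow> cmod c * completion_seminorm p (cls s)"
      using sn(3)[OF p] s by simp
  qed (use s in simp)
qed

abbreviation topology_C where "topology_C \<equiv> seminorm_topology C (completion_seminorm ` P)"

lemma seminormed_space_completion: "seminormed_space C (completion_seminorm ` P)"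
  by unfold_locales (use seminorm_on_completion in auto)

interpretation CS: seminormed_space C "completion_seminorm ` P"
  by (rule seminormed_space_completion)

definition embed :: "'v \<Rightarrow> (nat \<Rightarrow> 'v) set" where
  "embed x = cls (\<lambda>_. x)"

lemma embed:
  "x \<in> carrier V \<Longrightarrow> embed x \<in> carrier C"
  "\<lbrakk>x \<in> carrier V; y \<in> carrier V\<rbrakk> \<Longrightarrow> embed (x \<oplus> y) = embed x \<oplus>\<^bsub>C\<^esub> embed y"
  "\<lbrakk>x \<in> carrier V; y \<in> carrier V\<rbrakk> \<Longrightarrow> embed (x \<ominus> y) = embed x \<ominus>\<^bsub>C\<^esub> embed y"
  "x \<in> carrier V \<Longrightarrow> embed (c \<odot> x) = c \<odot>\<^bsub>C\<^esub> embed x"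
  "\<lbrakk>p \<in> P; x \<in> carrier V\<rbrakk> \<Longrightarrow> completion_seminorm p (embed x) = p x"
  "\<lbrakk>x \<in> carrier V; y \<in> carrier V; \<And>p. p \<in> P \<Longrightarrow> p (x \<ominus> y) = 0\<rbrakk> \<Longrightarrow> embed x = embed y"
proof -
  show "\<lbrakk>p \<in> P; x \<in> carrier V\<rbrakk> \<Longrightarrow> completion_seminorm p (embed x) = p x"
    unfolding embed_def by (rule completion_seminorm_eq) auto
  show "\<lbrakk>x \<in> carrier V; y \<in> carrier V; \<And>p. p \<in> P \<Longrightarrow> p (x \<ominus> y) = 0\<rbrakk> \<Longrightarrow> embed x = embed y"
  proof -
    assume x: "x \<in> carrier V" "y \<in> carrier V" and z: "\<And>p. p \<in> P \<Longrightarrow> p (x \<ominus> y) = 0"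
    have "(\<lambda>n::nat. p (x \<ominus> y)) \<longlonglongrightarrow> 0" if "p \<in> P" for p
      unfolding z[OF that] by simp
    then show "embed x = embed y"
      unfolding embed_def using x by (subst cls_eq) (simp_all add: equivalent_def)
  qed
qed (simp_all add: embed_def cls_add cls_smult cls_minus)

lemma embed_dense:
  assumes s: "s \<in> cauchy"
  shows "limitin topology_C (\<lambda>k. embed (s k)) (cls s) sequentially"
  unfolding CS.limitin_iff
proof (intro conjI ballI)
  show "cls s \<in> carrier C" "\<forall>\<^sub>F k in sequentially. embed (s k) \<in> carrier C" using s embed(1) by simp_all
  fix q assume "q \<in> completion_seminorm ` P"
  then obtain p where p: "p \<in> P" "q = completion_seminorm p" by blast
  have lim: "(\<lambda>n. p (s k \<ominus> s n)) \<longlonglongrightarrow> q (embed (s k) \<ominus>\<^bsub>C\<^esub> cls s)" for k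
    using completion_seminorm_lim[OF p(1), of "\<lambda>n. s k \<ominus> s n"] s p(2)
      cauchy_minus[OF cauchy_const[of "s k"] s] cls_minus[OF cauchy_const[of "s k"] s] by (simp add: embed_def)
  show "(\<lambda>k. q (embed (s k) \<ominus>\<^bsub>C\<^esub> cls s)) \<longlonglongrightarrow> 0"
  proof (rule LIMSEQ_I)
    fix e :: real assume e: "e > 0"
    obtain N where N: "\<And>m n. \<lbrakk>m \<ge> N; n \<ge> N\<rbrakk> \<Longrightarrow> p (s m \<ominus> s n) < e / 2"
      using cauchyD[OF s p(1), of "e / 2"] e by auto
    have "norm (q (embed (s k) \<ominus>\<^bsub>C\<^esub> cls s) - 0) < e" if k: "k \<ge> N" for k
    proof -
      have "q (embed (s k) \<ominus>\<^bsub>C\<^esub> cls s) \<le> e / 2"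
        by (rule LIMSEQ_le_const2[OF lim]) (use N k less_imp_le in blast)
      moreover have "q (embed (s k) \<ominus>\<^bsub>C\<^esub> cls s) \<ge> 0"
        by (rule LIMSEQ_le_const[OF lim]) (use sn(1)[OF p(1)] s in auto)
      ultimately show ?thesis using e by simp
    qed
    then show "\<exists>no. \<forall>k\<ge>no. norm (q (embed (s k) \<ominus>\<^bsub>C\<^esub> cls s) - 0) < e" by blast
  qed
qed

lemma continuous_on_completion_unique:
  assumes "lcs U" and T: "continuous_map topology_C (tvs_topology U) T" "continuous_map topology_C (tvs_topology U) T'"
    and eq: "\<And>x. x \<in> carrier V \<Longrightarrow> T (embed x) = T' (embed x)" and A: "A \<in> carrier C"
  shows "T A = T' A"
proof -
  interpret U: lcs U by fact
  obtain s where s: "s \<in> cauchy" "A = cls s" using A by (rule completionE)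
  have l: "limitin (tvs_topology U) (\<lambda>k. T (embed (s k))) (T A) sequentially"
    "limitin (tvs_topology U) (\<lambda>k. T' (embed (s k))) (T' A) sequentially"
    using continuous_map_limit[OF T(1) embed_dense[OF s(1)]] continuous_map_limit[OF T(2) embed_dense[OF s(1)]] s(2)
    by (simp_all add: o_def)
  have "(\<lambda>k. T (embed (s k))) = (\<lambda>k. T' (embed (s k)))" using eq s(1) by simp
  from U.limit_unique[OF l(1)[unfolded this] l(2) sequentially_bot] show ?thesis .
qed

lemma cauchy_image:
  assumes "seminormed_space W Q" and f: "linear_map V W f"
    and bd: "\<And>q. q \<in> Q \<Longrightarrow> \<exists>p\<in>P. \<forall>x\<in>carrier V. q (f x) \<le> p x"
  shows "s \<in> cauchy \<Longrightarrow> (\<lambda>n. f (s n)) \<in> cauchy_seqs W Q"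
    and "\<lbrakk>s \<in> cauchy; t \<in> cauchy; equivalent s t; q \<in> Q\<rbrakk> \<Longrightarrow> (\<lambda>n. q (f (s n) \<ominus>\<^bsub>W\<^esub> f (t n))) \<longlonglongrightarrow> 0"
proof -
  interpret W: seminormed_space W Q by fact
  note D = linear_mapD[OF f]
  have m: "f x \<ominus>\<^bsub>W\<^esub> f y = f (x \<ominus> y)" if "x \<in> carrier V" "y \<in> carrier V" for x y
    using that D by (simp add: minus_eq W.minus_eq)
  show "(\<lambda>n. f (s n)) \<in> cauchy_seqs W Q" if s: "s \<in> cauchy"
  proof (rule W.cauchyI)
    fix q and e :: real assume q: "q \<in> Q" and e: "e > 0"
    obtain p where p: "p \<in> P" "\<forall>x\<in>carrier V. q (f x) \<le> p x" using bd[OF q] by blast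
    obtain N where N: "\<And>m n. \<lbrakk>m \<ge> N; n \<ge> N\<rbrakk> \<Longrightarrow> p (s m \<ominus> s n) < e"
      using cauchyD[OF s p(1) e] by blast
    have "q (f (s m) \<ominus>\<^bsub>W\<^esub> f (s n)) < e" if "m \<ge> N" "n \<ge> N" for m n
      using p(2)[rule_format, of "s m \<ominus> s n"] N[OF that] s m[of "s m" "s n"] by simp
    then show "\<exists>N. \<forall>m\<ge>N. \<forall>n\<ge>N. q (f (s m) \<ominus>\<^bsub>W\<^esub> f (s n)) < e" by blast
  qed (use s D in simp)
  show "(\<lambda>n. q (f (s n) \<ominus>\<^bsub>W\<^esub> f (t n))) \<longlonglongrightarrow> 0"
    if s: "s \<in> cauchy" and t: "t \<in> cauchy" and e: "equivalent s t" and q: "q \<in> Q"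
  proof -
    obtain p where p: "p \<in> P" "\<forall>x\<in>carrier V. q (f x) \<le> p x" using bd[OF q] by blast
    have lim: "(\<lambda>n. p (s n \<ominus> t n)) \<longlonglongrightarrow> 0" using e p(1) by (simp add: equivalent_def)
    show ?thesis
      by (rule Lim_null_comparison[OF _ lim]) (use s t m W.sn(1)[OF q] D(1) p(2) in simp)
  qed
qed

text \<open>
  The bound makes the images of Cauchy sequences Cauchy, so their limits define the extension;
  passing to the limit, the extension satisfies the same bounds and is continuous.
\<close>

lemma extension_to_completion:
  fixes U :: "('u, 'n) tvs_scheme"
  assumes "complete_lcs U" and f: "linear_map V U f"
    and bd: "\<And>r. continuous_seminorm U r \<Longrightarrow> \<exists>p\<in>P. \<forall>x\<in>carrier V. r (f x) \<le> p x"
  obtains T where "linear_map C U T" "continuous_map topology_C (tvs_topology U) T"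
    "\<And>s. s \<in> cauchy \<Longrightarrow> limitin (tvs_topology U) (\<lambda>n. f (s n)) (T (cls s)) sequentially"
    "\<And>x. x \<in> carrier V \<Longrightarrow> T (embed x) = f x"
proof -
  interpret U: complete_lcs U by fact
  note D = linear_mapD[OF f]
  have im1: "(\<lambda>n. f (s n)) \<in> U.cauchy" if "s \<in> cauchy" for s
    by (rule cauchy_image(1)[OF U.seminormed_space_axioms f _ that]) (use bd in auto)
  have im2: "(\<lambda>n. q (f (s n) \<ominus>\<^bsub>U\<^esub> f (t n))) \<longlonglongrightarrow> 0"
    if "s \<in> cauchy" "t \<in> cauchy" "equivalent s t" "continuous_seminorm U q" for s t q
    by (rule cauchy_image(2)[OF U.seminormed_space_axioms f _ that(1-3)]) (use bd that in auto)
  define T where "T A = (THE l. \<forall>s\<in>A. limitin (tvs_topology U) (\<lambda>n. f (s n)) l sequentially)" for A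
  have lim: "limitin (tvs_topology U) (\<lambda>n. f (s n)) (T (cls s)) sequentially" if s: "s \<in> cauchy" for s
  proof -
    obtain l where l: "limitin (tvs_topology U) (\<lambda>n. f (s n)) l sequentially"
      using U.complete[OF im1[OF s]] by blast
    have all: "limitin (tvs_topology U) (\<lambda>n. f (t n)) l sequentially" if t: "t \<in> cls s" for t
    proof -
      have t': "t \<in> cauchy" "equivalent s t" using t by (simp_all add: mem_cls)
      have "limitin (tvs_topology U) (\<lambda>n. f (s n) \<ominus>\<^bsub>U\<^esub> f (t n)) \<zero>\<^bsub>U\<^esub> sequentially"
        using im2[OF s t'] s t'(1) D(1) by (intro U.limitin_tvsI) simp_all
      from U.limit_minus[OF l this]
      have "limitin (tvs_topology U) (\<lambda>n. f (s n) \<ominus>\<^bsub>U\<^esub> (f (s n) \<ominus>\<^bsub>U\<^esub> f (t n))) (l \<ominus>\<^bsub>U\<^esub> \<zero>\<^bsub>U\<^esub>) sequentially" .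
      moreover have "f (s n) \<ominus>\<^bsub>U\<^esub> (f (s n) \<ominus>\<^bsub>U\<^esub> f (t n)) = f (t n)" for n
        using s t'(1) D(1) by (rule_tac U.coordinates2[of "f (s n)" "f (t n)"]) simp_all
      ultimately show ?thesis using U.limitin_tvsD(1)[OF l] by simp
    qed
    have "T (cls s) = l"
      unfolding T_def
    proof (rule the_equality)
      show "\<forall>t\<in>cls s. limitin (tvs_topology U) (\<lambda>n. f (t n)) l sequentially" using all by blast
      show "l' = l" if "\<forall>t\<in>cls s. limitin (tvs_topology U) (\<lambda>n. f (t n)) l' sequentially" for l'
        by (rule U.limit_unique[OF that[rule_format, OF cls_self[OF s]] l sequentially_bot])
    qed
    with l show ?thesis by simp
  qed
  have lin: "linear_map C U T"
  proof (rule linear_mapI)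
    show "T A \<in> carrier U" if "A \<in> carrier C" for A
      using that by (rule completionE) (use lim U.limitin_tvsD(1) in blast)
    fix A B assume "A \<in> carrier C" "B \<in> carrier C"
    then obtain s t where s: "s \<in> cauchy" "A = cls s" and t: "t \<in> cauchy" "B = cls t" by (auto elim!: completionE)
    have "limitin (tvs_topology U) (\<lambda>n. f (s n \<oplus> t n)) (T A \<oplus>\<^bsub>U\<^esub> T B) sequentially"
      using U.limit_add[OF lim[OF s(1)] lim[OF t(1)]] s t D(2) by simp
    then show "T (A \<oplus>\<^bsub>C\<^esub> B) = T A \<oplus>\<^bsub>U\<^esub> T B"
      using U.limit_unique[OF lim[OF cauchy_add[OF s(1) t(1)]] _ sequentially_bot] s t by (simp add: cls_add)
  next
    fix A c assume "A \<in> carrier C"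
    then obtain s where s: "s \<in> cauchy" "A = cls s" by (rule completionE)
    have "limitin (tvs_topology U) (\<lambda>n. f (c \<odot> s n)) (c \<odot>\<^bsub>U\<^esub> T A) sequentially"
      using U.limit_smult[OF lim[OF s(1)] tendsto_const[of c]] s D(3) by simp
    then show "T (c \<odot>\<^bsub>C\<^esub> A) = c \<odot>\<^bsub>U\<^esub> T A"
      using U.limit_unique[OF lim[OF cauchy_smult[OF s(1)]] _ sequentially_bot] s by (simp add: cls_smult)
  qed
  note L = linear_mapD[OF lin]
  have cont: "continuous_map topology_C (tvs_topology U) T"
    unfolding continuous_map_atin
  proof
    fix A assume A: "A \<in> topspace topology_C"
    then have AC: "A \<in> carrier C" by simp
    have idl: "limitin topology_C id A (atin topology_C A)"
      by (rule limitin_continuous_map) (use A in auto)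
    show "limitin (tvs_topology U) T (T A) (atin topology_C A)"
    proof (rule U.limitin_tvsI)
      show "T A \<in> carrier U" using AC L(1) by simp
      have ev: "\<forall>\<^sub>F B in atin topology_C A. B \<in> carrier C" using idl by (simp add: CS.limitin_iff)
      then show "\<forall>\<^sub>F B in atin topology_C A. T B \<in> carrier U" by eventually_elim (rule L(1))
      fix r assume r: "continuous_seminorm U r"
      obtain p where p: "p \<in> P" "\<forall>x\<in>carrier V. r (f x) \<le> p x" using bd[OF r] by blast
      have le: "r (T B) \<le> completion_seminorm p B" if B: "B \<in> carrier C" for B
      proof -
        obtain s where s: "s \<in> cauchy" "B = cls s" using B by (rule completionE)
        show ?thesis
          unfolding s(2)
          by (rule LIMSEQ_le[OF U.limit_seminorm[OF lim[OF s(1)] r] completion_seminorm_lim[OF p(1) s(1)]])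
             (use p(2) s(1) in auto)
      qed
      have z: "((\<lambda>B. completion_seminorm p (B \<ominus>\<^bsub>C\<^esub> A)) \<longlongrightarrow> 0) (atin topology_C A)"
        using idl p(1) by (simp add: CS.limitin_iff)
      show "((\<lambda>B. r (T B \<ominus>\<^bsub>U\<^esub> T A)) \<longlongrightarrow> 0) (atin topology_C A)"
      proof (rule Lim_null_comparison[OF _ z])
        show "\<forall>\<^sub>F B in atin topology_C A. norm (r (T B \<ominus>\<^bsub>U\<^esub> T A)) \<le> completion_seminorm p (B \<ominus>\<^bsub>C\<^esub> A)"
          using ev
        proof eventually_elim
          case (elim B)
          have "T B \<ominus>\<^bsub>U\<^esub> T A = T (B \<ominus>\<^bsub>C\<^esub> A)" using elim AC L by (simp add: U.minus_eq C.minus_eq)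
          then show ?case using le[of "B \<ominus>\<^bsub>C\<^esub> A"] U.csn(1)[OF r, of "T (B \<ominus>\<^bsub>C\<^esub> A)"] elim AC L(1) by simp
        qed
      qed
    qed
  qed
  show thesis
  proof (rule that[OF lin cont lim])
    show "T (embed x) = f x" if x: "x \<in> carrier V" for x
      using U.limit_unique[OF lim[OF cauchy_const[OF x]] _ sequentially_bot, of "f x"] x D(1) by (simp add: embed_def)
  qed
qed

end

section \<open>The completed projective tensor product\<close>

lemma lookup_scale [simp]:
  "Poly_Mapping.lookup (Poly_Mapping.map ((*) c) x) k = (c::complex) * Poly_Mapping.lookup x k"
  by (simp add: Poly_Mapping.map.rep_eq when_def)

lemma scale_simps [simp]:
  "Poly_Mapping.map ((*) c) (x + y) = Poly_Mapping.map ((*) (c::complex)) x + Poly_Mapping.map ((*) c) y"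
  "Poly_Mapping.map ((*) c) (x - y) = Poly_Mapping.map ((*) c) x - Poly_Mapping.map ((*) c) y"
  "Poly_Mapping.map ((*) c) 0 = 0"
  "Poly_Mapping.map ((*) c) (Poly_Mapping.single k a) = Poly_Mapping.single k (c * a)"
  "Poly_Mapping.map ((*) c) (Poly_Mapping.map ((*) d) x) = Poly_Mapping.map ((*) (c * d)) x"
  "Poly_Mapping.map ((*) 1) x = x"
  by (rule poly_mapping_eqI; simp add: lookup_add lookup_minus lookup_single when_def algebra_simps)+

lemma keys_scale_subset: "Poly_Mapping.keys (Poly_Mapping.map ((*) (c::complex)) x) \<subseteq> Poly_Mapping.keys x"
  by (auto simp: in_keys_iff)

lemma sum_singles:
  "finite A \<Longrightarrow> Poly_Mapping.keys x \<subseteq> A \<Longrightarrow> (\<Sum>k\<in>A. Poly_Mapping.single k (Poly_Mapping.lookup x k)) = (x :: 'a \<Rightarrow>\<^sub>0 complex)"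
proof (rule poly_mapping_eqI)
  fix k assume A: "finite A" "Poly_Mapping.keys x \<subseteq> A"
  have "Poly_Mapping.lookup (\<Sum>k\<in>A. Poly_Mapping.single k (Poly_Mapping.lookup x k)) k =
      (\<Sum>j\<in>A. if j = k then Poly_Mapping.lookup x k else 0)"
    by (simp add: lookup_sum lookup_single when_def) (rule sum.cong, auto)
  also have "\<dots> = Poly_Mapping.lookup x k"
    using A by (auto simp: sum.delta' in_keys_iff)
  finally show "Poly_Mapping.lookup (\<Sum>k\<in>A. Poly_Mapping.single k (Poly_Mapping.lookup x k)) k = Poly_Mapping.lookup x k" .
qed

lemma free_space_simps [simp]:
  "carrier (free_space V W) = {x. Poly_Mapping.keys x \<subseteq> carrier V \<times> carrier W}"
  "x \<oplus>\<^bsub>free_space V W\<^esub> y = x + y" "\<zero>\<^bsub>free_space V W\<^esub> = 0"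
  "c \<odot>\<^bsub>free_space V W\<^esub> x = Poly_Mapping.map ((*) c) x"
  by (simp_all add: free_space_def)

lemma free_space_closed:
  fixes x y :: "'a \<Rightarrow>\<^sub>0 complex"
  assumes "Poly_Mapping.keys x \<subseteq> A" "Poly_Mapping.keys y \<subseteq> A"
  shows "Poly_Mapping.keys (x + y) \<subseteq> A" "Poly_Mapping.keys (x - y) \<subseteq> A" "Poly_Mapping.keys (- x) \<subseteq> A"
proof -
  have "Poly_Mapping.keys (x - y) \<subseteq> Poly_Mapping.keys x \<union> Poly_Mapping.keys y"
    "Poly_Mapping.keys (- x) = Poly_Mapping.keys x"
    by (auto simp: in_keys_iff lookup_minus)
  then show "Poly_Mapping.keys (x + y) \<subseteq> A" "Poly_Mapping.keys (x - y) \<subseteq> A" "Poly_Mapping.keys (- x) \<subseteq> A"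
    using assms Poly_Mapping.keys_add[of x y] by blast+
qed

lemma complex_space_free_space: "complex_space (free_space V W)"
proof (rule complex_space.intro)
  have "abelian_group (free_space V W)"
  proof (rule abelian_groupI)
    fix x assume "x \<in> carrier (free_space V W)"
    then show "\<exists>y\<in>carrier (free_space V W). y \<oplus>\<^bsub>free_space V W\<^esub> x = \<zero>\<^bsub>free_space V W\<^esub>"
      by (intro bexI[of _ "- x"]) (simp_all add: free_space_closed)
  qed (simp_all add: free_space_closed add_ac)
  then show "module complex_ring (free_space V W)"
    by (rule moduleI[OF cring_complex_ring])
       (auto simp: keys_scale_subset[THEN subset_trans] intro!: poly_mapping_eqI simp: lookup_add algebra_simps)
qed

lemma free_space_minus [simp]:
  assumes "Poly_Mapping.keys x \<subseteq> carrier V \<times> carrier W" "Poly_Mapping.keys y \<subseteq> carrier V \<times> carrier W"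
  shows "x \<ominus>\<^bsub>free_space V W\<^esub> y = x - y"
proof -
  interpret complex_space "free_space V W" by (rule complex_space_free_space)
  have "x \<ominus>\<^bsub>free_space V W\<^esub> y = x + Poly_Mapping.map ((*) (- 1)) y"
    using minus_eq[of x y] assms by simp
  also have "\<dots> = x - y" by (rule poly_mapping_eqI) (simp add: lookup_add lookup_minus)
  finally show ?thesis .
qed

lemma free_space_linear_unique:
  fixes V :: "(complex, 'a, 'm) module_scheme" and W :: "(complex, 'b, 'n) module_scheme"
  assumes "complex_space U" and f: "linear_map (free_space V W) U f" and g: "linear_map (free_space V W) U g"
    and eq: "\<And>v w. \<lbrakk>v \<in> carrier V; w \<in> carrier W\<rbrakk> \<Longrightarrow> f (Poly_Mapping.single (v, w) 1) = g (Poly_Mapping.single (v, w) 1)"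
    and x: "Poly_Mapping.keys x \<subseteq> carrier V \<times> carrier W"
  shows "f x = g x"
proof -
  interpret U: complex_space U by fact
  note F = linear_mapD[OF f, simplified] and G = linear_mapD[OF g, simplified]
  have single: "Poly_Mapping.single k c = Poly_Mapping.map ((*) c) (Poly_Mapping.single k 1)" for k and c :: complex
    by simp
  have "f (\<Sum>k\<in>A. Poly_Mapping.single k (c k)) = g (\<Sum>k\<in>A. Poly_Mapping.single k (c k)) \<and>
      Poly_Mapping.keys (\<Sum>k\<in>A. Poly_Mapping.single k (c k)) \<subseteq> carrier V \<times> carrier W"
    if "finite A" "A \<subseteq> carrier V \<times> carrier W" for A and c :: "'a \<times> 'b \<Rightarrow> complex"
    using that
  proof (induction A rule: finite_induct)
    case empty
    then show ?case using F(3)[of 0 0] F(1)[of 0] G(3)[of 0 0] G(1)[of 0] by simp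
  next
    case (insert k A)
    obtain v w where k: "k = (v, w)" "v \<in> carrier V" "w \<in> carrier W" using insert.prems by auto
    have "f (Poly_Mapping.single k (c k)) = g (Poly_Mapping.single k (c k))"
      unfolding single[of k "c k"] using F(3)[of "Poly_Mapping.single k 1" "c k"] G(3)[of "Poly_Mapping.single k 1" "c k"] eq k by simp
    moreover have "Poly_Mapping.keys (Poly_Mapping.single k (c k)) \<subseteq> carrier V \<times> carrier W" using k by simp
    moreover note insert
    ultimately show ?case by (simp add: F(2) G(2) free_space_closed)
  qed
  from this[OF finite_keys x, of "Poly_Mapping.lookup x"] show ?thesis
    by (simp add: sum_singles)
qed

definition linear_extension ::
    "(complex, 'u, 'm) module_scheme \<Rightarrow> ('a \<Rightarrow> 'u) \<Rightarrow> ('a \<Rightarrow>\<^sub>0 complex) \<Rightarrow> 'u" where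
  "linear_extension U b x = (\<Oplus>\<^bsub>U\<^esub>k\<in>Poly_Mapping.keys x. Poly_Mapping.lookup x k \<odot>\<^bsub>U\<^esub> b k)"

lemma (in complex_space) linear_extension_superset:
  assumes "finite A" "Poly_Mapping.keys x \<subseteq> A" "\<And>k. k \<in> A \<Longrightarrow> b k \<in> carrier V"
  shows "linear_extension V b x = (\<Oplus>k\<in>A. Poly_Mapping.lookup x k \<odot> b k)"
  unfolding linear_extension_def
  by (rule M.add.finprod_mono_neutral_cong_left) (use assms in \<open>auto simp: in_keys_iff\<close>)

lemma linear_map_linear_extension:
  fixes V :: "(complex, 'a, 'm) module_scheme" and W :: "(complex, 'b, 'n) module_scheme"
  assumes "complex_space U" and b: "\<And>v w. \<lbrakk>v \<in> carrier V; w \<in> carrier W\<rbrakk> \<Longrightarrow> b (v, w) \<in> carrier U"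
  shows "linear_map (free_space V W) U (linear_extension U b)"
    and "k \<in> carrier V \<times> carrier W \<Longrightarrow> linear_extension U b (Poly_Mapping.single k c) = c \<odot>\<^bsub>U\<^esub> b k"
proof -
  interpret U: complex_space U by fact
  have b': "b k \<in> carrier U" if "k \<in> carrier V \<times> carrier W" for k using b that by auto
  note sup = U.linear_extension_superset[where b = b]
  show "linear_map (free_space V W) U (linear_extension U b)"
  proof (rule linear_mapI; simp)
    show "linear_extension U b x \<in> carrier U" if "Poly_Mapping.keys x \<subseteq> carrier V \<times> carrier W" for x
      unfolding linear_extension_def by (rule U.M.finsum_closed) (use that b' in auto)
    fix x y :: "'a \<times> 'b \<Rightarrow>\<^sub>0 complex"
    assume xy: "Poly_Mapping.keys x \<subseteq> carrier V \<times> carrier W" "Poly_Mapping.keys y \<subseteq> carrier V \<times> carrier W"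
    let ?A = "Poly_Mapping.keys x \<union> Poly_Mapping.keys y"
    have A: "finite ?A" "?A \<subseteq> carrier V \<times> carrier W" using xy by auto
    have "linear_extension U b (x + y) = (\<Oplus>\<^bsub>U\<^esub>k\<in>?A. Poly_Mapping.lookup (x + y) k \<odot>\<^bsub>U\<^esub> b k)"
      by (rule sup[OF A(1)]) (use A b' Poly_Mapping.keys_add[of x y] in auto)
    also have "\<dots> = (\<Oplus>\<^bsub>U\<^esub>k\<in>?A. Poly_Mapping.lookup x k \<odot>\<^bsub>U\<^esub> b k \<oplus>\<^bsub>U\<^esub> Poly_Mapping.lookup y k \<odot>\<^bsub>U\<^esub> b k)"
      by (rule U.M.finsum_cong') (use A b' in \<open>auto simp: lookup_add U.smult_add_left\<close>)
    also have "\<dots> = (\<Oplus>\<^bsub>U\<^esub>k\<in>?A. Poly_Mapping.lookup x k \<odot>\<^bsub>U\<^esub> b k) \<oplus>\<^bsub>U\<^esub> (\<Oplus>\<^bsub>U\<^esub>k\<in>?A. Poly_Mapping.lookup y k \<odot>\<^bsub>U\<^esub> b k)"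
      by (rule U.M.finsum_addf) (use A b' in auto)
    also have "\<dots> = linear_extension U b x \<oplus>\<^bsub>U\<^esub> linear_extension U b y"
    proof -
      have bA: "b k \<in> carrier U" if "k \<in> ?A" for k using A(2) b' that by blast
      show ?thesis by (simp only: sup[OF A(1) Un_upper1 bA] sup[OF A(1) Un_upper2 bA])
    qed
    finally show "linear_extension U b (x + y) = linear_extension U b x \<oplus>\<^bsub>U\<^esub> linear_extension U b y" .
  next
    fix x :: "'a \<times> 'b \<Rightarrow>\<^sub>0 complex" and c
    assume x: "Poly_Mapping.keys x \<subseteq> carrier V \<times> carrier W"
    have "linear_extension U b (Poly_Mapping.map ((*) c) x) =
        (\<Oplus>\<^bsub>U\<^esub>k\<in>Poly_Mapping.keys x. Poly_Mapping.lookup (Poly_Mapping.map ((*) c) x) k \<odot>\<^bsub>U\<^esub> b k)"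
      by (rule sup) (use x b' keys_scale_subset[of c x] in auto)
    also have "\<dots> = (\<Oplus>\<^bsub>U\<^esub>k\<in>Poly_Mapping.keys x. c \<odot>\<^bsub>U\<^esub> (Poly_Mapping.lookup x k \<odot>\<^bsub>U\<^esub> b k))"
      by (rule U.M.finsum_cong') (use x b' in auto)
    also have "\<dots> = c \<odot>\<^bsub>U\<^esub> linear_extension U b x"
      unfolding linear_extension_def
      by (rule U.M.finsum_smult_ldistr[symmetric]) (use x b' in auto)
    finally show "linear_extension U b (Poly_Mapping.map ((*) c) x) = c \<odot>\<^bsub>U\<^esub> linear_extension U b x" .
  qed
  show "linear_extension U b (Poly_Mapping.single k c) = c \<odot>\<^bsub>U\<^esub> b k" if k: "k \<in> carrier V \<times> carrier W"
  proof -
    have "linear_extension U b (Poly_Mapping.single k c) = (\<Oplus>\<^bsub>U\<^esub>j\<in>{k}. Poly_Mapping.lookup (Poly_Mapping.single k c) j \<odot>\<^bsub>U\<^esub> b j)"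
      by (rule sup) (use k b' in auto)
    then show ?thesis using k b' by simp
  qed
qed

lemma (in complex_space) seminorm_linear_extension_le:
  assumes r: "seminorm_on V r" and b: "\<And>k. k \<in> A \<Longrightarrow> b k \<in> carrier V"
    and bd: "\<And>k. k \<in> A \<Longrightarrow> r (b k) \<le> d k" and "finite A"
  shows "r (\<Oplus>k\<in>A. c k \<odot> b k) \<le> (\<Sum>k\<in>A. cmod (c k) * d k)"
  using assms(4,2,3)
proof (induction A rule: finite_induct)
  case empty then show ?case using seminorm_onD(4)[OF r] by simp
next
  case (insert k A)
  have cl: "(\<lambda>k. c k \<odot> b k) \<in> A \<rightarrow> carrier V" "c k \<odot> b k \<in> carrier V" "(\<Oplus>k\<in>A. c k \<odot> b k) \<in> carrier V"
    using insert.prems by (auto intro!: M.finsum_closed)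
  have "r (\<Oplus>k\<in>insert k A. c k \<odot> b k) \<le> r (c k \<odot> b k) + r (\<Oplus>k\<in>A. c k \<odot> b k)"
    using insert.hyps cl seminorm_onD(2)[OF r cl(2,3)] by (simp add: M.finsum_insert)
  also have "r (c k \<odot> b k) \<le> cmod (c k) * d k"
    using seminorm_onD(3)[OF r] insert.prems by (simp add: mult_left_mono)
  also have "r (\<Oplus>k\<in>A. c k \<odot> b k) \<le> (\<Sum>k\<in>A. cmod (c k) * d k)" using insert by auto
  finally show ?case using insert.hyps by simp
qed

section \<open>Bilinear relations and projective seminorms\<close>

text \<open>
  The expression whose infimum over all representations of a tensor is the projective seminorm.
\<close>

definition representation_norm :: "('v \<Rightarrow> real) \<Rightarrow> ('w \<Rightarrow> real) \<Rightarrow> ('v \<times> 'w \<Rightarrow>\<^sub>0 complex) \<Rightarrow> real" where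
  "representation_norm p q y = (\<Sum>k\<in>Poly_Mapping.keys y. cmod (Poly_Mapping.lookup y k) * (p (fst k) * q (snd k)))"

lemma representation_norm_superset:
  "\<lbrakk>finite A; Poly_Mapping.keys y \<subseteq> A\<rbrakk> \<Longrightarrow>
    representation_norm p q y = (\<Sum>k\<in>A. cmod (Poly_Mapping.lookup y k) * (p (fst k) * q (snd k)))"
  unfolding representation_norm_def by (rule sum.mono_neutral_left) (auto simp: in_keys_iff)

locale tensor_pair = V: lcs V + W: lcs W
  for V :: "('v, 'm) tvs_scheme" and W :: "('w, 'n) tvs_scheme"
begin

abbreviation F where "F \<equiv> free_space V W"
abbreviation R where "R \<equiv> bilinear_relations V W"
abbreviation Q where "Q \<equiv> projective_seminorms V W"
abbreviation D where "D \<equiv> carrier V \<times> carrier W"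

sublocale F: complex_space F by (rule complex_space_free_space)

lemma relations_carrier: "x \<in> R \<Longrightarrow> Poly_Mapping.keys x \<subseteq> D"
proof (induction rule: bilinear_relations.induct)
  case (diff x y) then show ?case by (simp add: free_space_closed)
qed (simp_all add: free_space_closed)

lemma relations_zero: "0 \<in> R"
  using bilinear_relations.diff[OF bilinear_relations.smult_left bilinear_relations.smult_left,
      of "\<zero>\<^bsub>V\<^esub>" V "\<zero>\<^bsub>W\<^esub>" W "\<zero>\<^bsub>V\<^esub>" "\<zero>\<^bsub>W\<^esub>" 0 0 0 0] by simp

lemma relations_uminus: "x \<in> R \<Longrightarrow> - x \<in> R"
  using bilinear_relations.diff[OF relations_zero] by fastforce

lemma relations_add: "\<lbrakk>x \<in> R; y \<in> R\<rbrakk> \<Longrightarrow> x + y \<in> R"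
  using bilinear_relations.diff[of x V W "- y"] relations_uminus[of y] by simp

lemma relations_scale: "x \<in> R \<Longrightarrow> Poly_Mapping.map ((*) c) x \<in> R"
proof (induction rule: bilinear_relations.induct)
  case (smult_left v w a d)
  then show ?case using bilinear_relations.smult_left[of v V w W a "c * d"] by (simp add: mult.left_commute)
next
  case (smult_right v w a d)
  then show ?case using bilinear_relations.smult_right[of v V w W a "c * d"] by (simp add: mult.left_commute)
qed (simp_all add: bilinear_relations.intros)

lemma norm_nonneg:
  assumes "continuous_seminorm V p" "continuous_seminorm W q" "Poly_Mapping.keys y \<subseteq> D"
  shows "representation_norm p q y \<ge> 0"
  unfolding representation_norm_def
proof (rule sum_nonneg)
  fix k assume "k \<in> Poly_Mapping.keys y"
  then have "fst k \<in> carrier V" "snd k \<in> carrier W" using assms(3) by auto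
  then show "0 \<le> cmod (Poly_Mapping.lookup y k) * (p (fst k) * q (snd k))"
    using V.csn(1)[OF assms(1)] W.csn(1)[OF assms(2)] by simp
qed

lemma norm_add:
  assumes "continuous_seminorm V p" "continuous_seminorm W q" "Poly_Mapping.keys x \<subseteq> D" "Poly_Mapping.keys y \<subseteq> D"
  shows "representation_norm p q (x + y) \<le> representation_norm p q x + representation_norm p q y"
proof -
  let ?A = "Poly_Mapping.keys x \<union> Poly_Mapping.keys y"
  have "representation_norm p q (x + y) = (\<Sum>k\<in>?A. cmod (Poly_Mapping.lookup (x + y) k) * (p (fst k) * q (snd k)))"
    by (rule representation_norm_superset) (use Poly_Mapping.keys_add[of x y] in auto)
  also have "\<dots> \<le> (\<Sum>k\<in>?A. cmod (Poly_Mapping.lookup x k) * (p (fst k) * q (snd k)) +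
      cmod (Poly_Mapping.lookup y k) * (p (fst k) * q (snd k)))"
  proof (rule sum_mono)
    fix k assume "k \<in> ?A"
    then have "fst k \<in> carrier V" "snd k \<in> carrier W" using assms(3,4) by auto
    then have "p (fst k) * q (snd k) \<ge> 0" using V.csn(1)[OF assms(1)] W.csn(1)[OF assms(2)] by simp
    then show "cmod (Poly_Mapping.lookup (x + y) k) * (p (fst k) * q (snd k)) \<le>
        cmod (Poly_Mapping.lookup x k) * (p (fst k) * q (snd k)) + cmod (Poly_Mapping.lookup y k) * (p (fst k) * q (snd k))"
      unfolding distrib_right[symmetric] lookup_add by (intro mult_right_mono norm_triangle_ineq)
  qed
  also have "\<dots> = representation_norm p q x + representation_norm p q y"
    by (simp add: sum.distrib representation_norm_superset[of ?A])
  finally show ?thesis .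
qed

lemma norm_scale: "representation_norm p q (Poly_Mapping.map ((*) c) x) = cmod c * representation_norm p q x"
proof -
  have "representation_norm p q (Poly_Mapping.map ((*) c) x) =
      (\<Sum>k\<in>Poly_Mapping.keys x. cmod (Poly_Mapping.lookup (Poly_Mapping.map ((*) c) x) k) * (p (fst k) * q (snd k)))"
    by (rule representation_norm_superset) (use keys_scale_subset[of c x] in auto)
  then show ?thesis
    by (simp add: representation_norm_def sum_distrib_left norm_mult mult.assoc)
qed

lemma norm_single: "representation_norm p q (Poly_Mapping.single (v, w) c) = cmod c * (p v * q w)"
  using representation_norm_superset[of "{(v, w)}" "Poly_Mapping.single (v, w) c" p q] by simp

lemma projective_seminorm_eq:
  "projective_seminorm V W p q x = (INF y\<in>{y \<in> carrier F. x - y \<in> R}. representation_norm p q y)"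
  unfolding projective_seminorm_def representation_norm_def
  by (intro arg_cong[where f = Inf] image_cong refl sum.cong) (auto simp: mult.assoc)

context
  fixes p q assumes p: "continuous_seminorm V p" and q: "continuous_seminorm W q"
begin

lemma projective_le:
  assumes "Poly_Mapping.keys y \<subseteq> D" "x - y \<in> R"
  shows "projective_seminorm V W p q x \<le> representation_norm p q y"
  unfolding projective_seminorm_eq
proof (rule cINF_lower)
  show "bdd_below (representation_norm p q ` {y \<in> carrier F. x - y \<in> R})"
    by (rule bdd_belowI2[where m = 0]) (use norm_nonneg[OF p q] in simp)
qed (use assms in simp)

lemma projective_ge:
  assumes "Poly_Mapping.keys x \<subseteq> D" "\<And>y. \<lbrakk>Poly_Mapping.keys y \<subseteq> D; x - y \<in> R\<rbrakk> \<Longrightarrow> l \<le> representation_norm p q y"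
  shows "l \<le> projective_seminorm V W p q x"
  unfolding projective_seminorm_eq
proof (rule cINF_greatest)
  show "{y \<in> carrier F. x - y \<in> R} \<noteq> {}" using assms(1) relations_zero by (auto intro!: exI[of _ x])
qed (use assms(2) in simp)

lemma projective_scale_le:
  assumes x: "Poly_Mapping.keys x \<subseteq> D" and c: "c \<noteq> 0"
  shows "projective_seminorm V W p q (Poly_Mapping.map ((*) c) x) \<le> cmod c * projective_seminorm V W p q x"
proof -
  have "projective_seminorm V W p q (Poly_Mapping.map ((*) c) x) / cmod c \<le> projective_seminorm V W p q x"
  proof (rule projective_ge[OF x])
    fix y assume y: "Poly_Mapping.keys y \<subseteq> D" "x - y \<in> R"
    have "projective_seminorm V W p q (Poly_Mapping.map ((*) c) x) \<le> representation_norm p q (Poly_Mapping.map ((*) c) y)"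
      by (rule projective_le) (use y relations_scale[OF y(2), of c] keys_scale_subset[of c y] in auto)
    then show "projective_seminorm V W p q (Poly_Mapping.map ((*) c) x) / cmod c \<le> representation_norm p q y"
      using c by (simp add: norm_scale divide_le_eq mult.commute)
  qed
  then show ?thesis using c by (simp add: divide_le_eq mult.commute)
qed

lemma projective_nonneg: "Poly_Mapping.keys x \<subseteq> D \<Longrightarrow> 0 \<le> projective_seminorm V W p q x"
  by (rule projective_ge) (use norm_nonneg[OF p q] in auto)

lemma projective_relation: "x \<in> R \<Longrightarrow> projective_seminorm V W p q x = 0"
  using projective_le[of 0 x] projective_nonneg[of x] relations_carrier[of x] by (simp add: representation_norm_def)

lemma seminorm_on_projective: "seminorm_on F (projective_seminorm V W p q)"
  unfolding seminorm_on_def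
proof (intro conjI ballI allI; simp)
  show "0 \<le> projective_seminorm V W p q x" if "Poly_Mapping.keys x \<subseteq> D" for x
    by (rule projective_nonneg[OF that])
  fix x y :: "'v \<times> 'w \<Rightarrow>\<^sub>0 complex"
  assume x: "Poly_Mapping.keys x \<subseteq> D" and y: "Poly_Mapping.keys y \<subseteq> D"
  have "projective_seminorm V W p q (x + y) - projective_seminorm V W p q x \<le> projective_seminorm V W p q y"
  proof (rule projective_ge[OF y])
    fix y' assume y': "Poly_Mapping.keys y' \<subseteq> D" "y - y' \<in> R"
    have "projective_seminorm V W p q (x + y) - representation_norm p q y' \<le> projective_seminorm V W p q x"
    proof (rule projective_ge[OF x])
      fix x' assume x': "Poly_Mapping.keys x' \<subseteq> D" "x - x' \<in> R"
      have "projective_seminorm V W p q (x + y) \<le> representation_norm p q (x' + y')"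
        by (rule projective_le) (use x' y' relations_add[OF x'(2) y'(2)] in \<open>simp_all add: free_space_closed algebra_simps\<close>)
      then show "projective_seminorm V W p q (x + y) - representation_norm p q y' \<le> representation_norm p q x'"
        using norm_add[OF p q x'(1) y'(1)] by linarith
    qed
    then show "projective_seminorm V W p q (x + y) - projective_seminorm V W p q x \<le> representation_norm p q y'" by linarith
  qed
  then show "projective_seminorm V W p q (x + y) \<le> projective_seminorm V W p q x + projective_seminorm V W p q y" by linarith
next
  fix c and x :: "'v \<times> 'w \<Rightarrow>\<^sub>0 complex"
  assume x: "Poly_Mapping.keys x \<subseteq> D"
  show "projective_seminorm V W p q (Poly_Mapping.map ((*) c) x) = cmod c * projective_seminorm V W p q x"
  proof (cases "c = 0")
    case True
    have "Poly_Mapping.map ((*) 0) x = 0" by (rule poly_mapping_eqI) simp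
    then show ?thesis using True projective_relation[OF relations_zero] by simp
  next
    case False
    have "projective_seminorm V W p q (Poly_Mapping.map ((*) (inverse c)) (Poly_Mapping.map ((*) c) x)) \<le>
        cmod (inverse c) * projective_seminorm V W p q (Poly_Mapping.map ((*) c) x)"
      by (rule projective_scale_le) (use False x keys_scale_subset[of c x] in auto)
    then have "projective_seminorm V W p q x \<le> projective_seminorm V W p q (Poly_Mapping.map ((*) c) x) / cmod c"
      using False by (simp add: norm_inverse divide_inverse mult.commute)
    then have "cmod c * projective_seminorm V W p q x \<le> projective_seminorm V W p q (Poly_Mapping.map ((*) c) x)"
      using False by (simp add: le_divide_eq mult.commute)
    then show ?thesis using projective_scale_le[OF x False] by simp
  qed
qed

end

sublocale S: seminormed_space F Q
  by unfold_locales (use seminorm_on_projective in \<open>auto simp: projective_seminorms_def\<close>)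

lemma linear_extension_relations:
  assumes "complex_space U" and b: "bilinear_map V W U b" and x: "x \<in> R"
  shows "linear_extension U b x = \<zero>\<^bsub>U\<^esub>"
proof -
  interpret U: complex_space U by fact
  note B = bilinear_mapD[OF b]
  note L = linear_mapD[OF linear_map_linear_extension(1)[where V = V and W = W and b = b, OF assms(1) B(1)], simplified]
  note S = linear_map_linear_extension(2)[where V = V and W = W and b = b, OF assms(1) B(1)]
  have minus: "linear_extension U b (x - y) = linear_extension U b x \<ominus>\<^bsub>U\<^esub> linear_extension U b y"
    if "Poly_Mapping.keys x \<subseteq> D" "Poly_Mapping.keys y \<subseteq> D" for x y
  proof -
    have *: "x - y = x + Poly_Mapping.map ((*) (- 1)) y" by (rule poly_mapping_eqI) (simp add: lookup_add lookup_minus)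
    show ?thesis
      unfolding * using that L keys_scale_subset[of "- 1" y] by (simp add: U.minus_eq)
  qed
  show ?thesis
    using x
  proof (induction rule: bilinear_relations.induct)
    case (add_left v v' w c)
    then show ?case using B
      by (rule_tac U.coordinates2[of "b (v, w)" "b (v', w)"]) (simp_all add: minus S free_space_closed)
  next
    case (add_right v w w' c)
    then show ?case using B
      by (rule_tac U.coordinates2[of "b (v, w)" "b (v, w')"]) (simp_all add: minus S free_space_closed)
  next
    case (smult_left v w a c)
    then show ?case using B by (simp add: minus S mult.commute)
  next
    case (smult_right v w a c)
    then show ?case using B by (simp add: minus S mult.commute)
  next
    case (diff x y)
    then show ?case using relations_carrier by (simp add: minus)
  qed
qed

text \<open>
  Representations of the same tensor have the same image, so the triangle inequality may be applied
  to any of them before taking the infimum.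
\<close>

lemma linear_extension_bound:
  assumes "lcs U" and b: "bilinear_map V W U b" and r: "continuous_seminorm U r"
    and p: "continuous_seminorm V p" and q: "continuous_seminorm W q"
    and bd: "\<And>v w. \<lbrakk>v \<in> carrier V; w \<in> carrier W\<rbrakk> \<Longrightarrow> r (b (v, w)) \<le> p v * q w"
    and x: "Poly_Mapping.keys x \<subseteq> D"
  shows "r (linear_extension U b x) \<le> projective_seminorm V W p q x"
proof (rule projective_ge[OF p q x])
  interpret U: lcs U by fact
  note B = bilinear_mapD[OF b]
  have cs: "complex_space U" ..
  note L = linear_mapD[OF linear_map_linear_extension(1)[where V = V and W = W and b = b, OF cs B(1)], simplified]
  fix y assume y: "Poly_Mapping.keys y \<subseteq> D" "x - y \<in> R"
  have "linear_extension U b x = linear_extension U b (y + (x - y))" by simp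
  also have "\<dots> = linear_extension U b y"
    using L(2)[of y "x - y"] y x linear_extension_relations[OF cs b y(2)] L(1)[of y] by (simp add: free_space_closed)
  finally have "r (linear_extension U b x) = r (linear_extension U b y)" by simp
  also have "\<dots> \<le> representation_norm p q y"
    unfolding linear_extension_def representation_norm_def
    by (rule U.seminorm_linear_extension_le) (use r y B bd in \<open>auto simp: continuous_seminorm_def\<close>)
  finally show "r (linear_extension U b x) \<le> representation_norm p q y" .
qed

end

section \<open>The diagonal action on the completed tensor product\<close>

lemma keys_sum_closed:
  fixes g :: "'i \<Rightarrow> 'a \<Rightarrow>\<^sub>0 complex"
  shows "(\<And>i. i \<in> A \<Longrightarrow> Poly_Mapping.keys (g i) \<subseteq> D) \<Longrightarrow> Poly_Mapping.keys (sum g A) \<subseteq> D"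
  by (induction A rule: infinite_finite_induct) (simp_all add: free_space_closed)

lemma free_map_superset:
  "\<lbrakk>finite A; Poly_Mapping.keys x \<subseteq> A\<rbrakk> \<Longrightarrow> free_map f x = (\<Sum>k\<in>A. Poly_Mapping.single (f k) (Poly_Mapping.lookup x k))"
  unfolding free_map_def by (rule sum.mono_neutral_left) (auto simp: in_keys_iff)

lemma free_map_add: "free_map f (x + y) = free_map f x + free_map f y"
proof -
  let ?A = "Poly_Mapping.keys x \<union> Poly_Mapping.keys y"
  have "free_map f (x + y) = (\<Sum>k\<in>?A. Poly_Mapping.single (f k) (Poly_Mapping.lookup (x + y) k))"
    by (rule free_map_superset) (use Poly_Mapping.keys_add[of x y] in auto)
  also have "\<dots> = free_map f x + free_map f y"
    by (simp add: lookup_add single_add sum.distrib free_map_superset[of ?A])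
  finally show ?thesis .
qed

lemma free_map_scale: "free_map f (Poly_Mapping.map ((*) c) x) = Poly_Mapping.map ((*) c) (free_map f x)"
proof -
  have "free_map f (Poly_Mapping.map ((*) c) x) =
      (\<Sum>k\<in>Poly_Mapping.keys x. Poly_Mapping.single (f k) (Poly_Mapping.lookup (Poly_Mapping.map ((*) c) x) k))"
    by (rule free_map_superset) (use keys_scale_subset[of c x] in auto)
  also have "\<dots> = (\<Sum>k\<in>Poly_Mapping.keys x. Poly_Mapping.map ((*) c) (Poly_Mapping.single (f k) (Poly_Mapping.lookup x k)))"
    by simp
  also have "\<dots> = Poly_Mapping.map ((*) c) (free_map f x)"
    unfolding free_map_def by (rule sum_comp_morphism[unfolded o_def]) simp_all
  finally show ?thesis .
qed

lemma free_map_minus: "free_map f (x - y) = free_map f x - free_map f y"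
  using free_map_add[of f "x - y" y] by simp

lemma free_map_single [simp]: "free_map f (Poly_Mapping.single k c) = Poly_Mapping.single (f k) c"
  by (simp add: free_map_superset[of "{k}"])

locale tensor_representation =
  V: smooth_representation G V + W: smooth_representation G W + tensor_pair V W
  for G and V :: "(mat2, 'v) rep" and W :: "(mat2, 'w) rep"
begin

definition diag :: "mat2 \<Rightarrow> ('v \<times> 'w \<Rightarrow>\<^sub>0 complex) \<Rightarrow> ('v \<times> 'w \<Rightarrow>\<^sub>0 complex)" where
  "diag g = free_map (\<lambda>(v, w). (action V g v, action W g w))"

lemma diag_single [simp]: "diag g (Poly_Mapping.single (v, w) c) = Poly_Mapping.single (action V g v, action W g w) c"
  by (simp only: diag_def free_map_single prod.case)

lemma diag_linear:
  assumes "g \<in> G"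
  shows "linear_map F F (diag g)"
proof (rule linear_mapI)
  show "diag g x \<in> carrier F" if "x \<in> carrier F" for x
  proof -
    have "Poly_Mapping.keys (diag g x) \<subseteq> D"
      unfolding diag_def free_map_def
    proof (rule keys_sum_closed)
      fix k assume "k \<in> Poly_Mapping.keys x"
      then have "k \<in> D" using that by auto
      then show "Poly_Mapping.keys (Poly_Mapping.single (case k of (v, w) \<Rightarrow> (action V g v, action W g w))
          (Poly_Mapping.lookup x k)) \<subseteq> D"
        using assms by auto
    qed
    then show ?thesis by simp
  qed
qed (simp_all add: diag_def free_map_add free_map_scale)

lemma diag_relations:
  assumes g: "g \<in> G" and x: "x \<in> R"
  shows "diag g x \<in> R"
  using x
proof (induction rule: bilinear_relations.induct)
  case (add_left v v' w c)
  then show ?case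
    using bilinear_relations.add_left[of "action V g v" V "action V g v'" "action W g w" W c] g
    by (simp add: diag_def free_map_minus V.act_add)
next
  case (add_right v w w' c)
  then show ?case
    using bilinear_relations.add_right[of "action V g v" V "action W g w" W "action W g w'" c] g
    by (simp add: diag_def free_map_minus W.act_add)
next
  case (smult_left v w a c)
  then show ?case
    using bilinear_relations.smult_left[of "action V g v" V "action W g w" W a c] g
    by (simp add: diag_def free_map_minus V.act_smult)
next
  case (smult_right v w a c)
  then show ?case
    using bilinear_relations.smult_right[of "action V g v" V "action W g w" W a c] g
    by (simp add: diag_def free_map_minus W.act_smult)
next
  case (diff x y)
  then show ?case by (simp add: diag_def free_map_minus bilinear_relations.diff)
qed

lemma diag_norm:
  assumes g: "g \<in> G" and p: "continuous_seminorm V p" and q: "continuous_seminorm W q"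
    and y: "Poly_Mapping.keys y \<subseteq> D"
  shows "representation_norm p q (diag g y) \<le>
    representation_norm (\<lambda>v. p (action V g v)) (\<lambda>w. q (action W g w)) y"
proof -
  have "representation_norm p q (\<Sum>k\<in>A. Poly_Mapping.single (action V g (fst k), action W g (snd k)) (c k)) \<le>
      (\<Sum>k\<in>A. cmod (c k) * (p (action V g (fst k)) * q (action W g (snd k))))"
    if "finite A" "A \<subseteq> D" for A c
    using that
  proof (induction A rule: finite_induct)
    case empty then show ?case by (simp add: representation_norm_def)
  next
    case (insert k A)
    have k: "fst k \<in> carrier V" "snd k \<in> carrier W" using insert.prems by auto
    let ?a = "Poly_Mapping.single (action V g (fst k), action W g (snd k)) (c k)"
    let ?b = "\<Sum>k\<in>A. Poly_Mapping.single (action V g (fst k), action W g (snd k)) (c k)"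
    have a: "Poly_Mapping.keys ?a \<subseteq> D" using k g by simp
    have b: "Poly_Mapping.keys ?b \<subseteq> D"
    proof (rule keys_sum_closed)
      fix j assume "j \<in> A"
      then have "fst j \<in> carrier V" "snd j \<in> carrier W" using insert.prems by auto
      then show "Poly_Mapping.keys (Poly_Mapping.single (action V g (fst j), action W g (snd j)) (c j)) \<subseteq> D"
        using g by simp
    qed
    have "A \<subseteq> D" using insert.prems by simp
    then have "representation_norm p q (?a + ?b) \<le>
        cmod (c k) * (p (action V g (fst k)) * q (action W g (snd k))) +
        (\<Sum>k\<in>A. cmod (c k) * (p (action V g (fst k)) * q (action W g (snd k))))"
      using norm_add[OF p q a b] insert.IH norm_single[of p q "action V g (fst k)" "action W g (snd k)" "c k"] by linarith
    then show ?case using insert.hyps by simp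
  qed
  from this[OF finite_keys y] show ?thesis
    unfolding diag_def free_map_def representation_norm_def by (simp add: case_prod_beta)
qed

text \<open>
  Applying \<open>g\<close> to both entries of every pair in a representation of a tensor replaces \<open>p\<close> and
  \<open>q\<close> by the continuous seminorms \<open>v \<mapsto> p (g v)\<close> and \<open>w \<mapsto> q (g w)\<close>.
\<close>

lemma diag_bound:
  assumes g: "g \<in> G" and r: "r \<in> Q"
  shows "\<exists>r'\<in>Q. \<forall>x\<in>carrier F. r (diag g x) \<le> r' x"
proof -
  obtain p q where p: "continuous_seminorm V p" and q: "continuous_seminorm W q" and r: "r = projective_seminorm V W p q"
    using r unfolding projective_seminorms_def by blast
  let ?p = "\<lambda>v. p (action V g v)" and ?q = "\<lambda>w. q (action W g w)"
  have p': "continuous_seminorm V ?p"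
    by (rule V.pullback_seminorm[OF V.act_linear_continuous[OF g] p])
  have q': "continuous_seminorm W ?q"
    by (rule W.pullback_seminorm[OF W.act_linear_continuous[OF g] q])
  have "r (diag g x) \<le> projective_seminorm V W ?p ?q x" if x: "Poly_Mapping.keys x \<subseteq> D" for x
    unfolding r
  proof (rule projective_ge[OF p' q' x])
    fix y assume y: "Poly_Mapping.keys y \<subseteq> D" "x - y \<in> R"
    have "diag g x - diag g y \<in> R"
      using diag_relations[OF g y(2)] by (simp add: diag_def free_map_minus)
    moreover have "Poly_Mapping.keys (diag g y) \<subseteq> D" using linear_mapD(1)[OF diag_linear[OF g], of y] y by simp
    ultimately have "projective_seminorm V W p q (diag g x) \<le> representation_norm p q (diag g y)"
      by (intro projective_le[OF p q])
    also have "\<dots> \<le> representation_norm ?p ?q y" by (rule diag_norm[OF g p q y(1)])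
    finally show "projective_seminorm V W p q (diag g x) \<le> representation_norm ?p ?q y" .
  qed
  moreover have "projective_seminorm V W ?p ?q \<in> Q" using p' q' unfolding projective_seminorms_def by blast
  ultimately show ?thesis by auto
qed

lemma diag_cauchy: "\<lbrakk>g \<in> G; s \<in> S.cauchy\<rbrakk> \<Longrightarrow> (\<lambda>n. diag g (s n)) \<in> S.cauchy"
  by (rule S.cauchy_image(1)[OF S.seminormed_space_axioms diag_linear]) (use diag_bound in auto)

lemma diag_equivalent:
  "\<lbrakk>g \<in> G; s \<in> S.cauchy; t \<in> S.cauchy; S.equivalent s t\<rbrakk> \<Longrightarrow> S.equivalent (\<lambda>n. diag g (s n)) (\<lambda>n. diag g (t n))"
  unfolding S.equivalent_def[of "\<lambda>n. diag g (s n)"]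
  by (intro ballI S.cauchy_image(2)[OF S.seminormed_space_axioms diag_linear]) (use diag_bound in auto)

abbreviation tensor where "tensor \<equiv> diagonal_restriction (V \<boxtimes> W)"

lemma tensor_simps [simp]:
  "carrier tensor = carrier S.C" "x \<oplus>\<^bsub>tensor\<^esub> y = x \<oplus>\<^bsub>S.C\<^esub> y" "c \<odot>\<^bsub>tensor\<^esub> x = c \<odot>\<^bsub>S.C\<^esub> x"
  "\<zero>\<^bsub>tensor\<^esub> = \<zero>\<^bsub>S.C\<^esub>" "tvs_topology tensor = S.topology_C"
  "action tensor g A = (\<Union>s\<in>A. S.cls (\<lambda>n. diag g (s n)))"
  by (simp_all add: diagonal_restriction_def outer_tensor_def with_action_def completion_def diag_def
      tvs.defs rep.defs module.defs)

lemma action_cls: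
  assumes g: "g \<in> G" and s: "s \<in> S.cauchy"
  shows "action tensor g (S.cls s) = S.cls (\<lambda>n. diag g (s n))"
  unfolding tensor_simps
proof (rule S.UN_representatives[OF s])
  fix t assume t: "t \<in> S.cauchy" "S.equivalent s t"
  show "S.cls (\<lambda>n. diag g (t n)) = S.cls (\<lambda>n. diag g (s n))"
    by (subst S.cls_eq) (use g s t diag_cauchy diag_equivalent S.equivalent_sym in auto)
qed

lemma action_closed: "\<lbrakk>g \<in> G; A \<in> carrier tensor\<rbrakk> \<Longrightarrow> action tensor g A \<in> carrier tensor"
  unfolding tensor_simps(1)
  by (erule S.completionE) (simp add: action_cls diag_cauchy del: tensor_simps)

lemma complex_space_tensor_product: "complex_space tensor"
proof (rule complex_space.intro)
  have "abelian_group tensor"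
    by (rule abelian_groupI) (use S.C.M.a_ac S.C.M.add.l_inv_ex in auto)
  then show "module complex_ring tensor"
    by (rule moduleI[OF cring_complex_ring]) (auto simp: S.C.smult_add_left S.C.smult_add_right)
qed

section \<open>The universal property\<close>

definition pure :: "'v \<times> 'w \<Rightarrow> (nat \<Rightarrow> 'v \<times> 'w \<Rightarrow>\<^sub>0 complex) set" where
  "pure k = S.embed (Poly_Mapping.single k 1)"

lemma embed_relation:
  assumes "Poly_Mapping.keys x \<subseteq> D" "Poly_Mapping.keys y \<subseteq> D" "x - y \<in> R"
  shows "S.embed x = S.embed y"
proof (rule S.embed(6))
  show "r (x \<ominus>\<^bsub>F\<^esub> y) = 0" if "r \<in> Q" for r
    using that projective_relation[OF _ _ assms(3)] assms(1,2) unfolding projective_seminorms_def by auto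
qed (use assms in auto)

lemma pure_bilinear: "bilinear_map V W S.C pure"
proof (rule bilinear_mapI)
  show "pure (v, w) \<in> carrier S.C" if "v \<in> carrier V" "w \<in> carrier W" for v w
    unfolding pure_def by (rule S.embed(1)) (use that in simp)
  show "pure (v \<oplus>\<^bsub>V\<^esub> v', w) = pure (v, w) \<oplus>\<^bsub>S.C\<^esub> pure (v', w)"
    if "v \<in> carrier V" "v' \<in> carrier V" "w \<in> carrier W" for v v' w
  proof -
    have "S.embed (Poly_Mapping.single (v \<oplus>\<^bsub>V\<^esub> v', w) 1) =
        S.embed (Poly_Mapping.single (v, w) 1 + Poly_Mapping.single (v', w) 1)"
      by (rule embed_relation)
         (use that bilinear_relations.add_left[OF that, of 1] in \<open>simp_all add: free_space_closed algebra_simps\<close>)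
    then show ?thesis
      using S.embed(2)[of "Poly_Mapping.single (v, w) 1" "Poly_Mapping.single (v', w) 1"] that by (simp add: pure_def)
  qed
  show "pure (v, w \<oplus>\<^bsub>W\<^esub> w') = pure (v, w) \<oplus>\<^bsub>S.C\<^esub> pure (v, w')"
    if "v \<in> carrier V" "w \<in> carrier W" "w' \<in> carrier W" for v w w'
  proof -
    have "S.embed (Poly_Mapping.single (v, w \<oplus>\<^bsub>W\<^esub> w') 1) =
        S.embed (Poly_Mapping.single (v, w) 1 + Poly_Mapping.single (v, w') 1)"
      by (rule embed_relation)
         (use that bilinear_relations.add_right[OF that, of 1] in \<open>simp_all add: free_space_closed algebra_simps\<close>)
    then show ?thesis
      using S.embed(2)[of "Poly_Mapping.single (v, w) 1" "Poly_Mapping.single (v, w') 1"] that by (simp add: pure_def)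
  qed
  fix v w c assume vw: "v \<in> carrier V" "w \<in> carrier W"
  have "S.embed (Poly_Mapping.single (c \<odot>\<^bsub>V\<^esub> v, w) 1) = S.embed (Poly_Mapping.single (v, w) (c * 1))"
    by (rule embed_relation) (use vw bilinear_relations.smult_left[OF vw, of c 1] in simp_all)
  then show "pure (c \<odot>\<^bsub>V\<^esub> v, w) = c \<odot>\<^bsub>S.C\<^esub> pure (v, w)"
    using S.embed(4)[of "Poly_Mapping.single (v, w) 1" c] vw by (simp add: pure_def)
  have "S.embed (Poly_Mapping.single (v, c \<odot>\<^bsub>W\<^esub> w) 1) = S.embed (Poly_Mapping.single (v, w) (c * 1))"
    by (rule embed_relation) (use vw bilinear_relations.smult_right[OF vw, of c 1] in simp_all)
  then show "pure (v, c \<odot>\<^bsub>W\<^esub> w) = c \<odot>\<^bsub>S.C\<^esub> pure (v, w)"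
    using S.embed(4)[of "Poly_Mapping.single (v, w) 1" c] vw by (simp add: pure_def)
qed

lemma pure_action:
  "\<lbrakk>g \<in> G; v \<in> carrier V; w \<in> carrier W\<rbrakk> \<Longrightarrow> action tensor g (pure (v, w)) = pure (action V g v, action W g w)"
  unfolding pure_def S.embed_def by (subst action_cls) simp_all

text \<open>
  The cross seminorm of \<open>p\<close> and \<open>q\<close> is at most \<open>p v * q w\<close> on a pure tensor; continuity follows by
  splitting the difference as \<open>(v - v\<^sub>0) \<otimes> w + v\<^sub>0 \<otimes> (w - w\<^sub>0)\<close>.
\<close>

lemma pure_continuous:
  "continuous_map (prod_topology (tvs_topology V) (tvs_topology W)) S.topology_C pure"
  unfolding continuous_map_atin
proof
  interpret CS: seminormed_space S.C "completion_seminorm ` Q" by (rule S.seminormed_space_completion)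
  interpret P: bilinear_pairing V W S.C pure
    by (intro bilinear_pairing.intro bilinear_pairing_axioms.intro pure_bilinear V.complex_space_axioms W.complex_space_axioms S.C.complex_space_axioms)
  let ?T = "prod_topology (tvs_topology V) (tvs_topology W)"
  fix z assume z: "z \<in> topspace ?T"
  obtain v0 w0 where z0: "z = (v0, w0)" "v0 \<in> carrier V" "w0 \<in> carrier W" using z by auto
  have lv: "limitin (tvs_topology V) fst v0 (atin ?T z)" and lw: "limitin (tvs_topology W) snd w0 (atin ?T z)"
    using z z0 by (auto intro!: limitin_continuous_map continuous_map_fst continuous_map_snd)
  have ev: "\<forall>\<^sub>F u in atin ?T z. fst u \<in> carrier V \<and> snd u \<in> carrier W"
    using V.limitin_tvsD(2)[OF lv] W.limitin_tvsD(2)[OF lw] by (rule eventually_conj)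
  show "limitin S.topology_C pure (pure z) (atin ?T z)"
    unfolding CS.limitin_iff
  proof (intro conjI ballI)
    show "pure z \<in> carrier S.C" using z0 by simp
    show "\<forall>\<^sub>F u in atin ?T z. pure u \<in> carrier S.C"
      using ev by eventually_elim (metis P.bilin(1) prod.collapse)
    fix r assume "r \<in> completion_seminorm ` Q"
    then obtain p q where p: "continuous_seminorm V p" and q: "continuous_seminorm W q"
      and r: "r = completion_seminorm (projective_seminorm V W p q)" and rQ: "projective_seminorm V W p q \<in> Q"
      unfolding projective_seminorms_def by blast
    have r': "seminorm_on S.C r" unfolding r by (rule S.seminorm_on_completion[OF rQ])
    have le: "r (pure (v, w)) \<le> p v * q w" if "v \<in> carrier V" "w \<in> carrier W" for v w
    proof -
      have "r (pure (v, w)) = projective_seminorm V W p q (Poly_Mapping.single (v, w) 1)"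
        unfolding r pure_def by (rule S.embed(5)[OF rQ]) (use that in simp)
      also have "\<dots> \<le> representation_norm p q (Poly_Mapping.single (v, w) 1)"
        by (rule projective_le[OF p q]) (use that relations_zero in simp_all)
      finally show ?thesis by (simp add: norm_single)
    qed
    have "((\<lambda>u. p (fst u \<ominus>\<^bsub>V\<^esub> v0) * q (snd u) + p v0 * q (snd u \<ominus>\<^bsub>W\<^esub> w0)) \<longlongrightarrow> 0 * q w0 + p v0 * 0) (atin ?T z)"
      by (intro tendsto_intros V.limitin_tvsD(3)[OF lv p] W.limitin_tvsD(3)[OF lw q] W.limit_seminorm[OF lw q])
    then have lim: "((\<lambda>u. p (fst u \<ominus>\<^bsub>V\<^esub> v0) * q (snd u) + p v0 * q (snd u \<ominus>\<^bsub>W\<^esub> w0)) \<longlongrightarrow> 0) (atin ?T z)" by simp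
    show "((\<lambda>u. r (pure u \<ominus>\<^bsub>S.C\<^esub> pure z)) \<longlongrightarrow> 0) (atin ?T z)"
    proof (rule Lim_null_comparison[OF _ lim])
      show "\<forall>\<^sub>F u in atin ?T z. norm (r (pure u \<ominus>\<^bsub>S.C\<^esub> pure z)) \<le> p (fst u \<ominus>\<^bsub>V\<^esub> v0) * q (snd u) + p v0 * q (snd u \<ominus>\<^bsub>W\<^esub> w0)"
        using ev
      proof eventually_elim
        case (elim u)
        obtain v w where u: "u = (v, w)" "v \<in> carrier V" "w \<in> carrier W" using elim by (cases u) auto
        have "pure u \<ominus>\<^bsub>S.C\<^esub> pure z = pure (v \<ominus>\<^bsub>V\<^esub> v0, w) \<oplus>\<^bsub>S.C\<^esub> pure (v0, w \<ominus>\<^bsub>W\<^esub> w0)"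
          unfolding u(1) z0(1) using u z0
          by (rule_tac S.C.coordinates3[of "pure (v, w)" "pure (v0, w)" "pure (v0, w0)"]) simp_all
        moreover have "r (pure (v \<ominus>\<^bsub>V\<^esub> v0, w) \<oplus>\<^bsub>S.C\<^esub> pure (v0, w \<ominus>\<^bsub>W\<^esub> w0)) \<le>
            r (pure (v \<ominus>\<^bsub>V\<^esub> v0, w)) + r (pure (v0, w \<ominus>\<^bsub>W\<^esub> w0))"
          by (rule S.C.seminorm_onD(2)[OF r']) (use u z0 in simp_all)
        moreover have "0 \<le> r (pure (v \<ominus>\<^bsub>V\<^esub> v0, w) \<oplus>\<^bsub>S.C\<^esub> pure (v0, w \<ominus>\<^bsub>W\<^esub> w0))"
          by (rule S.C.seminorm_onD(1)[OF r']) (use u z0 in simp)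
        ultimately show ?case
          using le[of "v \<ominus>\<^bsub>V\<^esub> v0" w] le[of v0 "w \<ominus>\<^bsub>W\<^esub> w0"] u z0 by simp
      qed
    qed
  qed
qed

text \<open>
  Restriction to pure tensors identifies intertwiners on the completed tensor product with
  equivariant continuous bilinear maps.  It is injective because combinations of pure tensors are
  dense; conversely, a bilinear map extends linearly to the free space with a projective seminorm
  as a bound, and hence to the completion.
\<close>

lemma vdim_hom_space_tensor:
  fixes U :: "(mat2, 'u) rep"
  assumes U: "smooth_representation G U" and "complete_lcs U"
  shows "vdim (hom_space G tensor U) = vdim (bilinear_space G V W U)"
proof -
  interpret U: smooth_representation G U by fact
  interpret CS: seminormed_space S.C "completion_seminorm ` Q" by (rule S.seminormed_space_completion)
  have sU: "complex_space U" ..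
  note PB = bilinear_mapD[OF pure_bilinear]
  let ?H = "hom_space G tensor U" and ?B = "bilinear_space G V W U"
  have spaces: "complex_space ?H" "complex_space ?B"
    by (rule complex_space_hom_space[OF complex_space_tensor_product _ action_closed U], simp add: CS.topspace_seminorm, assumption+)
       (rule complex_space_bilinear_space[OF V.smooth_representation_axioms W.smooth_representation_axioms U])
  define J where "J T = (\<lambda>k\<in>D. T (pure k))" for T :: "_ \<Rightarrow> 'u"
  have HD: "linear_map S.C U T" "continuous_map S.topology_C (tvs_topology U) T"
    "\<And>g A. \<lbrakk>g \<in> G; A \<in> carrier S.C\<rbrakk> \<Longrightarrow> T (action tensor g A) = action U g (T A)"
    "T \<in> extensional (carrier S.C)" if "T \<in> carrier ?H" for T
    using that unfolding hom_space_eq intertwiner_def linear_map_def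
    by (simp_all del: tensor_simps(6))
  have lin: "linear_map ?H ?B J"
  proof (rule linear_mapI)
    fix T assume T: "T \<in> carrier ?H"
    note L = linear_mapD[OF HD(1)[OF T]]
    have "bilinear_map V W U (J T)"
      by (rule bilinear_mapI) (simp_all add: J_def PB L)
    moreover have "continuous_map (prod_topology (tvs_topology V) (tvs_topology W)) (tvs_topology U) (J T)"
      by (rule continuous_map_eq[OF continuous_map_compose[OF pure_continuous HD(2)[OF T]]]) (auto simp: J_def)
    moreover have "J T (action V g v, action W g w) = action U g (J T (v, w))"
      if "g \<in> G" "v \<in> carrier V" "w \<in> carrier W" for g v w
      using that HD(3)[OF T, of g "pure (v, w)"] PB(1) pure_action by (simp add: J_def del: tensor_simps)
    ultimately show "J T \<in> carrier ?B"
      by (simp add: bilinear_space_def equivariant_bilinear_map_def J_def[of T])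
  qed (auto simp: J_def hom_space_eq bilinear_space_def fun_eq_iff PB(1))
  have inj: "inj_on J (carrier ?H)"
  proof (rule linear_map_injI[OF spaces lin])
    fix T assume T: "T \<in> carrier ?H" and z: "J T = \<zero>\<^bsub>?B\<^esub>"
    note L = linear_mapD[OF HD(1)[OF T]]
    have pz: "T (pure (v, w)) = \<zero>\<^bsub>U\<^esub>" if "v \<in> carrier V" "w \<in> carrier W" for v w
      using fun_cong[OF z, of "(v, w)"] that by (simp add: J_def bilinear_space_def)
    have lin1: "linear_map F U (\<lambda>x. T (S.embed x))"
      by (rule linear_mapI) (use S.embed L in \<open>simp_all del: free_space_simps\<close>)
    have lin2: "linear_map F U (\<lambda>x. \<zero>\<^bsub>U\<^esub>)"
      by (rule linear_mapI) simp_all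
    have ez: "T (S.embed x) = \<zero>\<^bsub>U\<^esub>" if "x \<in> carrier F" for x
      by (rule free_space_linear_unique[OF sU lin1 lin2]) (use pz that in \<open>auto simp: pure_def\<close>)
    have "T A = \<zero>\<^bsub>U\<^esub>" if "A \<in> carrier S.C" for A
      by (rule S.continuous_on_completion_unique[OF U.lcs_axioms HD(2)[OF T] _ ez that]) simp
    then show "T = \<zero>\<^bsub>?H\<^esub>"
      using HD(4)[OF T] by (auto simp: hom_space_eq fun_eq_iff extensional_def)
  qed
  have surj: "\<exists>T\<in>carrier ?H. J T = b" if b: "b \<in> carrier ?B" for b
  proof -
    interpret b: equivariant_bilinear G V W U b
      by (rule equivariant_bilinearI[OF V.smooth_representation_axioms W.smooth_representation_axioms U])
         (use b in \<open>simp add: bilinear_space_def\<close>)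
    let ?f = "linear_extension U b"
    have f: "linear_map F U ?f" by (rule linear_map_linear_extension(1)[OF sU]) simp
    have fs: "?f (Poly_Mapping.single k c) = c \<odot>\<^bsub>U\<^esub> b k" if "k \<in> D" for k c
      by (rule linear_map_linear_extension(2)[OF sU _ that]) simp
    have bd: "\<exists>p\<in>Q. \<forall>x\<in>carrier F. r (?f x) \<le> p x" if r: "continuous_seminorm U r" for r
    proof -
      obtain p q where p: "continuous_seminorm V p" and q: "continuous_seminorm W q"
        and pq: "\<And>v w. \<lbrakk>v \<in> carrier V; w \<in> carrier W\<rbrakk> \<Longrightarrow> r (b (v, w)) \<le> p v * q w"
        using b.bilinear_bound[OF r] by blast
      have "projective_seminorm V W p q \<in> Q" using p q unfolding projective_seminorms_def by blast
      moreover have "r (?f x) \<le> projective_seminorm V W p q x" if "x \<in> carrier F" for x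
        by (rule linear_extension_bound[OF U.lcs_axioms b.bilinear r p q pq]) (use that in simp_all)
      ultimately show ?thesis by blast
    qed
    obtain T where T: "linear_map S.C U T" "continuous_map S.topology_C (tvs_topology U) T"
      "\<And>s. s \<in> S.cauchy \<Longrightarrow> limitin (tvs_topology U) (\<lambda>n. ?f (s n)) (T (S.cls s)) sequentially"
      "\<And>x. x \<in> carrier F \<Longrightarrow> T (S.embed x) = ?f x"
      using S.extension_to_completion[OF \<open>complete_lcs U\<close> f bd] by blast
    note L = linear_mapD[OF T(1)]
    have fd: "?f (diag g x) = action U g (?f x)" if g: "g \<in> G" and x: "x \<in> carrier F" for g x
    proof (rule free_space_linear_unique[OF sU])
      show "linear_map F U (\<lambda>x. ?f (diag g x))"
        by (rule linear_mapI) (use linear_mapD[OF f] linear_mapD[OF diag_linear[OF g]] in \<open>simp_all del: free_space_simps\<close>)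
      show "linear_map F U (\<lambda>x. action U g (?f x))"
        by (rule linear_mapI) (use linear_mapD[OF f] g in \<open>simp_all add: U.act_add U.act_smult del: free_space_simps\<close>)
      show "?f (diag g (Poly_Mapping.single (v, w) 1)) = action U g (?f (Poly_Mapping.single (v, w) 1))"
        if "v \<in> carrier V" "w \<in> carrier W" for v w
        using that g by (simp add: fs b.equivariant)
    qed (use x in simp)
    have TG: "T (action tensor g A) = action U g (T A)" if g: "g \<in> G" and A: "A \<in> carrier S.C" for g A
    proof -
      obtain s where s: "s \<in> S.cauchy" "A = S.cls s" using A by (rule S.completionE)
      have sF: "s n \<in> carrier F" for n using s by (rule_tac S.cauchy_carrier)
      have "limitin (tvs_topology U) (\<lambda>n. action U g (?f (s n))) (action U g (T A)) sequentially"
        using U.limit_act[OF tendsto_const _ g T(3)[OF s(1)]] s(2) g by simp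
      then have "limitin (tvs_topology U) (\<lambda>n. ?f (diag g (s n))) (action U g (T A)) sequentially"
        by (simp only: fd[OF g sF])
      from U.limit_unique[OF T(3)[OF diag_cauchy[OF g s(1)]] this sequentially_bot]
      show ?thesis unfolding s(2) action_cls[OF g s(1)] .
    qed
    let ?T = "restrict T (carrier S.C)"
    have "intertwiner G tensor U ?T"
      unfolding intertwiner_def
    proof (intro conjI ballI)
      show "linear_map tensor U ?T"
        by (rule linear_mapI) (simp_all add: L)
      show "continuous_map (tvs_topology tensor) (tvs_topology U) ?T"
        unfolding tensor_simps(5) by (rule continuous_map_eq[OF T(2)]) (simp add: CS.topspace_seminorm)
      show "?T (action tensor g A) = action U g (?T A)" if "g \<in> G" "A \<in> carrier tensor" for g A
        using action_closed[of g A] TG[of g A] that by (simp del: tensor_simps(6))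
    qed
    then have "?T \<in> carrier ?H" by (simp add: hom_space_eq)
    moreover have "J ?T = b"
    proof
      fix k
      show "J ?T k = b k"
      proof (cases "k \<in> D")
        case True
        then have c: "Poly_Mapping.single k 1 \<in> carrier F" by simp
        have "T (pure k) = b k" unfolding pure_def T(4)[OF c] fs[OF True] using True by auto
        then show ?thesis using True PB(1) by (auto simp: J_def)
      next
        case False
        then show ?thesis using b by (cases k) (auto simp: J_def bilinear_space_def extensional_def)
      qed
    qed
    ultimately show ?thesis by blast
  qed
  show ?thesis
  proof (rule antisym)
    show "vdim ?H \<le> vdim ?B" by (rule vdim_le_injective[OF spaces lin inj])
    let ?K = "inv_into (carrier ?H) J"
    have K: "?K b \<in> carrier ?H" "J (?K b) = b" if "b \<in> carrier ?B" for b
    proof -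
      have "b \<in> J ` carrier ?H" using surj[OF that] by blast
      then show "?K b \<in> carrier ?H" "J (?K b) = b" by (rule inv_into_into, rule f_inv_into_f)
    qed
    interpret H: complex_space ?H by (rule spaces(1))
    note JD = linear_mapD[OF lin]
    show "vdim ?B \<le> vdim ?H"
    proof (rule vdim_le_injective[OF spaces(2,1)])
      show "linear_map ?B ?H ?K"
      proof (rule linear_mapI)
        show "?K (b \<oplus>\<^bsub>?B\<^esub> b') = ?K b \<oplus>\<^bsub>?H\<^esub> ?K b'" if "b \<in> carrier ?B" "b' \<in> carrier ?B" for b b'
          by (rule inv_into_f_eq[OF inj H.closed(2)[OF K(1)[OF that(1)] K(1)[OF that(2)]]])
             (simp only: JD(2)[OF K(1)[OF that(1)] K(1)[OF that(2)]] K(2)[OF that(1)] K(2)[OF that(2)])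
        show "?K (c \<odot>\<^bsub>?B\<^esub> b) = c \<odot>\<^bsub>?H\<^esub> ?K b" if "b \<in> carrier ?B" for b c
          by (rule inv_into_f_eq[OF inj H.closed(4)[OF K(1)[OF that]]])
             (simp only: JD(3)[OF K(1)[OF that]] K(2)[OF that])
      qed (rule K(1))
      show "inj_on ?K (carrier ?B)"
        by (rule inj_onI) (metis K(2))
    qed
  qed
qed

end

section \<open>Multiplicities in neighbouring parameters\<close>

lemma (in real_form) mult_dim_eq_vdim_bilinear_space:
  assumes V: "V \<in> cat_M G" and W: "W \<in> cat_M G" and U: "U \<in> cat_M G"
  shows "mult_dim G (V \<boxtimes> W) U = vdim (bilinear_space G V W U)"
proof -
  interpret V: smooth_representation G V by (rule cat_M_representation(1)[OF V])
  interpret W: smooth_representation G W by (rule cat_M_representation(1)[OF W])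
  interpret tensor_representation G V W by unfold_locales
  show ?thesis
    unfolding mult_dim_def by (rule vdim_hom_space_tensor[OF cat_M_representation[OF U]])
qed

lemma reduced_coherent_familyD:
  assumes "reduced_coherent_family G \<xi> \<pi> F" and "\<nu> \<in> Lambda \<xi>"
  shows "F \<nu> \<in> cat_M G" "has_inf_char G (F \<nu>) \<nu>"
    "\<lbrakk>\<delta> \<in> {1, -1}; \<nu> + \<delta> \<in> Lambda \<xi>\<rbrakk> \<Longrightarrow>
      rep_iso G (primary_component G (\<nu> + \<delta>) (tensor_C2 (F \<nu>))) (F (\<nu> + \<delta>))"
    "\<lbrakk>\<delta> \<in> {1, -1}; \<nu> + \<delta> \<in> Lambda \<xi>\<rbrakk> \<Longrightarrow>
      rep_iso G (primary_component G \<nu> (tensor_C2 (F (\<nu> + \<delta>)))) (F \<nu>)"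
  using assms unfolding reduced_coherent_family_def by blast+

text \<open>
  The translations by \<open>(\<delta>', \<delta>'')\<close> and back are both injective on bilinear maps: reversing the step
  only changes the sign of \<open>\<delta>' \<nu>' + \<delta>'' \<nu>'' + 1\<close>.
\<close>

lemma (in real_form) mult_dim_translation:
  assumes F': "reduced_coherent_family G \<xi>' \<pi>' F'" and F'': "reduced_coherent_family G \<xi>'' \<pi>'' F''"
    and U: "U \<in> cat_M G" "has_inf_char G U \<mu>"
    and \<nu>': "\<nu>' \<in> Lambda \<xi>'" "\<nu>' + \<delta>' \<in> Lambda \<xi>'" "\<delta>' \<in> {1, -1}"
    and \<nu>'': "\<nu>'' \<in> Lambda \<xi>''" "\<nu>'' + \<delta>'' \<in> Lambda \<xi>''" "\<delta>'' \<in> {1, -1}"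
    and noncrossing: "(\<delta>' * \<nu>' + \<delta>'' * \<nu>'' + 1)\<^sup>2 \<noteq> \<mu>\<^sup>2"
  shows "mult_dim G (F' (\<nu>' + \<delta>') \<boxtimes> F'' (\<nu>'' + \<delta>'')) U = mult_dim G (F' \<nu>' \<boxtimes> F'' \<nu>'') U"
proof -
  note V = reduced_coherent_familyD[OF F' \<nu>'(1)] and W = reduced_coherent_familyD[OF F'' \<nu>''(1)]
  note V1 = reduced_coherent_familyD[OF F' \<nu>'(2)] and W1 = reduced_coherent_familyD[OF F'' \<nu>''(2)]
  note smooth = cat_M_representation(1)
  have square: "\<delta>' * \<delta>' = 1" "\<delta>'' * \<delta>'' = 1" "- \<delta>' * - \<delta>' = 1" "- \<delta>'' * - \<delta>'' = 1"
    using \<nu>'(3) \<nu>''(3) by auto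
  have iso: "rep_iso G (primary_component G (\<nu>' + \<delta>' + - \<delta>') (tensor_C2 (F' (\<nu>' + \<delta>')))) (F' \<nu>')"
    "rep_iso G (primary_component G (\<nu>'' + \<delta>'' + - \<delta>'') (tensor_C2 (F'' (\<nu>'' + \<delta>'')))) (F'' \<nu>'')"
    using V(4)[OF \<nu>'(3,2)] W(4)[OF \<nu>''(3,2)] by simp_all
  have "- \<delta>' * (\<nu>' + \<delta>') + - \<delta>'' * (\<nu>'' + \<delta>'') + 1 = - (\<delta>' * \<nu>' + \<delta>'' * \<nu>'' + 1)"
    using square by (simp add: algebra_simps)
  then have reverse: "(- \<delta>' * (\<nu>' + \<delta>') + - \<delta>'' * (\<nu>'' + \<delta>'') + 1)\<^sup>2 \<noteq> \<mu>\<^sup>2"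
    using noncrossing by (simp only: power2_minus not_False_eq_True)
  have "vdim (bilinear_space G (F' (\<nu>' + \<delta>')) (F'' (\<nu>'' + \<delta>'')) U) = vdim (bilinear_space G (F' \<nu>') (F'' \<nu>'') U)"
  proof (rule antisym)
    show "vdim (bilinear_space G (F' \<nu>') (F'' \<nu>'') U) \<le> vdim (bilinear_space G (F' (\<nu>' + \<delta>')) (F'' (\<nu>'' + \<delta>'')) U)"
      by (rule vdim_translation[OF smooth[OF V(1)] smooth[OF V1(1)] smooth[OF W(1)] smooth[OF W1(1)]
          smooth[OF U(1)] V(2) W(2) U(2) V(3)[OF \<nu>'(3,2)] W(3)[OF \<nu>''(3,2)] square(1,2) noncrossing])
    show "vdim (bilinear_space G (F' (\<nu>' + \<delta>')) (F'' (\<nu>'' + \<delta>'')) U) \<le> vdim (bilinear_space G (F' \<nu>') (F'' \<nu>'') U)"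
      by (rule vdim_translation[OF smooth[OF V1(1)] smooth[OF V(1)] smooth[OF W1(1)] smooth[OF W(1)]
          smooth[OF U(1)] V1(2) W1(2) U(2) iso square(3,4) reverse])
  qed
  then show ?thesis
    by (simp only: mult_dim_eq_vdim_bilinear_space[OF V(1) W(1) U(1)]
        mult_dim_eq_vdim_bilinear_space[OF V1(1) W1(1) U(1)])
qed

section \<open>The parameter region\<close>

lemma int_steps_constant:
  fixes f :: "int \<Rightarrow> 'a"
  assumes "m \<le> n" and "\<And>i. \<lbrakk>m \<le> i; i < n\<rbrakk> \<Longrightarrow> f (i + 1) = f i"
  shows "f n = f m"
  using assms
proof (induction n rule: int_ge_induct)
  case (step i)
  have "f (i + 1) = f i" by (rule step.prems) (use step.hyps in simp_all)
  also have "\<dots> = f m" by (rule step.IH) (use step.prems in simp)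
  finally show ?case .
qed simp

text \<open>
  The sets \<open>L'\<close> and \<open>L''\<close> are closed upwards or downwards; in each of the four cases one of the
  two corners \<open>(m\<^sub>1, n\<^sub>2)\<close> and \<open>(m\<^sub>2, n\<^sub>1)\<close> of the rectangle satisfies both of them.  Rows and columns
  of the region are intervals, so \<open>f\<close> is constant along the two sides through that corner.
\<close>

lemma constant_on_lattice_region:
  fixes f :: "int \<Rightarrow> int \<Rightarrow> 'a" and A B L' L'' :: "int \<Rightarrow> bool"
  defines "R \<equiv> \<lambda>m n. A m \<and> B n \<and> L' (m + n) \<and> L'' (m - n)"
  assumes A: "\<And>i j k. \<lbrakk>A i; A k; i \<le> j; j \<le> k\<rbrakk> \<Longrightarrow> A j"
    and B: "\<And>i j k. \<lbrakk>B i; B k; i \<le> j; j \<le> k\<rbrakk> \<Longrightarrow> B j"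
    and L': "mono L' \<or> antimono L'" and L'': "mono L'' \<or> antimono L''"
    and row: "\<And>m n. \<lbrakk>R m n; R (m + 1) n\<rbrakk> \<Longrightarrow> f (m + 1) n = f m n"
    and column: "\<And>m n. \<lbrakk>R m n; R m (n + 1)\<rbrakk> \<Longrightarrow> f m (n + 1) = f m n"
    and ends: "R m1 n1" "R m2 n2"
  shows "f m1 n1 = f m2 n2"
proof -
  have between: "L j" if "mono L \<or> antimono L" "L i" "L k" "i \<le> j" "j \<le> k" for L :: "int \<Rightarrow> bool" and i j k
    using that by (auto simp: monotone_def)
  have rows: "f m' n = f m n" if "R m n" "R m' n" "m \<le> m'" for m m' n
  proof (rule int_steps_constant[OF that(3)])
    fix i assume i: "m \<le> i" "i < m'"
    have "R j n" if "m \<le> j" "j \<le> m'" for j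
      using \<open>R m n\<close> \<open>R m' n\<close> A[of m m' j] between[OF L', of "m + n" "m' + n" "j + n"]
        between[OF L'', of "m - n" "m' - n" "j - n"] that
      by (simp add: R_def)
    then show "f (i + 1) n = f i n" using i by (intro row) simp_all
  qed
  have columns: "f m n' = f m n" if "R m n" "R m n'" "n \<le> n'" for m n n'
  proof (rule int_steps_constant[OF that(3)])
    fix i assume i: "n \<le> i" "i < n'"
    have "R m j" if "n \<le> j" "j \<le> n'" for j
      using \<open>R m n\<close> \<open>R m n'\<close> B[of n n' j] between[OF L', of "m + n" "m + n'" "m + j"]
        between[OF L'', of "m - n'" "m - n" "m - j"] that
      by (simp add: R_def)
    then show "f m (i + 1) = f m i" using i by (intro column) simp_all
  qed
  have rows: "f m' n = f m n" if "R m n" "R m' n" for m m' n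
    using rows[OF that] rows[OF that(2,1)] by (cases "m \<le> m'") simp_all
  have columns: "f m n' = f m n" if "R m n" "R m n'" for m n n'
    using columns[OF that] columns[OF that(2,1)] by (cases "n \<le> n'") simp_all
  have AB: "A m1" "A m2" "B n1" "B n2" and L: "L' (m1 + n1)" "L' (m2 + n2)" "L'' (m1 - n1)" "L'' (m2 - n2)"
    using ends by (simp_all add: R_def)
  have up: "L j" if "mono L" "L i" "i \<le> j" for L :: "int \<Rightarrow> bool" and i j
    using that by (auto simp: monotone_def)
  have down: "L i" if "antimono L" "L j" "i \<le> j" for L :: "int \<Rightarrow> bool" and i j
    using that by (auto simp: monotone_def)
  have "R m1 n2 \<or> R m2 n1"
  proof -
    consider "mono L'" "mono L''" | "mono L'" "antimono L''" | "antimono L'" "mono L''" | "antimono L'" "antimono L''"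
      using L' L'' by blast
    then show ?thesis
    proof cases
      case 1
      then show ?thesis unfolding R_def
        using AB up[OF 1(1) L(1), of "m2 + n1"] up[OF 1(1) L(2), of "m1 + n2"]
          up[OF 1(2) L(3), of "m2 - n1"] up[OF 1(2) L(4), of "m1 - n2"]
        by (cases "m1 \<le> m2") simp_all
    next
      case 2
      then show ?thesis unfolding R_def
        using AB up[OF 2(1) L(1), of "m1 + n2"] up[OF 2(1) L(2), of "m2 + n1"]
          down[OF 2(2) L(3), of "m1 - n2"] down[OF 2(2) L(4), of "m2 - n1"]
        by (cases "n1 \<le> n2") simp_all
    next
      case 3
      then show ?thesis unfolding R_def
        using AB down[OF 3(1) L(1), of "m1 + n2"] down[OF 3(1) L(2), of "m2 + n1"]
          up[OF 3(2) L(3), of "m1 - n2"] up[OF 3(2) L(4), of "m2 - n1"]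
        by (cases "n1 \<le> n2") simp_all
    next
      case 4
      then show ?thesis unfolding R_def
        using AB down[OF 4(1) L(1), of "m2 + n1"] down[OF 4(1) L(2), of "m1 + n2"]
          down[OF 4(2) L(3), of "m2 - n1"] down[OF 4(2) L(4), of "m1 - n2"]
        by (cases "m1 \<le> m2") simp_all
    qed
  qed
  then show ?thesis
    using ends rows[of m1 n2 m2] columns[of m1 n1 n2] rows[of m1 n1 m2] columns[of m2 n1 n2] by metis
qed

lemma Lambda_monotone: "mono (\<lambda>k. \<xi> + of_int k \<in> Lambda \<xi>) \<or> antimono (\<lambda>k. \<xi> + of_int k \<in> Lambda \<xi>)"
proof (cases "\<xi> \<in> \<int>")
  case False
  then have "\<xi> + of_int k \<in> Lambda \<xi>" for k unfolding Lambda_def by (auto simp: add.commute)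
  then show ?thesis by (simp add: monotone_def)
next
  case True
  then obtain n where n: "\<xi> = of_int n" by (rule Ints_cases)
  have of_int: "\<xi> + of_int k = of_int (n + k)" for k by (simp add: n)
  have "\<xi> + of_int k \<in> Lambda \<xi> \<longleftrightarrow> (if n > 0 then n + k > 0 else n + k < 0)" for k
    unfolding of_int unfolding Lambda_def n of_int_eq_iff by (auto simp del: of_int_add)
  then show ?thesis by (cases "n > 0") (auto simp: monotone_def)
qed

text \<open>
  The condition of \<open>D_sign\<close> in lattice coordinates: \<open>c\<close> is the value of the linear form at the base
  point and \<open>c + 2 m\<close> its value at the point with coordinate \<open>m\<close>.
\<close>

definition same_side :: "complex \<Rightarrow> int \<Rightarrow> bool" where
  "same_side c m \<longleftrightarrow>
     (\<exists>k::int. c = of_int (2 * k + 1)) \<longrightarrow> sgn (Re (c + of_int (2 * m))) = sgn (Re c)"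

lemma same_side_convex:
  assumes "same_side c i" "same_side c k" "i \<le> j" "j \<le> k"
  shows "same_side c j"
  unfolding same_side_def
proof
  assume "\<exists>k::int. c = of_int (2 * k + 1)"
  then have s: "sgn (Re c + of_int (2 * i)) = sgn (Re c)" "sgn (Re c + of_int (2 * k)) = sgn (Re c)"
    using assms(1,2) by (simp_all add: same_side_def)
  have "Re c + of_int (2 * i) \<le> Re c + of_int (2 * j)" "Re c + of_int (2 * j) \<le> Re c + of_int (2 * k)"
    using assms(3,4) by simp_all
  with s show "sgn (Re (c + of_int (2 * j))) = sgn (Re c)"
    by (auto simp: sgn_real_def split: if_splits)
qed

text \<open>
  Otherwise the linear form would take the values \<open>- 1\<close> and \<open>1\<close> at two points on the same side.
\<close>

lemma same_side_noncrossing: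
  assumes "same_side c m" "same_side c (m + 1)"
  shows "c + of_int (2 * m + 1) \<noteq> 0"
proof
  assume "c + of_int (2 * m + 1) = 0"
  then have c: "c = of_int (2 * (- m - 1) + 1)" by (simp add: eq_neg_iff_add_eq_0 algebra_simps)
  then have "sgn (Re (c + of_int (2 * m))) = sgn (Re (c + of_int (2 * (m + 1))))"
    using assms unfolding same_side_def by metis
  moreover have "Re (c + of_int (2 * m)) = -1" "Re (c + of_int (2 * (m + 1))) = 1" unfolding c by simp_all
  ultimately show False by (simp only: sgn_minus sgn_one)
qed

text \<open>
  The conditions for a pair of opposite signs \<open>(\<alpha>, \<beta>)\<close> and \<open>(- \<alpha>, - \<beta>)\<close> together; they concern the
  same lattice coordinate.
\<close>

definition same_strip :: "complex \<Rightarrow> complex \<Rightarrow> int \<Rightarrow> bool" where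
  "same_strip \<mu> s m \<longleftrightarrow> same_side (s + \<mu>) m \<and> same_side (- s + \<mu>) (- m)"

lemma same_strip_convex: "\<lbrakk>same_strip \<mu> s i; same_strip \<mu> s k; i \<le> j; j \<le> k\<rbrakk> \<Longrightarrow> same_strip \<mu> s j"
  unfolding same_strip_def
  using same_side_convex[of "s + \<mu>" i k j] same_side_convex[of "- s + \<mu>" "- k" "- i" "- j"] by simp

lemma same_strip_noncrossing:
  assumes "same_strip \<mu> s m" "same_strip \<mu> s (m + 1)"
  shows "(s + of_int (2 * m + 1))\<^sup>2 \<noteq> \<mu>\<^sup>2"
proof -
  have ne: "s + \<mu> + of_int (2 * m + 1) \<noteq> 0" "- s + \<mu> + of_int (2 * (- (m + 1)) + 1) \<noteq> 0"
    by (rule same_side_noncrossing; use assms in \<open>simp add: same_strip_def\<close>)+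
  show ?thesis
  proof
    assume "(s + of_int (2 * m + 1))\<^sup>2 = \<mu>\<^sup>2"
    then have "\<mu> = s + of_int (2 * m + 1) \<or> \<mu> = - (s + of_int (2 * m + 1))"
      by (metis power2_eq_iff)
    then show False using ne by (elim disjE) simp_all
  qed
qed

text \<open>
  The linear forms with \<open>\<alpha> = \<beta>\<close> depend only on \<open>m\<close> and those with \<open>\<alpha> = - \<beta>\<close> only on \<open>n\<close>.
\<close>

lemma D_region_iff:
  "(\<xi>' + of_int (m + n), \<xi>'' + of_int (m - n)) \<in> D_region \<xi>' \<xi>'' \<mu> \<longleftrightarrow>
     same_strip \<mu> (\<xi>' + \<xi>'') m \<and> same_strip \<mu> (\<xi>' - \<xi>'') n \<and>
     \<xi>' + of_int (m + n) \<in> Lambda \<xi>' \<and> \<xi>'' + of_int (m - n) \<in> Lambda \<xi>''"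
  (is "?p \<in> _ \<longleftrightarrow> _")
proof -
  have "even ((m + n) - (m - n))" by simp
  then have Xi: "?p \<in> Xi \<xi>' \<xi>'' \<longleftrightarrow> \<xi>' + of_int (m + n) \<in> Lambda \<xi>' \<and> \<xi>'' + of_int (m - n) \<in> Lambda \<xi>''"
    unfolding Xi_def by blast
  have D: "?p \<in> D_sign \<alpha> \<beta> \<xi>' \<xi>'' \<mu> \<longleftrightarrow> ?p \<in> Xi \<xi>' \<xi>'' \<and> same_side c k"
    if "\<alpha> * \<xi>' + \<beta> * \<xi>'' + \<mu> = c"
      "\<alpha> * (\<xi>' + of_int (m + n)) + \<beta> * (\<xi>'' + of_int (m - n)) + \<mu> = c + of_int (2 * k)" for \<alpha> \<beta> c k
    unfolding D_sign_def same_side_def mem_Collect_eq if_distrib[of "\<lambda>S. ?p \<in> S"] case_prod_conv that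
    by simp
  have "?p \<in> D_sign 1 1 \<xi>' \<xi>'' \<mu> \<longleftrightarrow> ?p \<in> Xi \<xi>' \<xi>'' \<and> same_side (\<xi>' + \<xi>'' + \<mu>) m"
    "?p \<in> D_sign (- 1) (- 1) \<xi>' \<xi>'' \<mu> \<longleftrightarrow> ?p \<in> Xi \<xi>' \<xi>'' \<and> same_side (- (\<xi>' + \<xi>'') + \<mu>) (- m)"
    "?p \<in> D_sign 1 (- 1) \<xi>' \<xi>'' \<mu> \<longleftrightarrow> ?p \<in> Xi \<xi>' \<xi>'' \<and> same_side (\<xi>' - \<xi>'' + \<mu>) n"
    "?p \<in> D_sign (- 1) 1 \<xi>' \<xi>'' \<mu> \<longleftrightarrow> ?p \<in> Xi \<xi>' \<xi>'' \<and> same_side (- (\<xi>' - \<xi>'') + \<mu>) (- n)"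
    by (rule D; simp add: algebra_simps)+
  then show ?thesis unfolding D_region_def same_strip_def Xi by auto
qed

lemma D_region_cases:
  assumes "p \<in> D_region \<xi>' \<xi>'' \<mu>"
  obtains m n where "p = (\<xi>' + of_int (m + n), \<xi>'' + of_int (m - n))"
proof -
  have "p \<in> D_sign 1 1 \<xi>' \<xi>'' \<mu>" using assms by (simp add: D_region_def)
  moreover have "D_sign 1 1 \<xi>' \<xi>'' \<mu> \<subseteq> Xi \<xi>' \<xi>''" unfolding D_sign_def by auto
  ultimately have "p \<in> Xi \<xi>' \<xi>''" by blast
  then obtain k1 k2 where p: "p = (\<xi>' + of_int k1, \<xi>'' + of_int k2)" and "even (k1 - k2)"
    unfolding Xi_def by auto
  then obtain n where n: "k1 - k2 = 2 * n" by (elim evenE)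
  then have "k1 = (k2 + n) + n" "k2 = (k2 + n) - n" by simp_all
  then show ?thesis using that[of "k2 + n" n] unfolding p by simp
qed

theorem theorem3p10:
  fixes G :: "mat2 set"
    and \<xi>' \<xi>'' \<mu> :: complex
    and \<pi>' :: "(mat2, 'a) rep" and F' :: "complex \<Rightarrow> (mat2, 'a) rep"
    and \<pi>'' :: "(mat2, 'b) rep" and F'' :: "complex \<Rightarrow> (mat2, 'b) rep"
    and \<pi>''' :: "(mat2, 'c) rep"
  assumes "real_form_SL2C G"
    and "\<xi>' \<noteq> 0" and "\<xi>'' \<noteq> 0"
    and "reduced_coherent_family G \<xi>' \<pi>' F'"
    and "reduced_coherent_family G \<xi>'' \<pi>'' F''"
    and "\<pi>''' \<in> cat_M G" and "has_inf_char G \<pi>''' \<mu>"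
  shows "(\<lambda>(\<nu>', \<nu>''). mult_dim G (F' \<nu>' \<boxtimes> F'' \<nu>'') \<pi>''') constant_on D_region \<xi>' \<xi>'' \<mu>"
proof -
  interpret real_form G by unfold_locales fact
  let ?f = "\<lambda>m n. mult_dim G (F' (\<xi>' + of_int (m + n)) \<boxtimes> F'' (\<xi>'' + of_int (m - n))) \<pi>'''"
  let ?R = "\<lambda>m n. same_strip \<mu> (\<xi>' + \<xi>'') m \<and> same_strip \<mu> (\<xi>' - \<xi>'') n \<and>
     \<xi>' + of_int (m + n) \<in> Lambda \<xi>' \<and> \<xi>'' + of_int (m - n) \<in> Lambda \<xi>''"
  note translation = mult_dim_translation[OF assms(4-7)]
  \<comment> \<open>A step in \<open>m\<close> moves both parameters up; the exceptional values are excluded by the strip for \<open>m\<close>.\<close>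
  have row: "?f (m + 1) n = ?f m n" if R: "?R m n" "?R (m + 1) n" for m n
  proof -
    have shift: "\<xi>' + of_int (m + n) + 1 = \<xi>' + of_int (m + 1 + n)"
      "\<xi>'' + of_int (m - n) + 1 = \<xi>'' + of_int (m + 1 - n)" by simp_all
    have "1 * (\<xi>' + of_int (m + n)) + 1 * (\<xi>'' + of_int (m - n)) + 1 = \<xi>' + \<xi>'' + of_int (2 * m + 1)"
      by simp
    then have "(1 * (\<xi>' + of_int (m + n)) + 1 * (\<xi>'' + of_int (m - n)) + 1)\<^sup>2 \<noteq> \<mu>\<^sup>2"
      using same_strip_noncrossing[of \<mu> "\<xi>' + \<xi>''" m] R by (simp only:) simp
    from translation[OF _ _ _ _ _ _ this, unfolded shift] R show ?thesis
      by simp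
  qed
  \<comment> \<open>A step in \<open>n\<close> moves the first parameter up and the second one down.\<close>
  have column: "?f m (n + 1) = ?f m n" if R: "?R m n" "?R m (n + 1)" for m n
  proof -
    have shift: "\<xi>' + of_int (m + n) + 1 = \<xi>' + of_int (m + (n + 1))"
      "\<xi>'' + of_int (m - n) + - 1 = \<xi>'' + of_int (m - (n + 1))" by simp_all
    have "1 * (\<xi>' + of_int (m + n)) + - 1 * (\<xi>'' + of_int (m - n)) + 1 = \<xi>' - \<xi>'' + of_int (2 * n + 1)"
      by simp
    then have "(1 * (\<xi>' + of_int (m + n)) + - 1 * (\<xi>'' + of_int (m - n)) + 1)\<^sup>2 \<noteq> \<mu>\<^sup>2"
      using same_strip_noncrossing[of \<mu> "\<xi>' - \<xi>''" n] R by (simp only:) simp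
    from translation[OF _ _ _ _ _ _ this, unfolded shift] R show ?thesis
      by simp
  qed
  have eq: "?f m1 n1 = ?f m2 n2" if "?R m1 n1" "?R m2 n2" for m1 n1 m2 n2
    by (rule constant_on_lattice_region[where f = ?f and A = "same_strip \<mu> (\<xi>' + \<xi>'')"
          and B = "same_strip \<mu> (\<xi>' - \<xi>'')" and L' = "\<lambda>k. \<xi>' + of_int k \<in> Lambda \<xi>'"
          and L'' = "\<lambda>k. \<xi>'' + of_int k \<in> Lambda \<xi>''"])
       (fact same_strip_convex Lambda_monotone row column that)+
  have "(case p of (\<nu>', \<nu>'') \<Rightarrow> mult_dim G (F' \<nu>' \<boxtimes> F'' \<nu>'') \<pi>''') =
      (case q of (\<nu>', \<nu>'') \<Rightarrow> mult_dim G (F' \<nu>' \<boxtimes> F'' \<nu>'') \<pi>''')"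
    if pq: "p \<in> D_region \<xi>' \<xi>'' \<mu>" "q \<in> D_region \<xi>' \<xi>'' \<mu>" for p q
  proof -
    obtain m1 n1 where p: "p = (\<xi>' + of_int (m1 + n1), \<xi>'' + of_int (m1 - n1))"
      using pq(1) by (rule D_region_cases)
    obtain m2 n2 where q: "q = (\<xi>' + of_int (m2 + n2), \<xi>'' + of_int (m2 - n2))"
      using pq(2) by (rule D_region_cases)
    show ?thesis
      unfolding p q case_prod_conv by (rule eq) (use pq p q D_region_iff in metis)+
  qed
  then show ?thesis unfolding constant_on_def by metis
qed

end
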